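(* Let $d=2$, $0<c<1$ and $s<-\frac34$. Then for any $T>0$, the data-to-solution map $(u_0,u_1,n_0,n_1)\mapsto(u,n)$ of the Cauchy problem $$\begin{cases}(\partial_t^2-\Delta+1)u=-nu,\\(\partial_t^2-c^2\Delta)n=\Delta|u|^2,\\(u,\partial_tu,n,\partial_tn)|_{t=0}=(u_0,u_1,n_0,n_1),\end{cases}$$ for real-valued functions $u,n$ on $\mathbb{R}^d=\mathbb{R}^2$, as a map from the unit ball of $H^{s+1}\times H^s\times H^s\times H^{s-1}$ to $$\big(C([0,T];H^{s+1})\cap C^1([0,T];H^s)\big)\times\big(C([0,T];H^s)\cap C^1([0,T];H^{s-1})\big),$$ fails to be $C^2$.
   Context: $H^\sigma=H^\sigma(\mathbb{R}^2)$ is the (real-valued) inhomogeneous $L^2$-based Sobolev space, and $C^2$ means twice continuously Fréchet differentiable. "The data-to-solution map fails to be $C^2$" is meant in the standard sense: there is no $C^2$ map from the unit ball to the stated target space which assigns to each datum in the ball belonging to $\bigcap_\sigma H^\sigma$ in every component, and for which the smooth solution exists on $[0,T]$, that solution $(u,n)$. *)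

theory Defs
  imports "HOL-Analysis.Analysis" "HOL-Library.Function_Algebras"
begin

section \<open>Normed spaces with an explicit carrier\<close>

text \<open>
  The Sobolev spaces form a family indexed by a real number and so cannot be types of class
  \<open>real_normed_vector\<close>. A normed space is therefore a subspace of an ambient real vector space
  (with the pointwise operations on functions) together with a norm on it.
\<close>

instantiation "fun" :: (type, scaleR) scaleR
begin
definition scaleR_fun_def: "scaleR r f = (\<lambda>x. r *\<^sub>R f x)"
instance ..
end

instance "fun" :: (type, real_vector) real_vector
  by standard (simp_all add: scaleR_fun_def fun_eq_iff plus_fun_def scaleR_add_right scaleR_add_left)

record 'a nspace =
  points :: "'a set"
  nrm :: "'a \<Rightarrow> real"

definition unit_ball :: "'a nspace \<Rightarrow> 'a set" where
  "unit_ball X = {x \<in> points X. nrm X x < 1}"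

definition prod_space :: "'a nspace \<Rightarrow> 'b nspace \<Rightarrow> ('a \<times> 'b) nspace" where
  "prod_space X Y =
    \<lparr>points = points X \<times> points Y,
     nrm = (\<lambda>(x, y). sqrt ((nrm X x)\<^sup>2 + (nrm Y y)\<^sup>2))\<rparr>"

definition inter_space :: "'a nspace \<Rightarrow> 'a nspace \<Rightarrow> 'a nspace" where
  "inter_space X Y = \<lparr>points = points X \<inter> points Y, nrm = (\<lambda>x. nrm X x + nrm Y x)\<rparr>"

text \<open>Bounded linear maps with the operator norm; maps are normalised to 0 off the carrier.\<close>

definition L_space :: "'a::real_vector nspace \<Rightarrow> 'b::real_vector nspace \<Rightarrow> ('a \<Rightarrow> 'b) nspace" where
  "L_space X Y =
    \<lparr>points = {L. (\<forall>h\<in>points X. L h \<in> points Y) \<and>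
        (\<forall>h\<in>points X. \<forall>k\<in>points X. L (h + k) = L h + L k) \<and>
        (\<forall>r. \<forall>h\<in>points X. L (r *\<^sub>R h) = r *\<^sub>R L h) \<and>
        (\<exists>K. \<forall>h\<in>points X. nrm Y (L h) \<le> K * nrm X h) \<and>
        (\<forall>h. h \<notin> points X \<longrightarrow> L h = 0)},
     nrm = (\<lambda>L. SUP h\<in>{h \<in> points X. nrm X h \<le> 1}. nrm Y (L h))\<rparr>"

definition continuous_into ::
  "'a::real_vector nspace \<Rightarrow> 'b::real_vector nspace \<Rightarrow> 'a set \<Rightarrow> ('a \<Rightarrow> 'b) \<Rightarrow> bool" where
  "continuous_into X Y U f \<longleftrightarrow>
    (\<forall>x\<in>U. f x \<in> points Y) \<and>
    (\<forall>x\<in>U. \<forall>\<epsilon>>0. \<exists>\<delta>>0. \<forall>y\<in>U. nrm X (y - x) < \<delta> \<longrightarrow> nrm Y (f y - f x) < \<epsilon>)"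

definition has_frechet_derivative_on ::
  "'a::real_vector nspace \<Rightarrow> 'b::real_vector nspace \<Rightarrow> 'a set \<Rightarrow> ('a \<Rightarrow> 'b) \<Rightarrow> ('a \<Rightarrow> 'a \<Rightarrow> 'b) \<Rightarrow> bool" where
  "has_frechet_derivative_on X Y U f f' \<longleftrightarrow>
    (\<forall>x\<in>U. f x \<in> points Y \<and> f' x \<in> points (L_space X Y) \<and>
      (\<forall>\<epsilon>>0. \<exists>\<delta>>0. \<forall>y\<in>U. nrm X (y - x) < \<delta> \<longrightarrow>
        nrm Y (f y - f x - f' x (y - x)) \<le> \<epsilon> * nrm X (y - x)))"

definition C2_on ::
  "'a::real_vector nspace \<Rightarrow> 'b::real_vector nspace \<Rightarrow> 'a set \<Rightarrow> ('a \<Rightarrow> 'b) \<Rightarrow> bool" where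
  "C2_on X Y U f \<longleftrightarrow> (\<exists>f' f''.
    has_frechet_derivative_on X Y U f f' \<and>
    has_frechet_derivative_on X (L_space X Y) U f' f'' \<and>
    continuous_into X (L_space X (L_space X Y)) U f'')"

subsection \<open>Spaces of k times continuously differentiable curves\<close>

text \<open>A curve on \<open>[0,T]\<close> is a function on \<open>\<real>\<close> normalised to 0 outside \<open>[0,T]\<close>.\<close>

definition has_curve_derivative ::
  "real \<Rightarrow> 'a::real_vector nspace \<Rightarrow> (real \<Rightarrow> 'a) \<Rightarrow> (real \<Rightarrow> 'a) \<Rightarrow> bool" where
  "has_curve_derivative T X f g \<longleftrightarrow>
    (\<forall>t\<in>{0..T}.
      ((\<lambda>\<tau>. nrm X ((1 / (\<tau> - t)) *\<^sub>R (f \<tau> - f t) - g t)) \<longlongrightarrow> 0) (at t within {0..T}))"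

definition C_space :: "real \<Rightarrow> 'a::real_vector nspace \<Rightarrow> (real \<Rightarrow> 'a) nspace" where
  "C_space T X =
    \<lparr>points = {f. (\<forall>t\<in>{0..T}. f t \<in> points X) \<and> (\<forall>t. t \<notin> {0..T} \<longrightarrow> f t = 0) \<and>
        (\<forall>t\<in>{0..T}. ((\<lambda>\<tau>. nrm X (f \<tau> - f t)) \<longlongrightarrow> 0) (at t within {0..T}))},
     nrm = (\<lambda>f. SUP t\<in>{0..T}. nrm X (f t))\<rparr>"

definition curve_derivative ::
  "real \<Rightarrow> 'a::real_vector nspace \<Rightarrow> (real \<Rightarrow> 'a) \<Rightarrow> (real \<Rightarrow> 'a)" where
  "curve_derivative T X f = (THE g. g \<in> points (C_space T X) \<and> has_curve_derivative T X f g)"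

primrec Ck_space :: "nat \<Rightarrow> real \<Rightarrow> 'a::real_vector nspace \<Rightarrow> (real \<Rightarrow> 'a) nspace" where
  "Ck_space 0 T X = C_space T X"
| "Ck_space (Suc k) T X =
    \<lparr>points = {f \<in> points (C_space T X).
        \<exists>g\<in>points (Ck_space k T X). has_curve_derivative T X f g},
     nrm = (\<lambda>f. nrm (C_space T X) f + nrm (Ck_space k T X) (curve_derivative T X f))\<rparr>"


section \<open>Tempered distributions and Sobolev spaces on the plane\<close>

definition partial :: "2 \<Rightarrow> (real^2 \<Rightarrow> 'a::real_normed_vector) \<Rightarrow> real^2 \<Rightarrow> 'a" where
  "partial i f x = frechet_derivative f (at x) (axis i 1)"

definition partials :: "2 list \<Rightarrow> (real^2 \<Rightarrow> 'a::real_normed_vector) \<Rightarrow> real^2 \<Rightarrow> 'a" where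
  "partials \<alpha> f = foldr partial \<alpha> f"

definition laplace :: "(real^2 \<Rightarrow> 'a::real_normed_vector) \<Rightarrow> real^2 \<Rightarrow> 'a" where
  "laplace f x = (\<Sum>i\<in>UNIV. partial i (partial i f) x)"

definition smooth :: "(real^2 \<Rightarrow> 'a::real_normed_vector) \<Rightarrow> bool" where
  "smooth f \<longleftrightarrow> (\<forall>\<alpha> x. partials \<alpha> f differentiable (at x))"

definition schwartz :: "(real^2 \<Rightarrow> complex) \<Rightarrow> bool" where
  "schwartz \<phi> \<longleftrightarrow> smooth \<phi> \<and>
    (\<forall>\<alpha> N. bounded (range (\<lambda>x. (1 + norm x) ^ N *\<^sub>R partials \<alpha> \<phi> x)))"

definition schwartz_seminorm :: "nat \<Rightarrow> (real^2 \<Rightarrow> complex) \<Rightarrow> real" where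
  "schwartz_seminorm N \<phi> =
    (SUP (\<alpha>, x)\<in>{\<alpha>. length \<alpha> \<le> N} \<times> UNIV. (1 + norm x) ^ N * cmod (partials \<alpha> \<phi> x))"

text \<open>
  A tempered distribution is a complex linear functional on Schwartz functions, continuous for
  the Schwartz seminorms; as a total function it is normalised to 0 on other arguments.
\<close>

type_synonym dist = "(real^2 \<Rightarrow> complex) \<Rightarrow> complex"

definition tempered :: "dist \<Rightarrow> bool" where
  "tempered F \<longleftrightarrow>
    (\<forall>\<phi> \<psi> a b. schwartz \<phi> \<and> schwartz \<psi> \<longrightarrow>
      F (\<lambda>x. a * \<phi> x + b * \<psi> x) = a * F \<phi> + b * F \<psi>) \<and>
    (\<exists>N C. \<forall>\<phi>. schwartz \<phi> \<longrightarrow> cmod (F \<phi>) \<le> C * schwartz_seminorm N \<phi>) \<and>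
    (\<forall>\<phi>. \<not> schwartz \<phi> \<longrightarrow> F \<phi> = 0)"

definition real_valued :: "dist \<Rightarrow> bool" where
  "real_valued F \<longleftrightarrow> (\<forall>\<phi>. schwartz \<phi> \<longrightarrow> F (\<lambda>x. cnj (\<phi> x)) = cnj (F \<phi>))"

definition dist_of :: "(real^2 \<Rightarrow> real) \<Rightarrow> dist" where
  "dist_of f = (\<lambda>\<phi>. if schwartz \<phi> then (\<integral>x. of_real (f x) * \<phi> x \<partial>lborel) else 0)"

definition inv_fourier :: "(real^2 \<Rightarrow> complex) \<Rightarrow> real^2 \<Rightarrow> complex" where
  "inv_fourier \<phi> \<xi> = of_real (1 / (2 * pi)) * (\<integral>x. cis (x \<bullet> \<xi>) * \<phi> x \<partial>lborel)"

text \<open>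
  \<open>F\<close> has Fourier transform the function \<open>g\<close>: \<open>F\<close> is the inverse Fourier transform, defined by
  duality, of the distribution \<open>g\<close>. The transform is unitary on square integrable functions.
\<close>

definition has_fourier :: "dist \<Rightarrow> (real^2 \<Rightarrow> complex) \<Rightarrow> bool" where
  "has_fourier F g \<longleftrightarrow> g \<in> borel_measurable borel \<and>
    (\<forall>\<phi>. schwartz \<phi> \<longrightarrow>
      integrable lborel (\<lambda>\<xi>. g \<xi> * inv_fourier \<phi> \<xi>) \<and>
      F \<phi> = (\<integral>\<xi>. g \<xi> * inv_fourier \<phi> \<xi> \<partial>lborel))"

text \<open>The choice below is unique up to null sets, so the Sobolev norm does not depend on it.\<close>

definition fourier_of :: "dist \<Rightarrow> real^2 \<Rightarrow> complex" where
  "fourier_of F = (SOME g. has_fourier F g)"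

definition sobolev :: "real \<Rightarrow> dist nspace" where
  "sobolev \<sigma> =
    \<lparr>points = {F. tempered F \<and> real_valued F \<and>
        (\<exists>g. has_fourier F g \<and>
          integrable lborel (\<lambda>\<xi>. (1 + (norm \<xi>)\<^sup>2) powr \<sigma> * (cmod (g \<xi>))\<^sup>2))},
     nrm = (\<lambda>F. sqrt (\<integral>\<xi>. (1 + (norm \<xi>)\<^sup>2) powr \<sigma> * (cmod (fourier_of F \<xi>))\<^sup>2 \<partial>lborel))\<rparr>"


section \<open>The Klein--Gordon--Zakharov system\<close>

definition data_space :: "real \<Rightarrow> (dist \<times> dist \<times> dist \<times> dist) nspace" where
  "data_space s =
    prod_space (sobolev (s + 1)) (prod_space (sobolev s) (prod_space (sobolev s) (sobolev (s - 1))))"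

definition solution_space :: "real \<Rightarrow> real \<Rightarrow> ((real \<Rightarrow> dist) \<times> (real \<Rightarrow> dist)) nspace" where
  "solution_space s T =
    prod_space
      (inter_space (Ck_space 0 T (sobolev (s + 1))) (Ck_space 1 T (sobolev s)))
      (inter_space (Ck_space 0 T (sobolev s)) (Ck_space 1 T (sobolev (s - 1))))"

definition curve_of :: "real \<Rightarrow> (real \<Rightarrow> real^2 \<Rightarrow> real) \<Rightarrow> real \<Rightarrow> dist" where
  "curve_of T u = (\<lambda>t. if t \<in> {0..T} then dist_of (u t) else 0)"

text \<open>Smooth curves with values in every Sobolev space.\<close>

definition smooth_curve :: "real \<Rightarrow> (real \<Rightarrow> real^2 \<Rightarrow> real) \<Rightarrow> bool" where
  "smooth_curve T u \<longleftrightarrow>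
    (\<forall>t\<in>{0..T}. smooth (u t)) \<and> (\<forall>k \<sigma>. curve_of T u \<in> points (Ck_space k T (sobolev \<sigma>)))"

definition smooth_solution ::
  "real \<Rightarrow> real \<Rightarrow> dist \<times> dist \<times> dist \<times> dist \<Rightarrow>
    (real \<Rightarrow> real^2 \<Rightarrow> real) \<Rightarrow> (real \<Rightarrow> real^2 \<Rightarrow> real) \<Rightarrow> bool" where
  "smooth_solution c T d u n \<longleftrightarrow>
    smooth_curve T u \<and> smooth_curve T n \<and>
    (\<exists>ut utt nt ntt.
      (\<forall>t\<in>{0..T}. \<forall>x.
        ((\<lambda>\<tau>. u \<tau> x) has_real_derivative ut t x) (at t within {0..T}) \<and>
        ((\<lambda>\<tau>. ut \<tau> x) has_real_derivative utt t x) (at t within {0..T}) \<and>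
        ((\<lambda>\<tau>. n \<tau> x) has_real_derivative nt t x) (at t within {0..T}) \<and>
        ((\<lambda>\<tau>. nt \<tau> x) has_real_derivative ntt t x) (at t within {0..T}) \<and>
        utt t x - laplace (u t) x + u t x = - (n t x * u t x) \<and>
        ntt t x - c\<^sup>2 * laplace (n t) x = laplace (\<lambda>y. \<bar>u t y\<bar>\<^sup>2) x) \<and>
      d = (dist_of (u 0), dist_of (ut 0), dist_of (n 0), dist_of (nt 0)))"

definition smooth_data :: "(dist \<times> dist \<times> dist \<times> dist) set" where
  "smooth_data = (let H = \<Inter>\<sigma>. points (sobolev \<sigma>) in H \<times> H \<times> H \<times> H)"

definition data_to_solution_map ::
  "real \<Rightarrow> real \<Rightarrow> real \<Rightarrow>
    (dist \<times> dist \<times> dist \<times> dist \<Rightarrow> (real \<Rightarrow> dist) \<times> (real \<Rightarrow> dist)) \<Rightarrow> bool" where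
  "data_to_solution_map c s T \<Phi> \<longleftrightarrow>
    (\<forall>d\<in>unit_ball (data_space s) \<inter> smooth_data. \<forall>u n.
      smooth_solution c T d u n \<longrightarrow> \<Phi> d = (curve_of T u, curve_of T n))"

end

theory Submission
  imports Defs "HOL-Probability.Probability"
begin

text \<open>
  A \<open>C\<^sup>2\<close> data-to-solution map \<open>\<Phi>\<close> has a bounded second derivative at \<open>0\<close>, so for data \<open>r d\<close> the
  coefficient of \<open>r\<^sup>2\<close> in any bounded linear functional of \<open>\<Phi> (r d)\<close> is bounded by the norm of the
  functional, uniformly in \<open>d\<close> in the unit ball. Take \<open>d = (u\<^sub>0, 0, 0, 0)\<close>. For small \<open>r\<close> the smooth
  solution is a fixed point of the Duhamel map on the Fourier side, in an algebra with an exponential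
  weight, and \<open>n = r\<^sup>2 n\<^sub>2 + O(r\<^sup>4)\<close>, where \<open>n\<^sub>2\<close> is driven by the square of the free Klein--Gordon
  wave. Let the Fourier transform of \<open>u\<^sub>0\<close> be nonnegative and concentrated on rectangles of size
  \<open>\<delta> \<times> \<delta> \<surd>N\<close> around \<open>(\<plusminus>N, 0)\<close> and \<open>(\<plusminus>\<kappa> N, 0)\<close>, where \<open>\<kappa> = (1 - c) / (1 + c)\<close>. The interaction of
  \<open>(N, 0)\<close> and \<open>(\<kappa> N, 0)\<close> is resonant with the wave equation, so near \<open>((1 + \<kappa>) N, 0)\<close> the transform of
  \<open>n\<^sub>2 (T)\<close> has size about \<open>N\<^bsup>3/2\<^esup>\<close>, with a fixed sign. Integrating it over a rectangle of area about
  \<open>\<surd>N\<close> and normalising \<open>u\<^sub>0\<close> in \<open>H\<^bsup>s + 1\<^esup>\<close> gives \<open>N\<^sup>2 \<le> C N\<^bsup>2 s + 5/2\<^esup> N\<^bsup>- s + 1/4\<^esup>\<close> for arbitrarily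
  large \<open>N\<close>, which is false for \<open>s < - 3/4\<close>.
\<close>

section \<open>Calculus in normed spaces with an explicit carrier\<close>

text \<open>\<open>data_to_solution_map\<close> constrains \<open>\<Phi>\<close> only at data that
  possess a smooth solution, so solutions have to be exhibited for all small multiples of each datum
  used; any one of them fixes the value of \<open>\<Phi>\<close>, and uniqueness for the system
  never enters. The range of \<open>r\<close> in which a solution is built may depend on
  \<open>d\<close>, since only the coefficient of \<open>r\<^sup>2\<close> is compared. This permits
  a weight as wasteful as an exponential one. It dominates every polynomial weight, hence all
  Sobolev norms at once. The wave kernel loses one power of frequency to the Laplacian and the
  Klein-Gordon kernel gains one back, so the composed cubic map is bounded in a single space. The
  height of the rectangles decides the range of \<open>s\<close>. With bounded width and height
  \<open>N^h\<close> the same count gives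
  \<open>N^(1 + 2 h) \<le> C N^(2 s + 2 + h) N^(- s + h / 2)\<close>, false for
  \<open>s < h / 2 - 1\<close>, so taller is better. A transversal displacement \<open>z\<close>
  changes a norm of size \<open>N\<close> by about \<open>z\<^sup>2 / N\<close>, which stays bounded
  up to \<open>h = 1 / 2\<close>. The sign matters too: all interactions that reach the window of
  integration must contribute with the same sign.\<close>

locale normed_points =
  fixes X :: "'a::real_vector nspace"
  assumes zero_in: "0 \<in> points X"
    and add_in: "x \<in> points X \<Longrightarrow> y \<in> points X \<Longrightarrow> x + y \<in> points X"
    and scale_in: "x \<in> points X \<Longrightarrow> r *\<^sub>R x \<in> points X"
    and nrm_nonneg: "x \<in> points X \<Longrightarrow> 0 \<le> nrm X x"
    and nrm_add: "x \<in> points X \<Longrightarrow> y \<in> points X \<Longrightarrow> nrm X (x + y) \<le> nrm X x + nrm X y"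
    and nrm_scale: "x \<in> points X \<Longrightarrow> nrm X (r *\<^sub>R x) = \<bar>r\<bar> * nrm X x"
    and nrm_eq_0: "x \<in> points X \<Longrightarrow> nrm X x = 0 \<Longrightarrow> x = 0"
begin

lemma minus_in: "x \<in> points X \<Longrightarrow> - x \<in> points X"
  using scale_in[of x "-1"] by simp

lemma diff_in: "x \<in> points X \<Longrightarrow> y \<in> points X \<Longrightarrow> x - y \<in> points X"
  using add_in[of x "- y"] minus_in[of y] by simp

lemma nrm_minus: "x \<in> points X \<Longrightarrow> nrm X (- x) = nrm X x"
  using nrm_scale[of x "-1"] by simp

lemma nrm_0: "nrm X 0 = 0"
  using nrm_scale[OF zero_in, of 0] by simp

lemma nrm_diff_commute: "x \<in> points X \<Longrightarrow> y \<in> points X \<Longrightarrow> nrm X (x - y) = nrm X (y - x)"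
  using nrm_minus[OF diff_in, of x y] by simp

lemma nrm_diff: "x \<in> points X \<Longrightarrow> y \<in> points X \<Longrightarrow> nrm X (x - y) \<le> nrm X x + nrm X y"
  using nrm_add[of x "- y"] minus_in[of y] nrm_minus[of y] by simp

lemma nrm_reverse_triangle:
  assumes "x \<in> points X" "y \<in> points X"
  shows "\<bar>nrm X x - nrm X y\<bar> \<le> nrm X (x - y)"
  using nrm_add[OF diff_in[OF assms] assms(2)] nrm_add[OF diff_in[OF assms(2,1)] assms(1)]
    nrm_diff_commute[OF assms] by simp

end

section \<open>Norms on products, intersections and spaces of curves\<close>

lemma normed_points_prod:
  assumes "normed_points X" "normed_points Y"
  shows "normed_points (prod_space X Y)"
proof -
  interpret X: normed_points X by fact
  interpret Y: normed_points Y by fact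
  show ?thesis
  proof
    fix p q assume pq: "p \<in> points (prod_space X Y)" "q \<in> points (prod_space X Y)"
    have "sqrt ((nrm X (fst p + fst q))\<^sup>2 + (nrm Y (snd p + snd q))\<^sup>2)
        \<le> sqrt ((nrm X (fst p) + nrm X (fst q))\<^sup>2 + (nrm Y (snd p) + nrm Y (snd q))\<^sup>2)"
      using pq by (intro real_sqrt_le_mono add_mono power_mono)
        (auto simp: prod_space_def X.nrm_add Y.nrm_add X.nrm_nonneg Y.nrm_nonneg X.add_in Y.add_in)
    also have "\<dots> \<le> sqrt ((nrm X (fst p))\<^sup>2 + (nrm Y (snd p))\<^sup>2) + sqrt ((nrm X (fst q))\<^sup>2 + (nrm Y (snd q))\<^sup>2)"
      by (rule real_sqrt_sum_squares_triangle_ineq)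
    finally show "nrm (prod_space X Y) (p + q) \<le> nrm (prod_space X Y) p + nrm (prod_space X Y) q"
      by (simp add: prod_space_def split_beta)
  next
    fix p r assume "p \<in> points (prod_space X Y)"
    then show "nrm (prod_space X Y) (r *\<^sub>R p) = \<bar>r\<bar> * nrm (prod_space X Y) p"
      by (auto simp: prod_space_def X.nrm_scale Y.nrm_scale power_mult_distrib
          simp flip: distrib_left real_sqrt_mult real_sqrt_abs)
  qed (auto simp: prod_space_def zero_prod_def X.zero_in Y.zero_in X.add_in Y.add_in X.scale_in Y.scale_in
      sum_power2_eq_zero_iff X.nrm_eq_0 Y.nrm_eq_0)
qed

lemma normed_points_inter:
  assumes "normed_points X" "normed_points Y"
  shows "normed_points (inter_space X Y)"
proof -
  interpret X: normed_points X by fact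
  interpret Y: normed_points Y by fact
  show ?thesis
  proof
    fix x y assume "x \<in> points (inter_space X Y)" "y \<in> points (inter_space X Y)"
    then show "nrm (inter_space X Y) (x + y) \<le> nrm (inter_space X Y) x + nrm (inter_space X Y) y"
      using X.nrm_add[of x y] Y.nrm_add[of x y] by (simp add: inter_space_def)
  next
    fix x assume "x \<in> points (inter_space X Y)" "nrm (inter_space X Y) x = 0"
    then show "x = 0"
      using X.nrm_nonneg[of x] Y.nrm_nonneg[of x] X.nrm_eq_0[of x] by (simp add: inter_space_def)
  qed (auto simp: inter_space_def X.zero_in Y.zero_in X.add_in Y.add_in X.scale_in Y.scale_in
      X.nrm_nonneg Y.nrm_nonneg X.nrm_scale Y.nrm_scale distrib_left)
qed

lemma C_space_nrm_continuous:
  assumes "normed_points X" "f \<in> points (C_space T X)"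
  shows "continuous_on {0..T} (\<lambda>t. nrm X (f t))"
proof -
  interpret X: normed_points X by fact
  show ?thesis
    unfolding continuous_on_def
  proof
    fix t assume t: "t \<in> {0..T}"
    have lim: "((\<lambda>\<tau>. nrm X (f \<tau> - f t)) \<longlongrightarrow> 0) (at t within {0..T})"
      using assms(2) t by (simp add: C_space_def)
    have "((\<lambda>\<tau>. nrm X (f \<tau>) - nrm X (f t)) \<longlongrightarrow> 0) (at t within {0..T})"
    proof (rule Lim_null_comparison[OF _ lim])
      show "\<forall>\<^sub>F \<tau> in at t within {0..T}. norm (nrm X (f \<tau>) - nrm X (f t)) \<le> nrm X (f \<tau> - f t)"
        unfolding eventually_at_filter
        by (rule always_eventually) (use assms(2) t X.nrm_reverse_triangle in \<open>auto simp: C_space_def\<close>)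
    qed
    then show "((\<lambda>\<tau>. nrm X (f \<tau>)) \<longlongrightarrow> nrm X (f t)) (at t within {0..T})"
      by (subst Lim_null)
  qed
qed

text \<open>\<open>nrm (C_space T X)\<close> is a supremum in a conditionally complete order and
  carries information only for bounded families. Boundedness comes from compactness of
  \<open>{0..T}\<close> and continuity of the norm along the curve.\<close>

lemma C_space_bdd:
  assumes "normed_points X" "f \<in> points (C_space T X)"
  shows "bdd_above ((\<lambda>t. nrm X (f t)) ` {0..T})"
  using compact_continuous_image[OF C_space_nrm_continuous[OF assms]]
  by (intro bounded_imp_bdd_above compact_imp_bounded) auto

lemma C_space_nrm_ge:
  assumes "normed_points X" "f \<in> points (C_space T X)" "t \<in> {0..T}"
  shows "nrm X (f t) \<le> nrm (C_space T X) f"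
  using cSUP_upper[OF assms(3) C_space_bdd[OF assms(1,2)]] by (simp add: C_space_def)

lemma normed_points_C_space:
  assumes "normed_points X" "T \<ge> 0"
  shows "normed_points (C_space T X)"
proof -
  interpret X: normed_points X by fact
  have ne: "{0..T} \<noteq> {}" using assms(2) by auto
  show ?thesis
  proof
    show "0 \<in> points (C_space T X)"
      by (simp add: C_space_def X.zero_in X.nrm_0)
  next
    fix f g assume fg: "f \<in> points (C_space T X)" "g \<in> points (C_space T X)"
    have "((\<lambda>\<tau>. nrm X ((f + g) \<tau> - (f + g) t)) \<longlongrightarrow> 0) (at t within {0..T})" if t: "t \<in> {0..T}" for t
    proof (rule Lim_null_comparison)
      show "((\<lambda>\<tau>. nrm X (f \<tau> - f t) + nrm X (g \<tau> - g t)) \<longlongrightarrow> 0) (at t within {0..T})"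
        using tendsto_add[of "\<lambda>\<tau>. nrm X (f \<tau> - f t)" 0 _ "\<lambda>\<tau>. nrm X (g \<tau> - g t)" 0] fg t
        by (simp add: C_space_def)
      have "norm (nrm X ((f + g) \<tau> - (f + g) t)) \<le> nrm X (f \<tau> - f t) + nrm X (g \<tau> - g t)"
        if "\<tau> \<in> {0..T}" for \<tau>
      proof -
        have *: "f \<tau> \<in> points X" "f t \<in> points X" "g \<tau> \<in> points X" "g t \<in> points X"
          using fg t that by (auto simp: C_space_def)
        have "(f + g) \<tau> - (f + g) t = (f \<tau> - f t) + (g \<tau> - g t)" by simp
        then show ?thesis
          using X.nrm_add[of "f \<tau> - f t" "g \<tau> - g t"] X.nrm_nonneg[of "(f \<tau> - f t) + (g \<tau> - g t)"] *
          by (simp only:) (simp add: X.diff_in X.add_in)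
      qed
      then show "\<forall>\<^sub>F \<tau> in at t within {0..T}. norm (nrm X ((f + g) \<tau> - (f + g) t)) \<le> nrm X (f \<tau> - f t) + nrm X (g \<tau> - g t)"
        by (auto simp: eventually_at_filter)
    qed
    then show "f + g \<in> points (C_space T X)"
      using fg by (simp add: C_space_def X.add_in)
    show "nrm (C_space T X) (f + g) \<le> nrm (C_space T X) f + nrm (C_space T X) g"
      unfolding C_space_def nspace.simps
    proof (rule cSUP_least[OF ne])
      fix t assume t: "t \<in> {0..T}"
      show "nrm X ((f + g) t) \<le> (SUP t\<in>{0..T}. nrm X (f t)) + (SUP t\<in>{0..T}. nrm X (g t))"
        using C_space_nrm_ge[OF assms(1) fg(1) t] C_space_nrm_ge[OF assms(1) fg(2) t] fg t
          X.nrm_add[of "f t" "g t"] by (simp add: C_space_def)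
    qed
  next
    fix f r assume f: "f \<in> points (C_space T X)"
    have fX: "t \<in> {0..T} \<Longrightarrow> f t \<in> points X" for t using f by (simp add: C_space_def)
    have "((\<lambda>\<tau>. nrm X ((r *\<^sub>R f) \<tau> - (r *\<^sub>R f) t)) \<longlongrightarrow> 0) (at t within {0..T})" if t: "t \<in> {0..T}" for t
    proof (rule Lim_transform_within[OF _ zero_less_one])
      show "((\<lambda>\<tau>. \<bar>r\<bar> * nrm X (f \<tau> - f t)) \<longlongrightarrow> 0) (at t within {0..T})"
        using f t by (intro tendsto_mult_right_zero) (simp add: C_space_def)
      fix \<tau> assume "\<tau> \<in> {0..T}"
      then show "\<bar>r\<bar> * nrm X (f \<tau> - f t) = nrm X ((r *\<^sub>R f) \<tau> - (r *\<^sub>R f) t)"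
        using X.nrm_scale[OF X.diff_in[OF fX fX[OF t]], of \<tau> r] by (simp add: scaleR_fun_def scaleR_diff_right)
    qed
    then show "r *\<^sub>R f \<in> points (C_space T X)"
      using f by (simp add: C_space_def X.scale_in scaleR_fun_def)
    have "(SUP t\<in>{0..T}. nrm X (r *\<^sub>R f t)) = (SUP t\<in>{0..T}. \<bar>r\<bar> * nrm X (f t))"
      using fX by (intro SUP_cong) (auto simp: X.nrm_scale)
    also have "\<dots> = \<bar>r\<bar> * (SUP t\<in>{0..T}. nrm X (f t))"
    proof (rule antisym)
      show "(SUP t\<in>{0..T}. \<bar>r\<bar> * nrm X (f t)) \<le> \<bar>r\<bar> * (SUP t\<in>{0..T}. nrm X (f t))"
        by (rule cSUP_least[OF ne]) (intro mult_left_mono cSUP_upper C_space_bdd[OF assms(1) f], auto)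
      show "\<bar>r\<bar> * (SUP t\<in>{0..T}. nrm X (f t)) \<le> (SUP t\<in>{0..T}. \<bar>r\<bar> * nrm X (f t))"
      proof (cases "r = 0")
        case False
        have bd: "bdd_above ((\<lambda>t. \<bar>r\<bar> * nrm X (f t)) ` {0..T})"
        proof -
          obtain M where "\<forall>t\<in>{0..T}. nrm X (f t) \<le> M"
            using C_space_bdd[OF assms(1) f] unfolding bdd_above_def by blast
          then show ?thesis
            by (intro bdd_aboveI2[where M = "\<bar>r\<bar> * M"] mult_left_mono) auto
        qed
        have "(SUP t\<in>{0..T}. nrm X (f t)) \<le> (SUP t\<in>{0..T}. \<bar>r\<bar> * nrm X (f t)) / \<bar>r\<bar>"
        proof (rule cSUP_least[OF ne])
          fix t assume "t \<in> {0..T}"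
          then show "nrm X (f t) \<le> (SUP t\<in>{0..T}. \<bar>r\<bar> * nrm X (f t)) / \<bar>r\<bar>"
            using cSUP_upper[OF _ bd, of t] False by (simp add: field_simps)
        qed
        then show ?thesis using False by (simp add: field_simps)
      qed (use ne in simp)
    qed
    finally show "nrm (C_space T X) (r *\<^sub>R f) = \<bar>r\<bar> * nrm (C_space T X) f"
      by (simp add: C_space_def scaleR_fun_def)
  next
    fix f assume f: "f \<in> points (C_space T X)"
    have fX: "t \<in> {0..T} \<Longrightarrow> f t \<in> points X" for t using f by (simp add: C_space_def)
    have "0 \<in> {0..T}" using assms(2) by simp
    from order_trans[OF X.nrm_nonneg[OF fX[OF this]] C_space_nrm_ge[OF assms(1) f this]]
    show "0 \<le> nrm (C_space T X) f" .
    assume z: "nrm (C_space T X) f = 0"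
    have "f t = 0" for t
    proof (cases "t \<in> {0..T}")
      case True
      then show ?thesis
        using C_space_nrm_ge[OF assms(1) f True] z X.nrm_nonneg[OF fX] X.nrm_eq_0[OF fX] by fastforce
    qed (use f in \<open>simp add: C_space_def\<close>)
    then show "f = 0" by (simp add: fun_eq_iff)
  qed
qed

text \<open>\<open>curve_derivative\<close> is a definite description and can be computed only after
  uniqueness. \<open>T > 0\<close> makes every point of \<open>{0..T}\<close> a limit point of the
  interval, so limits of difference quotients are unique; off the interval both curves vanish by
  normalisation.\<close>

lemma has_curve_derivative_unique:
  assumes "normed_points X" "T > 0" "f \<in> points (C_space T X)"
    and g: "g \<in> points (C_space T X)" "has_curve_derivative T X f g"
    and h: "h \<in> points (C_space T X)" "has_curve_derivative T X f h"
  shows "g = h"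
proof
  interpret X: normed_points X by fact
  fix t
  show "g t = h t"
  proof (cases "t \<in> {0..T}")
    case t: True
    have nt: "at t within {0..T} \<noteq> bot"
      using t assms(2) by (simp add: at_within_Icc_at trivial_limit_within islimpt_Icc)
    let ?q = "\<lambda>\<tau>. (1 / (\<tau> - t)) *\<^sub>R (f \<tau> - f t)"
    have lim: "((\<lambda>\<tau>. nrm X (?q \<tau> - g t) + nrm X (?q \<tau> - h t)) \<longlongrightarrow> 0) (at t within {0..T})"
      using tendsto_add[OF g(2)[unfolded has_curve_derivative_def, rule_format, OF t]
          h(2)[unfolded has_curve_derivative_def, rule_format, OF t]] by simp
    have pts: "g t \<in> points X" "h t \<in> points X" "f t \<in> points X"
      using t g h assms(3) by (auto simp: C_space_def)
    have "nrm X (g t - h t) \<le> 0"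
    proof (rule tendsto_lowerbound[OF lim _ nt])
      have "nrm X (g t - h t) \<le> nrm X (?q \<tau> - g t) + nrm X (?q \<tau> - h t)" if "\<tau> \<in> {0..T}" for \<tau>
      proof -
        have q: "?q \<tau> \<in> points X"
          using that assms(3) pts by (auto simp: C_space_def intro!: X.scale_in X.diff_in)
        have "g t - h t = (?q \<tau> - h t) - (?q \<tau> - g t)" by simp
        then show ?thesis
          using X.nrm_diff[OF X.diff_in[OF q pts(2)] X.diff_in[OF q pts(1)]] by (simp only:)
      qed
      then show "\<forall>\<^sub>F \<tau> in at t within {0..T}. nrm X (g t - h t) \<le> nrm X (?q \<tau> - g t) + nrm X (?q \<tau> - h t)"
        by (auto simp: eventually_at_filter)
    qed
    then show ?thesis
      using X.nrm_nonneg[OF X.diff_in[OF pts(1,2)]] X.nrm_eq_0[OF X.diff_in[OF pts(1,2)]] by simp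
  qed (use g h in \<open>simp add: C_space_def\<close>)
qed

lemma Ck_space_subset: "points (Ck_space k T X) \<subseteq> points (C_space T X)"
  by (cases k) auto

lemma curve_derivative_eq:
  assumes "normed_points X" "T > 0" "f \<in> points (C_space T X)"
    and "g \<in> points (C_space T X)" "has_curve_derivative T X f g"
  shows "curve_derivative T X f = g"
  unfolding curve_derivative_def using has_curve_derivative_unique[OF assms(1,2,3)] assms(4,5)
  by (intro the_equality) auto

lemma has_curve_derivative_add:
  assumes "normed_points X" "f \<in> points (C_space T X)" "f' \<in> points (C_space T X)"
    and g: "g \<in> points (C_space T X)" "has_curve_derivative T X f g"
    and h: "g' \<in> points (C_space T X)" "has_curve_derivative T X f' g'"
  shows "has_curve_derivative T X (f + f') (g + g')"
  unfolding has_curve_derivative_def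
proof
  interpret X: normed_points X by fact
  fix t assume t: "t \<in> {0..T}"
  let ?q = "\<lambda>f \<tau>. (1 / (\<tau> - t)) *\<^sub>R (f \<tau> - f t)"
  show "((\<lambda>\<tau>. nrm X (?q (f + f') \<tau> - (g + g') t)) \<longlongrightarrow> 0) (at t within {0..T})"
  proof (rule Lim_null_comparison)
    show "((\<lambda>\<tau>. nrm X (?q f \<tau> - g t) + nrm X (?q f' \<tau> - g' t)) \<longlongrightarrow> 0) (at t within {0..T})"
      using tendsto_add[OF g(2)[unfolded has_curve_derivative_def, rule_format, OF t]
          h(2)[unfolded has_curve_derivative_def, rule_format, OF t]] by simp
    have "norm (nrm X (?q (f + f') \<tau> - (g + g') t)) \<le> nrm X (?q f \<tau> - g t) + nrm X (?q f' \<tau> - g' t)"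
      if "\<tau> \<in> {0..T}" for \<tau>
    proof -
      have *: "?q f \<tau> - g t \<in> points X" "?q f' \<tau> - g' t \<in> points X"
        using that t assms by (auto simp: C_space_def intro!: X.scale_in X.diff_in)
      have "?q (f + f') \<tau> - (g + g') t = (?q f \<tau> - g t) + (?q f' \<tau> - g' t)"
        by (simp add: scaleR_add_right scaleR_diff_right)
      then show ?thesis
        using X.nrm_add[OF *] X.nrm_nonneg[OF X.add_in[OF *]] by (simp only:) simp
    qed
    then show "\<forall>\<^sub>F \<tau> in at t within {0..T}. norm (nrm X (?q (f + f') \<tau> - (g + g') t)) \<le> nrm X (?q f \<tau> - g t) + nrm X (?q f' \<tau> - g' t)"
      by (auto simp: eventually_at_filter)
  qed
qed

lemma has_curve_derivative_scale:
  assumes "normed_points X" "f \<in> points (C_space T X)"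
    and g: "g \<in> points (C_space T X)" "has_curve_derivative T X f g"
  shows "has_curve_derivative T X (r *\<^sub>R f) (r *\<^sub>R g)"
  unfolding has_curve_derivative_def
proof
  interpret X: normed_points X by fact
  fix t assume t: "t \<in> {0..T}"
  let ?q = "\<lambda>f \<tau>. (1 / (\<tau> - t)) *\<^sub>R (f \<tau> - f t)"
  show "((\<lambda>\<tau>. nrm X (?q (r *\<^sub>R f) \<tau> - (r *\<^sub>R g) t)) \<longlongrightarrow> 0) (at t within {0..T})"
  proof (rule Lim_transform_within[OF _ zero_less_one])
    show "((\<lambda>\<tau>. \<bar>r\<bar> * nrm X (?q f \<tau> - g t)) \<longlongrightarrow> 0) (at t within {0..T})"
      using g t by (intro tendsto_mult_right_zero) (simp add: has_curve_derivative_def)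
    fix \<tau> assume "\<tau> \<in> {0..T}"
    then have *: "?q f \<tau> - g t \<in> points X"
      using t assms by (auto simp: C_space_def intro!: X.scale_in X.diff_in)
    have "?q (r *\<^sub>R f) \<tau> - (r *\<^sub>R g) t = r *\<^sub>R (?q f \<tau> - g t)"
      by (simp add: scaleR_fun_def scaleR_diff_right)
    then show "\<bar>r\<bar> * nrm X (?q f \<tau> - g t) = nrm X (?q (r *\<^sub>R f) \<tau> - (r *\<^sub>R g) t)"
      using X.nrm_scale[OF *] by simp
  qed
qed

text \<open>The norm at level \<open>Suc k\<close> passes through \<open>curve_derivative\<close>,
  so the norm laws reduce to linearity of the derivative. Uniqueness identifies the described
  derivative with the witness supplied by membership.\<close>

lemma normed_points_Ck_space:
  assumes "normed_points X" "T > 0"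
  shows "normed_points (Ck_space k T X)"
proof (induction k)
  case 0
  then show ?case using normed_points_C_space[of X T] assms by simp
next
  case (Suc k)
  interpret C: normed_points "C_space T X"
    using normed_points_C_space[of X T] assms by simp
  interpret K: normed_points "Ck_space k T X" by fact
  note sub = subsetD[OF Ck_space_subset[of k T X]]
  note eq = curve_derivative_eq[OF assms]
  note add = has_curve_derivative_add[OF assms(1)]
  note scale = has_curve_derivative_scale[OF assms(1)]
  have 0: "has_curve_derivative T X 0 0"
    using assms(1) by (simp add: has_curve_derivative_def normed_points.nrm_0)
  show ?case
  proof
    show "0 \<in> points (Ck_space (Suc k) T X)"
      using 0 K.zero_in C.zero_in by auto
  next
    fix f g assume "f \<in> points (Ck_space (Suc k) T X)" "g \<in> points (Ck_space (Suc k) T X)"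
    then obtain f' g' where
      f: "f \<in> points (C_space T X)" "f' \<in> points (Ck_space k T X)" "has_curve_derivative T X f f'" and
      g: "g \<in> points (C_space T X)" "g' \<in> points (Ck_space k T X)" "has_curve_derivative T X g g'"
      by auto
    note fg = add[OF f(1) g(1) sub[OF f(2)] f(3) sub[OF g(2)] g(3)]
    show "f + g \<in> points (Ck_space (Suc k) T X)"
      using f g fg C.add_in K.add_in by auto
    have "curve_derivative T X (f + g) = f' + g'"
      using f g fg by (intro eq) (auto intro: C.add_in sub)
    moreover have "curve_derivative T X f = f'" "curve_derivative T X g = g'"
      using f g by (auto intro!: eq intro: sub)
    ultimately show "nrm (Ck_space (Suc k) T X) (f + g) \<le> nrm (Ck_space (Suc k) T X) f + nrm (Ck_space (Suc k) T X) g"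
      using C.nrm_add[OF f(1) g(1)] K.nrm_add[OF f(2) g(2)] by simp
  next
    fix f r assume "f \<in> points (Ck_space (Suc k) T X)"
    then obtain f' where
      f: "f \<in> points (C_space T X)" "f' \<in> points (Ck_space k T X)" "has_curve_derivative T X f f'"
      by auto
    note rf = scale[OF f(1) sub[OF f(2)] f(3)]
    show "r *\<^sub>R f \<in> points (Ck_space (Suc k) T X)"
      using f rf C.scale_in K.scale_in[OF f(2)] by (auto intro!: bexI[of _ "r *\<^sub>R f'"])
    have "curve_derivative T X (r *\<^sub>R f) = r *\<^sub>R f'"
      using f rf by (intro eq) (auto intro: C.scale_in sub)
    moreover have d: "curve_derivative T X f = f'"
      using f by (auto intro!: eq intro: sub)
    ultimately show "nrm (Ck_space (Suc k) T X) (r *\<^sub>R f) = \<bar>r\<bar> * nrm (Ck_space (Suc k) T X) f"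
      using f by (simp add: C.nrm_scale K.nrm_scale distrib_left)
    show "0 \<le> nrm (Ck_space (Suc k) T X) f"
      using d f C.nrm_nonneg[OF f(1)] K.nrm_nonneg[OF f(2)] by simp
    assume "nrm (Ck_space (Suc k) T X) f = 0"
    then show "f = 0"
      using d f C.nrm_nonneg[OF f(1)] K.nrm_nonneg[OF f(2)] C.nrm_eq_0[OF f(1)] by simp
  qed
qed

section \<open>Operator norms and the second-order expansion along a ray\<close>

lemma L_space_in: "L \<in> points (L_space X Y) \<Longrightarrow> h \<in> points X \<Longrightarrow> L h \<in> points Y"
  and L_space_scale: "L \<in> points (L_space X Y) \<Longrightarrow> h \<in> points X \<Longrightarrow> L (r *\<^sub>R h) = r *\<^sub>R L h"
  by (simp_all add: L_space_def)

lemma L_space_bound_obtain: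
  assumes "L \<in> points (L_space X Y)"
  obtains K where "\<And>h. h \<in> points X \<Longrightarrow> nrm Y (L h) \<le> K * nrm X h"
proof -
  have "\<exists>K. \<forall>h\<in>points X. nrm Y (L h) \<le> K * nrm X h"
    using assms unfolding L_space_def nspace.simps mem_Collect_eq by (elim conjE)
  then show thesis using that by metis
qed

lemma L_space_bdd:
  assumes "L \<in> points (L_space X Y)" "normed_points X"
  shows "bdd_above ((\<lambda>h. nrm Y (L h)) ` {h \<in> points X. nrm X h \<le> 1})"
proof -
  interpret X: normed_points X by fact
  obtain K where K: "\<And>h. h \<in> points X \<Longrightarrow> nrm Y (L h) \<le> K * nrm X h"
    using L_space_bound_obtain[OF assms(1)] by metis
  show ?thesis
  proof (rule bdd_aboveI2)
    fix h assume h: "h \<in> {h \<in> points X. nrm X h \<le> 1}"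
    have "nrm Y (L h) \<le> \<bar>K\<bar> * nrm X h"
      using K[of h] h by (auto intro!: order_trans[OF K mult_right_mono] X.nrm_nonneg)
    also have "\<dots> \<le> \<bar>K\<bar>" using h X.nrm_nonneg[of h] by (simp add: mult_left_le)
    finally show "nrm Y (L h) \<le> \<bar>K\<bar>" .
  qed
qed

lemma L_space_bound:
  assumes "L \<in> points (L_space X Y)" "normed_points X" "h \<in> points X" "nrm X h \<le> 1"
  shows "nrm Y (L h) \<le> nrm (L_space X Y) L"
  using cSUP_upper[OF _ L_space_bdd[OF assms(1,2)], of h] assms(3,4) by (simp add: L_space_def)

text \<open>The Frechet remainder of \<open>f'\<close> is a combination of operators. Knowing that
  it lies in \<open>L_space X Y\<close> allows \<open>L_space_bound\<close> to turn its operator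
  norm into an estimate in one direction.\<close>

lemma L_space_diff:
  assumes "L \<in> points (L_space X Y)" "M \<in> points (L_space X Y)" "normed_points X" "normed_points Y"
  shows "L - M \<in> points (L_space X Y)"
proof -
  interpret Y: normed_points Y by fact
  interpret X: normed_points X by fact
  have LM: "L h \<in> points Y" "M h \<in> points Y" if "h \<in> points X" for h
    using assms(1,2) that by (auto intro: L_space_in)
  obtain K where K: "\<And>h. h \<in> points X \<Longrightarrow> nrm Y (L h) \<le> K * nrm X h"
    using L_space_bound_obtain[OF assms(1)] by metis
  obtain K' where K': "\<And>h. h \<in> points X \<Longrightarrow> nrm Y (M h) \<le> K' * nrm X h"
    using L_space_bound_obtain[OF assms(2)] by metis
  have "\<forall>h\<in>points X. nrm Y ((L - M) h) \<le> (K + K') * nrm X h"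
  proof
    fix h assume h: "h \<in> points X"
    have "nrm Y (L h - M h) \<le> nrm Y (L h) + nrm Y (M h)"
      using Y.nrm_diff LM[OF h] by blast
    with K[OF h] K'[OF h] show "nrm Y ((L - M) h) \<le> (K + K') * nrm X h"
      by (simp add: distrib_right)
  qed
  then have ex: "\<exists>K. \<forall>h\<in>points X. nrm Y ((L - M) h) \<le> K * nrm X h" by blast
  have "\<forall>h\<in>points X. (L - M) h \<in> points Y"
    using LM Y.diff_in by simp
  moreover have "\<forall>h\<in>points X. \<forall>k\<in>points X. (L - M) (h + k) = (L - M) h + (L - M) k"
    "\<forall>r. \<forall>h\<in>points X. (L - M) (r *\<^sub>R h) = r *\<^sub>R (L - M) h"
    "\<forall>h. h \<notin> points X \<longrightarrow> (L - M) h = 0"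
    using assms(1,2) by (simp_all add: L_space_def scaleR_diff_right)
  ultimately show ?thesis
    using ex unfolding L_space_def nspace.simps mem_Collect_eq by blast
qed

text \<open>
  Along the ray through \<open>d\<close>, a scalar functional of \<open>\<Phi>\<close> is twice differentiable at \<open>0\<close>; its second
  derivative there is twice the quadratic coefficient and is controlled by the second derivative
  of \<open>\<Phi>\<close> at the origin.
\<close>

lemma C2_quadratic_coefficient_bound:
  fixes X :: "'a::real_vector nspace" and Y :: "'b::real_vector nspace"
  assumes X: "normed_points X" and Y: "normed_points Y"
    and C2: "C2_on X Y (unit_ball X) \<Phi>"
  obtains K where "K \<ge> 0"
    "\<And>d \<phi> L q M e. d \<in> points X \<Longrightarrow> nrm X d \<le> 1 \<Longrightarrow>
      (\<And>x y. x \<in> points Y \<Longrightarrow> y \<in> points Y \<Longrightarrow> \<phi> (x + y) = \<phi> x + \<phi> y) \<Longrightarrow>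
      (\<And>r x. x \<in> points Y \<Longrightarrow> \<phi> (r *\<^sub>R x) = r * \<phi> x) \<Longrightarrow>
      (\<And>x. x \<in> points Y \<Longrightarrow> \<bar>\<phi> x\<bar> \<le> L * nrm Y x) \<Longrightarrow> L \<ge> 0 \<Longrightarrow> 0 < e \<Longrightarrow>
      (\<And>r. 0 \<le> r \<Longrightarrow> r < e \<Longrightarrow> \<bar>\<phi> (\<Phi> (r *\<^sub>R d)) - r\<^sup>2 * q\<bar> \<le> M * r ^ 3) \<Longrightarrow>
      \<bar>q\<bar> \<le> K * L"
proof -
  interpret X: normed_points X by fact
  interpret Y: normed_points Y by fact
  obtain f' f'' where f': "has_frechet_derivative_on X Y (unit_ball X) \<Phi> f'"
    and f'': "has_frechet_derivative_on X (L_space X Y) (unit_ball X) f' f''"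
    using C2 unfolding C2_on_def by blast
  have f0: "0 \<in> unit_ball X" by (simp add: unit_ball_def X.zero_in X.nrm_0)
  have f''0: "f'' 0 \<in> points (L_space X (L_space X Y))"
    using f'' f0 by (auto simp: has_frechet_derivative_on_def)
  then obtain K where K: "\<And>h. h \<in> points X \<Longrightarrow> nrm (L_space X Y) (f'' 0 h) \<le> K * nrm X h"
    using L_space_bound_obtain by metis
  show ?thesis
  proof (rule that[of "\<bar>K\<bar>"])
    fix d \<phi> L q M and e :: real
    assume d: "d \<in> points X" "nrm X d \<le> 1"
      and add: "\<And>x y. x \<in> points Y \<Longrightarrow> y \<in> points Y \<Longrightarrow> \<phi> (x + y) = \<phi> x + \<phi> y"
      and scale: "\<And>r x. x \<in> points Y \<Longrightarrow> \<phi> (r *\<^sub>R x) = r * \<phi> x"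
      and bound: "\<And>x. x \<in> points Y \<Longrightarrow> \<bar>\<phi> x\<bar> \<le> L * nrm Y x" and L: "L \<ge> 0" and e: "0 < e"
      and expand: "\<And>r. 0 \<le> r \<Longrightarrow> r < e \<Longrightarrow> \<bar>\<phi> (\<Phi> (r *\<^sub>R d)) - r\<^sup>2 * q\<bar> \<le> M * r ^ 3"
    have diff: "\<phi> (x - y) = \<phi> x - \<phi> y" if "x \<in> points Y" "y \<in> points Y" for x y
      using add[of "x - y" y] that Y.diff_in by simp
    have ball: "r *\<^sub>R d \<in> unit_ball X" if "\<bar>r\<bar> < 1" for r
    proof -
      have "\<bar>r\<bar> * nrm X d \<le> \<bar>r\<bar>" using d X.nrm_nonneg[OF d(1)] by (simp add: mult_left_le)
      then show ?thesis using that d by (simp add: unit_ball_def X.nrm_scale X.scale_in)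
    qed
    have nd: "nrm X (r *\<^sub>R d - r' *\<^sub>R d) \<le> \<bar>r - r'\<bar>" for r r'
      using X.nrm_scale[OF d(1), of "r - r'"] d X.nrm_nonneg[OF d(1)] by (simp add: mult_left_le flip: scaleR_diff_left)
    define G where "G r = \<phi> (\<Phi> (r *\<^sub>R d))" for r
    define G' where "G' r = \<phi> (f' (r *\<^sub>R d) d)" for r
    define p where "p = \<phi> (f'' 0 d d)"
    have \<Phi>in: "\<Phi> (r *\<^sub>R d) \<in> points Y" and f'in: "f' (r *\<^sub>R d) \<in> points (L_space X Y)" if "\<bar>r\<bar> < 1" for r
      using f' ball[OF that] by (auto simp: has_frechet_derivative_on_def)
    have DG: "(G has_real_derivative G' r) (at r)" if r: "\<bar>r\<bar> < 1" for r
      unfolding has_field_derivative_def has_derivative_at_alt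
    proof (intro conjI allI impI)
      fix \<epsilon> :: real assume \<epsilon>: "\<epsilon> > 0"
      \<comment> \<open>The summand \<open>1\<close> keeps the quotient meaningful when the
        functional has \<open>L = 0\<close>.\<close>
      define \<eta> where "\<eta> = \<epsilon> / (L + 1)"
      have \<eta>: "\<eta> > 0" "L * \<eta> \<le> \<epsilon>" using \<epsilon> L by (auto simp: \<eta>_def field_simps)
      obtain \<delta> where \<delta>: "\<delta> > 0" "\<And>y. y \<in> unit_ball X \<Longrightarrow> nrm X (y - r *\<^sub>R d) < \<delta> \<Longrightarrow>
        nrm Y (\<Phi> y - \<Phi> (r *\<^sub>R d) - f' (r *\<^sub>R d) (y - r *\<^sub>R d)) \<le> \<eta> * nrm X (y - r *\<^sub>R d)"
        using f' ball[OF r] \<eta>(1) unfolding has_frechet_derivative_on_def by blast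
      show "\<exists>\<delta>>0. \<forall>r'. norm (r' - r) < \<delta> \<longrightarrow> norm (G r' - G r - G' r * (r' - r)) \<le> \<epsilon> * norm (r' - r)"
      \<comment> \<open>The second entry keeps \<open>r' *\<^sub>R d\<close> inside the unit ball,
        the only place where the Frechet estimate is available.\<close>
      proof (intro exI[of _ "min \<delta> (1 - \<bar>r\<bar>)"] conjI allI impI)
        fix r' assume "norm (r' - r) < min \<delta> (1 - \<bar>r\<bar>)"
        then have r': "\<bar>r'\<bar> < 1" "\<bar>r' - r\<bar> < \<delta>" by auto
        have lin: "f' (r *\<^sub>R d) (r' *\<^sub>R d - r *\<^sub>R d) = (r' - r) *\<^sub>R f' (r *\<^sub>R d) d"
          using L_space_scale[OF f'in[OF r] d(1)] by (simp flip: scaleR_diff_left)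
        have fd: "f' (r *\<^sub>R d) d \<in> points Y" by (rule L_space_in[OF f'in[OF r] d(1)])
        have "G r' - G r - G' r * (r' - r) = \<phi> (\<Phi> (r' *\<^sub>R d) - \<Phi> (r *\<^sub>R d) - (r' - r) *\<^sub>R f' (r *\<^sub>R d) d)"
          using \<Phi>in[OF r] \<Phi>in[OF r'(1)] fd
          by (simp add: diff Y.diff_in Y.scale_in scale G_def G'_def)
        also have "\<bar>\<dots>\<bar> \<le> L * nrm Y (\<Phi> (r' *\<^sub>R d) - \<Phi> (r *\<^sub>R d) - (r' - r) *\<^sub>R f' (r *\<^sub>R d) d)"
          using \<Phi>in[OF r] \<Phi>in[OF r'(1)] fd by (intro bound) (simp add: Y.diff_in Y.scale_in)
        also have "\<dots> \<le> L * (\<eta> * nrm X (r' *\<^sub>R d - r *\<^sub>R d))"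
          using \<delta>(2)[OF ball[OF r'(1)]] nd[of r' r] r'(2) L by (intro mult_left_mono) (auto simp: lin)
        also have "\<dots> \<le> L * (\<eta> * \<bar>r' - r\<bar>)"
          by (rule mult_left_mono[OF mult_left_mono[OF nd]]) (use L \<eta> in auto)
        also have "\<dots> \<le> \<epsilon> * \<bar>r' - r\<bar>"
          using mult_right_mono[OF \<eta>(2), of "\<bar>r' - r\<bar>"] by (simp add: mult_ac)
        finally show "norm (G r' - G r - G' r * (r' - r)) \<le> \<epsilon> * norm (r' - r)" by simp
      qed (use \<delta>(1) r in auto)
    qed (rule bounded_linear_mult_right)
    have G0: "G 0 = 0" using expand[of 0] e by (simp add: G_def)
    \<comment> \<open>The expansion is assumed for \<open>r \<ge> 0\<close> only. A limit from the
      right suffices, because differentiability of \<open>G\<close> at \<open>0\<close> is already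
      known and the one-sided limit must agree with it.\<close>
    have G'0: "G' 0 = 0"
    proof -
      have "((\<lambda>r. (G r - G 0) / (r - 0)) \<longlongrightarrow> G' 0) (at_right 0)"
        using DG[of 0]
        by (intro tendsto_within_subset[where T = "{0<..}" and S = UNIV]) (simp_all add: has_field_derivative_iff)
      moreover have "((\<lambda>r. (G r - G 0) / (r - 0)) \<longlongrightarrow> 0) (at_right 0)"
      proof (rule Lim_null_comparison)
        show "\<forall>\<^sub>F r in at_right 0. norm ((G r - G 0) / (r - 0)) \<le> r * \<bar>q\<bar> + \<bar>M\<bar> * r\<^sup>2"
          unfolding eventually_at_right_field
        proof (intro exI[of _ e] conjI e allI impI)
          fix r assume r: "(0::real) < r" "r < e"
          have "\<bar>G r\<bar> \<le> r\<^sup>2 * \<bar>q\<bar> + M * r ^ 3"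
            using expand[of r] r abs_triangle_ineq[of "G r - r\<^sup>2 * q" "r\<^sup>2 * q"] by (simp add: G_def abs_mult)
          also have "\<dots> \<le> r\<^sup>2 * \<bar>q\<bar> + \<bar>M\<bar> * r ^ 3" using r by (intro add_left_mono mult_right_mono) auto
          finally have "\<bar>G r\<bar> \<le> (r * \<bar>q\<bar> + \<bar>M\<bar> * r\<^sup>2) * r"
            by (simp add: algebra_simps power2_eq_square power3_eq_cube)
          then show "norm ((G r - G 0) / (r - 0)) \<le> r * \<bar>q\<bar> + \<bar>M\<bar> * r\<^sup>2"
            using r by (simp add: G0 field_simps abs_mult)
        qed
        show "((\<lambda>r. r * \<bar>q\<bar> + \<bar>M\<bar> * r\<^sup>2) \<longlongrightarrow> 0) (at_right 0)"
          by (auto intro!: tendsto_eq_intros)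
      qed
      ultimately show ?thesis
        by (intro tendsto_unique[OF trivial_limit_at_right_real])
    qed
    have f''d: "f'' 0 d \<in> points (L_space X Y)" by (rule L_space_in[OF f''0 d(1)])
    have f''lin: "f'' 0 (r *\<^sub>R d) = r *\<^sub>R f'' 0 d" for r by (rule L_space_scale[OF f''0 d(1)])
    \<comment> \<open>Two quadratic approximations of \<open>G\<close> are compared at one small
      \<open>r\<close>: coefficient \<open>p / 2\<close> from the second derivative, coefficient
      \<open>q\<close> from the assumed expansion. The allowed error \<open>\<eta>\<close> is split
      in halves.\<close>
    have key: "\<bar>q - p / 2\<bar> \<le> \<eta>" if \<eta>: "\<eta> > 0" for \<eta>
    proof -
      define \<zeta> where "\<zeta> = \<eta> / (2 * (L + 1))"
      have \<zeta>: "\<zeta> > 0" "L * \<zeta> \<le> \<eta> / 2" using \<eta> L by (auto simp: \<zeta>_def field_simps)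
      obtain \<delta> where \<delta>: "\<delta> > 0" "\<And>y. y \<in> unit_ball X \<Longrightarrow> nrm X (y - 0) < \<delta> \<Longrightarrow>
        nrm (L_space X Y) (f' y - f' 0 - f'' 0 (y - 0)) \<le> \<zeta> * nrm X (y - 0)"
        using f'' f0 \<zeta>(1) unfolding has_frechet_derivative_on_def by blast
      have G'b: "\<bar>G' r - r * p\<bar> \<le> \<eta> / 2 * r" if r: "0 \<le> r" "r < \<delta>" "r < 1" for r
      proof -
        have r1: "\<bar>r\<bar> < 1" using r by simp
        let ?D = "f' (r *\<^sub>R d) - f' 0 - f'' 0 (r *\<^sub>R d)"
        have D: "?D \<in> points (L_space X Y)"
          using f'in[OF r1] f'in[of 0] L_space_in[OF f''0 X.scale_in[OF d(1)]] by (intro L_space_diff X Y) auto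
        have in1: "f' (r *\<^sub>R d) d \<in> points Y" "f' 0 d \<in> points Y" "f'' 0 d d \<in> points Y"
          using f'in[OF r1] f'in[of 0] f''d d by (auto intro: L_space_in)
        have "G' r - r * p = G' r - G' 0 - r * p" by (simp add: G'0)
        also have "\<dots> = \<phi> (?D d)"
          using in1 by (simp add: diff Y.diff_in Y.scale_in scale G'_def p_def f''lin scaleR_fun_def)
        also have "\<bar>\<dots>\<bar> \<le> L * nrm Y (?D d)"
          by (rule bound[OF L_space_in[OF D d(1)]])
        also have "\<dots> \<le> L * nrm (L_space X Y) ?D"
          using L_space_bound[OF D X d] L by (intro mult_left_mono)
        also have "\<dots> \<le> L * (\<zeta> * nrm X (r *\<^sub>R d))"
          using \<delta>(2)[OF ball[OF r1]] nd[of r 0] r L by (intro mult_left_mono) auto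
        also have "\<dots> \<le> L * (\<zeta> * r)"
          using nd[of r 0] L \<zeta> r by (intro mult_left_mono) auto
        also have "\<dots> \<le> \<eta> / 2 * r"
          using mult_right_mono[OF \<zeta>(2), of r] r by (simp add: mult_ac)
        finally show ?thesis .
      qed
      \<comment> \<open>The entries serve, in turn, the Frechet estimate for \<open>f'\<close>,
        membership in the ball, validity of the expansion, and a cubic error of at most
        \<open>\<eta> / 2\<close> times \<open>r\<^sup>2\<close>.\<close>
      define m where "m = min (min \<delta> 1) (min e (\<eta> / (\<bar>M\<bar> + 1)))"
      have m: "0 < m" "m \<le> \<delta>" "m \<le> 1" "m \<le> e" "m \<le> \<eta> / (\<bar>M\<bar> + 1)"
        using \<delta>(1) e \<eta> by (auto simp: m_def)
      define r where "r = m / 2"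
      have r: "0 < r" "r < \<delta>" "r < 1" "r < e" "\<bar>M\<bar> * r \<le> \<eta> / 2"
      proof -
        show "0 < r" "r < \<delta>" "r < 1" "r < e" using m by (auto simp: r_def)
        have "2 * r \<le> \<eta> / (\<bar>M\<bar> + 1)" using m by (simp add: r_def)
        then have "r * (\<bar>M\<bar> + 1) \<le> \<eta> / 2" by (simp add: field_simps)
        then show "\<bar>M\<bar> * r \<le> \<eta> / 2" using \<open>0 < r\<close> by (simp add: algebra_simps)
      qed
      \<comment> \<open>The mean value theorem for \<open>H\<close> raises the first-order estimate
        of \<open>G'\<close> near \<open>0\<close> to a second-order estimate of \<open>G\<close>
        without any integration.\<close>
      define H where "H = (\<lambda>x. G x - x\<^sup>2 * p / 2)"
      have "\<exists>z>0. z < r \<and> H r - H 0 = (r - 0) * (G' z - z * p)"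
      proof (rule MVT2)
        fix x assume "0 \<le> x" "x \<le> r"
        then have "(G has_real_derivative G' x) (at x)" using r by (intro DG) auto
        then show "(H has_real_derivative G' x - x * p) (at x)"
          unfolding H_def by (auto intro!: derivative_eq_intros)
      qed (use r in auto)
      then obtain z where z: "0 < z" "z < r" "H r = r * (G' z - z * p)" by (auto simp: H_def G0)
      have "\<bar>H r\<bar> = r * \<bar>G' z - z * p\<bar>" using z(3) r by (simp add: abs_mult)
      also have "\<dots> \<le> r * (\<eta> / 2 * z)" using G'b[of z] z r by (intro mult_left_mono) auto
      also have "\<dots> \<le> r * (\<eta> / 2 * r)" using z r \<eta> by (intro mult_left_mono) auto
      finally have 1: "\<bar>G r - r\<^sup>2 * (p / 2)\<bar> \<le> r\<^sup>2 * (\<eta> / 2)" by (simp add: H_def power2_eq_square mult_ac)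
      have 2: "\<bar>G r - r\<^sup>2 * q\<bar> \<le> r\<^sup>2 * (\<eta> / 2)"
      proof -
        have "\<bar>G r - r\<^sup>2 * q\<bar> \<le> M * r ^ 3" using expand[of r] r by (simp add: G_def)
        also have "\<dots> \<le> \<bar>M\<bar> * r ^ 3" using r by (intro mult_right_mono) auto
        also have "\<dots> = r\<^sup>2 * (\<bar>M\<bar> * r)" by (simp add: power2_eq_square power3_eq_cube)
        also have "\<dots> \<le> r\<^sup>2 * (\<eta> / 2)" using r by (intro mult_left_mono) auto
        finally show ?thesis .
      qed
      have "r\<^sup>2 * \<bar>q - p / 2\<bar> = \<bar>r\<^sup>2 * q - r\<^sup>2 * (p / 2)\<bar>"
        using abs_mult[of "r\<^sup>2" "q - p / 2"] by (simp add: right_diff_distrib)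
      also have "\<dots> \<le> r\<^sup>2 * \<eta>" using 1 2 by linarith
      finally show ?thesis using r by simp
    qed
    have "\<bar>q - p / 2\<bar> = 0"
      using key field_le_epsilon[of "\<bar>q - p / 2\<bar>" 0] by force
    then have "\<bar>q\<bar> = \<bar>p\<bar> / 2" by auto
    also have "\<dots> \<le> \<bar>p\<bar>" by simp
    also have "\<bar>p\<bar> \<le> L * nrm Y (f'' 0 d d)" unfolding p_def
      by (rule bound[OF L_space_in[OF f''d d(1)]])
    also have "\<dots> \<le> L * nrm (L_space X Y) (f'' 0 d)"
      using L_space_bound[OF f''d X d] L by (intro mult_left_mono)
    also have "\<dots> \<le> L * (K * nrm X d)" using K[OF d(1)] L by (intro mult_left_mono)
    also have "\<dots> \<le> L * (\<bar>K\<bar> * 1)"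
      using L X.nrm_nonneg[OF d(1)] d(2) by (intro mult_left_mono mult_mono) auto
    finally show "\<bar>q\<bar> \<le> \<bar>K\<bar> * L" by (simp add: mult.commute)
  qed simp
qed


section \<open>Integration on the plane\<close>

lemma Basis_real2: "(Basis :: (real^2) set) = {axis 1 1, axis 2 1}"
  by (auto simp: Basis_vec_def UNIV_2)

lemma inner_real2: "(x::real^2) \<bullet> y = x$1 * y$1 + x$2 * y$2"
  by (simp add: inner_vec_def sum_2)

lemma axis_real2_neq: "axis 1 1 \<noteq> (axis 2 1 :: real^2)"
  by (simp add: axis_eq_axis)

text \<open>By \<open>lborel_eq\<close>, Lebesgue measure on the plane is the image of a product
  measure indexed by the two basis vectors. The factors are therefore indexed by
  \<open>Basis\<close> through \<open>F\<close>, and the product rule for finite product measures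
  applies.\<close>

lemma lborel_real2_prod:
  fixes f g :: "real \<Rightarrow> 'a::{real_normed_field, banach, second_countable_topology}"
  assumes f: "integrable lborel f" and g: "integrable lborel g"
  shows "integrable lborel (\<lambda>x::real^2. f (x$1) * g (x$2))"
    and "(\<integral>x. f ((x::real^2)$1) * g (x$2) \<partial>lborel) = (\<integral>x. f x \<partial>lborel) * (\<integral>x. g x \<partial>lborel)"
proof -
  define F where "F b = (if b = (axis 1 1 :: real^2) then f else g)" for b
  have [measurable]: "f \<in> borel_measurable borel" "g \<in> borel_measurable borel"
    using borel_measurable_integrable[OF f] borel_measurable_integrable[OF g] by simp_all
  interpret product_sigma_finite "\<lambda>_::real^2. lborel :: real measure" by standard
  have F: "integrable lborel (F b)" for b using f g by (simp add: F_def)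
  have eq: "(\<Prod>b\<in>Basis. F b (h b)) = f (h (axis 1 1)) * g (h (axis 2 1))" for h
    using axis_real2_neq by (auto simp: Basis_real2 F_def)
  have eq': "f ((\<Sum>b\<in>Basis. h b *\<^sub>R b)$1) * g ((\<Sum>b\<in>Basis. h b *\<^sub>R b)$2) = (\<Prod>b\<in>Basis. F b (h b))" for h
    using axis_real2_neq by (simp add: eq) (auto simp: Basis_real2 axis_def)
  have I: "integrable (\<Pi>\<^sub>M b\<in>Basis. lborel) (\<lambda>h. \<Prod>b\<in>(Basis::(real^2) set). F b (h b))"
    using F by (intro product_integrable_prod) auto
  show "integrable lborel (\<lambda>x::real^2. f (x$1) * g (x$2))"
    unfolding lborel_eq[where 'a="real^2"] using I
    by (subst integrable_distr_eq) (auto simp only: eq', measurable)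
  have "(\<integral>x. f ((x::real^2)$1) * g (x$2) \<partial>lborel) = (\<integral>h. (\<Prod>b\<in>(Basis::(real^2) set). F b (h b)) \<partial>(\<Pi>\<^sub>M b\<in>Basis. lborel))"
    unfolding lborel_eq[where 'a="real^2"]
    by (subst integral_distr) (auto simp only: eq', measurable)
  also have "\<dots> = (\<Prod>b\<in>(Basis::(real^2) set). integral\<^sup>L lborel (F b))"
    using F by (intro product_integral_prod) auto
  also have "\<dots> = (\<integral>x. f x \<partial>lborel) * (\<integral>x. g x \<partial>lborel)"
    using axis_real2_neq by (auto simp: Basis_real2 F_def)
  finally show "(\<integral>x. f ((x::real^2)$1) * g (x$2) \<partial>lborel) = (\<integral>x. f x \<partial>lborel) * (\<integral>x. g x \<partial>lborel)" .
qed

text \<open>Fourth powers leave room for a product of two one-dimensional Cauchy densities, because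
  each \<open>1 + (x$i)\<^sup>2\<close> is at most \<open>(1 + norm x)\<^sup>2\<close>. Four extra
  powers of decay are the price of integrability everywhere below.\<close>

lemma integrable_decay: "integrable lborel (\<lambda>x::real^2. 1 / (1 + norm x) ^ 4)"
proof -
  have 1: "integrable lborel (\<lambda>x::real. inverse (1 + x\<^sup>2))"
    using integrable_inverse_1_plus_square by (simp add: set_integrable_def)
  show ?thesis
  proof (rule Bochner_Integration.integrable_bound[OF lborel_real2_prod(1)[OF 1 1]])
    show "AE x in (lborel :: (real^2) measure). norm (1 / (1 + norm x) ^ 4) \<le> norm (inverse (1 + (x$1)\<^sup>2) * inverse (1 + (x$2)\<^sup>2))"
    proof (rule AE_I2)
      fix x :: "real^2"
      have "1 + (x$i)\<^sup>2 \<le> (1 + norm x)\<^sup>2" for i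
      proof -
        have "(x$i)\<^sup>2 \<le> (norm x)\<^sup>2" using component_le_norm_cart[of x i] abs_le_square_iff by fastforce
        moreover have "0 \<le> 2 * norm x" by simp
        ultimately show ?thesis unfolding power2_sum by (simp add: add_increasing2)
      qed
      from mult_mono[OF this this, of 2 1] have "(1 + (x$1)\<^sup>2) * (1 + (x$2)\<^sup>2) \<le> (1 + norm x) ^ 4"
        by (simp add: power_add[symmetric])
      moreover have "0 < (1 + (x$1)\<^sup>2) * (1 + (x$2)\<^sup>2)" by (intro mult_pos_pos add_pos_nonneg) auto
      ultimately have "1 / (1 + norm x) ^ 4 \<le> 1 / ((1 + (x$1)\<^sup>2) * (1 + (x$2)\<^sup>2))"
        by (intro divide_left_mono mult_pos_pos zero_less_power) (auto intro: add_pos_nonneg)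
      then show "norm (1 / (1 + norm x) ^ 4) \<le> norm (inverse (1 + (x$1)\<^sup>2) * inverse (1 + (x$2)\<^sup>2))"
        by (simp add: abs_mult divide_inverse)
    qed
  qed measurable
qed

lemma integrable_of_decay:
  fixes f :: "real^2 \<Rightarrow> 'b::{banach, second_countable_topology}"
  assumes "f \<in> borel_measurable borel" "\<And>x. (1 + norm x) ^ 4 * norm (f x) \<le> C"
  shows "integrable lborel f"
proof (rule Bochner_Integration.integrable_bound[OF integrable_mult_right[OF integrable_decay, of C]])
  have "norm (f x) \<le> C / (1 + norm x) ^ 4" for x
    using assms(2)[of x] by (simp add: field_simps add_nonneg_eq_0_iff)
  then show "AE x in lborel. norm (f x) \<le> norm (C * (1 / (1 + norm x) ^ 4))"
    by (intro AE_I2) (auto intro: order_trans[OF _ divide_right_mono[OF abs_ge_self]])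
qed (use assms(1) in simp)

lemma integrable_mult_bounded:
  fixes f g :: "'a \<Rightarrow> 'b::{real_normed_algebra, banach, second_countable_topology}"
  assumes f: "integrable M f" and g: "g \<in> borel_measurable M" "\<And>x. norm (g x) \<le> B"
  shows "integrable M (\<lambda>x. f x * g x)"
proof (rule Bochner_Integration.integrable_bound)
  show "integrable M (\<lambda>x. B * norm (f x))" using f by (intro integrable_mult_right integrable_norm)
  show "AE x in M. norm (f x * g x) \<le> norm (B * norm (f x))"
  proof (rule AE_I2)
    fix x
    have "norm (f x * g x) \<le> norm (f x) * norm (g x)" by (rule norm_mult_ineq)
    also have "\<dots> \<le> norm (f x) * B" using g(2) by (intro mult_left_mono) auto
    also have "\<dots> \<le> norm (B * norm (f x))" by (simp add: mult.commute)
    finally show "norm (f x * g x) \<le> norm (B * norm (f x))" .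
  qed
qed (use f g in measurable)


section \<open>Schwartz functions and Gaussians\<close>

lemma partial_eq: "(f has_derivative f') (at x) \<Longrightarrow> partial i f x = f' (axis i 1)"
  unfolding partial_def using frechet_derivative_at by metis

lemma partials_Nil [simp]: "partials [] f = f"
  and partials_Cons [simp]: "partials (i # \<alpha>) f = partial i (partials \<alpha> f)"
  by (simp_all add: partials_def)

text \<open>\<open>smooth\<close> speaks of all iterated partial derivatives. A class of
  differentiable functions that is closed under \<open>partial\<close> settles them all by
  induction, without formulas for the higher derivatives.\<close>

lemma smooth_invariant:
  assumes "P f" "\<And>f x. P f \<Longrightarrow> f differentiable (at x)" "\<And>f i. P f \<Longrightarrow> P (partial i f)"
  shows "P (partials \<alpha> f)" "smooth f"
proof -
  show *: "P (partials \<alpha> f)" for \<alpha> by (induction \<alpha>) (auto simp: assms)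
  show "smooth f" unfolding smooth_def using assms(2)[OF *] by blast
qed

lemma differentiable_partials: "smooth f \<Longrightarrow> partials \<alpha> f differentiable (at x)"
  by (simp add: smooth_def)

lemma partial_add:
  assumes "f differentiable (at x)" "g differentiable (at x)"
  shows "partial i (\<lambda>x. f x + g x) x = partial i f x + partial i g x"
  using partial_eq[OF has_derivative_add[OF assms[unfolded frechet_derivative_works]]]
  by (simp add: partial_def)

lemma partial_mult:
  fixes f g :: "real^2 \<Rightarrow> complex"
  assumes "f differentiable (at x)" "g differentiable (at x)"
  shows "partial i (\<lambda>x. f x * g x) x = f x * partial i g x + partial i f x * g x"
  using partial_eq[OF has_derivative_mult[OF assms[unfolded frechet_derivative_works]]]
  by (simp add: partial_def)

lemma partial_const: "partial i (\<lambda>x. c) = (\<lambda>x. 0)"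
  using partial_eq[OF has_derivative_const] by blast

lemma partial_linear:
  assumes "bounded_linear h" "f differentiable (at x)"
  shows "partial i (\<lambda>x. h (f x)) x = h (partial i f x)"
  using partial_eq[OF bounded_linear.has_derivative[OF assms(1) assms(2)[unfolded frechet_derivative_works]]]
  by (simp add: partial_def)

lemma partials_linear:
  assumes "smooth f" "bounded_linear h"
  shows "partials \<alpha> (\<lambda>x. h (f x)) = (\<lambda>x. h (partials \<alpha> f x))"
  by (induction \<alpha>) (auto simp: partial_linear[OF assms(2) differentiable_partials[OF assms(1)]])

lemma partials_lincomb:
  fixes f g :: "real^2 \<Rightarrow> complex"
  assumes "smooth f" "smooth g"
  shows "partials \<alpha> (\<lambda>x. a * f x + b * g x) = (\<lambda>x. a * partials \<alpha> f x + b * partials \<alpha> g x)"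
proof (induction \<alpha>)
  case (Cons i \<alpha>)
  show ?case
    unfolding partials_Cons Cons.IH
    using assms
    by (intro ext, subst partial_add)
      (auto intro!: differentiable_mult simp: differentiable_partials partial_linear[OF bounded_linear_mult_right])
qed simp

lemma schwartz_lincomb:
  assumes "schwartz \<phi>" "schwartz \<psi>"
  shows "schwartz (\<lambda>x. a * \<phi> x + b * \<psi> x)"
  unfolding schwartz_def
proof (intro conjI allI)
  have s: "smooth \<phi>" "smooth \<psi>" using assms by (auto simp: schwartz_def)
  show "smooth (\<lambda>x. a * \<phi> x + b * \<psi> x)"
    using s by (auto simp: smooth_def partials_lincomb[OF s] intro!: differentiable_add differentiable_mult)
  fix \<alpha> N
  have "bounded (range (\<lambda>x. (1 + norm x) ^ N *\<^sub>R partials \<alpha> \<phi> x))" "bounded (range (\<lambda>x. (1 + norm x) ^ N *\<^sub>R partials \<alpha> \<psi> x))"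
    using assms by (auto simp: schwartz_def)
  then obtain B C where BC: "\<And>x. norm ((1 + norm x) ^ N *\<^sub>R partials \<alpha> \<phi> x) \<le> B" "\<And>x. norm ((1 + norm x) ^ N *\<^sub>R partials \<alpha> \<psi> x) \<le> C"
    unfolding bounded_iff by auto
  show "bounded (range (\<lambda>x. (1 + norm x) ^ N *\<^sub>R partials \<alpha> (\<lambda>x. a * \<phi> x + b * \<psi> x) x))"
    unfolding bounded_iff
  proof (intro exI ballI, clarify)
    fix x :: "real^2"
    have "(1 + norm x) ^ N *\<^sub>R (a * partials \<alpha> \<phi> x + b * partials \<alpha> \<psi> x)
      = a * ((1 + norm x) ^ N *\<^sub>R partials \<alpha> \<phi> x) + b * ((1 + norm x) ^ N *\<^sub>R partials \<alpha> \<psi> x)"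
      by (simp add: scaleR_add_right)
    also have "norm \<dots> \<le> norm (a * ((1 + norm x) ^ N *\<^sub>R partials \<alpha> \<phi> x)) + norm (b * ((1 + norm x) ^ N *\<^sub>R partials \<alpha> \<psi> x))"
      by (rule norm_triangle_ineq)
    also have "\<dots> \<le> cmod a * B + cmod b * C"
      unfolding norm_mult using BC by (intro add_mono mult_left_mono) auto
    finally show "norm ((1 + norm x) ^ N *\<^sub>R partials \<alpha> (\<lambda>x. a * \<phi> x + b * \<psi> x) x) \<le> cmod a * B + cmod b * C"
      by (simp add: partials_lincomb[OF s])
  qed
qed

lemma schwartz_cnj:
  assumes "schwartz \<phi>"
  shows "schwartz (\<lambda>x. cnj (\<phi> x))"
proof -
  have s: "smooth \<phi>" using assms by (simp add: schwartz_def)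
  note eq = partials_linear[OF s bounded_linear_cnj]
  have "norm ((1 + norm x) ^ N *\<^sub>R cnj (partials \<alpha> \<phi> x)) = norm ((1 + norm x) ^ N *\<^sub>R partials \<alpha> \<phi> x)" for N \<alpha> x
    by simp
  moreover have "(\<lambda>x. cnj (partials \<alpha> \<phi> x)) differentiable (at x)" for \<alpha> x
    using bounded_linear.has_derivative[OF bounded_linear_cnj] differentiable_partials[OF s, of \<alpha> x]
    unfolding differentiable_def by blast
  ultimately show ?thesis
    using assms unfolding schwartz_def smooth_def eq bounded_iff by simp
qed

lemma schwartz_decay:
  assumes "schwartz \<phi>"
  obtains C where "\<And>x. (1 + norm x) ^ N * cmod (\<phi> x) \<le> C"
proof -
  have "bounded (range (\<lambda>x. (1 + norm x) ^ N *\<^sub>R partials [] \<phi> x))"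
    using assms unfolding schwartz_def by blast
  then obtain C where "\<And>x. norm ((1 + norm x) ^ N *\<^sub>R \<phi> x) \<le> C"
    by (auto simp: bounded_iff)
  then show thesis by (intro that[of C]) (simp add: abs_of_nonneg)
qed

lemma schwartz_continuous: "schwartz \<phi> \<Longrightarrow> continuous_on UNIV \<phi>"
  using differentiable_partials[of \<phi> "[]"]
  by (auto simp: schwartz_def intro!: continuous_at_imp_continuous_on differentiable_imp_continuous_within)

lemma schwartz_measurable: "schwartz \<phi> \<Longrightarrow> \<phi> \<in> borel_measurable borel"
  by (intro borel_measurable_continuous_onI schwartz_continuous)

lemma schwartz_integrable: "schwartz \<phi> \<Longrightarrow> integrable lborel \<phi>"
  using schwartz_decay[of \<phi> 4] integrable_of_decay[OF schwartz_measurable] by metis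

text \<open>Polynomials in the two coordinates, given by generation so that closure under
  \<open>partial\<close> and polynomial growth follow by rule induction. They are the prefactors
  that differentiation of a Gaussian produces.\<close>

inductive plane_poly :: "(real^2 \<Rightarrow> complex) \<Rightarrow> bool" where
  plane_poly_const: "plane_poly (\<lambda>x. c)"
| plane_poly_coord: "plane_poly (\<lambda>x. of_real (x$i))"
| plane_poly_add: "plane_poly f \<Longrightarrow> plane_poly g \<Longrightarrow> plane_poly (\<lambda>x. f x + g x)"
| plane_poly_mult: "plane_poly f \<Longrightarrow> plane_poly g \<Longrightarrow> plane_poly (\<lambda>x. f x * g x)"

lemma has_derivative_coord: "((\<lambda>x::real^2. complex_of_real (x$i)) has_derivative (\<lambda>h. of_real (h$i))) (at x)"
  by (auto intro!: derivative_eq_intros bounded_linear_imp_has_derivative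
      bounded_linear_compose[OF bounded_linear_of_real bounded_linear_vec_nth])

lemma plane_poly_differentiable:
  assumes "plane_poly f"
  shows "f differentiable (at x)" "plane_poly (partial i f)"
proof -
  have "(\<forall>x. f differentiable (at x)) \<and> plane_poly (partial i f)"
    using assms
  proof induction
    case (plane_poly_coord j)
    have "partial i (\<lambda>x. complex_of_real (x$j)) = (\<lambda>x. of_real (axis i 1 $ j))"
      by (intro ext partial_eq has_derivative_coord)
    then show ?case
      using plane_poly.plane_poly_const has_derivative_coord unfolding differentiable_def by auto
  next
    case (plane_poly_add f g)
    then have "partial i (\<lambda>x. f x + g x) = (\<lambda>x. partial i f x + partial i g x)"
      by (intro ext partial_add) auto
    with plane_poly_add show ?case by (auto intro: plane_poly.plane_poly_add)
  next
    case (plane_poly_mult f g)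
    then have "partial i (\<lambda>x. f x * g x) = (\<lambda>x. f x * partial i g x + partial i f x * g x)"
      by (intro ext partial_mult) auto
    with plane_poly_mult show ?case by (auto intro!: plane_poly.intros differentiable_mult)
  qed (auto simp: partial_const intro: plane_poly.intros)
  then show "f differentiable (at x)" "plane_poly (partial i f)" by auto
qed

lemma plane_poly_growth:
  assumes "plane_poly f"
  shows "\<exists>C k. \<forall>x. cmod (f x) \<le> C * (1 + norm x) ^ k"
  using assms
proof induction
  case (plane_poly_const c)
  show ?case by (rule exI[of _ "cmod c"], rule exI[of _ 0]) simp
next
  case (plane_poly_coord i)
  have "\<bar>x$i\<bar> \<le> 1 + norm x" for x :: "real^2" using component_le_norm_cart[of x i] by simp
  then show ?case by (intro exI[of _ 1]) auto
next
  case (plane_poly_add f g)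
  then obtain C k D l where f: "\<And>x. cmod (f x) \<le> C * (1 + norm x) ^ k" and g: "\<And>x. cmod (g x) \<le> D * (1 + norm x) ^ l"
    by blast
  have "cmod (f x + g x) \<le> (\<bar>C\<bar> + \<bar>D\<bar>) * (1 + norm x) ^ (k + l)" for x
  proof -
    have 1: "(1 + norm x) ^ k \<le> (1 + norm x) ^ (k + l)" "(1 + norm x) ^ l \<le> (1 + norm x) ^ (k + l)"
      by (rule power_increasing; simp)+
    have "cmod (f x + g x) \<le> C * (1 + norm x) ^ k + D * (1 + norm x) ^ l"
      using norm_triangle_ineq[of "f x" "g x"] f[of x] g[of x] by linarith
    also have "\<dots> \<le> \<bar>C\<bar> * (1 + norm x) ^ (k + l) + \<bar>D\<bar> * (1 + norm x) ^ (k + l)"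
      using 1 by (intro add_mono mult_mono) auto
    finally show ?thesis by (simp add: distrib_right)
  qed
  then show ?case by blast
next
  case (plane_poly_mult f g)
  then obtain C k D l where f: "\<And>x. cmod (f x) \<le> C * (1 + norm x) ^ k" and g: "\<And>x. cmod (g x) \<le> D * (1 + norm x) ^ l"
    by blast
  have "cmod (f x * g x) \<le> (C * D) * (1 + norm x) ^ (k + l)" for x
    using mult_mono'[OF f[of x] g[of x]] by (simp add: norm_mult power_add mult_ac)
  then show ?case by blast
qed

text \<open>The modulation by \<open>p\<close> becomes a translation under
  \<open>inv_fourier\<close>, so translated Gaussians in frequency are transforms of Schwartz
  functions and can serve as test functions.\<close>

definition gauss :: "real \<Rightarrow> real^2 \<Rightarrow> real^2 \<Rightarrow> complex" where
  "gauss b p x = exp (- of_real (b * (x \<bullet> x)) - \<i> * of_real (x \<bullet> p))"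

lemma has_derivative_gauss:
  "(gauss b p has_derivative (\<lambda>h. (- of_real (2 * b * (x \<bullet> h)) - \<i> * of_real (h \<bullet> p)) * gauss b p x)) (at x)"
proof -
  have "((\<lambda>x. - of_real (b * (x \<bullet> x)) - \<i> * of_real (x \<bullet> p)) has_derivative
      (\<lambda>h. - of_real (2 * b * (x \<bullet> h)) - \<i> * of_real (h \<bullet> p))) (at x)"
    by (auto intro!: derivative_eq_intros simp: inner_commute algebra_simps)
  from has_derivative_compose[OF this DERIV_exp[unfolded has_field_derivative_def]]
  show ?thesis by (simp add: gauss_def[abs_def] mult.commute)
qed

lemma partial_gauss:
  "partial i (gauss b p) = (\<lambda>x. (of_real (- 2 * b) * of_real (x$i) + - \<i> * of_real (p$i)) * gauss b p x)"
  by (intro ext, subst partial_eq[OF has_derivative_gauss]) (simp add: inner_axis inner_axis')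

lemma exp_ge_power:
  assumes "x \<ge> (0::real)"
  shows "x ^ n \<le> fact n * exp x"
proof -
  have "(\<Sum>k\<in>{n}. x ^ k /\<^sub>R fact k) \<le> exp x"
    unfolding exp_def using assms by (intro sum_le_suminf summable_exp_generic) auto
  then have "x ^ n / fact n \<le> exp x" by (simp add: divide_inverse mult.commute)
  then show ?thesis by (simp add: pos_divide_le_eq mult.commute)
qed

text \<open>The invariant class consists of polynomial multiples of the Gaussian. Their polynomial
  growth is absorbed by one term of the exponential series, and the resulting factor
  \<open>exp (1 + norm x)\<close> by the Gaussian.\<close>

lemma schwartz_gauss:
  assumes b: "b > 0"
  shows "schwartz (gauss b p)"
proof -
  define P where "P f \<longleftrightarrow> (\<exists>q. plane_poly q \<and> f = (\<lambda>x. q x * gauss b p x))" for f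
  have dg: "gauss b p differentiable (at x)" for x
    using has_derivative_gauss unfolding differentiable_def by blast
  have P0: "P (gauss b p)" unfolding P_def by (intro exI[of _ "\<lambda>x. 1"]) (auto intro: plane_poly.intros)
  have P1: "f differentiable (at x)" if "P f" for f x
  proof -
    obtain q where q: "plane_poly q" "f = (\<lambda>x. q x * gauss b p x)" using \<open>P f\<close> by (auto simp: P_def)
    show ?thesis unfolding q(2) by (intro differentiable_mult plane_poly_differentiable(1) q(1) dg)
  qed
  have P2: "P (partial i f)" if f: "P f" for f i
  proof -
    obtain q where q: "plane_poly q" "f = (\<lambda>x. q x * gauss b p x)" using f by (auto simp: P_def)
    have "partial i f = (\<lambda>x. (q x * (of_real (- 2 * b) * of_real (x$i) + - \<i> * of_real (p$i)) + partial i q x) * gauss b p x)"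
      unfolding q(2) by (intro ext, subst partial_mult[OF plane_poly_differentiable(1)[OF q(1)] dg])
        (simp add: partial_gauss algebra_simps)
    moreover have "plane_poly (\<lambda>x. q x * (of_real (- 2 * b) * of_real (x$i) + - \<i> * of_real (p$i)) + partial i q x)"
      by (intro plane_poly.intros q plane_poly_differentiable)
    ultimately show ?thesis unfolding P_def by blast
  qed
  have bd: "bounded (range (\<lambda>x. (1 + norm x) ^ N *\<^sub>R f x))" if f: "P f" for f N
  proof -
    obtain q where q: "plane_poly q" "f = (\<lambda>x. q x * gauss b p x)" using f by (auto simp: P_def)
    obtain C k where C: "\<And>x. cmod (q x) \<le> C * (1 + norm x) ^ k" using plane_poly_growth[OF q(1)] by blast
    have C0: "C \<ge> 0" using order_trans[OF norm_ge_zero C[of 0]] by simp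
    show ?thesis
      unfolding bounded_iff
    proof (intro exI ballI, clarify)
      fix x :: "real^2"
      have ng: "cmod (gauss b p x) = exp (- b * (norm x)\<^sup>2)" by (simp add: gauss_def power2_norm_eq_inner)
      \<comment> \<open>Completing the square in \<open>norm x\<close>: its maximum sits at
        \<open>norm x = 1 / (2 * b)\<close>.\<close>
      have sq: "1 + norm x - b * (norm x)\<^sup>2 \<le> 1 + 1 / (4 * b)"
      proof -
        have "0 \<le> (2 * b * norm x - 1)\<^sup>2" by simp
        then have "(norm x - b * (norm x)\<^sup>2) * (4 * b) \<le> 1" by (simp add: power2_eq_square algebra_simps)
        then have "norm x - b * (norm x)\<^sup>2 \<le> 1 / (4 * b)" using b by (simp add: pos_le_divide_eq)
        then show ?thesis by simp
      qed
      have "norm ((1 + norm x) ^ N *\<^sub>R f x) = (1 + norm x) ^ N * (cmod (q x) * exp (- b * (norm x)\<^sup>2))"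
        by (simp add: q norm_mult ng)
      also have "\<dots> \<le> (1 + norm x) ^ N * (C * (1 + norm x) ^ k * exp (- b * (norm x)\<^sup>2))"
        using C[of x] by (intro mult_left_mono mult_right_mono) auto
      also have "\<dots> = C * ((1 + norm x) ^ (N + k) * exp (- b * (norm x)\<^sup>2))"
        by (simp add: power_add)
      also have "\<dots> \<le> C * ((fact (N + k) * exp (1 + norm x)) * exp (- b * (norm x)\<^sup>2))"
        using exp_ge_power[of "1 + norm x" "N + k"] C0 by (intro mult_left_mono mult_right_mono) auto
      also have "\<dots> = C * (fact (N + k) * exp (1 + norm x - b * (norm x)\<^sup>2))"
        by (simp add: exp_diff exp_minus field_simps)
      also have "\<dots> \<le> C * (fact (N + k) * exp (1 + 1 / (4 * b)))"
        using sq C0 by (intro mult_left_mono) auto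
      finally show "norm ((1 + norm x) ^ N *\<^sub>R f x) \<le> C * (fact (N + k) * exp (1 + 1 / (4 * b)))" .
    qed
  qed
  show ?thesis
    unfolding schwartz_def
    using smooth_invariant[of P, OF P0 P1 P2] bd by blast
qed

text \<open>This is the characteristic function of the standard normal distribution after the
  substitution by \<open>k = sqrt (2 * b)\<close>, which matches \<open>b * x\<^sup>2\<close> with
  half the square of the new variable.\<close>

lemma gauss_integral_1d:
  assumes b: "b > 0"
  shows "integrable lborel (\<lambda>x. cis (x * y) * of_real (exp (- b * x\<^sup>2)))"
    and "(\<integral>x. cis (x * y) * of_real (exp (- b * x\<^sup>2)) \<partial>lborel) = of_real (sqrt (pi / b) * exp (- y\<^sup>2 / (4 * b)))"
proof -
  define k where "k = sqrt (2 * b)"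
  have k: "k > 0" "k\<^sup>2 = 2 * b" using b by (auto simp: k_def)
  define t where "t = y / k"
  let ?f = "\<lambda>x. cis (x * t) * of_real (std_normal_density x)"
  have Id: "integrable lborel (\<lambda>x. complex_of_real (std_normal_density x))"
    by (intro integrable_of_real) simp
  have mc: "(\<lambda>x. cis (x * t)) \<in> borel_measurable borel"
    by (intro borel_measurable_continuous_onI continuous_intros)
  have If: "integrable lborel ?f"
    by (subst mult.commute, rule integrable_mult_bounded[OF Id, where B = 1]) (use mc in simp_all)
  have "char std_normal_distribution t = (\<integral>x. std_normal_density x *\<^sub>R iexp (t * x) \<partial>lborel)"
    unfolding char_def by (rule integral_density) auto
  also have "\<dots> = (\<integral>x. ?f x \<partial>lborel)"
    by (rule Bochner_Integration.integral_cong) (simp_all only: scaleR_conv_of_real cis_conv_exp mult.commute)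
  finally have I: "(\<integral>x. ?f x \<partial>lborel) = of_real (exp (- (t^2) / 2))"
    by (simp only: char_std_normal_distribution)
  define c where "c = sqrt (2 * pi)"
  have c: "c > 0" by (simp add: c_def)
  have eq: "cis (x * y) * of_real (exp (- b * x\<^sup>2)) = of_real c * ?f (0 + k * x)" for x
  proof -
    have "k * x * t = x * y" using k by (simp add: t_def)
    moreover have "c * std_normal_density (k * x) = exp (- b * x\<^sup>2)"
      using c k(2) by (simp add: std_normal_density_def power_mult_distrib flip: c_def)
    ultimately show ?thesis
      by (simp only: add_0 mult.left_commute[of "of_real c"] of_real_mult[symmetric])
  qed
  have "integrable lborel (\<lambda>x. ?f (0 + k * x))"
    by (rule lborel_integrable_real_affine[OF If]) (use k in simp)
  from integrable_mult_right[OF this, of "of_real c"]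
  show "integrable lborel (\<lambda>x. cis (x * y) * of_real (exp (- b * x\<^sup>2)))"
    unfolding eq .
  have "(\<integral>x. ?f x \<partial>lborel) = k *\<^sub>R (\<integral>x. ?f (0 + k * x) \<partial>lborel)"
    using lborel_integral_real_affine[of k ?f 0] k(1) by simp
  then have "of_real (c / k) * (\<integral>x. ?f x \<partial>lborel) = of_real c * (\<integral>x. ?f (0 + k * x) \<partial>lborel)"
    using k(1) by (simp add: scaleR_conv_of_real)
  also have "\<dots> = (\<integral>x. cis (x * y) * of_real (exp (- b * x\<^sup>2)) \<partial>lborel)"
    unfolding eq by (rule integral_mult_right_zero[symmetric])
  finally have "(\<integral>x. cis (x * y) * of_real (exp (- b * x\<^sup>2)) \<partial>lborel) = of_real (c / k * exp (- (t^2) / 2))"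
    unfolding I by (simp only: of_real_mult)
  moreover have "c / k = sqrt (pi / b)"
    by (simp add: k_def c_def real_sqrt_mult real_sqrt_divide)
  moreover have "t\<^sup>2 = y\<^sup>2 / (2 * b)" using k(2) by (simp add: t_def power_divide)
  then have "- (t^2) / 2 = - y\<^sup>2 / (4 * b)" by simp
  ultimately show "(\<integral>x. cis (x * y) * of_real (exp (- b * x\<^sup>2)) \<partial>lborel) = of_real (sqrt (pi / b) * exp (- y\<^sup>2 / (4 * b)))"
    by (simp only:)
qed

lemma inv_fourier_gauss:
  assumes b: "b > 0"
  shows "inv_fourier (gauss b p) \<xi> = of_real (1 / (2 * b) * exp (- ((\<xi> - p) \<bullet> (\<xi> - p)) / (4 * b)))"
proof -
  define q where "q = \<xi> - p"
  have eq: "cis (x \<bullet> \<xi>) * gauss b p x = (cis (x$1 * q$1) * of_real (exp (- b * (x$1)\<^sup>2))) * (cis (x$2 * q$2) * of_real (exp (- b * (x$2)\<^sup>2)))" for x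
  proof -
    have of_real_exp: "of_real (exp y) = (exp (of_real y) :: complex)" for y by (rule exp_of_real[symmetric])
    have "\<i> * of_real (x \<bullet> \<xi>) + (- of_real (b * (x \<bullet> x)) - \<i> * of_real (x \<bullet> p))
      = (\<i> * of_real (x$1 * q$1) + of_real (- b * (x$1)\<^sup>2)) + (\<i> * of_real (x$2 * q$2) + of_real (- b * (x$2)\<^sup>2))"
      by (simp add: complex_eq_iff inner_real2 q_def algebra_simps power2_eq_square)
    then show ?thesis
      unfolding gauss_def cis_conv_exp of_real_exp mult_exp_exp by (simp only:)
  qed
  have "(\<integral>x. cis (x \<bullet> \<xi>) * gauss b p x \<partial>lborel) = of_real (sqrt (pi / b) * exp (- (q$1)\<^sup>2 / (4 * b))) * of_real (sqrt (pi / b) * exp (- (q$2)\<^sup>2 / (4 * b)))"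
    unfolding eq lborel_real2_prod(2)[OF gauss_integral_1d(1)[OF b] gauss_integral_1d(1)[OF b]]
    by (simp only: gauss_integral_1d(2)[OF b])
  also have "\<dots> = of_real (pi / b * exp (- (q \<bullet> q) / (4 * b)))"
  proof -
    have "sqrt (pi / b) * sqrt (pi / b) = pi / b" using b by simp
    moreover have "exp (- (q$1)\<^sup>2 / (4 * b)) * exp (- (q$2)\<^sup>2 / (4 * b)) = exp (- (q \<bullet> q) / (4 * b))"
      by (simp add: inner_real2 add_divide_distrib diff_divide_distrib power2_eq_square flip: exp_add)
    moreover have "sqrt (pi / b) * exp (- (q$1)\<^sup>2 / (4 * b)) * (sqrt (pi / b) * exp (- (q$2)\<^sup>2 / (4 * b)))
      = (sqrt (pi / b) * sqrt (pi / b)) * (exp (- (q$1)\<^sup>2 / (4 * b)) * exp (- (q$2)\<^sup>2 / (4 * b)))"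
      by (simp only: mult_ac)
    ultimately show ?thesis unfolding of_real_mult[symmetric] by (simp only:)
  qed
  finally have "inv_fourier (gauss b p) \<xi> = of_real (1 / (2 * pi)) * of_real (pi / b * exp (- (q \<bullet> q) / (4 * b)))"
    by (simp only: inv_fourier_def)
  moreover have "1 / (2 * pi) * (pi / b * exp (- (q \<bullet> q) / (4 * b))) = 1 / (2 * b) * exp (- (q \<bullet> q) / (4 * b))"
    by simp
  ultimately show ?thesis by (simp only: q_def flip: of_real_mult)
qed


section \<open>Uniqueness of the Fourier transform\<close>

text \<open>Orthogonality to all Gaussians of arbitrary centre and width. A quadratic exponent with
  a free linear term is closed under multiplication by further Gaussians, which is what lets the
  condition be localised.\<close>

definition gauss_orth :: "(real^2 \<Rightarrow> complex) \<Rightarrow> bool" where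
  "gauss_orth g \<longleftrightarrow> integrable lborel g \<and>
    (\<forall>b q. b > 0 \<longrightarrow> (\<integral>x. g x * of_real (exp (- b * (x \<bullet> x) + x \<bullet> q)) \<partial>lborel) = 0)"

lemma gauss_orth_eq_0:
  "gauss_orth g \<Longrightarrow> b > 0 \<Longrightarrow> (\<integral>x. g x * of_real (exp (- b * (x \<bullet> x) + x \<bullet> q)) \<partial>lborel) = 0"
  unfolding gauss_orth_def by blast

lemma shifted_gauss_bound:
  fixes x :: "'a::real_inner"
  assumes "b > 0"
  shows "exp (- b * (x \<bullet> x) + x \<bullet> q) \<le> exp ((q \<bullet> q) / (4 * b))"
proof -
  have "0 \<le> b * ((x - (1 / (2 * b)) *\<^sub>R q) \<bullet> (x - (1 / (2 * b)) *\<^sub>R q))" using assms by simp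
  also have "\<dots> = b * (x \<bullet> x) - x \<bullet> q + (q \<bullet> q) / (4 * b)"
    using assms by (simp add: inner_diff inner_commute[of q x] field_simps power2_eq_square)
  finally show ?thesis by simp
qed

lemma gauss_orth_diff:
  assumes "gauss_orth f" "gauss_orth g"
  shows "gauss_orth (\<lambda>x. f x - g x)"
proof -
  have I: "integrable lborel (\<lambda>x. h x * of_real (exp (- b * (x \<bullet> x) + x \<bullet> q)))"
    if "integrable lborel h" "b > 0" for h :: "real^2 \<Rightarrow> complex" and b q
    by (rule integrable_mult_bounded[OF that(1), where B = "exp ((q \<bullet> q) / (4 * b))"])
      (use shifted_gauss_bound[OF that(2)] in \<open>auto simp del: of_real_exp\<close>)
  show ?thesis
    using assms I unfolding gauss_orth_def by (auto simp: left_diff_distrib simp del: of_real_exp)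
qed

lemma gauss_orth_limit:
  assumes "\<And>n. gauss_orth (\<lambda>x. g x * of_real (u n x))"
    and "integrable lborel g" "\<And>n. u n \<in> borel_measurable borel"
    and "\<And>n x. \<bar>u n x\<bar> \<le> 1" "\<And>x. (\<lambda>n. u n x) \<longlonglongrightarrow> v x"
  shows "gauss_orth (\<lambda>x. g x * of_real (v x))"
proof -
  have [measurable]: "g \<in> borel_measurable borel" "\<And>n. u n \<in> borel_measurable borel"
    using assms by auto
  have [measurable]: "v \<in> borel_measurable borel"
    by (rule borel_measurable_LIMSEQ_real[OF assms(5)]) measurable
  have v: "\<bar>v x\<bar> \<le> 1" for x
    using LIMSEQ_le_const2[OF tendsto_rabs[OF assms(5)[of x]]] assms(4)[of _ x] by auto
  have I: "integrable lborel (\<lambda>x. g x * of_real (v x))"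
    by (rule integrable_mult_bounded[OF assms(2), where B = 1]) (use v in auto)
  have "(\<integral>x. g x * of_real (v x) * of_real (exp (- b * (x \<bullet> x) + x \<bullet> q)) \<partial>lborel) = 0" if b: "b > 0" for b q
  proof (rule LIMSEQ_unique)
    show "(\<lambda>n. (\<integral>x. g x * of_real (u n x) * of_real (exp (- b * (x \<bullet> x) + x \<bullet> q)) \<partial>lborel)) \<longlonglongrightarrow> 0"
      using assms(1) b by (simp add: gauss_orth_def)
    show "(\<lambda>n. (\<integral>x. g x * of_real (u n x) * of_real (exp (- b * (x \<bullet> x) + x \<bullet> q)) \<partial>lborel)) \<longlonglongrightarrow>
        (\<integral>x. g x * of_real (v x) * of_real (exp (- b * (x \<bullet> x) + x \<bullet> q)) \<partial>lborel)"
    proof (rule integral_dominated_convergence[where w = "\<lambda>x. exp ((q \<bullet> q) / (4 * b)) * cmod (g x)"])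
      show "integrable lborel (\<lambda>x. exp ((q \<bullet> q) / (4 * b)) * cmod (g x))"
        using assms(2) by (intro integrable_mult_right integrable_norm)
      show "AE x in lborel. (\<lambda>n. g x * of_real (u n x) * of_real (exp (- b * (x \<bullet> x) + x \<bullet> q)))
          \<longlonglongrightarrow> g x * of_real (v x) * of_real (exp (- b * (x \<bullet> x) + x \<bullet> q))"
        by (intro AE_I2 tendsto_intros assms)
      show "AE x in lborel. cmod (g x * of_real (u n x) * of_real (exp (- b * (x \<bullet> x) + x \<bullet> q)))
          \<le> exp ((q \<bullet> q) / (4 * b)) * cmod (g x)" for n
      proof (rule AE_I2)
        fix x
        have "cmod (g x * of_real (u n x) * of_real (exp (- b * (x \<bullet> x) + x \<bullet> q)))
          = cmod (g x) * \<bar>u n x\<bar> * exp (- b * (x \<bullet> x) + x \<bullet> q)"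
          by (simp add: norm_mult del: of_real_exp)
        also have "\<dots> \<le> cmod (g x) * 1 * exp ((q \<bullet> q) / (4 * b))"
          using shifted_gauss_bound[OF b] assms(4) by (intro mult_mono) auto
        finally show "cmod (g x * of_real (u n x) * of_real (exp (- b * (x \<bullet> x) + x \<bullet> q)))
          \<le> exp ((q \<bullet> q) / (4 * b)) * cmod (g x)" by (simp add: mult.commute)
      qed
    qed measurable
  qed
  with I show ?thesis by (simp add: gauss_orth_def)
qed

text \<open>The product of two Gaussians is again one up to a constant: the parameters
  \<open>b\<close> and \<open>q\<close> move to \<open>b + m\<close> and
  \<open>q + (2 * m) *\<^sub>R p\<close>.\<close>

lemma gauss_orth_mult_bump:
  assumes g: "gauss_orth g" and m: "m > 0"
  shows "gauss_orth (\<lambda>x. g x * of_real (exp (- m * (norm (x - p))\<^sup>2)))"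
proof -
  have eq: "exp (- m * (norm (x - p))\<^sup>2) * exp (- b * (x \<bullet> x) + x \<bullet> q)
      = exp (- m * (p \<bullet> p)) * exp (- (b + m) * (x \<bullet> x) + x \<bullet> (q + (2 * m) *\<^sub>R p))" for x b q
    unfolding power2_norm_eq_inner
    by (simp add: inner_diff inner_commute[of p x] inner_add_right algebra_simps flip: exp_add)
  have "(\<integral>x. g x * of_real (exp (- m * (norm (x - p))\<^sup>2)) * of_real (exp (- b * (x \<bullet> x) + x \<bullet> q)) \<partial>lborel) = 0"
    if b: "b > 0" for b q
  proof -
    have "(\<integral>x. g x * of_real (exp (- m * (norm (x - p))\<^sup>2)) * of_real (exp (- b * (x \<bullet> x) + x \<bullet> q)) \<partial>lborel)
      = (\<integral>x. of_real (exp (- m * (p \<bullet> p))) * (g x * of_real (exp (- (b + m) * (x \<bullet> x) + x \<bullet> (q + (2 * m) *\<^sub>R p)))) \<partial>lborel)"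
      unfolding mult.assoc of_real_mult[symmetric] eq by (simp add: mult_ac)
    also have "\<dots> = of_real (exp (- m * (p \<bullet> p))) * (\<integral>x. g x * of_real (exp (- (b + m) * (x \<bullet> x) + x \<bullet> (q + (2 * m) *\<^sub>R p))) \<partial>lborel)"
      by (rule integral_mult_right_zero)
    also have "\<dots> = 0" using gauss_orth_eq_0[OF g, of "b + m" "q + (2 * m) *\<^sub>R p"] b m by (simp only:) simp
    finally show ?thesis .
  qed
  moreover have "integrable lborel (\<lambda>x. g x * of_real (exp (- m * (norm (x - p))\<^sup>2)))"
    using g m by (intro integrable_mult_bounded[where B = 1]) (auto simp: gauss_orth_def simp del: of_real_exp)
  ultimately show ?thesis by (simp add: gauss_orth_def)
qed

text \<open>
  With \<open>y = exp (- m |x - p|\<^sup>2)\<close> and \<open>M\<close> about \<open>m exp (m r\<^sup>2)\<close>, the functions \<open>(1 - y) ^ M\<close> converge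
  to the indicator of the complement of the ball of radius \<open>r\<close> around \<open>p\<close> as \<open>m\<close> grows.
\<close>

lemma bump_power_limit:
  fixes d r :: real
  assumes "d \<ge> 0" "r \<ge> 0"
  shows "(\<lambda>m. (1 - exp (- real (Suc m) * d\<^sup>2)) ^ nat \<lceil>real (Suc m) * exp (real (Suc m) * r\<^sup>2)\<rceil>)
    \<longlonglongrightarrow> (if d \<le> r then 0 else 1)"
proof (cases "d \<le> r")
  case True
  \<comment> \<open>Inside the ball \<open>1 - y \<le> exp (- y)\<close> bounds the power by
    \<open>exp (- (M * y))\<close>, and \<open>M * y \<ge> n\<close> because
    \<open>y \<ge> exp (- n * r\<^sup>2)\<close>.\<close>
  have *: "(1 - exp (- n * d\<^sup>2)) ^ nat \<lceil>n * exp (n * r\<^sup>2)\<rceil> \<le> exp (- n)" if n: "n > 0" for n :: real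
  proof -
    let ?M = "nat \<lceil>n * exp (n * r\<^sup>2)\<rceil>" and ?y = "exp (- n * d\<^sup>2)"
    have "0 \<le> n * d\<^sup>2" using n by simp
    then have "(1 - ?y) ^ ?M \<le> exp (- ?y) ^ ?M"
      using exp_ge_add_one_self[of "- ?y"] by (intro power_mono) auto
    also have "\<dots> = exp (- (real ?M * ?y))" using exp_of_nat_mult[of ?M "- ?y"] by simp
    also have "\<dots> \<le> exp (- n)"
    proof -
      have "d\<^sup>2 \<le> r\<^sup>2" using True assms by (intro power_mono) auto
      then have "1 \<le> exp (n * r\<^sup>2) * ?y" using n by (simp add: mult_left_mono flip: exp_add)
      then have "n * 1 \<le> n * (exp (n * r\<^sup>2) * ?y)" using n by (intro mult_left_mono) auto
      also have "\<dots> = n * exp (n * r\<^sup>2) * ?y" by simp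
      also have "\<dots> \<le> real ?M * ?y" by (intro mult_right_mono) (auto intro: real_nat_ceiling_ge)
      finally show ?thesis by simp
    qed
    finally show ?thesis .
  qed
  have "exp (- real m) = exp (- 1) ^ m" for m using exp_of_nat_mult[of m "-1 :: real"] by simp
  then have lim: "(\<lambda>m. exp (- real (Suc m))) \<longlonglongrightarrow> 0"
    using LIMSEQ_Suc[OF LIMSEQ_power_zero[of "exp (- 1 :: real)"]] by (simp del: of_nat_Suc power_Suc)
  have nn: "0 \<le> (1 - exp (- real (Suc m) * d\<^sup>2)) ^ k" for m k by (intro zero_le_power) (simp del: of_nat_Suc)
  have "(\<lambda>m. (1 - exp (- real (Suc m) * d\<^sup>2)) ^ nat \<lceil>real (Suc m) * exp (real (Suc m) * r\<^sup>2)\<rceil>) \<longlonglongrightarrow> 0"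
    by (rule tendsto_sandwich[OF always_eventually always_eventually tendsto_const lim])
      (use * nn in \<open>simp_all del: of_nat_Suc\<close>)
  then show ?thesis using True by simp
next
  case False
  define e where "e = d\<^sup>2 - r\<^sup>2"
  have "r\<^sup>2 < d\<^sup>2" using False assms by (intro power_strict_mono) auto
  then have e: "e > 0" by (simp add: e_def)
  \<comment> \<open>Outside the ball Bernoulli's inequality bounds the power below by
    \<open>1 - M * y\<close>. The second summand pays for rounding up in \<open>M\<close>, since
    \<open>1 \<le> exp (n * r\<^sup>2)\<close>.\<close>
  have *: "1 - (n * exp (- n * e) + exp (- n * e)) \<le> (1 - exp (- n * d\<^sup>2)) ^ nat \<lceil>n * exp (n * r\<^sup>2)\<rceil>"
    if n: "n > 0" for n :: real
  proof -
    let ?M = "nat \<lceil>n * exp (n * r\<^sup>2)\<rceil>" and ?y = "exp (- n * d\<^sup>2)"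
    have n1: "0 \<le> n * r\<^sup>2" "0 \<le> n * d\<^sup>2" using n by simp_all
    have "real ?M \<le> n * exp (n * r\<^sup>2) + 1"
      using n of_int_ceiling_le_add_one[of "n * exp (n * r\<^sup>2)"] by simp
    also have "\<dots> \<le> n * exp (n * r\<^sup>2) + exp (n * r\<^sup>2)" using n1 by simp
    finally have "real ?M * ?y \<le> (n * exp (n * r\<^sup>2) + exp (n * r\<^sup>2)) * ?y"
      by (intro mult_right_mono) auto
    also have "\<dots> = n * (exp (n * r\<^sup>2) * ?y) + exp (n * r\<^sup>2) * ?y" by (simp add: distrib_right)
    also have "exp (n * r\<^sup>2) * ?y = exp (- n * e)"
      unfolding exp_add[symmetric] by (simp add: e_def algebra_simps)
    finally have "1 - (n * exp (- n * e) + exp (- n * e)) \<le> 1 + real ?M * (- ?y)" by simp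
    also have "\<dots> \<le> (1 + - ?y) ^ ?M" using n1 by (intro Bernoulli_inequality) simp
    finally show ?thesis by simp
  qed
  have x: "norm (exp (- e)) < 1" using e by simp
  have "(\<lambda>m. 1 - (real m * exp (- e) ^ m + exp (- e) ^ m)) \<longlonglongrightarrow> 1 - (0 + 0)"
    by (intro tendsto_intros powser_times_n_limit_0[OF x] LIMSEQ_power_zero[OF x])
  moreover have "exp (- e) ^ m = exp (- real m * e)" for m using exp_of_nat_mult[of m "- e"] by simp
  ultimately have lim: "(\<lambda>m. 1 - (real (Suc m) * exp (- real (Suc m) * e) + exp (- real (Suc m) * e))) \<longlonglongrightarrow> 1"
    using LIMSEQ_Suc[of "\<lambda>m. 1 - (real m * exp (- e) ^ m + exp (- e) ^ m)" 1] by (simp del: of_nat_Suc power_Suc)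
  have le1: "(1 - exp (- real (Suc m) * d\<^sup>2)) ^ k \<le> 1" for m k by (intro power_le_one) (simp_all del: of_nat_Suc)
  have "(\<lambda>m. (1 - exp (- real (Suc m) * d\<^sup>2)) ^ nat \<lceil>real (Suc m) * exp (real (Suc m) * r\<^sup>2)\<rceil>) \<longlonglongrightarrow> 1"
    by (rule tendsto_sandwich[OF always_eventually always_eventually lim tendsto_const])
      (use * le1 in \<open>simp_all del: of_nat_Suc\<close>)
  then show ?thesis using False by simp
qed

text \<open>These are not null sets: they are the sets to which every \<open>gauss_orth\<close>
  function can be restricted without losing orthogonality. The aim is to see that all Borel sets
  qualify.\<close>

definition gauss_null_set :: "(real^2) set \<Rightarrow> bool" where
  "gauss_null_set A \<longleftrightarrow> A \<in> sets borel \<and>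
    (\<forall>g. gauss_orth g \<longrightarrow> gauss_orth (\<lambda>x. g x * of_real (indicat_real A x)))"

lemma gauss_null_set_compl:
  assumes "gauss_null_set A"
  shows "gauss_null_set (- A)"
proof -
  have "of_real (indicat_real (- A) x) = 1 - (of_real (indicat_real A x) :: complex)" for x :: "real^2"
    by (simp add: indicator_def)
  then show ?thesis
    using assms gauss_orth_diff unfolding gauss_null_set_def by (auto simp: right_diff_distrib)
qed

text \<open>Multiplying repeatedly by \<open>1 - y\<close> for a Gaussian bump \<open>y\<close>
  preserves orthogonality, and suitable powers converge to the indicator of the complement of the
  ball. Complementation then gives the ball itself.\<close>

lemma gauss_null_set_cball: "gauss_null_set (cball p r)"
proof (cases "r \<ge> 0")
  case r: True
  define u where "u m x = (1 - exp (- real (Suc m) * (norm (x - p))\<^sup>2)) ^ nat \<lceil>real (Suc m) * exp (real (Suc m) * r\<^sup>2)\<rceil>" for m and x :: "real^2"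
  have "gauss_orth (\<lambda>x. g x * of_real (indicat_real (- cball p r) x))" if g: "gauss_orth g" for g
  proof (rule gauss_orth_limit[of _ u])
    show "gauss_orth (\<lambda>x. g x * of_real (u m x))" for m
    proof -
      have "gauss_orth (\<lambda>x. g x * of_real ((1 - exp (- real (Suc m) * (norm (x - p))\<^sup>2)) ^ M))" for M
      proof (induction M)
        case (Suc M)
        have "g x * of_real ((1 - exp (- real (Suc m) * (norm (x - p))\<^sup>2)) ^ Suc M)
          = g x * of_real ((1 - exp (- real (Suc m) * (norm (x - p))\<^sup>2)) ^ M)
            - g x * of_real ((1 - exp (- real (Suc m) * (norm (x - p))\<^sup>2)) ^ M) * of_real (exp (- real (Suc m) * (norm (x - p))\<^sup>2))" for x
          by (simp add: algebra_simps del: of_nat_Suc)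
        then show ?case
          using gauss_orth_diff[OF Suc gauss_orth_mult_bump[OF Suc, of "real (Suc m)" p]] by (simp only:)
      qed (use g in simp)
      then show ?thesis unfolding u_def .
    qed
    show "(\<lambda>m. u m x) \<longlonglongrightarrow> indicat_real (- cball p r) x" for x
      using bump_power_limit[of "norm (x - p)" r] r
      by (cases "norm (p - x) \<le> r") (simp_all add: u_def indicator_def dist_norm norm_minus_commute del: of_nat_Suc)
    show "\<bar>u m x\<bar> \<le> 1" for m x
      unfolding u_def power_abs by (intro power_le_one) (auto simp del: of_nat_Suc)
  qed (use g in \<open>auto simp: gauss_orth_def u_def[abs_def]\<close>)
  then have "gauss_null_set (- cball p r)" by (simp add: gauss_null_set_def)
  from gauss_null_set_compl[OF this] show ?thesis by simp
qed (auto simp: gauss_null_set_def gauss_orth_def)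

text \<open>The complement of a finite union has as indicator a product of complement indicators, so
  finite unions are reached by successive restriction; dominated convergence passes to the countable
  union.\<close>

lemma gauss_null_set_Union:
  assumes A: "\<And>i::nat. gauss_null_set (A i)"
  shows "gauss_null_set (\<Union>i. A i)"
  unfolding gauss_null_set_def
proof (intro conjI allI impI)
  have m: "A i \<in> sets borel" for i using A by (simp add: gauss_null_set_def)
  then show "(\<Union>i. A i) \<in> sets borel" by auto
  fix g assume g: "gauss_orth g"
  define B where "B n = (\<Union>i<n. A i)" for n
  have B: "gauss_orth (\<lambda>x. g x * of_real (indicat_real (- B n) x))" for n
  proof (induction n)
    case (Suc n)
    have "indicat_real (- B (Suc n)) x = indicat_real (- B n) x * indicat_real (- A n) x" for x
      by (auto simp: B_def indicator_def lessThan_Suc)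
    then show ?case
      using Suc gauss_null_set_compl[OF A[of n]] unfolding gauss_null_set_def
      by (simp add: mult.assoc[symmetric])
  qed (simp add: B_def g)
  have "gauss_orth (\<lambda>x. g x * of_real (indicat_real (B n) x))" for n
  proof -
    have "of_real (indicat_real (B n) x) = 1 - (of_real (indicat_real (- B n) x) :: complex)" for x
      by (simp add: indicator_def)
    then show ?thesis using gauss_orth_diff[OF g B[of n]] by (simp add: right_diff_distrib)
  qed
  then show "gauss_orth (\<lambda>x. g x * of_real (indicat_real (\<Union>i. A i) x))"
  proof (rule gauss_orth_limit[of _ "\<lambda>n. indicat_real (B n)"])
    show "(\<lambda>n. indicat_real (B n) x) \<longlonglongrightarrow> indicat_real (\<Union>i. A i) x" for x
      unfolding B_def by (rule LIMSEQ_indicator_UN)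
    have "B n \<in> sets borel" for n unfolding B_def using m by auto
    then show "indicat_real (B n) \<in> borel_measurable borel" for n by auto
  qed (use g in \<open>auto simp: gauss_orth_def indicator_def\<close>)
qed

text \<open>Lindelof's theorem for the open balls whose closed versions stay inside
  \<open>S\<close>. Closed balls are kept because they are the sets that the limit of bump powers
  supplies.\<close>

lemma open_eq_Union_cballs:
  fixes S :: "'a::{metric_space, second_countable_topology} set"
  assumes "open S" "S \<noteq> {}"
  obtains x :: "nat \<Rightarrow> 'a" and r where "S = (\<Union>n. cball (x n) (r n))"
proof -
  define P where "P = {p :: 'a \<times> real. cball (fst p) (snd p) \<subseteq> S}"
  define b where "b p = ball (fst p) (snd p)" for p :: "'a \<times> real"
  obtain F where F: "F \<subseteq> b ` P" "countable F" "\<Union>F = \<Union>(b ` P)"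
    using Lindelof[of "b ` P"] by (auto simp: b_def)
  obtain Q where Q: "Q \<subseteq> P" "countable Q" "F = b ` Q"
    using F(1,2) by (metis countable_image_inj_on countable_subset_image)
  have sub: "S \<subseteq> (\<Union>p\<in>Q. b p)"
  proof
    fix x assume "x \<in> S"
    then obtain e where e: "e > 0" "cball x e \<subseteq> S" using assms open_contains_cball[of S] by metis
    then have "(x, e) \<in> P" "x \<in> b (x, e)" by (simp_all add: P_def b_def)
    then have "x \<in> \<Union>(b ` P)" by blast
    then show "x \<in> (\<Union>p\<in>Q. b p)" unfolding F(3)[symmetric] Q(3) .
  qed
  then have "Q \<noteq> {}" using assms(2) by blast
  then have Qeq: "range (from_nat_into Q) = Q" using Q(2) by (rule range_from_nat_into)
  have "S = (\<Union>p\<in>Q. cball (fst p) (snd p))"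
  proof
    have "b p \<subseteq> cball (fst p) (snd p)" for p unfolding b_def by (rule ball_subset_cball)
    then show "S \<subseteq> (\<Union>p\<in>Q. cball (fst p) (snd p))" using sub UN_mono[OF order_refl, of Q b "\<lambda>p. cball (fst p) (snd p)"] by (meson order_trans)
    show "(\<Union>p\<in>Q. cball (fst p) (snd p)) \<subseteq> S" using Q(1) by (auto simp: P_def)
  qed
  also have "\<dots> = (\<Union>p\<in>range (from_nat_into Q). cball (fst p) (snd p))" by (simp only: Qeq)
  also have "\<dots> = (\<Union>n. cball (fst (from_nat_into Q n)) (snd (from_nat_into Q n)))" by (simp only: image_image)
  finally show thesis by (rule that)
qed

lemma gauss_null_set_open:
  assumes "open S"
  shows "gauss_null_set S"
proof (cases "S = {}")
  case False
  obtain x :: "nat \<Rightarrow> real^2" and r where "S = (\<Union>n. cball (x n) (r n))"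
    by (rule open_eq_Union_cballs[OF assms False])
  then show ?thesis using gauss_null_set_Union[of "\<lambda>n. cball (x n) (r n)"] gauss_null_set_cball by simp
qed (auto simp: gauss_null_set_def gauss_orth_def)

text \<open>Closure under complements and arbitrary countable unions makes these sets a
  sigma-algebra containing the open sets, so induction over \<open>sigma_sets\<close>
  finishes.\<close>

lemma gauss_null_set_borel:
  assumes "A \<in> sets borel"
  shows "gauss_null_set A"
proof -
  have "A \<in> sigma_sets UNIV {S. open S}" using assms by (simp add: borel_def)
  then show ?thesis
  proof induction
    case Empty
    then show ?case by (auto simp: gauss_null_set_def gauss_orth_def)
  next
    case (Compl a)
    then show ?case using gauss_null_set_compl by (simp add: Compl_eq_Diff_UNIV)
  qed (auto intro: gauss_null_set_open gauss_null_set_Union)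
qed

text \<open>Restricting \<open>g\<close> to the Borel set where a real linear part
  \<open>h (g x)\<close> is positive keeps it orthogonal to one fixed Gaussian. The integral of a
  nonnegative function then vanishes, so \<open>h (g x) \<le> 0\<close> almost everywhere. The four
  choices of \<open>h\<close> are the real and imaginary parts with both signs.\<close>

lemma gauss_orth_AE_0:
  assumes g: "gauss_orth g"
  shows "AE x in lborel. g x = 0"
proof -
  have [measurable]: "g \<in> borel_measurable borel" using g by (auto simp: gauss_orth_def)
  have half: "AE x in lborel. h (g x) \<le> 0" if h: "bounded_linear h" for h :: "complex \<Rightarrow> real"
  proof -
    interpret bounded_linear h by fact
    have [measurable]: "(\<lambda>x. h (g x)) \<in> borel_measurable borel"
      using borel_measurable_continuous_onI[OF linear_continuous_on[OF h]] by measurable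
    define A where "A = {x. h (g x) > 0}"
    have "A \<in> sets borel" unfolding A_def by measurable
    define G where "G x = g x * of_real (indicat_real A x)" for x
    have G: "gauss_orth G"
      unfolding G_def using gauss_null_set_borel[OF \<open>A \<in> sets borel\<close>] g by (simp add: gauss_null_set_def)
    let ?e = "\<lambda>x::real^2. exp (- 1 * (x \<bullet> x) + x \<bullet> 0)"
    have I: "integrable lborel (\<lambda>x. G x * of_real (?e x))"
      using G by (intro integrable_mult_bounded[where B = 1]) (auto simp: gauss_orth_def simp del: of_real_exp)
    have 0: "(\<integral>x. G x * of_real (?e x) \<partial>lborel) = 0" using gauss_orth_eq_0[OF G zero_less_one, of 0] .
    have hG: "h (G x * of_real (?e x)) = indicat_real A x * ?e x * h (g x)" for x
      using scaleR[of "indicat_real A x * ?e x" "g x"] by (simp add: G_def scaleR_conv_of_real mult_ac del: of_real_exp)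
    have nn: "0 \<le> h (G x * of_real (?e x))" for x
      unfolding hG by (auto simp: A_def indicator_def)
    have "(\<integral>x. h (G x * of_real (?e x)) \<partial>lborel) = h (\<integral>x. G x * of_real (?e x) \<partial>lborel)"
      by (rule integral_bounded_linear[OF h I])
    then have "(\<integral>x. h (G x * of_real (?e x)) \<partial>lborel) = 0" using 0 zero by simp
    then have "AE x in lborel. h (G x * of_real (?e x)) = 0"
      using integral_nonneg_eq_0_iff_AE[OF integrable_bounded_linear[OF h I]] nn by auto
    then show ?thesis
      unfolding hG by eventually_elim (auto simp: A_def indicator_def split: if_splits)
  qed
  have "AE x in lborel. Re (g x) \<le> 0" "AE x in lborel. - Re (g x) \<le> 0"
    "AE x in lborel. Im (g x) \<le> 0" "AE x in lborel. - Im (g x) \<le> 0"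
    by (intro half bounded_linear_Re bounded_linear_Im bounded_linear_minus)+
  then show ?thesis by eventually_elim (simp add: complex_eq_iff)
qed

text \<open>A transform in the sense of \<open>has_fourier\<close> need not be integrable. Damping
  the difference by a fixed Gaussian makes it integrable, and the damping is absorbed into the test
  Gaussians; as it never vanishes, it can be removed at the end.\<close>

lemma has_fourier_unique:
  assumes "has_fourier F g" "has_fourier F h"
  shows "AE \<xi> in lborel. g \<xi> = h \<xi>"
proof -
  have [measurable]: "g \<in> borel_measurable borel" "h \<in> borel_measurable borel"
    using assms by (auto simp: has_fourier_def)
  define f where "f \<xi> = (g \<xi> - h \<xi>) * of_real (exp (- 1 * (\<xi> \<bullet> \<xi>) + \<xi> \<bullet> 0))" for \<xi>
  have test: "integrable lborel (\<lambda>\<xi>. (g \<xi> - h \<xi>) * of_real (exp (- b * (\<xi> \<bullet> \<xi>) + \<xi> \<bullet> q)))"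
    "(\<integral>\<xi>. (g \<xi> - h \<xi>) * of_real (exp (- b * (\<xi> \<bullet> \<xi>) + \<xi> \<bullet> q)) \<partial>lborel) = 0" if b: "b > 0" for b q
  proof -
    \<comment> \<open>Width and modulation are chosen so that \<open>inv_fourier \<phi>\<close> is
      the required Gaussian in \<open>\<xi>\<close> up to the constant \<open>c\<close>.\<close>
    define \<phi> where "\<phi> = gauss (1 / (4 * b)) ((1 / (2 * b)) *\<^sub>R q)"
    define c :: complex where "c = of_real (1 / (2 * b) * exp (q \<bullet> q / (4 * b)))"
    have "schwartz \<phi>" unfolding \<phi>_def using b by (intro schwartz_gauss) simp
    then have I: "integrable lborel (\<lambda>\<xi>. g \<xi> * inv_fourier \<phi> \<xi>)" "integrable lborel (\<lambda>\<xi>. h \<xi> * inv_fourier \<phi> \<xi>)"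
      and eq: "(\<integral>\<xi>. g \<xi> * inv_fourier \<phi> \<xi> \<partial>lborel) = (\<integral>\<xi>. h \<xi> * inv_fourier \<phi> \<xi> \<partial>lborel)"
      using assms by (auto simp: has_fourier_def)
    have *: "of_real (exp (- b * (\<xi> \<bullet> \<xi>) + \<xi> \<bullet> q)) = c * inv_fourier \<phi> \<xi>" for \<xi>
    proof -
      have "- ((\<xi> - (1 / (2 * b)) *\<^sub>R q) \<bullet> (\<xi> - (1 / (2 * b)) *\<^sub>R q)) / (4 * (1 / (4 * b)))
        = - b * (\<xi> \<bullet> \<xi>) + \<xi> \<bullet> q - q \<bullet> q / (4 * b)"
        using b by (simp add: inner_diff inner_commute[of q \<xi>] field_simps power2_eq_square)
      then have "inv_fourier \<phi> \<xi> = of_real ((2 * b) * exp (- b * (\<xi> \<bullet> \<xi>) + \<xi> \<bullet> q - q \<bullet> q / (4 * b)))"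
        using b by (simp add: \<phi>_def inv_fourier_gauss del: of_real_exp)
      then show ?thesis
        using b unfolding c_def of_real_mult[symmetric] by (simp add: exp_diff del: of_real_exp)
    qed
    have **: "(g \<xi> - h \<xi>) * (c * inv_fourier \<phi> \<xi>) = c * (g \<xi> * inv_fourier \<phi> \<xi> - h \<xi> * inv_fourier \<phi> \<xi>)" for \<xi>
      by (simp add: algebra_simps)
    show "integrable lborel (\<lambda>\<xi>. (g \<xi> - h \<xi>) * of_real (exp (- b * (\<xi> \<bullet> \<xi>) + \<xi> \<bullet> q)))"
      unfolding * ** using I by (intro integrable_mult_right Bochner_Integration.integrable_diff)
    show "(\<integral>\<xi>. (g \<xi> - h \<xi>) * of_real (exp (- b * (\<xi> \<bullet> \<xi>) + \<xi> \<bullet> q)) \<partial>lborel) = 0"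
      unfolding * ** using I eq by (simp add: Bochner_Integration.integral_diff)
  qed
  have "gauss_orth f"
    unfolding gauss_orth_def f_def
  proof (intro conjI allI impI)
    show "integrable lborel (\<lambda>\<xi>. (g \<xi> - h \<xi>) * of_real (exp (- 1 * (\<xi> \<bullet> \<xi>) + \<xi> \<bullet> 0)))"
      by (rule test) simp
    fix b :: real and q :: "real^2" assume "b > 0"
    have "exp (- 1 * (x \<bullet> x) + x \<bullet> 0) * exp (- b * (x \<bullet> x) + x \<bullet> q) = exp (- (1 + b) * (x \<bullet> x) + x \<bullet> q)" for x :: "real^2"
      by (simp add: algebra_simps flip: exp_add)
    then show "(\<integral>x. (g x - h x) * of_real (exp (- 1 * (x \<bullet> x) + x \<bullet> 0)) * of_real (exp (- b * (x \<bullet> x) + x \<bullet> q)) \<partial>lborel) = 0"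
      using test(2)[of "1 + b" q] \<open>b > 0\<close> unfolding mult.assoc of_real_mult[symmetric] by (simp only:)
  qed
  from gauss_orth_AE_0[OF this] show ?thesis
    unfolding f_def by eventually_elim (auto simp del: of_real_exp)
qed


section \<open>Sobolev spaces\<close>

lemma integral_Cauchy_Schwarz:
  fixes f g :: "'a \<Rightarrow> real"
  assumes "f \<in> borel_measurable M" "g \<in> borel_measurable M"
    and f2: "integrable M (\<lambda>x. (f x)\<^sup>2)" and g2: "integrable M (\<lambda>x. (g x)\<^sup>2)"
  shows "integrable M (\<lambda>x. f x * g x)"
    and "(\<integral>x. f x * g x \<partial>M) \<le> sqrt (\<integral>x. (f x)\<^sup>2 \<partial>M) * sqrt (\<integral>x. (g x)\<^sup>2 \<partial>M)"
proof -
  show fg: "integrable M (\<lambda>x. f x * g x)"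
  proof (rule Bochner_Integration.integrable_bound[OF Bochner_Integration.integrable_add[OF f2 g2]])
    show "AE x in M. norm (f x * g x) \<le> norm ((f x)\<^sup>2 + (g x)\<^sup>2)"
    proof (rule AE_I2)
      fix x
      have "0 \<le> (\<bar>f x\<bar> - \<bar>g x\<bar>)\<^sup>2" by simp
      then have "2 * (\<bar>f x\<bar> * \<bar>g x\<bar>) \<le> (f x)\<^sup>2 + (g x)\<^sup>2" by (simp add: power2_diff)
      moreover have "0 \<le> \<bar>f x\<bar> * \<bar>g x\<bar>" by simp
      ultimately have "\<bar>f x\<bar> * \<bar>g x\<bar> \<le> (f x)\<^sup>2 + (g x)\<^sup>2" by linarith
      then show "norm (f x * g x) \<le> norm ((f x)\<^sup>2 + (g x)\<^sup>2)" by (simp add: abs_mult)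
    qed
  qed (use assms(1,2) in measurable)
  define A B D where "A = (\<integral>x. (f x)\<^sup>2 \<partial>M)" and "B = (\<integral>x. (g x)\<^sup>2 \<partial>M)" and "D = (\<integral>x. f x * g x \<partial>M)"
  have AB: "0 \<le> A" "0 \<le> B" by (simp_all add: A_def B_def)
  have quad: "0 \<le> A - 2 * t * D + t\<^sup>2 * B" for t
  proof -
    have "0 \<le> (\<integral>x. (f x - t * g x)\<^sup>2 \<partial>M)" by simp
    also have "\<dots> = (\<integral>x. (f x)\<^sup>2 - (2 * t) * (f x * g x) + t\<^sup>2 * (g x)\<^sup>2 \<partial>M)"
      by (rule Bochner_Integration.integral_cong) (simp_all add: power2_eq_square algebra_simps)
    also have "\<dots> = A - 2 * t * D + t\<^sup>2 * B"
      using f2 g2 fg by (simp add: A_def B_def D_def)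
    finally show ?thesis .
  qed
  have "D \<le> sqrt A * sqrt B"
  proof (cases "B = 0")
    case True
    have "D \<le> 0"
    proof (rule ccontr)
      assume "\<not> D \<le> 0"
      \<comment> \<open>With \<open>B = 0\<close> the quadratic is affine in \<open>t\<close>; this
        \<open>t\<close> gives it the value \<open>- 1\<close>.\<close>
      then show False using quad[of "(A + 1) / (2 * D)"] True by simp
    qed
    then show ?thesis using True by simp
  next
    case False
    then have "0 < B" using AB by simp
    have "0 \<le> A - D\<^sup>2 / B" using quad[of "D / B"] False by (simp add: power2_eq_square)
    then have "D\<^sup>2 \<le> A * B" using \<open>0 < B\<close> by (simp add: field_simps)
    then have "\<bar>D\<bar> \<le> sqrt (A * B)" by (simp add: real_le_rsqrt)
    then show ?thesis by (simp add: real_sqrt_mult)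
  qed
  then show "(\<integral>x. f x * g x \<partial>M) \<le> sqrt (\<integral>x. (f x)\<^sup>2 \<partial>M) * sqrt (\<integral>x. (g x)\<^sup>2 \<partial>M)"
    by (simp add: A_def B_def D_def)
qed

lemma L2_triangle:
  fixes f g :: "'a \<Rightarrow> real"
  assumes [measurable]: "f \<in> borel_measurable M" "g \<in> borel_measurable M"
    and f2: "integrable M (\<lambda>x. (f x)\<^sup>2)" and g2: "integrable M (\<lambda>x. (g x)\<^sup>2)"
  shows "integrable M (\<lambda>x. (f x + g x)\<^sup>2)"
    and "sqrt (\<integral>x. (f x + g x)\<^sup>2 \<partial>M) \<le> sqrt (\<integral>x. (f x)\<^sup>2 \<partial>M) + sqrt (\<integral>x. (g x)\<^sup>2 \<partial>M)"
proof -
  note CS = integral_Cauchy_Schwarz[OF assms]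
  have eq: "(f x + g x)\<^sup>2 = (f x)\<^sup>2 + 2 * (f x * g x) + (g x)\<^sup>2" for x by (simp add: power2_eq_square algebra_simps)
  show "integrable M (\<lambda>x. (f x + g x)\<^sup>2)"
    unfolding eq using CS(1) f2 g2 by simp
  have "(\<integral>x. (f x + g x)\<^sup>2 \<partial>M) = (\<integral>x. (f x)\<^sup>2 \<partial>M) + 2 * (\<integral>x. f x * g x \<partial>M) + (\<integral>x. (g x)\<^sup>2 \<partial>M)"
    unfolding eq using CS(1) f2 g2 by simp
  also have "\<dots> \<le> (sqrt (\<integral>x. (f x)\<^sup>2 \<partial>M) + sqrt (\<integral>x. (g x)\<^sup>2 \<partial>M))\<^sup>2"
    using CS(2) by (simp add: power2_sum)
  finally show "sqrt (\<integral>x. (f x + g x)\<^sup>2 \<partial>M) \<le> sqrt (\<integral>x. (f x)\<^sup>2 \<partial>M) + sqrt (\<integral>x. (g x)\<^sup>2 \<partial>M)"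
    by (intro real_le_lsqrt) auto
qed

section \<open>The Sobolev norm as a weighted square integral of the transform\<close>

lemma has_fourier_measurable: "has_fourier F g \<Longrightarrow> g \<in> borel_measurable borel"
  by (simp add: has_fourier_def)

lemma has_fourier_add:
  assumes "has_fourier F f" "has_fourier G g"
  shows "has_fourier (F + G) (\<lambda>\<xi>. f \<xi> + g \<xi>)"
proof -
  have [measurable]: "f \<in> borel_measurable borel" "g \<in> borel_measurable borel"
    using assms by (auto intro: has_fourier_measurable)
  show ?thesis
    using assms unfolding has_fourier_def by (simp add: distrib_right)
qed

lemma has_fourier_scale:
  assumes "has_fourier F f"
  shows "has_fourier (r *\<^sub>R F) (\<lambda>\<xi>. r *\<^sub>R f \<xi>)"
proof -
  have [measurable]: "f \<in> borel_measurable borel"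
    using assms by (auto intro: has_fourier_measurable)
  show ?thesis
    using assms unfolding has_fourier_def by (simp add: scaleR_fun_def)
qed

lemma has_fourier_0: "has_fourier 0 (\<lambda>\<xi>. 0)"
  by (simp add: has_fourier_def)

lemma fourier_of_AE:
  assumes "has_fourier F g"
  shows "has_fourier F (fourier_of F)" "AE \<xi> in lborel. fourier_of F \<xi> = g \<xi>"
proof -
  show 1: "has_fourier F (fourier_of F)"
    unfolding fourier_of_def by (rule someI[of "has_fourier F", OF assms])
  show "AE \<xi> in lborel. fourier_of F \<xi> = g \<xi>"
    by (rule has_fourier_unique[OF 1 assms])
qed

abbreviation sobolev_weight :: "real \<Rightarrow> real^2 \<Rightarrow> real" where
  "sobolev_weight \<sigma> \<xi> \<equiv> (1 + (norm \<xi>)\<^sup>2) powr \<sigma>"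

text \<open>The norm is defined through a chosen transform \<open>fourier_of F\<close>. Almost
  everywhere uniqueness allows any transform at hand to compute it.\<close>

lemma nrm_sobolev_eq:
  assumes "has_fourier F g"
  shows "nrm (sobolev \<sigma>) F = sqrt (\<integral>\<xi>. sobolev_weight \<sigma> \<xi> * (cmod (g \<xi>))\<^sup>2 \<partial>lborel)"
proof -
  have [measurable]: "g \<in> borel_measurable borel" "fourier_of F \<in> borel_measurable borel"
    using assms fourier_of_AE[OF assms] by (auto intro: has_fourier_measurable)
  have "(\<integral>\<xi>. sobolev_weight \<sigma> \<xi> * (cmod (fourier_of F \<xi>))\<^sup>2 \<partial>lborel) = (\<integral>\<xi>. sobolev_weight \<sigma> \<xi> * (cmod (g \<xi>))\<^sup>2 \<partial>lborel)"
  proof (rule integral_cong_AE)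
    show "AE \<xi> in lborel. sobolev_weight \<sigma> \<xi> * (cmod (fourier_of F \<xi>))\<^sup>2 = sobolev_weight \<sigma> \<xi> * (cmod (g \<xi>))\<^sup>2"
      using fourier_of_AE(2)[OF assms] by eventually_elim simp
  qed measurable
  then show ?thesis by (simp add: sobolev_def)
qed

lemma sobolev_points_iff:
  "F \<in> points (sobolev \<sigma>) \<longleftrightarrow> tempered F \<and> real_valued F \<and>
    (\<exists>g. has_fourier F g \<and> integrable lborel (\<lambda>\<xi>. sobolev_weight \<sigma> \<xi> * (cmod (g \<xi>))\<^sup>2))"
  by (simp add: sobolev_def)

lemma sobolev_points_fourier:
  assumes "F \<in> points (sobolev \<sigma>)"
  obtains g where "has_fourier F g" "integrable lborel (\<lambda>\<xi>. sobolev_weight \<sigma> \<xi> * (cmod (g \<xi>))\<^sup>2)"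
  using assms unfolding sobolev_points_iff by (elim conjE exE)

lemma sobolev_weight_sqrt: "sobolev_weight \<sigma> \<xi> * a\<^sup>2 = (sobolev_weight (\<sigma> / 2) \<xi> * a)\<^sup>2"
  by (simp add: power_mult_distrib power2_eq_square flip: powr_add)

text \<open>There are finitely many lists of length at most \<open>N\<close> over the two-element
  index type, so the bounds for the single derivatives have a maximum and
  \<open>schwartz_seminorm\<close> is a genuine supremum.\<close>

lemma schwartz_seminorm_bdd:
  assumes "schwartz \<phi>"
  shows "bdd_above ((\<lambda>(\<alpha>, x). (1 + norm x) ^ N * cmod (partials \<alpha> \<phi> x)) ` ({\<alpha>. length \<alpha> \<le> N} \<times> UNIV))"
proof -
  have "\<exists>C. \<forall>x. (1 + norm x) ^ N * cmod (partials \<alpha> \<phi> x) \<le> C" for \<alpha>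
  proof -
    have "bounded (range (\<lambda>x. (1 + norm x) ^ N *\<^sub>R partials \<alpha> \<phi> x))"
      using assms by (simp add: schwartz_def)
    then obtain C where "\<forall>x\<in>range (\<lambda>x. (1 + norm x) ^ N *\<^sub>R partials \<alpha> \<phi> x). norm x \<le> C"
      unfolding bounded_iff ..
    then show ?thesis by (intro exI[of _ C]) simp
  qed
  then obtain C where C: "\<And>\<alpha> x. (1 + norm x) ^ N * cmod (partials \<alpha> \<phi> x) \<le> C \<alpha>" by metis
  have fin: "finite {\<alpha> :: 2 list. length \<alpha> \<le> N}" using finite_lists_length_le[of "UNIV :: 2 set" N] by simp
  show ?thesis
  proof (rule bdd_aboveI2)
    fix p :: "2 list \<times> (real^2)" assume p: "p \<in> {\<alpha>. length \<alpha> \<le> N} \<times> UNIV"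
    have "(case p of (\<alpha>, x) \<Rightarrow> (1 + norm x) ^ N * cmod (partials \<alpha> \<phi> x)) \<le> C (fst p)"
      using C by (simp add: split_beta)
    also have "\<dots> \<le> Max (C ` {\<alpha>. length \<alpha> \<le> N})"
      using p fin by (intro Max_ge) auto
    finally show "(case p of (\<alpha>, x) \<Rightarrow> (1 + norm x) ^ N * cmod (partials \<alpha> \<phi> x)) \<le> Max (C ` {\<alpha>. length \<alpha> \<le> N})" .
  qed
qed

lemma schwartz_seminorm_ge:
  assumes "schwartz \<phi>" "length \<alpha> \<le> N"
  shows "(1 + norm x) ^ N * cmod (partials \<alpha> \<phi> x) \<le> schwartz_seminorm N \<phi>"
  using cSUP_upper[OF _ schwartz_seminorm_bdd[OF assms(1), of N], of "(\<alpha>, x)"] assms(2)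
  by (simp add: schwartz_seminorm_def)

lemma schwartz_seminorm_nonneg:
  assumes "schwartz \<phi>"
  shows "0 \<le> schwartz_seminorm N \<phi>"
  using order_trans[OF _ schwartz_seminorm_ge[OF assms, of "[]" N 0]] by simp

lemma schwartz_seminorm_mono:
  assumes "schwartz \<phi>" "N \<le> M"
  shows "schwartz_seminorm N \<phi> \<le> schwartz_seminorm M \<phi>"
proof -
  have "(case p of (\<alpha>, x) \<Rightarrow> (1 + norm x) ^ N * cmod (partials \<alpha> \<phi> x)) \<le> schwartz_seminorm M \<phi>"
    if "p \<in> {\<alpha>. length \<alpha> \<le> N} \<times> UNIV" for p
  proof -
    obtain \<alpha> x where p: "p = (\<alpha>, x)" "length \<alpha> \<le> N" using \<open>p \<in> _\<close> by (cases p) simp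
    have "(1 + norm x) ^ N * cmod (partials \<alpha> \<phi> x) \<le> (1 + norm x) ^ M * cmod (partials \<alpha> \<phi> x)"
      using assms(2) by (intro mult_right_mono power_increasing) auto
    also have "\<dots> \<le> schwartz_seminorm M \<phi>" using assms p by (intro schwartz_seminorm_ge) auto
    finally show ?thesis by (simp add: p)
  qed
  then show ?thesis
    unfolding schwartz_seminorm_def[of N] by (rule cSUP_least[rotated]) (auto intro: exI[of _ "[]"])
qed

lemma temperedI:
  assumes "\<And>\<phi> \<psi> a b. schwartz \<phi> \<Longrightarrow> schwartz \<psi> \<Longrightarrow> F (\<lambda>x. a * \<phi> x + b * \<psi> x) = a * F \<phi> + b * F \<psi>"
    and "\<And>\<phi>. schwartz \<phi> \<Longrightarrow> cmod (F \<phi>) \<le> C * schwartz_seminorm N \<phi>"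
    and "\<And>\<phi>. \<not> schwartz \<phi> \<Longrightarrow> F \<phi> = 0"
  shows "tempered F"
  unfolding tempered_def
proof (intro conjI)
  show "\<exists>N C. \<forall>\<phi>. schwartz \<phi> \<longrightarrow> cmod (F \<phi>) \<le> C * schwartz_seminorm N \<phi>"
    using assms(2) by (intro exI allI impI)
qed (simp_all add: assms)

lemma tempered_linear:
  assumes "tempered F" "schwartz \<phi>" "schwartz \<psi>"
  shows "F (\<lambda>x. a * \<phi> x + b * \<psi> x) = a * F \<phi> + b * F \<psi>"
proof -
  have "\<forall>\<phi> \<psi> a b. schwartz \<phi> \<and> schwartz \<psi> \<longrightarrow> F (\<lambda>x. a * \<phi> x + b * \<psi> x) = a * F \<phi> + b * F \<psi>"
    using assms(1) unfolding tempered_def by (elim conjE)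
  from this[rule_format, OF conjI[OF assms(2,3)]] show ?thesis .
qed

lemma tempered_off: "tempered F \<Longrightarrow> \<not> schwartz \<phi> \<Longrightarrow> F \<phi> = 0"
  by (simp add: tempered_def)

lemma tempered_bound:
  assumes "tempered F"
  obtains N C where "C \<ge> 0" "\<And>\<phi> M. schwartz \<phi> \<Longrightarrow> N \<le> M \<Longrightarrow> cmod (F \<phi>) \<le> C * schwartz_seminorm M \<phi>"
proof -
  have "\<exists>N C. \<forall>\<phi>. schwartz \<phi> \<longrightarrow> cmod (F \<phi>) \<le> C * schwartz_seminorm N \<phi>"
    using assms unfolding tempered_def by (elim conjE)
  then obtain N C where NC: "\<forall>\<phi>. schwartz \<phi> \<longrightarrow> cmod (F \<phi>) \<le> C * schwartz_seminorm N \<phi>" by (elim exE)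
  show thesis
  proof (rule that[of "\<bar>C\<bar>" N])
    fix \<phi> M assume \<phi>: "schwartz \<phi>" and "N \<le> M"
    have "cmod (F \<phi>) \<le> C * schwartz_seminorm N \<phi>" using NC \<phi> by simp
    also have "\<dots> \<le> \<bar>C\<bar> * schwartz_seminorm M \<phi>"
      using schwartz_seminorm_nonneg[OF \<phi>] schwartz_seminorm_mono[OF \<phi> \<open>N \<le> M\<close>] by (intro mult_mono) auto
    finally show "cmod (F \<phi>) \<le> \<bar>C\<bar> * schwartz_seminorm M \<phi>" .
  qed simp
qed

lemma tempered_0: "tempered 0"
  by (rule temperedI[where C = 0 and N = 0]) simp_all

lemma tempered_add:
  assumes F: "tempered F" and G: "tempered G"
  shows "tempered (F + G)"
proof -
  from F obtain N C where N: "C \<ge> 0" "\<And>\<phi> M. schwartz \<phi> \<Longrightarrow> N \<le> M \<Longrightarrow> cmod (F \<phi>) \<le> C * schwartz_seminorm M \<phi>"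
    by (rule tempered_bound) (rule that)
  from G obtain M D where M: "D \<ge> 0" "\<And>\<phi> N. schwartz \<phi> \<Longrightarrow> M \<le> N \<Longrightarrow> cmod (G \<phi>) \<le> D * schwartz_seminorm N \<phi>"
    by (rule tempered_bound) (rule that)
  show ?thesis
  proof (rule temperedI[where C = "C + D" and N = "max N M"])
    fix \<phi> assume \<phi>: "schwartz \<phi>"
    have "cmod (F \<phi> + G \<phi>) \<le> cmod (F \<phi>) + cmod (G \<phi>)" by (rule norm_triangle_ineq)
    also have "\<dots> \<le> C * schwartz_seminorm (max N M) \<phi> + D * schwartz_seminorm (max N M) \<phi>"
      by (intro add_mono N M \<phi>) auto
    finally show "cmod ((F + G) \<phi>) \<le> (C + D) * schwartz_seminorm (max N M) \<phi>" by (simp add: distrib_right)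
  qed (simp_all add: tempered_linear[OF F] tempered_linear[OF G] tempered_off[OF F] tempered_off[OF G] algebra_simps)
qed

lemma tempered_scale:
  assumes F: "tempered F"
  shows "tempered (r *\<^sub>R F)"
proof -
  from F obtain N C where N: "C \<ge> 0" "\<And>\<phi> M. schwartz \<phi> \<Longrightarrow> N \<le> M \<Longrightarrow> cmod (F \<phi>) \<le> C * schwartz_seminorm M \<phi>"
    by (rule tempered_bound) (rule that)
  show ?thesis
  proof (rule temperedI[where C = "\<bar>r\<bar> * C" and N = N])
    fix \<phi> assume \<phi>: "schwartz \<phi>"
    show "cmod ((r *\<^sub>R F) \<phi>) \<le> \<bar>r\<bar> * C * schwartz_seminorm N \<phi>"
      using mult_left_mono[OF N(2)[OF \<phi> order_refl], of "\<bar>r\<bar>"] by (simp add: scaleR_fun_def mult.assoc)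
  qed (simp_all add: scaleR_fun_def scaleR_add_right tempered_linear[OF F] tempered_off[OF F])
qed

lemma normed_points_sobolev: "normed_points (sobolev \<sigma>)"
proof
  show "0 \<in> points (sobolev \<sigma>)"
    unfolding sobolev_points_iff
    by (intro conjI exI[of _ "\<lambda>\<xi>. 0"]) (simp_all add: tempered_0 real_valued_def has_fourier_0)
next
  fix F G assume FG: "F \<in> points (sobolev \<sigma>)" "G \<in> points (sobolev \<sigma>)"
  obtain f where f: "has_fourier F f" "integrable lborel (\<lambda>\<xi>. sobolev_weight \<sigma> \<xi> * (cmod (f \<xi>))\<^sup>2)"
    by (rule sobolev_points_fourier[OF FG(1)])
  obtain g where g: "has_fourier G g" "integrable lborel (\<lambda>\<xi>. sobolev_weight \<sigma> \<xi> * (cmod (g \<xi>))\<^sup>2)"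
    by (rule sobolev_points_fourier[OF FG(2)])
  have [measurable]: "f \<in> borel_measurable borel" "g \<in> borel_measurable borel"
    using f g by (auto intro: has_fourier_measurable)
  let ?f = "\<lambda>\<xi>. sobolev_weight (\<sigma> / 2) \<xi> * cmod (f \<xi>)" and ?g = "\<lambda>\<xi>. sobolev_weight (\<sigma> / 2) \<xi> * cmod (g \<xi>)"
  have I: "integrable lborel (\<lambda>\<xi>. (?f \<xi>)\<^sup>2)" "integrable lborel (\<lambda>\<xi>. (?g \<xi>)\<^sup>2)"
    using f(2) g(2) by (simp_all only: sobolev_weight_sqrt)
  have M: "?f \<in> borel_measurable lborel" "?g \<in> borel_measurable lborel" by measurable
  note tri = L2_triangle[OF M I]
  have le: "sobolev_weight \<sigma> \<xi> * (cmod (f \<xi> + g \<xi>))\<^sup>2 \<le> (?f \<xi> + ?g \<xi>)\<^sup>2" for \<xi>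
    unfolding sobolev_weight_sqrt distrib_left[symmetric]
    by (intro power_mono mult_left_mono norm_triangle_ineq) auto
  have I2: "integrable lborel (\<lambda>\<xi>. sobolev_weight \<sigma> \<xi> * (cmod (f \<xi> + g \<xi>))\<^sup>2)"
    by (rule Bochner_Integration.integrable_bound[OF tri(1)]) (use le in auto)
  have "real_valued (F + G)"
    using FG by (simp add: sobolev_points_iff real_valued_def)
  then show "F + G \<in> points (sobolev \<sigma>)"
    using FG I2 has_fourier_add[OF f(1) g(1)] tempered_add[of F G] unfolding sobolev_points_iff by (intro conjI exI) auto
  have "sqrt (\<integral>\<xi>. sobolev_weight \<sigma> \<xi> * (cmod (f \<xi> + g \<xi>))\<^sup>2 \<partial>lborel) \<le> sqrt (\<integral>\<xi>. (?f \<xi> + ?g \<xi>)\<^sup>2 \<partial>lborel)"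
    by (intro real_sqrt_le_mono integral_mono I2 tri(1) le)
  also note tri(2)
  finally show "nrm (sobolev \<sigma>) (F + G) \<le> nrm (sobolev \<sigma>) F + nrm (sobolev \<sigma>) G"
    by (simp only: nrm_sobolev_eq[OF has_fourier_add[OF f(1) g(1)]] nrm_sobolev_eq[OF f(1)] nrm_sobolev_eq[OF g(1)] sobolev_weight_sqrt)
next
  fix F r assume F: "F \<in> points (sobolev \<sigma>)"
  obtain f where f: "has_fourier F f" "integrable lborel (\<lambda>\<xi>. sobolev_weight \<sigma> \<xi> * (cmod (f \<xi>))\<^sup>2)"
    by (rule sobolev_points_fourier[OF F])
  have [measurable]: "f \<in> borel_measurable borel"
    using f by (auto intro: has_fourier_measurable)
  have eq: "sobolev_weight \<sigma> \<xi> * (cmod (r *\<^sub>R f \<xi>))\<^sup>2 = r\<^sup>2 * (sobolev_weight \<sigma> \<xi> * (cmod (f \<xi>))\<^sup>2)" for \<xi>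
    by (simp add: power_mult_distrib)
  have "integrable lborel (\<lambda>\<xi>. sobolev_weight \<sigma> \<xi> * (cmod (r *\<^sub>R f \<xi>))\<^sup>2)"
    unfolding eq using f(2) by simp
  moreover have "real_valued (r *\<^sub>R F)"
    using F by (simp add: sobolev_points_iff real_valued_def scaleR_fun_def scaleR_conv_of_real)
  ultimately show "r *\<^sub>R F \<in> points (sobolev \<sigma>)"
    using F has_fourier_scale[OF f(1), of r] tempered_scale[of F r] unfolding sobolev_points_iff by (intro conjI exI) auto
  show "nrm (sobolev \<sigma>) (r *\<^sub>R F) = \<bar>r\<bar> * nrm (sobolev \<sigma>) F"
    unfolding nrm_sobolev_eq[OF has_fourier_scale[OF f(1)]] nrm_sobolev_eq[OF f(1)] eq
    by (simp add: real_sqrt_mult)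
  show "0 \<le> nrm (sobolev \<sigma>) F" by (simp add: sobolev_def)
  assume "nrm (sobolev \<sigma>) F = 0"
  then have "(\<integral>\<xi>. sobolev_weight \<sigma> \<xi> * (cmod (f \<xi>))\<^sup>2 \<partial>lborel) = 0"
    unfolding nrm_sobolev_eq[OF f(1)] by simp
  then have "AE \<xi> in lborel. sobolev_weight \<sigma> \<xi> * (cmod (f \<xi>))\<^sup>2 = 0"
    using integral_nonneg_eq_0_iff_AE[OF f(2)] by simp
  then have ae: "AE \<xi> in lborel. f \<xi> = 0"
  proof eventually_elim
    case (elim \<xi>)
    have "1 + (norm \<xi>)\<^sup>2 > 0" by (intro add_pos_nonneg) auto
    then show ?case using elim by simp
  qed
  \<comment> \<open>A transform that vanishes almost everywhere kills \<open>F\<close> on Schwartz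
    functions; on all other arguments the normalisation in \<open>tempered\<close> takes
    over.\<close>
  have "F \<phi> = 0" for \<phi>
  proof (cases "schwartz \<phi>")
    case True
    then have "F \<phi> = (\<integral>\<xi>. f \<xi> * inv_fourier \<phi> \<xi> \<partial>lborel)" using f(1) by (simp add: has_fourier_def)
    also have "\<dots> = 0"
      by (rule integral_eq_zero_AE) (use ae in \<open>eventually_elim, simp\<close>)
    finally show ?thesis .
  next
    case False
    then show ?thesis using F tempered_off by (simp add: sobolev_points_iff)
  qed
  then show "F = 0" by (simp add: fun_eq_iff)
qed

text \<open>This is the duality between the Sobolev spaces of orders \<open>\<sigma>\<close> and
  \<open>- \<sigma>\<close>: Cauchy-Schwarz after splitting the weight as exponents
  \<open>- \<sigma> / 2\<close> and \<open>\<sigma> / 2\<close>, paired with the indicator of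
  \<open>E\<close>.\<close>

lemma sobolev_localized_functional:
  fixes E :: "(real^2) set"
  assumes E: "E \<in> sets borel" "integrable lborel (\<lambda>\<xi>. indicat_real E \<xi> * sobolev_weight (- \<sigma>) \<xi>)"
    and F: "F \<in> points (sobolev \<sigma>)" and g: "has_fourier F g"
  shows "integrable lborel (\<lambda>\<xi>. indicat_real E \<xi> *\<^sub>R g \<xi>)"
    and "cmod (\<integral>\<xi>. indicat_real E \<xi> *\<^sub>R g \<xi> \<partial>lborel)
      \<le> sqrt (\<integral>\<xi>. indicat_real E \<xi> * sobolev_weight (- \<sigma>) \<xi> \<partial>lborel) * nrm (sobolev \<sigma>) F"
proof -
  obtain f where f: "has_fourier F f" "integrable lborel (\<lambda>\<xi>. sobolev_weight \<sigma> \<xi> * (cmod (f \<xi>))\<^sup>2)"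
    by (rule sobolev_points_fourier[OF F])
  have [measurable]: "f \<in> borel_measurable borel" "g \<in> borel_measurable borel" "E \<in> sets borel"
    using f g E by (auto intro: has_fourier_measurable)
  have "AE \<xi> in lborel. f \<xi> = g \<xi>" by (rule has_fourier_unique[OF f(1) g])
  then have "AE \<xi> in lborel. sobolev_weight \<sigma> \<xi> * (cmod (f \<xi>))\<^sup>2 = sobolev_weight \<sigma> \<xi> * (cmod (g \<xi>))\<^sup>2"
    by eventually_elim simp
  from integrable_cong_AE[THEN iffD1, OF _ _ this f(2)]
  have g2: "integrable lborel (\<lambda>\<xi>. sobolev_weight \<sigma> \<xi> * (cmod (g \<xi>))\<^sup>2)" by simp
  let ?e = "\<lambda>\<xi>. indicat_real E \<xi> * sobolev_weight (- \<sigma> / 2) \<xi>" and ?g = "\<lambda>\<xi>. sobolev_weight (\<sigma> / 2) \<xi> * cmod (g \<xi>)"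
  have e2: "(?e \<xi>)\<^sup>2 = indicat_real E \<xi> * sobolev_weight (- \<sigma>) \<xi>" for \<xi>
    by (simp add: power_mult_distrib power2_eq_square indicator_def flip: powr_add)
  have g2': "(?g \<xi>)\<^sup>2 = sobolev_weight \<sigma> \<xi> * (cmod (g \<xi>))\<^sup>2" for \<xi>
    by (simp only: sobolev_weight_sqrt)
  have eg: "?e \<xi> * ?g \<xi> = indicat_real E \<xi> * cmod (g \<xi>)" for \<xi>
  proof -
    have "1 + (norm \<xi>)\<^sup>2 > 0" by (intro add_pos_nonneg) auto
    then have "sobolev_weight (- \<sigma> / 2) \<xi> * sobolev_weight (\<sigma> / 2) \<xi> = 1"
      by (simp flip: powr_add)
    then have "(indicat_real E \<xi> * cmod (g \<xi>)) * (sobolev_weight (- \<sigma> / 2) \<xi> * sobolev_weight (\<sigma> / 2) \<xi>) = indicat_real E \<xi> * cmod (g \<xi>)"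
      by simp
    then show ?thesis by (simp only: mult_ac)
  qed
  have I: "integrable lborel (\<lambda>\<xi>. (?e \<xi>)\<^sup>2)" "integrable lborel (\<lambda>\<xi>. (?g \<xi>)\<^sup>2)"
    unfolding e2 g2' using E(2) g2 by simp_all
  have M: "?e \<in> borel_measurable lborel" "?g \<in> borel_measurable lborel" by measurable
  note CS = integral_Cauchy_Schwarz[OF M I, unfolded eg e2 g2']
  have n: "norm (indicat_real E \<xi> *\<^sub>R g \<xi>) = indicat_real E \<xi> * cmod (g \<xi>)" for \<xi> by simp
  show "integrable lborel (\<lambda>\<xi>. indicat_real E \<xi> *\<^sub>R g \<xi>)"
    by (rule Bochner_Integration.integrable_bound[OF CS(1)]) (auto simp: n)
  have "cmod (\<integral>\<xi>. indicat_real E \<xi> *\<^sub>R g \<xi> \<partial>lborel) \<le> (\<integral>\<xi>. norm (indicat_real E \<xi> *\<^sub>R g \<xi>) \<partial>lborel)"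
    by (rule integral_norm_bound)
  then show "cmod (\<integral>\<xi>. indicat_real E \<xi> *\<^sub>R g \<xi> \<partial>lborel)
      \<le> sqrt (\<integral>\<xi>. indicat_real E \<xi> * sobolev_weight (- \<sigma>) \<xi> \<partial>lborel) * nrm (sobolev \<sigma>) F"
    using CS(2) by (simp only: n nrm_sobolev_eq[OF g])
qed


section \<open>Inverse Fourier transforms of rapidly decreasing functions\<close>

text \<open>The case \<open>\<bar>c\<bar> = 1\<close> covers translations and reflections together,
  the two symmetries used for convolutions and for hermitian symbols.\<close>

lemma lborel_affine_unit:
  fixes t :: "'a::euclidean_space"
  assumes "\<bar>c\<bar> = 1"
  shows "distr lborel borel (\<lambda>x. t + c *\<^sub>R x) = lborel"
  using lborel_affine[of c t] assms by (auto simp: density_1)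

lemma integral_lborel_affine_unit:
  fixes f :: "'a::euclidean_space \<Rightarrow> 'b::{banach, second_countable_topology}"
  assumes [measurable]: "f \<in> borel_measurable borel" and c: "\<bar>c\<bar> = 1"
  shows "(\<integral>x. f (t + c *\<^sub>R x) \<partial>lborel) = (\<integral>x. f x \<partial>lborel)"
    and "integrable lborel (\<lambda>x. f (t + c *\<^sub>R x)) \<longleftrightarrow> integrable lborel f"
proof -
  have "(\<integral>x. f x \<partial>(distr lborel borel (\<lambda>x. t + c *\<^sub>R x))) = (\<integral>x. f (t + c *\<^sub>R x) \<partial>lborel)"
    by (rule integral_distr) measurable
  then show "(\<integral>x. f (t + c *\<^sub>R x) \<partial>lborel) = (\<integral>x. f x \<partial>lborel)"
    by (simp only: lborel_affine_unit[OF c])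
  have "integrable (distr lborel borel (\<lambda>x. t + c *\<^sub>R x)) f \<longleftrightarrow> integrable lborel (\<lambda>x. f (t + c *\<^sub>R x))"
    by (rule integrable_distr_eq) measurable
  then show "integrable lborel (\<lambda>x. f (t + c *\<^sub>R x)) \<longleftrightarrow> integrable lborel f"
    by (simp only: lborel_affine_unit[OF c])
qed

lemmas integral_lborel_reflect = integral_lborel_affine_unit[of _ "-1", simplified]
lemmas integral_lborel_shift = integral_lborel_affine_unit[of _ 1, simplified]

lemma borel_measurable_cis [measurable]: "cis \<in> borel_measurable borel"
  by (intro borel_measurable_continuous_onI continuous_intros)

lemma integrable_cis_mult:
  assumes "integrable lborel g"
  shows "integrable lborel (\<lambda>\<xi>. cis (\<xi> \<bullet> x) * g \<xi>)"
proof -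
  have "(\<lambda>\<xi>. cis (\<xi> \<bullet> x)) \<in> borel_measurable lborel" by measurable
  then show ?thesis
    by (subst mult.commute) (rule integrable_mult_bounded[OF assms, where B = 1], simp_all)
qed

lemma inv_fourier_add:
  assumes "integrable lborel f" "integrable lborel g"
  shows "inv_fourier (\<lambda>\<xi>. f \<xi> + g \<xi>) x = inv_fourier f x + inv_fourier g x"
  using assms by (simp add: inv_fourier_def distrib_left integrable_cis_mult)

lemma inv_fourier_diff:
  assumes "integrable lborel f" "integrable lborel g"
  shows "inv_fourier (\<lambda>\<xi>. f \<xi> - g \<xi>) x = inv_fourier f x - inv_fourier g x"
  using assms by (simp add: inv_fourier_def right_diff_distrib integrable_cis_mult)

lemma inv_fourier_cmult: "inv_fourier (\<lambda>\<xi>. c * f \<xi>) x = c * inv_fourier f x"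
  by (simp add: inv_fourier_def mult.left_commute[of _ c])

lemma inv_fourier_norm_le:
  assumes "integrable lborel g"
  shows "cmod (inv_fourier g x) \<le> 1 / (2 * pi) * (\<integral>\<xi>. cmod (g \<xi>) \<partial>lborel)"
proof -
  have "cmod (inv_fourier g x) = 1 / (2 * pi) * cmod (\<integral>\<xi>. cis (\<xi> \<bullet> x) * g \<xi> \<partial>lborel)"
    by (simp add: inv_fourier_def norm_mult norm_divide)
  also have "\<dots> \<le> 1 / (2 * pi) * (\<integral>\<xi>. norm (cis (\<xi> \<bullet> x) * g \<xi>) \<partial>lborel)"
    by (intro mult_left_mono integral_norm_bound) auto
  finally show ?thesis by (simp add: norm_mult)
qed

text \<open>The constant that converts a weighted supremum bound of order four into a bound of the
  integral.\<close>

definition decay_mass :: real where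
  "decay_mass = (\<integral>x. 1 / (1 + norm x) ^ 4 \<partial>(lborel :: (real^2) measure))"

lemma decay_mass_nonneg: "0 \<le> decay_mass"
  unfolding decay_mass_def by (rule integral_nonneg_AE) auto

lemma integral_le_decay_mass:
  fixes f :: "real^2 \<Rightarrow> 'b::{banach, second_countable_topology}"
  assumes "f \<in> borel_measurable borel" "\<And>x. (1 + norm x) ^ 4 * norm (f x) \<le> C"
  shows "(\<integral>x. norm (f x) \<partial>lborel) \<le> C * decay_mass"
proof -
  have "norm (f x) \<le> C * (1 / (1 + norm x) ^ 4)" for x
    using assms(2)[of x] by (simp add: field_simps add_nonneg_eq_0_iff)
  from integral_mono[OF integrable_norm[OF integrable_of_decay[OF assms]] integrable_mult_right[OF integrable_decay] this]
  have "(\<integral>x. norm (f x) \<partial>lborel) \<le> (\<integral>x. C * (1 / (1 + norm (x :: real^2)) ^ 4) \<partial>lborel)" .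
  then show ?thesis by (simp only: decay_mass_def integral_mult_right_zero)
qed

lemma inv_fourier_decay_le:
  assumes "g \<in> borel_measurable borel" "\<And>\<xi>. (1 + norm \<xi>) ^ 4 * cmod (g \<xi>) \<le> C"
  shows "cmod (inv_fourier g x) \<le> C * decay_mass"
proof -
  have "0 \<le> C" using order_trans[OF _ assms(2)[of 0]] by simp
  have "cmod (inv_fourier g x) \<le> 1 / (2 * pi) * (\<integral>\<xi>. cmod (g \<xi>) \<partial>lborel)"
    by (rule inv_fourier_norm_le[OF integrable_of_decay[OF assms]])
  also have "\<dots> \<le> 1 * (C * decay_mass)"
    using integral_le_decay_mass[OF assms] pi_gt3 decay_mass_nonneg \<open>0 \<le> C\<close>
    by (intro mult_mono) (auto simp: field_simps)
  finally show ?thesis by simp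
qed

text \<open>Decay of the symbol is what makes its inverse transform smooth. Smoothness of the symbol
  is not part of the notion, so piecewise linear symbols with compact support qualify.\<close>

definition rapid :: "(real^2 \<Rightarrow> complex) \<Rightarrow> bool" where
  "rapid g \<longleftrightarrow> continuous_on UNIV g \<and> (\<forall>m. \<exists>C. \<forall>\<xi>. (1 + norm \<xi>) ^ m * cmod (g \<xi>) \<le> C)"

definition hermitian :: "(real^2 \<Rightarrow> complex) \<Rightarrow> bool" where
  "hermitian g \<longleftrightarrow> (\<forall>\<xi>. g (- \<xi>) = cnj (g \<xi>))"

lemma rapid_continuous: "rapid g \<Longrightarrow> continuous_on UNIV g"
  by (simp add: rapid_def)

lemma rapid_measurable: "rapid g \<Longrightarrow> g \<in> borel_measurable borel"
  by (intro borel_measurable_continuous_onI rapid_continuous)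

lemma rapid_bound:
  assumes "rapid g"
  obtains C where "C \<ge> 0" "\<And>\<xi>. (1 + norm \<xi>) ^ m * cmod (g \<xi>) \<le> C"
proof -
  from assms obtain C where C: "\<forall>\<xi>. (1 + norm \<xi>) ^ m * cmod (g \<xi>) \<le> C" unfolding rapid_def by metis
  then have "0 \<le> C" using order_trans[OF norm_ge_zero, of "g 0" C] by (metis add.right_neutral mult_1 norm_zero power_one)
  then show thesis using C that by blast
qed

lemma rapid_integrable: "rapid g \<Longrightarrow> integrable lborel g"
  using rapid_bound[of g 4] integrable_of_decay[OF rapid_measurable] by metis

lemma rapid_mult:
  assumes g: "rapid g" and p: "continuous_on UNIV p" "\<And>\<xi>. cmod (p \<xi>) \<le> K * (1 + norm \<xi>) ^ k"
  shows "rapid (\<lambda>\<xi>. p \<xi> * g \<xi>)"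
  unfolding rapid_def
proof (intro conjI allI)
  show "continuous_on UNIV (\<lambda>\<xi>. p \<xi> * g \<xi>)" by (rule continuous_on_mult[OF p(1) rapid_continuous[OF g]])
  fix m
  obtain C where C: "C \<ge> 0" "\<And>\<xi>. (1 + norm \<xi>) ^ (k + m) * cmod (g \<xi>) \<le> C" using rapid_bound[OF g] by metis
  have K: "K \<ge> 0" using order_trans[OF norm_ge_zero p(2)[of 0]] by simp
  have "(1 + norm \<xi>) ^ m * cmod (p \<xi> * g \<xi>) \<le> K * C" for \<xi>
  proof -
    have "(1 + norm \<xi>) ^ m * cmod (p \<xi> * g \<xi>) \<le> (1 + norm \<xi>) ^ m * (K * (1 + norm \<xi>) ^ k * cmod (g \<xi>))"
      unfolding norm_mult using p(2) by (intro mult_left_mono mult_right_mono) auto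
    also have "\<dots> = K * ((1 + norm \<xi>) ^ (k + m) * cmod (g \<xi>))" by (simp add: power_add)
    also have "\<dots> \<le> K * C" using C K by (intro mult_left_mono)
    finally show ?thesis .
  qed
  then show "\<exists>C. \<forall>\<xi>. (1 + norm \<xi>) ^ m * cmod (p \<xi> * g \<xi>) \<le> C" by blast
qed

lemma rapid_add:
  assumes "rapid f" "rapid g"
  shows "rapid (\<lambda>\<xi>. f \<xi> + g \<xi>)"
  unfolding rapid_def
proof (intro conjI allI)
  show "continuous_on UNIV (\<lambda>\<xi>. f \<xi> + g \<xi>)" using assms by (intro continuous_on_add rapid_continuous)
  fix m
  obtain C D where C: "\<And>\<xi>. (1 + norm \<xi>) ^ m * cmod (f \<xi>) \<le> C" and D: "\<And>\<xi>. (1 + norm \<xi>) ^ m * cmod (g \<xi>) \<le> D"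
    using rapid_bound[OF assms(1)] rapid_bound[OF assms(2)] by metis
  have "(1 + norm \<xi>) ^ m * cmod (f \<xi> + g \<xi>) \<le> C + D" for \<xi>
  proof -
    have "(1 + norm \<xi>) ^ m * cmod (f \<xi> + g \<xi>) \<le> (1 + norm \<xi>) ^ m * (cmod (f \<xi>) + cmod (g \<xi>))"
      by (intro mult_left_mono norm_triangle_ineq) auto
    then show ?thesis using C[of \<xi>] D[of \<xi>] by (simp add: distrib_left)
  qed
  then show "\<exists>C. \<forall>\<xi>. (1 + norm \<xi>) ^ m * cmod (f \<xi> + g \<xi>) \<le> C" by blast
qed

lemma rapid_mult_coord: "rapid g \<Longrightarrow> rapid (\<lambda>\<xi>. \<i> * of_real (\<xi>$i) * g \<xi>)"
  by (rule rapid_mult[where K = 1 and k = 1])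
    (auto intro!: continuous_intros simp: norm_mult order_trans[OF component_le_norm_cart])

lemma has_derivative_quadratic_remainder:
  fixes f :: "'a::real_normed_vector \<Rightarrow> 'b::real_normed_vector"
  assumes "bounded_linear L" "\<And>h. norm (f (x + h) - f x - L h) \<le> K * (norm h)\<^sup>2"
  shows "(f has_derivative L) (at x)"
  unfolding has_derivative_at
proof (intro conjI assms(1))
  show "(\<lambda>h. norm (f (x + h) - f x - L h) / norm h) \<midarrow>0\<rightarrow> 0"
  proof (rule Lim_null_comparison)
    show "\<forall>\<^sub>F h in at 0. norm (norm (f (x + h) - f x - L h) / norm h) \<le> K * norm h"
    proof (rule always_eventually, rule allI)
      fix h
      show "norm (norm (f (x + h) - f x - L h) / norm h) \<le> K * norm h"
        using assms(2)[of h] by (cases "h = 0") (auto simp: field_simps power2_eq_square)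
    qed
    show "(\<lambda>h. K * norm h) \<midarrow>0\<rightarrow> 0" by (auto intro!: tendsto_eq_intros)
  qed
qed

lemma cis_second_order: "cmod (cis (a + b) - cis a - \<i> * of_real b * cis a) \<le> b\<^sup>2"
proof -
  have "cmod (iexp b - (\<Sum>k\<le>1. (\<i> * b) ^ k / fact k)) \<le> \<bar>b\<bar> ^ Suc 1 / fact (Suc 1)" by (rule iexp_approx1)
  then have 1: "cmod (cis b - 1 - \<i> * of_real b) \<le> b\<^sup>2 / 2"
    by (simp add: cis_conv_exp algebra_simps numeral_2_eq_2)
  have "cis (a + b) - cis a - \<i> * of_real b * cis a = cis a * (cis b - 1 - \<i> * of_real b)"
    by (simp add: cis_mult[symmetric] algebra_simps)
  then have "cmod (cis (a + b) - cis a - \<i> * of_real b * cis a) = cmod (cis b - 1 - \<i> * of_real b)"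
    by (simp add: norm_mult)
  also have "\<dots> \<le> b\<^sup>2" using 1 zero_le_power2[of b] by linarith
  finally show ?thesis .
qed

text \<open>A remainder quadratic in \<open>h\<close> is bounded under the integral. It costs six
  powers of decay: two for \<open>(\<xi> \<bullet> h)\<^sup>2\<close> and four for
  integrability.\<close>

lemma inv_fourier_has_derivative:
  assumes g: "rapid g"
  shows "(inv_fourier g has_derivative
    (\<lambda>h. of_real (h$1) * inv_fourier (\<lambda>\<xi>. \<i> * of_real (\<xi>$1) * g \<xi>) x
       + of_real (h$2) * inv_fourier (\<lambda>\<xi>. \<i> * of_real (\<xi>$2) * g \<xi>) x)) (at x)"
proof -
  let ?A = "\<lambda>i. inv_fourier (\<lambda>\<xi>. \<i> * of_real (\<xi>$i) * g \<xi>) x"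
  obtain C where C: "C \<ge> 0" "\<And>\<xi>. (1 + norm \<xi>) ^ 6 * cmod (g \<xi>) \<le> C" using rapid_bound[OF g] by metis
  show ?thesis
  proof (rule has_derivative_quadratic_remainder[where K = "C * decay_mass"])
  show "bounded_linear (\<lambda>h::real^2. of_real (h$1) * ?A 1 + of_real (h$2) * ?A 2)"
    by (intro bounded_linear_add bounded_linear_mult_const bounded_linear_compose[OF bounded_linear_of_real bounded_linear_vec_nth])
  fix h :: "real^2"
  have gi: "integrable lborel g" by (rule rapid_integrable[OF g])
  have [measurable]: "g \<in> borel_measurable borel" by (rule rapid_measurable[OF g])
  have ci: "integrable lborel (\<lambda>\<xi>. \<i> * of_real (\<xi>$i) * g \<xi>)" for i by (rule rapid_integrable[OF rapid_mult_coord[OF g]])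
  define R where "R \<xi> = (cis (\<xi> \<bullet> x + \<xi> \<bullet> h) - cis (\<xi> \<bullet> x) - \<i> * of_real (\<xi> \<bullet> h) * cis (\<xi> \<bullet> x)) * g \<xi>" for \<xi>
  have "inv_fourier g (x + h) - inv_fourier g x - (of_real (h$1) * ?A 1 + of_real (h$2) * ?A 2)
    = of_real (1 / (2 * pi)) * ((\<integral>\<xi>. cis (\<xi> \<bullet> (x + h)) * g \<xi> \<partial>lborel) - (\<integral>\<xi>. cis (\<xi> \<bullet> x) * g \<xi> \<partial>lborel)
      - ((\<integral>\<xi>. of_real (h$1) * (cis (\<xi> \<bullet> x) * (\<i> * of_real (\<xi>$1) * g \<xi>)) \<partial>lborel)
       + (\<integral>\<xi>. of_real (h$2) * (cis (\<xi> \<bullet> x) * (\<i> * of_real (\<xi>$2) * g \<xi>)) \<partial>lborel)))"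
    unfolding inv_fourier_def integral_mult_right_zero by (simp add: algebra_simps)
  also have "\<dots> = of_real (1 / (2 * pi)) * (\<integral>\<xi>. cis (\<xi> \<bullet> (x + h)) * g \<xi> - cis (\<xi> \<bullet> x) * g \<xi>
      - (of_real (h$1) * (cis (\<xi> \<bullet> x) * (\<i> * of_real (\<xi>$1) * g \<xi>))
       + of_real (h$2) * (cis (\<xi> \<bullet> x) * (\<i> * of_real (\<xi>$2) * g \<xi>))) \<partial>lborel)"
    using integrable_cis_mult[OF gi] integrable_cis_mult[OF ci]
    by (simp add: Bochner_Integration.integral_diff Bochner_Integration.integral_add
        Bochner_Integration.integrable_diff Bochner_Integration.integrable_add del: integral_mult_right_zero integral_mult_right)
  also have "\<dots> = of_real (1 / (2 * pi)) * (\<integral>\<xi>. R \<xi> \<partial>lborel)"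
    by (intro arg_cong2[where f = "(*)"] refl Bochner_Integration.integral_cong)
      (simp add: R_def inner_real2 inner_add_right algebra_simps)
  finally have eq: "inv_fourier g (x + h) - inv_fourier g x - (of_real (h$1) * ?A 1 + of_real (h$2) * ?A 2)
    = of_real (1 / (2 * pi)) * (\<integral>\<xi>. R \<xi> \<partial>lborel)" .
  have Rm: "R \<in> borel_measurable borel"
    unfolding R_def inner_add_right[symmetric] by measurable
  have Rb: "(1 + norm \<xi>) ^ 4 * cmod (R \<xi>) \<le> C * (norm h)\<^sup>2" for \<xi>
  proof -
    have "cmod (R \<xi>) \<le> (\<xi> \<bullet> h)\<^sup>2 * cmod (g \<xi>)"
      unfolding R_def norm_mult by (intro mult_right_mono cis_second_order) auto
    also have "\<dots> \<le> ((1 + norm \<xi>) * norm h)\<^sup>2 * cmod (g \<xi>)"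
    proof (intro mult_right_mono)
      have "\<bar>\<xi> \<bullet> h\<bar> \<le> norm \<xi> * norm h" by (rule Cauchy_Schwarz_ineq2)
      also have "\<dots> \<le> (1 + norm \<xi>) * norm h" by (intro mult_right_mono) auto
      finally have "\<bar>\<xi> \<bullet> h\<bar>\<^sup>2 \<le> ((1 + norm \<xi>) * norm h)\<^sup>2" by (intro power_mono) auto
      then show "(\<xi> \<bullet> h)\<^sup>2 \<le> ((1 + norm \<xi>) * norm h)\<^sup>2" by simp
    qed simp
    finally have "(1 + norm \<xi>) ^ 4 * cmod (R \<xi>) \<le> (1 + norm \<xi>) ^ 4 * (((1 + norm \<xi>) * norm h)\<^sup>2 * cmod (g \<xi>))"
      by (intro mult_left_mono) auto
    also have "\<dots> = (norm h)\<^sup>2 * ((1 + norm \<xi>) ^ (4 + 2) * cmod (g \<xi>))"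
      unfolding power_add power_mult_distrib by (simp only: mult_ac)
    also have "\<dots> \<le> (norm h)\<^sup>2 * C" using C(2)[of \<xi>] by (intro mult_left_mono) auto
    finally show ?thesis by (simp only: mult.commute)
  qed
  have "cmod (of_real (1 / (2 * pi)) * (\<integral>\<xi>. R \<xi> \<partial>lborel)) \<le> 1 * (C * (norm h)\<^sup>2 * decay_mass)"
    unfolding norm_mult
  proof (rule mult_mono)
    show "cmod (of_real (1 / (2 * pi))) \<le> 1" using pi_gt3 by (simp add: norm_divide norm_mult)
    show "cmod (\<integral>\<xi>. R \<xi> \<partial>lborel) \<le> C * (norm h)\<^sup>2 * decay_mass"
      using integral_norm_bound[of lborel R] integral_le_decay_mass[OF Rm Rb] by linarith
  qed auto
  then show "norm (inv_fourier g (x + h) - inv_fourier g x - (of_real (h$1) * ?A 1 + of_real (h$2) * ?A 2)) \<le> (C * decay_mass) * (norm h)\<^sup>2"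
    unfolding eq by (simp only: mult_ac mult_1)
  qed
qed

lemma partial_inv_fourier:
  assumes "rapid g"
  shows "inv_fourier g differentiable (at x)"
    and "partial i (inv_fourier g) x = inv_fourier (\<lambda>\<xi>. \<i> * of_real (\<xi>$i) * g \<xi>) x"
proof -
  note d = inv_fourier_has_derivative[OF assms, of x]
  show "inv_fourier g differentiable (at x)" using d unfolding differentiable_def by blast
  have "i = 1 \<or> i = 2" by (rule exhaust_2)
  then show "partial i (inv_fourier g) x = inv_fourier (\<lambda>\<xi>. \<i> * of_real (\<xi>$i) * g \<xi>) x"
    unfolding partial_eq[OF d] by (auto simp: axis_def)
qed

text \<open>Taking the real part yields a real function for every symbol. For hermitian symbols
  nothing is lost, by \<open>inv_fourier_hermitian\<close>.\<close>

definition synth :: "(real^2 \<Rightarrow> complex) \<Rightarrow> real^2 \<Rightarrow> real" where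
  "synth g x = Re (inv_fourier g x)"

lemma partial_synth:
  assumes "rapid g"
  shows "synth g differentiable (at x)"
    and "partial i (synth g) = synth (\<lambda>\<xi>. \<i> * of_real (\<xi>$i) * g \<xi>)"
proof -
  note d = inv_fourier_has_derivative[OF assms]
  show "synth g differentiable (at x)"
    using has_derivative_Re[OF d] unfolding differentiable_def synth_def[abs_def] by blast
  show "partial i (synth g) = synth (\<lambda>\<xi>. \<i> * of_real (\<xi>$i) * g \<xi>)"
    using partial_linear[OF bounded_linear_Re partial_inv_fourier(1)[OF assms], of i]
      partial_inv_fourier(2)[OF assms, of i]
    by (simp add: synth_def[abs_def] fun_eq_iff)
qed

text \<open>Differentiation multiplies the symbol by a coordinate, which preserves
  \<open>rapid\<close>; hence the class of all \<open>synth g\<close> with \<open>rapid g\<close> is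
  closed under \<open>partial\<close>.\<close>

lemma smooth_synth:
  assumes "rapid g"
  shows "smooth (synth g)"
proof (rule smooth_invariant(2)[where P = "\<lambda>f. \<exists>g. rapid g \<and> f = synth g"])
  show "\<exists>g'. rapid g' \<and> synth g = synth g'" using assms by blast
qed (use partial_synth rapid_mult_coord in blast)+

lemma laplace_synth:
  assumes "rapid g"
  shows "laplace (synth g) x = synth (\<lambda>\<xi>. - of_real ((norm \<xi>)\<^sup>2) * g \<xi>) x"
proof -
  let ?c = "\<lambda>i g \<xi>. \<i> * of_real (\<xi>$i) * g \<xi> :: complex"
  have "laplace (synth g) x = synth (?c 1 (?c 1 g)) x + synth (?c 2 (?c 2 g)) x"
    by (simp add: laplace_def sum_2 partial_synth(2)[OF assms] partial_synth(2)[OF rapid_mult_coord[OF assms]])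
  also have "\<dots> = synth (\<lambda>\<xi>. ?c 1 (?c 1 g) \<xi> + ?c 2 (?c 2 g) \<xi>) x"
    unfolding synth_def
    by (subst inv_fourier_add) (auto intro!: rapid_integrable rapid_mult_coord assms)
  also have "(\<lambda>\<xi>. ?c 1 (?c 1 g) \<xi> + ?c 2 (?c 2 g) \<xi>) = (\<lambda>\<xi>. - of_real ((norm \<xi>)\<^sup>2) * g \<xi>)"
    by (simp add: fun_eq_iff power2_norm_eq_inner inner_real2 algebra_simps)
  finally show ?thesis .
qed

lemma inv_fourier_hermitian:
  assumes "rapid g" "hermitian g"
  shows "inv_fourier g x = of_real (synth g x)"
proof -
  have [measurable]: "g \<in> borel_measurable borel" by (rule rapid_measurable[OF assms(1)])
  have "cnj (inv_fourier g x) = of_real (1 / (2 * pi)) * (\<integral>\<xi>. cnj (cis (\<xi> \<bullet> x) * g \<xi>) \<partial>lborel)"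
    by (simp only: inv_fourier_def complex_cnj_mult[of "of_real _"] complex_cnj_complex_of_real Bochner_Integration.integral_cnj)
  also have "(\<integral>\<xi>. cnj (cis (\<xi> \<bullet> x) * g \<xi>) \<partial>lborel) = (\<integral>\<xi>. cis ((- \<xi>) \<bullet> x) * g (- \<xi>) \<partial>lborel)"
    using assms(2) by (simp add: hermitian_def cis_cnj)
  also have "\<dots> = (\<integral>\<xi>. cis (\<xi> \<bullet> x) * g \<xi> \<partial>lborel)"
    using integral_lborel_reflect(1)[of "\<lambda>\<xi>. cis (\<xi> \<bullet> x) * g \<xi>" 0] by simp
  finally have "cnj (inv_fourier g x) = inv_fourier g x" by (simp add: inv_fourier_def)
  then show ?thesis by (simp add: synth_def complex_eq_iff)
qed

lemma inv_fourier_measurable: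
  assumes "g \<in> borel_measurable borel"
  shows "inv_fourier g \<in> borel_measurable borel"
proof -
  note [measurable] = assms
  have "(\<lambda>x. \<integral>\<xi>. cis (\<xi> \<bullet> x) * g \<xi> \<partial>lborel) \<in> borel_measurable borel" by measurable
  then show ?thesis unfolding inv_fourier_def[abs_def] by measurable
qed

text \<open>Fubini with the symmetric kernel \<open>cis (\<xi> \<bullet> x)\<close>. This
  multiplication formula identifies the transform of \<open>dist_of (synth g)\<close> without an
  inversion theorem.\<close>

lemma inv_fourier_duality:
  assumes f: "integrable lborel f" and g: "integrable lborel g"
  shows "(\<integral>x. inv_fourier f x * g x \<partial>lborel) = (\<integral>\<xi>. f \<xi> * inv_fourier g \<xi> \<partial>lborel)"
proof -
  have [measurable]: "f \<in> borel_measurable borel" "g \<in> borel_measurable borel"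
    using f g by auto
  let ?h = "\<lambda>x \<xi>. cis (\<xi> \<bullet> x) * f \<xi> * g x"
  have I: "integrable (lborel \<Otimes>\<^sub>M lborel) (case_prod ?h)"
  proof (rule lborel_pair.Fubini_integrable)
    show "case_prod ?h \<in> borel_measurable (lborel \<Otimes>\<^sub>M lborel)" by measurable
    have "(\<lambda>x. \<integral>\<xi>. norm (case (x, \<xi>) of (x, \<xi>) \<Rightarrow> ?h x \<xi>) \<partial>lborel) = (\<lambda>x. (\<integral>\<xi>. cmod (f \<xi>) \<partial>lborel) * cmod (g x))"
      by (simp add: norm_mult)
    then show "integrable lborel (\<lambda>x. \<integral>\<xi>. norm (case (x, \<xi>) of (x, \<xi>) \<Rightarrow> ?h x \<xi>) \<partial>lborel)" using g by simp
    show "AE x in lborel. integrable lborel (\<lambda>\<xi>. case (x, \<xi>) of (x, \<xi>) \<Rightarrow> ?h x \<xi>)"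
      using integrable_cis_mult[OF f] by simp
  qed
  have "(\<integral>x. inv_fourier f x * g x \<partial>lborel) = (\<integral>x. of_real (1 / (2 * pi)) * (\<integral>\<xi>. ?h x \<xi> \<partial>lborel) \<partial>lborel)"
    by (simp add: inv_fourier_def)
  also have "\<dots> = of_real (1 / (2 * pi)) * (\<integral>x. (\<integral>\<xi>. ?h x \<xi> \<partial>lborel) \<partial>lborel)"
    by (rule integral_mult_right_zero)
  also have "(\<integral>x. (\<integral>\<xi>. ?h x \<xi> \<partial>lborel) \<partial>lborel) = (\<integral>\<xi>. (\<integral>x. ?h x \<xi> \<partial>lborel) \<partial>lborel)"
    by (rule lborel_pair.Fubini_integral[OF I, symmetric])
  also have "\<dots> = (\<integral>\<xi>. f \<xi> * (\<integral>x. cis (x \<bullet> \<xi>) * g x \<partial>lborel) \<partial>lborel)"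
    by (simp add: inner_commute mult_ac flip: integral_mult_right_zero)
  also have "of_real (1 / (2 * pi)) * \<dots> = (\<integral>\<xi>. f \<xi> * inv_fourier g \<xi> \<partial>lborel)"
    unfolding inv_fourier_def by (subst integral_mult_right_zero[symmetric]) (simp only: mult.left_commute)
  finally show ?thesis .
qed

lemma dist_of_synth:
  assumes g: "rapid g" "hermitian g"
  shows "has_fourier (dist_of (synth g)) g"
    and "tempered (dist_of (synth g))" and "real_valued (dist_of (synth g))"
proof -
  have gi: "integrable lborel g" and [measurable]: "g \<in> borel_measurable borel"
    using rapid_integrable rapid_measurable g by auto
  have eq: "dist_of (synth g) \<phi> = (\<integral>x. inv_fourier g x * \<phi> x \<partial>lborel)" if "schwartz \<phi>" for \<phi>
    using that by (simp add: dist_of_def inv_fourier_hermitian[OF g])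
  obtain C where C: "C \<ge> 0" "\<And>\<xi>. (1 + norm \<xi>) ^ 4 * cmod (g \<xi>) \<le> C" using rapid_bound[OF g(1)] by metis
  note bnd = inv_fourier_decay_le[OF rapid_measurable[OF g(1)] C(2)]
  note meas [measurable] = inv_fourier_measurable[OF rapid_measurable[OF g(1)]]
  have I: "integrable lborel (\<lambda>x. inv_fourier g x * \<phi> x)" if "schwartz \<phi>" for \<phi>
    by (subst mult.commute, rule integrable_mult_bounded[OF schwartz_integrable[OF that] _ bnd]) simp
  show "has_fourier (dist_of (synth g)) g"
    unfolding has_fourier_def
  proof (intro conjI allI impI)
    fix \<phi> assume \<phi>: "schwartz \<phi>"
    show "integrable lborel (\<lambda>\<xi>. g \<xi> * inv_fourier \<phi> \<xi>)"
      by (rule integrable_mult_bounded[OF gi _ inv_fourier_norm_le[OF schwartz_integrable[OF \<phi>]]])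
        (use inv_fourier_measurable[OF schwartz_measurable[OF \<phi>]] in simp)
    show "dist_of (synth g) \<phi> = (\<integral>\<xi>. g \<xi> * inv_fourier \<phi> \<xi> \<partial>lborel)"
      unfolding eq[OF \<phi>] by (rule inv_fourier_duality[OF gi schwartz_integrable[OF \<phi>]])
  qed simp
  show "tempered (dist_of (synth g))"
  proof (rule temperedI[where C = "C * decay_mass * decay_mass" and N = 4])
    fix \<phi> \<psi> a b assume s: "schwartz \<phi>" "schwartz \<psi>"
    show "dist_of (synth g) (\<lambda>x. a * \<phi> x + b * \<psi> x) = a * dist_of (synth g) \<phi> + b * dist_of (synth g) \<psi>"
      unfolding eq[OF s(1)] eq[OF s(2)] eq[OF schwartz_lincomb[OF s]]
      using I[OF s(1)] I[OF s(2)] by (simp add: distrib_left mult.left_commute)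
  next
    fix \<phi> assume \<phi>: "schwartz \<phi>"
    have m: "(\<lambda>x. inv_fourier g x * \<phi> x) \<in> borel_measurable borel" using schwartz_measurable[OF \<phi>] by measurable
    have "(1 + norm x) ^ 4 * norm (inv_fourier g x * \<phi> x) \<le> (C * decay_mass) * schwartz_seminorm 4 \<phi>" for x
    proof -
      have "(1 + norm x) ^ 4 * norm (inv_fourier g x * \<phi> x) = cmod (inv_fourier g x) * ((1 + norm x) ^ 4 * cmod (\<phi> x))"
        by (simp add: norm_mult)
      also have "\<dots> \<le> (C * decay_mass) * schwartz_seminorm 4 \<phi>"
        using bnd schwartz_seminorm_ge[OF \<phi>, of "[]" 4 x] C(1) decay_mass_nonneg by (intro mult_mono) auto
      finally show ?thesis .
    qed
    from order_trans[OF integral_norm_bound integral_le_decay_mass[OF m this]]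
    show "cmod (dist_of (synth g) \<phi>) \<le> C * decay_mass * decay_mass * schwartz_seminorm 4 \<phi>"
      unfolding eq[OF \<phi>] by (simp only: mult_ac)
  qed (simp add: dist_of_def)
  show "real_valued (dist_of (synth g))"
    unfolding real_valued_def
  proof (intro allI impI)
    fix \<phi> assume \<phi>: "schwartz \<phi>"
    have "dist_of (synth g) (\<lambda>x. cnj (\<phi> x)) = (\<integral>x. cnj (of_real (synth g x) * \<phi> x) \<partial>lborel)"
      using schwartz_cnj[OF \<phi>] by (simp add: dist_of_def)
    also have "\<dots> = cnj (dist_of (synth g) \<phi>)" using \<phi> by (simp add: dist_of_def del: complex_cnj_mult)
    finally show "dist_of (synth g) (\<lambda>x. cnj (\<phi> x)) = cnj (dist_of (synth g) \<phi>)" .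
  qed
qed

lemma sobolev_weight_growth: "\<exists>N. \<forall>\<xi>. sobolev_weight \<sigma> \<xi> \<le> (1 + norm \<xi>) ^ N"
proof (intro exI allI)
  fix \<xi> :: "real^2"
  have ge1: "1 \<le> 1 + (norm \<xi>)\<^sup>2" by simp
  have "sobolev_weight \<sigma> \<xi> \<le> sobolev_weight (real (nat \<lceil>\<bar>\<sigma>\<bar>\<rceil>)) \<xi>"
    by (rule powr_mono) (use ge1 in linarith)+
  also have "\<dots> = (1 + (norm \<xi>)\<^sup>2) ^ nat \<lceil>\<bar>\<sigma>\<bar>\<rceil>" using ge1 by (intro powr_realpow) linarith
  also have "\<dots> \<le> ((1 + norm \<xi>)\<^sup>2) ^ nat \<lceil>\<bar>\<sigma>\<bar>\<rceil>" by (intro power_mono) (auto simp: power2_sum)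
  finally show "sobolev_weight \<sigma> \<xi> \<le> (1 + norm \<xi>) ^ (2 * nat \<lceil>\<bar>\<sigma>\<bar>\<rceil>)" by (simp add: power_mult)
qed

text \<open>\<open>N\<close> and \<open>K\<close> depend on \<open>\<sigma>\<close> alone, and the
  bound is linear in \<open>C\<close>. Inserting constants proportional to a time difference or its
  square then gives continuity and differentiability of curves.\<close>

lemma sobolev_decay_bound:
  "\<exists>N K. K \<ge> 0 \<and>
    (\<forall>g C. g \<in> borel_measurable borel \<longrightarrow> (\<forall>\<xi>. (1 + norm \<xi>) ^ N * cmod (g \<xi>) \<le> C) \<longrightarrow>
      integrable lborel (\<lambda>\<xi>. sobolev_weight \<sigma> \<xi> * (cmod (g \<xi>))\<^sup>2)) \<and>
    (\<forall>F g C. has_fourier F g \<longrightarrow> (\<forall>\<xi>. (1 + norm \<xi>) ^ N * cmod (g \<xi>) \<le> C) \<longrightarrow> nrm (sobolev \<sigma>) F \<le> K * C)"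
proof -
  obtain M where M: "\<And>\<xi>. sobolev_weight \<sigma> \<xi> \<le> (1 + norm \<xi>) ^ M" using sobolev_weight_growth by metis
  have key: "(1 + norm \<xi>) ^ 4 * norm (sobolev_weight \<sigma> \<xi> * (cmod (g \<xi>))\<^sup>2) \<le> C\<^sup>2"
    if "\<And>\<xi>. (1 + norm \<xi>) ^ (M + 4) * cmod (g \<xi>) \<le> C" for g :: "real^2 \<Rightarrow> complex" and C \<xi>
  proof -
    have "(1 + norm \<xi>) ^ 4 * norm (sobolev_weight \<sigma> \<xi> * (cmod (g \<xi>))\<^sup>2) = (1 + norm \<xi>) ^ 4 * (sobolev_weight \<sigma> \<xi> * (cmod (g \<xi>))\<^sup>2)"
      by simp
    also have "\<dots> \<le> (1 + norm \<xi>) ^ 4 * ((1 + norm \<xi>) ^ M * (cmod (g \<xi>))\<^sup>2)"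
      using M by (intro mult_left_mono mult_right_mono) auto
    also have "\<dots> = (1 + norm \<xi>) ^ (M + 4) * (cmod (g \<xi>))\<^sup>2" by (simp add: power_add)
    also have "\<dots> \<le> (1 + norm \<xi>) ^ ((M + 4) * 2) * (cmod (g \<xi>))\<^sup>2"
      by (intro mult_right_mono power_increasing) auto
    also have "\<dots> = ((1 + norm \<xi>) ^ (M + 4) * cmod (g \<xi>))\<^sup>2" by (simp only: power_mult power_mult_distrib)
    also have "\<dots> \<le> C\<^sup>2" using that by (intro power_mono) auto
    finally show ?thesis .
  qed
  show ?thesis
  proof (intro exI[of _ "M + 4"] exI[of _ "sqrt decay_mass"] conjI allI impI)
    fix g :: "real^2 \<Rightarrow> complex" and C
    assume [measurable]: "g \<in> borel_measurable borel" and C: "\<forall>\<xi>. (1 + norm \<xi>) ^ (M + 4) * cmod (g \<xi>) \<le> C"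
    show "integrable lborel (\<lambda>\<xi>. sobolev_weight \<sigma> \<xi> * (cmod (g \<xi>))\<^sup>2)"
      by (rule integrable_of_decay[OF _ key[OF C[rule_format]]]) measurable
  next
    fix F g C assume F: "has_fourier F g" and C: "\<forall>\<xi>. (1 + norm \<xi>) ^ (M + 4) * cmod (g \<xi>) \<le> C"
    have [measurable]: "g \<in> borel_measurable borel" by (rule has_fourier_measurable[OF F])
    have "0 \<le> C" using order_trans[OF _ C[rule_format, of 0]] by simp
    have "(\<integral>\<xi>. norm (sobolev_weight \<sigma> \<xi> * (cmod (g \<xi>))\<^sup>2) \<partial>lborel) \<le> C\<^sup>2 * decay_mass"
      by (rule integral_le_decay_mass[OF _ key[OF C[rule_format]]]) measurable
    then have "nrm (sobolev \<sigma>) F \<le> sqrt (C\<^sup>2 * decay_mass)"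
      unfolding nrm_sobolev_eq[OF F] by simp
    then show "nrm (sobolev \<sigma>) F \<le> sqrt decay_mass * C"
      using \<open>0 \<le> C\<close> by (simp add: real_sqrt_mult mult.commute)
  qed (simp add: decay_mass_nonneg)
qed

lemma dist_of_synth_sobolev:
  assumes "rapid g" "hermitian g"
  shows "dist_of (synth g) \<in> points (sobolev \<sigma>)"
proof -
  obtain N where I: "\<forall>g C. g \<in> borel_measurable borel \<longrightarrow> (\<forall>\<xi>. (1 + norm \<xi>) ^ N * cmod (g \<xi>) \<le> C) \<longrightarrow>
      integrable lborel (\<lambda>\<xi>. sobolev_weight \<sigma> \<xi> * (cmod (g \<xi>))\<^sup>2)"
    using sobolev_decay_bound[of \<sigma>] by (elim exE conjE)
  obtain C where "\<And>\<xi>. (1 + norm \<xi>) ^ N * cmod (g \<xi>) \<le> C" using rapid_bound[OF assms(1)] by metis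
  from I[rule_format, OF rapid_measurable[OF assms(1)] this] have "integrable lborel (\<lambda>\<xi>. sobolev_weight \<sigma> \<xi> * (cmod (g \<xi>))\<^sup>2)" .
  then show ?thesis
    unfolding sobolev_points_iff using dist_of_synth[OF assms] by (intro conjI exI)
qed


section \<open>Convolution\<close>

text \<open>The constant is an explicit argument, so that bounds such as
  \<open>C * \<bar>\<tau> - t\<bar>\<close> can be carried through sums, multipliers and
  convolutions.\<close>

definition decays :: "nat \<Rightarrow> (real^2 \<Rightarrow> complex) \<Rightarrow> real \<Rightarrow> bool" where
  "decays m f C \<longleftrightarrow> (\<forall>\<xi>. (1 + norm \<xi>) ^ m * cmod (f \<xi>) \<le> C)"

definition conv :: "(real^2 \<Rightarrow> complex) \<Rightarrow> (real^2 \<Rightarrow> complex) \<Rightarrow> real^2 \<Rightarrow> complex" where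
  "conv f g \<xi> = (\<integral>\<eta>. f (\<xi> - \<eta>) * g \<eta> \<partial>lborel)"

lemma decaysD: "decays m f C \<Longrightarrow> (1 + norm \<xi>) ^ m * cmod (f \<xi>) \<le> C"
  by (simp add: decays_def)

lemma decays_nonneg: "decays m f C \<Longrightarrow> 0 \<le> C"
  using order_trans[OF _ decaysD[of m f C 0]] by simp

lemma decays_mono: "decays m f C \<Longrightarrow> C \<le> D \<Longrightarrow> decays m f D"
  unfolding decays_def by (meson order_trans)

lemma decays_add:
  assumes "decays m f A" "decays m g B"
  shows "decays m (\<lambda>\<xi>. f \<xi> + g \<xi>) (A + B)"
  unfolding decays_def
proof
  fix \<xi>
  have "(1 + norm \<xi>) ^ m * cmod (f \<xi> + g \<xi>) \<le> (1 + norm \<xi>) ^ m * (cmod (f \<xi>) + cmod (g \<xi>))"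
    by (intro mult_left_mono norm_triangle_ineq) auto
  then show "(1 + norm \<xi>) ^ m * cmod (f \<xi> + g \<xi>) \<le> A + B"
    using decaysD[OF assms(1), of \<xi>] decaysD[OF assms(2), of \<xi>] by (simp add: distrib_left)
qed

lemma decays_mult:
  assumes g: "decays (k + m) g C" and p: "\<And>\<xi>. cmod (p \<xi>) \<le> K * (1 + norm \<xi>) ^ k"
  shows "decays m (\<lambda>\<xi>. p \<xi> * g \<xi>) (K * C)"
  unfolding decays_def
proof
  fix \<xi>
  have K: "K \<ge> 0" using order_trans[OF norm_ge_zero p[of 0]] by simp
  have "(1 + norm \<xi>) ^ m * cmod (p \<xi> * g \<xi>) \<le> (1 + norm \<xi>) ^ m * (K * (1 + norm \<xi>) ^ k * cmod (g \<xi>))"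
    unfolding norm_mult using p by (intro mult_left_mono mult_right_mono) auto
  also have "\<dots> = K * ((1 + norm \<xi>) ^ (k + m) * cmod (g \<xi>))" by (simp add: power_add)
  also have "\<dots> \<le> K * C" using decaysD[OF g] K by (intro mult_left_mono)
  finally show "(1 + norm \<xi>) ^ m * cmod (p \<xi> * g \<xi>) \<le> K * C" .
qed

lemma decays_cmult:
  assumes "decays m g C"
  shows "decays m (\<lambda>\<xi>. c * g \<xi>) (cmod c * C)"
  using decays_mult[of 0 m g C "\<lambda>_. c" "cmod c"] assms by simp

lemma rapid_decays: "rapid g \<longleftrightarrow> continuous_on UNIV g \<and> (\<forall>m. \<exists>C. decays m g C)"
  by (simp add: rapid_def decays_def)

lemma rapid_cmult: "rapid g \<Longrightarrow> rapid (\<lambda>\<xi>. c * g \<xi>)"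
  by (rule rapid_mult[where K = "cmod c" and k = 0]) auto

lemma rapid_diff:
  assumes "rapid f" "rapid g"
  shows "rapid (\<lambda>\<xi>. f \<xi> - g \<xi>)"
  using rapid_add[OF assms(1) rapid_cmult[OF assms(2), of "-1"]] by simp

lemma conv_measurable_pair:
  fixes f g :: "real^2 \<Rightarrow> complex"
  assumes [measurable]: "f \<in> borel_measurable borel" "g \<in> borel_measurable borel"
  shows "(\<lambda>\<eta>. f (\<xi> - \<eta>) * g \<eta>) \<in> borel_measurable borel"
  by measurable

lemma conv_integrable:
  assumes f: "rapid f" and g: "rapid g"
  shows "integrable lborel (\<lambda>\<eta>. f (\<xi> - \<eta>) * g \<eta>)"
proof -
  obtain C where "\<And>\<xi>. (1 + norm \<xi>) ^ 0 * cmod (f \<xi>) \<le> C" using rapid_bound[OF f] by metis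
  moreover have [measurable]: "f \<in> borel_measurable borel" by (rule rapid_measurable[OF f])
  have "(\<lambda>\<eta>. f (\<xi> - \<eta>)) \<in> borel_measurable lborel" by measurable
  ultimately show ?thesis
    by (subst mult.commute) (rule integrable_mult_bounded[OF rapid_integrable[OF g], where B = C], simp_all)
qed

lemma conv_diff_left: "rapid f \<Longrightarrow> rapid f' \<Longrightarrow> rapid g \<Longrightarrow> conv (\<lambda>\<xi>. f \<xi> - f' \<xi>) g \<xi> = conv f g \<xi> - conv f' g \<xi>"
  by (simp add: conv_def left_diff_distrib conv_integrable)

lemma conv_diff_right: "rapid f \<Longrightarrow> rapid g \<Longrightarrow> rapid g' \<Longrightarrow> conv f (\<lambda>\<xi>. g \<xi> - g' \<xi>) \<xi> = conv f g \<xi> - conv f g' \<xi>"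
  by (simp add: conv_def right_diff_distrib conv_integrable)

lemma conv_cmult_left: "conv (\<lambda>\<xi>. c * f \<xi>) g \<xi> = c * conv f g \<xi>"
  by (simp add: conv_def mult.assoc)

lemma conv_cmult_right: "conv f (\<lambda>\<xi>. c * g \<xi>) \<xi> = c * conv f g \<xi>"
  by (simp add: conv_def mult.left_commute)

text \<open>The weight is submultiplicative, \<open>1 + norm \<xi> \<le> (1 + norm (\<xi> - \<eta>))
  * (1 + norm \<eta>)\<close>, so each factor carries its own share. The second factor pays the four
  extra powers for the integral over \<open>\<eta>\<close>.\<close>

lemma decays_conv:
  assumes f: "f \<in> borel_measurable borel" "decays m f A"
    and g: "g \<in> borel_measurable borel" "decays (m + 4) g B"
  shows "decays m (conv f g) (A * B * decay_mass)"
  unfolding decays_def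
proof
  fix \<xi> :: "real^2"
  have AB: "0 \<le> A" "0 \<le> B" using f g by (auto intro: decays_nonneg)
  have m: "(\<lambda>\<eta>. f (\<xi> - \<eta>) * g \<eta>) \<in> borel_measurable borel" by (rule conv_measurable_pair[OF f(1) g(1)])
  have "(1 + norm \<eta>) ^ 4 * norm (of_real ((1 + norm \<xi>) ^ m) * (f (\<xi> - \<eta>) * g \<eta>)) \<le> A * B" for \<eta>
  proof -
    have "1 + norm \<xi> \<le> (1 + norm (\<xi> - \<eta>)) * (1 + norm \<eta>)"
    proof -
      have "norm \<xi> \<le> norm (\<xi> - \<eta>) + norm \<eta>" "0 \<le> norm (\<xi> - \<eta>) * norm \<eta>"
        using norm_triangle_sub[of \<xi> \<eta>] by simp_all
      then show ?thesis by (simp only: distrib_left distrib_right mult_1 mult_1_right)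
    qed
    then have "(1 + norm \<xi>) ^ m \<le> ((1 + norm (\<xi> - \<eta>)) * (1 + norm \<eta>)) ^ m" by (intro power_mono) auto
    then have "(1 + norm \<eta>) ^ 4 * ((1 + norm \<xi>) ^ m * (cmod (f (\<xi> - \<eta>)) * cmod (g \<eta>)))
      \<le> (1 + norm \<eta>) ^ 4 * (((1 + norm (\<xi> - \<eta>)) * (1 + norm \<eta>)) ^ m * (cmod (f (\<xi> - \<eta>)) * cmod (g \<eta>)))"
      by (intro mult_left_mono mult_right_mono) auto
    also have "\<dots> = ((1 + norm (\<xi> - \<eta>)) ^ m * cmod (f (\<xi> - \<eta>))) * ((1 + norm \<eta>) ^ (m + 4) * cmod (g \<eta>))"
      by (simp add: power_mult_distrib power_add)
    also have "\<dots> \<le> A * B" using decaysD[OF f(2)] decaysD[OF g(2)] AB by (intro mult_mono) auto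
    finally show ?thesis by (simp add: norm_mult abs_of_nonneg del: of_real_power of_real_add)
  qed
  from integral_le_decay_mass[OF _ this] m
  have "(\<integral>\<eta>. norm (of_real ((1 + norm \<xi>) ^ m) * (f (\<xi> - \<eta>) * g \<eta>)) \<partial>lborel) \<le> A * B * decay_mass" by simp
  moreover have "(1 + norm \<xi>) ^ m * cmod (conv f g \<xi>) = cmod (\<integral>\<eta>. of_real ((1 + norm \<xi>) ^ m) * (f (\<xi> - \<eta>) * g \<eta>) \<partial>lborel)"
    unfolding conv_def integral_mult_right_zero by (simp add: norm_mult abs_of_nonneg del: of_real_power of_real_add)
  ultimately show "(1 + norm \<xi>) ^ m * cmod (conv f g \<xi>) \<le> A * B * decay_mass"
    using integral_norm_bound[of lborel "\<lambda>\<eta>. of_real ((1 + norm \<xi>) ^ m) * (f (\<xi> - \<eta>) * g \<eta>)"] by linarith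
qed

lemma continuous_on_lebesgue_integral:
  fixes k :: "'a::metric_space \<Rightarrow> 'b \<Rightarrow> 'c::{banach, second_countable_topology}"
  assumes "\<And>\<eta>. continuous_on S (\<lambda>p. k p \<eta>)" "\<And>p. p \<in> S \<Longrightarrow> k p \<in> borel_measurable M"
    and "integrable M w" "\<And>p \<eta>. p \<in> S \<Longrightarrow> norm (k p \<eta>) \<le> w \<eta>"
  shows "continuous_on S (\<lambda>p. \<integral>\<eta>. k p \<eta> \<partial>M)"
  unfolding continuous_on_sequentially
proof (intro allI ballI impI)
  fix x a assume a: "a \<in> S" and x: "(\<forall>n. x n \<in> S) \<and> x \<longlonglongrightarrow> a"
  have lim: "(\<lambda>n. k (x n) \<eta>) \<longlonglongrightarrow> k a \<eta>" for \<eta>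
    using assms(1)[of \<eta>] a x unfolding continuous_on_sequentially by (simp add: o_def)
  have "(\<lambda>n. \<integral>\<eta>. k (x n) \<eta> \<partial>M) \<longlonglongrightarrow> (\<integral>\<eta>. k a \<eta> \<partial>M)"
    by (rule integral_dominated_convergence[where w = w]) (use assms a x lim in auto)
  then show "((\<lambda>p. \<integral>\<eta>. k p \<eta> \<partial>M) \<circ> x) \<longlonglongrightarrow> (\<integral>\<eta>. k a \<eta> \<partial>M)" by (simp add: o_def)
qed

lemma rapid_conv:
  assumes f: "rapid f" and g: "rapid g"
  shows "rapid (conv f g)"
  unfolding rapid_decays
proof (intro conjI allI)
  have fm [measurable]: "f \<in> borel_measurable borel" and gm [measurable]: "g \<in> borel_measurable borel"
    using rapid_measurable f g by auto
  obtain C where C: "\<And>\<xi>. (1 + norm \<xi>) ^ 0 * cmod (f \<xi>) \<le> C" using rapid_bound[OF f] by metis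
  show "continuous_on UNIV (conv f g)"
    unfolding conv_def[abs_def]
  proof (rule continuous_on_lebesgue_integral[where w = "\<lambda>\<eta>. C * cmod (g \<eta>)"])
    show "continuous_on UNIV (\<lambda>\<xi>. f (\<xi> - \<eta>) * g \<eta>)" for \<eta>
      by (intro continuous_intros continuous_on_compose2[OF rapid_continuous[OF f]]) auto
    show "integrable lborel (\<lambda>\<eta>. C * cmod (g \<eta>))"
      by (intro integrable_mult_right integrable_norm rapid_integrable g)
    show "norm (f (\<xi> - \<eta>) * g \<eta>) \<le> C * cmod (g \<eta>)" for \<xi> \<eta>
      unfolding norm_mult using C[of "\<xi> - \<eta>"] by (intro mult_right_mono) auto
  qed simp
  fix m
  obtain A where "decays m f A" using f unfolding rapid_decays by metis
  moreover obtain B where "decays (m + 4) g B" using g unfolding rapid_decays by metis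
  ultimately show "\<exists>C. decays m (conv f g) C"
    using decays_conv[OF fm _ gm] by metis
qed

lemma hermitian_conv:
  assumes "rapid f" "rapid g" "hermitian f" "hermitian g"
  shows "hermitian (conv f g)"
  unfolding hermitian_def
proof
  fix \<xi>
  have [measurable]: "f \<in> borel_measurable borel" "g \<in> borel_measurable borel"
    using rapid_measurable assms by auto
  have "conv f g (- \<xi>) = (\<integral>\<eta>. f (- \<xi> - (- \<eta>)) * g (- \<eta>) \<partial>lborel)"
    unfolding conv_def using integral_lborel_reflect(1)[of "\<lambda>\<eta>. f (- \<xi> - \<eta>) * g \<eta>" 0] by simp
  also have "\<dots> = (\<integral>\<eta>. cnj (f (\<xi> - \<eta>) * g \<eta>) \<partial>lborel)"
  proof (rule Bochner_Integration.integral_cong)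
    fix \<eta>
    have "f (- (\<xi> - \<eta>)) = cnj (f (\<xi> - \<eta>))" "g (- \<eta>) = cnj (g \<eta>)"
      using assms(3,4) unfolding hermitian_def by blast+
    then show "f (- \<xi> - (- \<eta>)) * g (- \<eta>) = cnj (f (\<xi> - \<eta>) * g \<eta>)" by simp
  qed simp
  also have "\<dots> = cnj (conv f g \<xi>)" unfolding conv_def by (rule Bochner_Integration.integral_cnj)
  finally show "conv f g (- \<xi>) = cnj (conv f g \<xi>)" .
qed

text \<open>The factor \<open>2 * pi\<close> comes from the unitary normalisation in two dimensions.
  It is the source of every \<open>1 / (2 * pi)\<close> in front of a nonlinear term.\<close>

lemma inv_fourier_conv:
  assumes f: "rapid f" and g: "rapid g"
  shows "inv_fourier (conv f g) x = of_real (2 * pi) * inv_fourier f x * inv_fourier g x"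
proof -
  have [measurable]: "f \<in> borel_measurable borel" "g \<in> borel_measurable borel"
    using rapid_measurable f g by auto
  have fi: "integrable lborel f" and gi: "integrable lborel g" using f g by (auto intro: rapid_integrable)
  let ?h = "\<lambda>\<xi> \<eta>. cis (\<xi> \<bullet> x) * (f (\<xi> - \<eta>) * g \<eta>)"
  have shift: "(\<integral>\<xi>. F (\<xi> - \<eta>) \<partial>lborel) = (\<integral>\<xi>. F \<xi> \<partial>lborel)" "integrable lborel (\<lambda>\<xi>. F (\<xi> - \<eta>)) = integrable lborel F"
    if [measurable]: "F \<in> borel_measurable borel" for F :: "real^2 \<Rightarrow> 'b::{banach, second_countable_topology}" and \<eta>
    using integral_lborel_shift[OF that, of "- \<eta>"] by (simp_all add: algebra_simps)
  have I: "integrable (lborel \<Otimes>\<^sub>M lborel) (case_prod (\<lambda>\<eta> \<xi>. ?h \<xi> \<eta>))"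
  proof (rule lborel_pair.Fubini_integrable)
    show "case_prod (\<lambda>\<eta> \<xi>. ?h \<xi> \<eta>) \<in> borel_measurable (lborel \<Otimes>\<^sub>M lborel)" by measurable
    have "(\<integral>\<xi>. norm (?h \<xi> \<eta>) \<partial>lborel) = (\<integral>\<xi>. cmod (f \<xi>) \<partial>lborel) * cmod (g \<eta>)" for \<eta>
      using shift(1)[of "\<lambda>\<xi>. cmod (f \<xi>)" \<eta>] by (simp add: norm_mult)
    then show "integrable lborel (\<lambda>\<eta>. \<integral>\<xi>. norm (case (\<eta>, \<xi>) of (\<eta>, \<xi>) \<Rightarrow> ?h \<xi> \<eta>) \<partial>lborel)"
      using gi by simp
    have "integrable lborel (\<lambda>\<xi>. f (\<xi> - \<eta>) * g \<eta>)" for \<eta>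
      using shift(2)[of f \<eta>] fi by simp
    from integrable_cis_mult[OF this]
    show "AE \<eta> in lborel. integrable lborel (\<lambda>\<xi>. case (\<eta>, \<xi>) of (\<eta>, \<xi>) \<Rightarrow> ?h \<xi> \<eta>)" by simp
  qed
  have inner: "(\<integral>\<xi>. ?h \<xi> \<eta> \<partial>lborel) = (\<integral>\<xi>. cis (\<xi> \<bullet> x) * f \<xi> \<partial>lborel) * (cis (\<eta> \<bullet> x) * g \<eta>)" for \<eta>
  proof -
    have "(\<integral>\<xi>. ?h \<xi> \<eta> \<partial>lborel) = (\<integral>\<xi>. cis ((\<xi> - \<eta>) \<bullet> x) * f (\<xi> - \<eta>) * (cis (\<eta> \<bullet> x) * g \<eta>) \<partial>lborel)"
    proof (rule Bochner_Integration.integral_cong)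
      fix \<xi>
      have "cis (\<xi> \<bullet> x) = cis ((\<xi> - \<eta>) \<bullet> x) * cis (\<eta> \<bullet> x)" by (simp add: cis_mult inner_diff_left)
      then show "?h \<xi> \<eta> = cis ((\<xi> - \<eta>) \<bullet> x) * f (\<xi> - \<eta>) * (cis (\<eta> \<bullet> x) * g \<eta>)" by simp
    qed simp
    also have "\<dots> = (\<integral>\<xi>. cis ((\<xi> - \<eta>) \<bullet> x) * f (\<xi> - \<eta>) \<partial>lborel) * (cis (\<eta> \<bullet> x) * g \<eta>)"
      by (rule integral_mult_left_zero)
    also have "(\<integral>\<xi>. cis ((\<xi> - \<eta>) \<bullet> x) * f (\<xi> - \<eta>) \<partial>lborel) = (\<integral>\<xi>. cis (\<xi> \<bullet> x) * f \<xi> \<partial>lborel)"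
      by (rule shift(1)) measurable
    finally show ?thesis .
  qed
  have "inv_fourier (conv f g) x = of_real (1 / (2 * pi)) * (\<integral>\<xi>. (\<integral>\<eta>. ?h \<xi> \<eta> \<partial>lborel) \<partial>lborel)"
    unfolding inv_fourier_def conv_def integral_mult_right_zero ..
  also have "(\<integral>\<xi>. (\<integral>\<eta>. ?h \<xi> \<eta> \<partial>lborel) \<partial>lborel) = (\<integral>\<eta>. (\<integral>\<xi>. ?h \<xi> \<eta> \<partial>lborel) \<partial>lborel)"
    by (rule lborel_pair.Fubini_integral[OF I])
  also have "\<dots> = (\<integral>\<xi>. cis (\<xi> \<bullet> x) * f \<xi> \<partial>lborel) * (\<integral>\<eta>. cis (\<eta> \<bullet> x) * g \<eta> \<partial>lborel)"
    unfolding inner by (rule integral_mult_right_zero)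
  finally show ?thesis unfolding inv_fourier_def by simp
qed


section \<open>Smooth time-dependent families of symbols\<close>

text \<open>Bounded and Lipschitz in time with respect to every decay weight. One constant serves
  both bounds for each \<open>m\<close>.\<close>

definition tame :: "real \<Rightarrow> (real \<Rightarrow> real^2 \<Rightarrow> complex) \<Rightarrow> bool" where
  "tame T a \<longleftrightarrow> (\<forall>t\<in>{0..T}. continuous_on UNIV (a t) \<and> hermitian (a t)) \<and>
    (\<forall>m. \<exists>C. (\<forall>t\<in>{0..T}. decays m (a t) C) \<and>
      (\<forall>t\<in>{0..T}. \<forall>\<tau>\<in>{0..T}. decays m (\<lambda>\<xi>. a \<tau> \<xi> - a t \<xi>) (C * \<bar>\<tau> - t\<bar>)))"

definition has_td :: "real \<Rightarrow> (real \<Rightarrow> real^2 \<Rightarrow> complex) \<Rightarrow> (real \<Rightarrow> real^2 \<Rightarrow> complex) \<Rightarrow> bool" where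
  "has_td T a b \<longleftrightarrow> (\<forall>t\<in>{0..T}. \<forall>\<xi>. ((\<lambda>\<tau>. a \<tau> \<xi>) has_vector_derivative b t \<xi>) (at t within {0..T}))"

primrec ctame :: "nat \<Rightarrow> real \<Rightarrow> (real \<Rightarrow> real^2 \<Rightarrow> complex) \<Rightarrow> bool" where
  "ctame 0 T a \<longleftrightarrow> tame T a"
| "ctame (Suc k) T a \<longleftrightarrow> tame T a \<and> (\<exists>b. ctame k T b \<and> has_td T a b)"

lemma tame_hermitian: "tame T a \<Longrightarrow> t \<in> {0..T} \<Longrightarrow> hermitian (a t)"
  and tame_continuous: "tame T a \<Longrightarrow> t \<in> {0..T} \<Longrightarrow> continuous_on UNIV (a t)"
  by (simp_all add: tame_def)

lemma tame_bound:
  assumes "tame T a"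
  shows "\<exists>C\<ge>0. (\<forall>t\<in>{0..T}. decays m (a t) C) \<and>
    (\<forall>t\<in>{0..T}. \<forall>\<tau>\<in>{0..T}. decays m (\<lambda>\<xi>. a \<tau> \<xi> - a t \<xi>) (C * \<bar>\<tau> - t\<bar>))"
proof -
  obtain C where C: "\<forall>t\<in>{0..T}. decays m (a t) C"
    "\<forall>t\<in>{0..T}. \<forall>\<tau>\<in>{0..T}. decays m (\<lambda>\<xi>. a \<tau> \<xi> - a t \<xi>) (C * \<bar>\<tau> - t\<bar>)"
    using assms unfolding tame_def by metis
  show ?thesis
  proof (intro exI[of _ "\<bar>C\<bar>"] conjI ballI)
    fix t \<tau> assume t: "t \<in> {0..T}"
    show "decays m (a t) \<bar>C\<bar>" by (rule decays_mono[OF C(1)[rule_format, OF t] abs_ge_self])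
    assume "\<tau> \<in> {0..T}"
    show "decays m (\<lambda>\<xi>. a \<tau> \<xi> - a t \<xi>) (\<bar>C\<bar> * \<bar>\<tau> - t\<bar>)"
      by (rule decays_mono[OF C(2)[rule_format, OF t \<open>\<tau> \<in> _\<close>] mult_right_mono]) auto
  qed simp
qed

lemma tame_rapid:
  assumes "tame T a" "t \<in> {0..T}"
  shows "rapid (a t)"
  unfolding rapid_decays using assms tame_bound[OF assms(1)] tame_continuous by blast

lemma ctame_tame: "ctame k T a \<Longrightarrow> tame T a"
  by (cases k) auto

lemma ctame_Suc_imp: "ctame (Suc k) T a \<Longrightarrow> ctame k T a"
proof (induction k arbitrary: a)
  case (Suc k)
  then obtain b where b: "tame T a" "ctame (Suc k) T b" "has_td T a b" by auto
  from Suc.IH[OF b(2)] b show ?case by auto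
qed auto

text \<open>\<open>has_td\<close> is pointwise in \<open>\<xi>\<close>; uniformity is recovered from
  the Lipschitz bound on \<open>b\<close>. The mean value inequality for
  \<open>a \<sigma> \<xi> - \<sigma> * b t \<xi>\<close> on the segment from \<open>t\<close> to
  \<open>\<tau>\<close> has a derivative of size \<open>\<bar>\<tau> - t\<bar>\<close>.\<close>

lemma td_remainder:
  assumes ab: "has_td T a b" and b: "tame T b"
  shows "\<exists>C\<ge>0. \<forall>t\<in>{0..T}. \<forall>\<tau>\<in>{0..T}.
    decays m (\<lambda>\<xi>. a \<tau> \<xi> - a t \<xi> - of_real (\<tau> - t) * b t \<xi>) (C * (\<tau> - t)\<^sup>2)"
proof -
  obtain C where C: "C \<ge> 0" "\<forall>t\<in>{0..T}. \<forall>\<tau>\<in>{0..T}. decays m (\<lambda>\<xi>. b \<tau> \<xi> - b t \<xi>) (C * \<bar>\<tau> - t\<bar>)"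
    using tame_bound[OF b] by metis
  have "decays m (\<lambda>\<xi>. a \<tau> \<xi> - a t \<xi> - of_real (\<tau> - t) * b t \<xi>) (C * (\<tau> - t)\<^sup>2)"
    if t: "t \<in> {0..T}" and \<tau>: "\<tau> \<in> {0..T}" for t \<tau>
    unfolding decays_def
  proof
    fix \<xi> :: "real^2"
    define w where "w = (1 + norm \<xi>) ^ m"
    have w: "w > 0" unfolding w_def by (intro zero_less_power add_pos_nonneg) auto
    let ?S = "closed_segment t \<tau>"
    have S: "?S \<subseteq> {0..T}" using t \<tau> by (intro closed_segment_subset) auto
    define \<phi> where "\<phi> \<sigma> = a \<sigma> \<xi> - of_real \<sigma> * b t \<xi>" for \<sigma>
    have "norm (\<phi> \<tau> - \<phi> t) \<le> (C * \<bar>\<tau> - t\<bar> / w) * norm (\<tau> - t)"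
    proof (rule differentiable_bound[of ?S \<phi> "\<lambda>\<sigma> h. h *\<^sub>R (b \<sigma> \<xi> - b t \<xi>)"])
      fix \<sigma> assume \<sigma>: "\<sigma> \<in> ?S"
      then have \<sigma>T: "\<sigma> \<in> {0..T}" using S by auto
      have "((\<lambda>\<sigma>. a \<sigma> \<xi>) has_vector_derivative b \<sigma> \<xi>) (at \<sigma> within ?S)"
        by (rule has_vector_derivative_within_subset[OF _ S]) (use ab \<sigma>T in \<open>simp add: has_td_def\<close>)
      moreover have "((\<lambda>\<sigma>. of_real \<sigma> * b t \<xi>) has_vector_derivative b t \<xi>) (at \<sigma> within ?S)"
        by (auto intro!: derivative_eq_intros)
      ultimately show "(\<phi> has_derivative (\<lambda>h. h *\<^sub>R (b \<sigma> \<xi> - b t \<xi>))) (at \<sigma> within ?S)"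
        unfolding \<phi>_def has_vector_derivative_def[symmetric] by (rule has_vector_derivative_diff)
      have "w * cmod (b \<sigma> \<xi> - b t \<xi>) \<le> C * \<bar>\<sigma> - t\<bar>"
        using C(2) t \<sigma>T decaysD unfolding w_def by blast
      also have "\<dots> \<le> C * \<bar>\<tau> - t\<bar>"
        using \<sigma> C(1) by (intro mult_left_mono) (auto simp: closed_segment_eq_real_ivl split: if_splits)
      finally have "cmod (b \<sigma> \<xi> - b t \<xi>) \<le> C * \<bar>\<tau> - t\<bar> / w" using w by (simp add: field_simps)
      then show "onorm (\<lambda>h. h *\<^sub>R (b \<sigma> \<xi> - b t \<xi>)) \<le> C * \<bar>\<tau> - t\<bar> / w"
      proof (intro onorm_le)
        fix h :: real
        show "norm (h *\<^sub>R (b \<sigma> \<xi> - b t \<xi>)) \<le> C * \<bar>\<tau> - t\<bar> / w * norm h"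
          unfolding norm_scaleR using mult_left_mono[OF \<open>cmod _ \<le> _\<close>, of "\<bar>h\<bar>"] by (simp only: mult.commute real_norm_def abs_ge_zero)
      qed
    qed auto
    then have "w * norm (\<phi> \<tau> - \<phi> t) \<le> C * \<bar>\<tau> - t\<bar> * norm (\<tau> - t)" using w by (simp add: field_simps)
    also have "\<dots> = C * (\<tau> - t)\<^sup>2" by (simp add: power2_eq_square)
    finally show "(1 + norm \<xi>) ^ m * cmod (a \<tau> \<xi> - a t \<xi> - of_real (\<tau> - t) * b t \<xi>) \<le> C * (\<tau> - t)\<^sup>2"
      by (simp add: w_def \<phi>_def algebra_simps)
  qed
  then show ?thesis using C(1) by blast
qed

lemma has_derivative_within_quadratic_remainder:
  fixes f :: "real \<Rightarrow> 'b::real_normed_vector"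
  assumes "\<And>y. y \<in> S \<Longrightarrow> norm (f y - f x - (y - x) *\<^sub>R d) \<le> K * (y - x)\<^sup>2"
  shows "(f has_vector_derivative d) (at x within S)"
  unfolding has_vector_derivative_def has_derivative_within
proof (intro conjI bounded_linear_scaleR_left)
  show "((\<lambda>y. (1 / norm (y - x)) *\<^sub>R (f y - (f x + (y - x) *\<^sub>R d))) \<longlongrightarrow> 0) (at x within S)"
  proof (rule Lim_null_comparison)
    have "norm ((1 / norm (y - x)) *\<^sub>R (f y - (f x + (y - x) *\<^sub>R d))) \<le> K * \<bar>y - x\<bar>" if "y \<in> S" "y \<noteq> x" for y
    proof -
      have "norm ((1 / norm (y - x)) *\<^sub>R (f y - (f x + (y - x) *\<^sub>R d))) = norm (f y - f x - (y - x) *\<^sub>R d) / \<bar>y - x\<bar>"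
        by (simp add: diff_diff_eq)
      also have "\<dots> \<le> K * (y - x)\<^sup>2 / \<bar>y - x\<bar>" using assms[OF that(1)] by (intro divide_right_mono) auto
      also have "\<dots> = K * \<bar>y - x\<bar>"
        using that(2) power2_abs[of "y - x"] by (simp add: power2_eq_square field_simps)
      finally show ?thesis .
    qed
    then show "\<forall>\<^sub>F y in at x within S. norm ((1 / norm (y - x)) *\<^sub>R (f y - (f x + (y - x) *\<^sub>R d))) \<le> K * \<bar>y - x\<bar>"
      by (simp add: eventually_at_filter)
    show "((\<lambda>y. K * \<bar>y - x\<bar>) \<longlongrightarrow> 0) (at x within S)"
      by (auto intro!: tendsto_eq_intros)
  qed
qed

lemma has_td_of_remainder:
  assumes "\<And>t \<tau>. t \<in> {0..T} \<Longrightarrow> \<tau> \<in> {0..T} \<Longrightarrow>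
    decays 0 (\<lambda>\<xi>. a \<tau> \<xi> - a t \<xi> - of_real (\<tau> - t) * b t \<xi>) (C * (\<tau> - t)\<^sup>2)"
  shows "has_td T a b"
  unfolding has_td_def
proof (intro ballI allI)
  fix t \<xi> assume "t \<in> {0..T}"
  then show "((\<lambda>\<tau>. a \<tau> \<xi>) has_vector_derivative b t \<xi>) (at t within {0..T})"
    using decaysD[OF assms, of t _ \<xi>]
    by (intro has_derivative_within_quadratic_remainder[where K = C]) (simp add: scaleR_conv_of_real)
qed

lemma has_td_add: "has_td T a b \<Longrightarrow> has_td T a' b' \<Longrightarrow> has_td T (\<lambda>t \<xi>. a t \<xi> + a' t \<xi>) (\<lambda>t \<xi>. b t \<xi> + b' t \<xi>)"
  unfolding has_td_def by (intro ballI allI has_vector_derivative_add) auto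

lemma has_td_mult: "has_td T a b \<Longrightarrow> has_td T (\<lambda>t \<xi>. p \<xi> * a t \<xi>) (\<lambda>t \<xi>. p \<xi> * b t \<xi>)"
  unfolding has_td_def by (intro ballI allI has_vector_derivative_mult_right) auto

lemma tame_add:
  assumes a: "tame T a" and b: "tame T b"
  shows "tame T (\<lambda>t \<xi>. a t \<xi> + b t \<xi>)"
  unfolding tame_def
proof (intro conjI ballI allI)
  fix t assume t: "t \<in> {0..T}"
  show "continuous_on UNIV (\<lambda>\<xi>. a t \<xi> + b t \<xi>)" using a b t by (intro continuous_on_add tame_continuous)
  show "hermitian (\<lambda>\<xi>. a t \<xi> + b t \<xi>)" using tame_hermitian[OF a t] tame_hermitian[OF b t] by (simp add: hermitian_def)
next
  fix m
  obtain A where A: "\<forall>t\<in>{0..T}. decays m (a t) A" "\<forall>t\<in>{0..T}. \<forall>\<tau>\<in>{0..T}. decays m (\<lambda>\<xi>. a \<tau> \<xi> - a t \<xi>) (A * \<bar>\<tau> - t\<bar>)"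
    using tame_bound[OF a] by metis
  obtain B where B: "\<forall>t\<in>{0..T}. decays m (b t) B" "\<forall>t\<in>{0..T}. \<forall>\<tau>\<in>{0..T}. decays m (\<lambda>\<xi>. b \<tau> \<xi> - b t \<xi>) (B * \<bar>\<tau> - t\<bar>)"
    using tame_bound[OF b] by metis
  have "decays m (\<lambda>\<xi>. a t \<xi> + b t \<xi>) (A + B)" if "t \<in> {0..T}" for t
    using A B that by (intro decays_add) auto
  moreover have "decays m (\<lambda>\<xi>. a \<tau> \<xi> + b \<tau> \<xi> - (a t \<xi> + b t \<xi>)) ((A + B) * \<bar>\<tau> - t\<bar>)" if "t \<in> {0..T}" "\<tau> \<in> {0..T}" for t \<tau>
    using decays_add[OF A(2)[rule_format, OF that] B(2)[rule_format, OF that]]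
    by (simp add: distrib_right add_diff_add)
  ultimately show "\<exists>C. (\<forall>t\<in>{0..T}. decays m (\<lambda>\<xi>. a t \<xi> + b t \<xi>) C) \<and>
    (\<forall>t\<in>{0..T}. \<forall>\<tau>\<in>{0..T}. decays m (\<lambda>\<xi>. a \<tau> \<xi> + b \<tau> \<xi> - (a t \<xi> + b t \<xi>)) (C * \<bar>\<tau> - t\<bar>))" by blast
qed

definition multiplier :: "(real^2 \<Rightarrow> complex) \<Rightarrow> bool" where
  "multiplier p \<longleftrightarrow> continuous_on UNIV p \<and> hermitian p \<and> (\<exists>K k. \<forall>\<xi>. cmod (p \<xi>) \<le> K * (1 + norm \<xi>) ^ k)"

lemma tame_mult:
  assumes p: "multiplier p" and a: "tame T a"
  shows "tame T (\<lambda>t \<xi>. p \<xi> * a t \<xi>)"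
  unfolding tame_def
proof (intro conjI ballI allI)
  fix t assume t: "t \<in> {0..T}"
  show "continuous_on UNIV (\<lambda>\<xi>. p \<xi> * a t \<xi>)"
    using p tame_continuous[OF a t] by (intro continuous_on_mult) (auto simp: multiplier_def)
  show "hermitian (\<lambda>\<xi>. p \<xi> * a t \<xi>)" using tame_hermitian[OF a t] p by (simp add: hermitian_def multiplier_def)
next
  fix m
  obtain K k where K: "\<And>\<xi>. cmod (p \<xi>) \<le> K * (1 + norm \<xi>) ^ k" using p unfolding multiplier_def by metis
  obtain A where A: "\<forall>t\<in>{0..T}. decays (k + m) (a t) A" "\<forall>t\<in>{0..T}. \<forall>\<tau>\<in>{0..T}. decays (k + m) (\<lambda>\<xi>. a \<tau> \<xi> - a t \<xi>) (A * \<bar>\<tau> - t\<bar>)"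
    using tame_bound[OF a] by metis
  have "decays m (\<lambda>\<xi>. p \<xi> * a t \<xi>) (K * A)" if "t \<in> {0..T}" for t
    using A that by (intro decays_mult[OF _ K]) auto
  moreover have "decays m (\<lambda>\<xi>. p \<xi> * a \<tau> \<xi> - p \<xi> * a t \<xi>) (K * A * \<bar>\<tau> - t\<bar>)" if "t \<in> {0..T}" "\<tau> \<in> {0..T}" for t \<tau>
    using decays_mult[OF A(2)[rule_format, OF that] K] by (simp add: right_diff_distrib mult.assoc)
  ultimately show "\<exists>C. (\<forall>t\<in>{0..T}. decays m (\<lambda>\<xi>. p \<xi> * a t \<xi>) C) \<and>
    (\<forall>t\<in>{0..T}. \<forall>\<tau>\<in>{0..T}. decays m (\<lambda>\<xi>. p \<xi> * a \<tau> \<xi> - p \<xi> * a t \<xi>) (C * \<bar>\<tau> - t\<bar>))" by blast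
qed

lemma tame_conv:
  assumes a: "tame T a" and b: "tame T b"
  shows "tame T (\<lambda>t. conv (a t) (b t))"
  unfolding tame_def
proof (intro conjI ballI allI)
  fix t assume t: "t \<in> {0..T}"
  show "continuous_on UNIV (conv (a t) (b t))"
    by (intro rapid_continuous rapid_conv tame_rapid[OF a t] tame_rapid[OF b t])
  show "hermitian (conv (a t) (b t))"
    by (intro hermitian_conv tame_rapid[OF a t] tame_rapid[OF b t] tame_hermitian[OF a t] tame_hermitian[OF b t])
next
  fix m
  note ra = tame_rapid[OF a] and rb = tame_rapid[OF b]
  note ma = rapid_measurable[OF ra] and mb = rapid_measurable[OF rb]
  obtain A where A: "A \<ge> 0" "\<forall>t\<in>{0..T}. decays m (a t) A" "\<forall>t\<in>{0..T}. \<forall>\<tau>\<in>{0..T}. decays m (\<lambda>\<xi>. a \<tau> \<xi> - a t \<xi>) (A * \<bar>\<tau> - t\<bar>)"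
    using tame_bound[OF a] by metis
  obtain B where B: "B \<ge> 0" "\<forall>t\<in>{0..T}. decays (m + 4) (b t) B" "\<forall>t\<in>{0..T}. \<forall>\<tau>\<in>{0..T}. decays (m + 4) (\<lambda>\<xi>. b \<tau> \<xi> - b t \<xi>) (B * \<bar>\<tau> - t\<bar>)"
    using tame_bound[OF b] by metis
  define C where "C = A * B * decay_mass"
  have C: "C \<ge> 0" using A B decay_mass_nonneg by (simp add: C_def)
  have "decays m (conv (a t) (b t)) (2 * C)" if t: "t \<in> {0..T}" for t
  proof (rule decays_mono)
    show "decays m (conv (a t) (b t)) C"
      unfolding C_def by (rule decays_conv[OF ma[OF t] A(2)[rule_format, OF t] mb[OF t] B(2)[rule_format, OF t]])
  qed (use C in simp)
  moreover have "decays m (\<lambda>\<xi>. conv (a \<tau>) (b \<tau>) \<xi> - conv (a t) (b t) \<xi>) (2 * C * \<bar>\<tau> - t\<bar>)" if t: "t \<in> {0..T}" "\<tau> \<in> {0..T}" for t \<tau>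
  proof -
    have eq: "conv (a \<tau>) (b \<tau>) \<xi> - conv (a t) (b t) \<xi> = conv (\<lambda>\<xi>. a \<tau> \<xi> - a t \<xi>) (b \<tau>) \<xi> + conv (a t) (\<lambda>\<xi>. b \<tau> \<xi> - b t \<xi>) \<xi>" for \<xi>
      using ra rb t by (simp add: conv_diff_left conv_diff_right)
    have "decays m (\<lambda>\<xi>. conv (\<lambda>\<xi>. a \<tau> \<xi> - a t \<xi>) (b \<tau>) \<xi> + conv (a t) (\<lambda>\<xi>. b \<tau> \<xi> - b t \<xi>) \<xi>)
      (A * \<bar>\<tau> - t\<bar> * B * decay_mass + A * (B * \<bar>\<tau> - t\<bar>) * decay_mass)"
      by (intro decays_add decays_conv rapid_measurable rapid_diff ra rb t A(2)[rule_format] A(3)[rule_format] B(2)[rule_format] B(3)[rule_format])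
    then show ?thesis unfolding eq C_def by (simp add: algebra_simps)
  qed
  ultimately show "\<exists>C. (\<forall>t\<in>{0..T}. decays m (conv (a t) (b t)) C) \<and>
    (\<forall>t\<in>{0..T}. \<forall>\<tau>\<in>{0..T}. decays m (\<lambda>\<xi>. conv (a \<tau>) (b \<tau>) \<xi> - conv (a t) (b t) \<xi>) (C * \<bar>\<tau> - t\<bar>))" by blast
qed

text \<open>In the product rule the remainder splits into three convolutions. The outer ones contain
  the quadratic remainders of \<open>a\<close> and \<open>b\<close>; the mixed one is quadratic
  because \<open>\<tau> - t\<close> multiplies a Lipschitz difference of \<open>b\<close>.\<close>

lemma has_td_conv:
  assumes a: "tame T a" "tame T a'" "has_td T a a'" and b: "tame T b" "tame T b'" "has_td T b b'"
  shows "has_td T (\<lambda>t. conv (a t) (b t)) (\<lambda>t \<xi>. conv (a' t) (b t) \<xi> + conv (a t) (b' t) \<xi>)"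
proof -
  note ra = tame_rapid[OF a(1)] and rb = tame_rapid[OF b(1)] and ra' = tame_rapid[OF a(2)] and rb' = tame_rapid[OF b(2)]
  note ma = rapid_measurable[OF ra] and mb = rapid_measurable[OF rb]
  obtain A where A: "\<forall>t\<in>{0..T}. decays 0 (a t) A" using tame_bound[OF a(1)] by metis
  obtain A' where A': "\<forall>t\<in>{0..T}. decays 0 (a' t) A'" using tame_bound[OF a(2)] by metis
  obtain B where B: "\<forall>t\<in>{0..T}. decays (0 + 4) (b t) B" "\<forall>t\<in>{0..T}. \<forall>\<tau>\<in>{0..T}. decays (0 + 4) (\<lambda>\<xi>. b \<tau> \<xi> - b t \<xi>) (B * \<bar>\<tau> - t\<bar>)"
    using tame_bound[OF b(1)] by metis
  obtain R where R: "\<forall>t\<in>{0..T}. \<forall>\<tau>\<in>{0..T}. decays 0 (\<lambda>\<xi>. a \<tau> \<xi> - a t \<xi> - of_real (\<tau> - t) * a' t \<xi>) (R * (\<tau> - t)\<^sup>2)"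
    using td_remainder[OF a(3,2)] by metis
  obtain S where S: "\<forall>t\<in>{0..T}. \<forall>\<tau>\<in>{0..T}. decays (0 + 4) (\<lambda>\<xi>. b \<tau> \<xi> - b t \<xi> - of_real (\<tau> - t) * b' t \<xi>) (S * (\<tau> - t)\<^sup>2)"
    using td_remainder[OF b(3,2)] by metis
  show ?thesis
  proof (rule has_td_of_remainder)
    fix t \<tau> assume t: "t \<in> {0..T}" "\<tau> \<in> {0..T}"
    have eq: "conv (a \<tau>) (b \<tau>) \<xi> - conv (a t) (b t) \<xi> - of_real (\<tau> - t) * (conv (a' t) (b t) \<xi> + conv (a t) (b' t) \<xi>)
      = conv (\<lambda>\<xi>. a \<tau> \<xi> - a t \<xi> - of_real (\<tau> - t) * a' t \<xi>) (b \<tau>) \<xi>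
        + of_real (\<tau> - t) * conv (a' t) (\<lambda>\<xi>. b \<tau> \<xi> - b t \<xi>) \<xi>
        + conv (a t) (\<lambda>\<xi>. b \<tau> \<xi> - b t \<xi> - of_real (\<tau> - t) * b' t \<xi>) \<xi>" for \<xi>
      using t by (simp only: conv_diff_left conv_diff_right conv_cmult_left conv_cmult_right ra rb ra' rb' rapid_diff rapid_cmult)
        (simp add: algebra_simps)
    have "decays 0 (\<lambda>\<xi>. conv (\<lambda>\<xi>. a \<tau> \<xi> - a t \<xi> - of_real (\<tau> - t) * a' t \<xi>) (b \<tau>) \<xi>
        + of_real (\<tau> - t) * conv (a' t) (\<lambda>\<xi>. b \<tau> \<xi> - b t \<xi>) \<xi>
        + conv (a t) (\<lambda>\<xi>. b \<tau> \<xi> - b t \<xi> - of_real (\<tau> - t) * b' t \<xi>) \<xi>)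
      (R * (\<tau> - t)\<^sup>2 * B * decay_mass + cmod (of_real (\<tau> - t)) * (A' * (B * \<bar>\<tau> - t\<bar>) * decay_mass) + A * (S * (\<tau> - t)\<^sup>2) * decay_mass)"
      by (intro decays_add decays_cmult decays_conv rapid_measurable rapid_diff rapid_cmult ra rb ra' rb' t
          A[rule_format] A'[rule_format] B(1)[rule_format] B(2)[rule_format] R[rule_format] S[rule_format])
    moreover have "R * (\<tau> - t)\<^sup>2 * B * decay_mass + cmod (of_real (\<tau> - t)) * (A' * (B * \<bar>\<tau> - t\<bar>) * decay_mass) + A * (S * (\<tau> - t)\<^sup>2) * decay_mass
      = ((R * B + A' * B + A * S) * decay_mass) * (\<tau> - t)\<^sup>2"
    proof -
      have "cmod (of_real (\<tau> - t)) * \<bar>\<tau> - t\<bar> = (\<tau> - t)\<^sup>2" by (simp add: norm_of_real power2_eq_square del: of_real_diff)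
      then have "cmod (of_real (\<tau> - t)) * (A' * (B * \<bar>\<tau> - t\<bar>) * decay_mass) = A' * B * decay_mass * (\<tau> - t)\<^sup>2"
        by (metis (no_types, opaque_lifting) mult.assoc mult.commute mult.left_commute)
      then show ?thesis by (simp add: algebra_simps)
    qed
    ultimately show "decays 0 (\<lambda>\<xi>. conv (a \<tau>) (b \<tau>) \<xi> - conv (a t) (b t) \<xi> - of_real (\<tau> - t) * (conv (a' t) (b t) \<xi> + conv (a t) (b' t) \<xi>))
      (((R * B + A' * B + A * S) * decay_mass) * (\<tau> - t)\<^sup>2)" unfolding eq by (simp only:)
  qed
qed

lemma ctame_add:
  assumes "ctame k T a" "ctame k T b"
  shows "ctame k T (\<lambda>t \<xi>. a t \<xi> + b t \<xi>)"
  using assms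
proof (induction k arbitrary: a b)
  case (Suc k)
  then obtain a' b' where "ctame k T a'" "has_td T a a'" "ctame k T b'" "has_td T b b'" by auto
  with Suc.IH[of a' b'] has_td_add[of T a a' b b'] tame_add[of T a b] Suc.prems show ?case by auto
qed (simp add: tame_add)

lemma ctame_mult:
  assumes "multiplier p" "ctame k T a"
  shows "ctame k T (\<lambda>t \<xi>. p \<xi> * a t \<xi>)"
  using assms(2)
proof (induction k arbitrary: a)
  case (Suc k)
  then obtain a' where "ctame k T a'" "has_td T a a'" by auto
  with Suc.IH[of a'] has_td_mult[of T a a' p] tame_mult[OF assms(1), of T a] Suc.prems show ?case by auto
qed (simp add: tame_mult[OF assms(1)])

lemma ctame_conv:
  assumes "ctame k T a" "ctame k T b"
  shows "ctame k T (\<lambda>t. conv (a t) (b t))"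
  using assms
proof (induction k arbitrary: a b)
  case (Suc k)
  then obtain a' b' where *: "ctame k T a'" "has_td T a a'" "ctame k T b'" "has_td T b b'" by auto
  have ab: "tame T a" "tame T b" "ctame k T a" "ctame k T b"
    using Suc.prems ctame_Suc_imp by (auto intro: ctame_tame)
  have "ctame k T (\<lambda>t \<xi>. conv (a' t) (b t) \<xi> + conv (a t) (b' t) \<xi>)"
    by (intro ctame_add Suc.IH * ab)
  moreover have "has_td T (\<lambda>t. conv (a t) (b t)) (\<lambda>t \<xi>. conv (a' t) (b t) \<xi> + conv (a t) (b' t) \<xi>)"
    by (intro has_td_conv ab * ctame_tame[OF *(1)] ctame_tame[OF *(3)])
  ultimately show ?case using tame_conv[OF ab(1,2)] by auto
qed (simp add: tame_conv)

section \<open>From families of symbols to curves in every Sobolev space\<close>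

lemma has_fourier_diff:
  assumes "has_fourier F f" "has_fourier G g"
  shows "has_fourier (F - G) (\<lambda>\<xi>. f \<xi> - g \<xi>)"
  using has_fourier_add[OF assms(1) has_fourier_scale[OF assms(2), of "-1"]] by simp

lemma tame_curve:
  assumes a: "tame T a"
  shows "curve_of T (\<lambda>t. synth (a t)) \<in> points (C_space T (sobolev \<sigma>))"
proof -
  note ra = tame_rapid[OF a] and ha = tame_hermitian[OF a]
  obtain N K where K: "K \<ge> 0" "\<forall>F g C. has_fourier F g \<longrightarrow> (\<forall>\<xi>. (1 + norm \<xi>) ^ N * cmod (g \<xi>) \<le> C) \<longrightarrow> nrm (sobolev \<sigma>) F \<le> K * C"
    using sobolev_decay_bound[of \<sigma>] by (elim exE conjE)
  obtain C where C: "\<forall>t\<in>{0..T}. \<forall>\<tau>\<in>{0..T}. decays N (\<lambda>\<xi>. a \<tau> \<xi> - a t \<xi>) (C * \<bar>\<tau> - t\<bar>)"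
    using tame_bound[OF a] by metis
  let ?F = "curve_of T (\<lambda>t. synth (a t))"
  have F: "has_fourier (?F t) (a t)" if "t \<in> {0..T}" for t
    using dist_of_synth(1)[OF ra ha] that by (simp add: curve_of_def)
  have lip: "nrm (sobolev \<sigma>) (?F \<tau> - ?F t) \<le> K * (C * \<bar>\<tau> - t\<bar>)" if t: "t \<in> {0..T}" "\<tau> \<in> {0..T}" for t \<tau>
    by (rule K(2)[rule_format, OF has_fourier_diff[OF F[OF t(2)] F[OF t(1)]]])
      (use C t in \<open>simp add: decays_def\<close>)
  have "((\<lambda>\<tau>. nrm (sobolev \<sigma>) (?F \<tau> - ?F t)) \<longlongrightarrow> 0) (at t within {0..T})" if t: "t \<in> {0..T}" for t
  proof (rule Lim_null_comparison)
    show "((\<lambda>\<tau>. K * (C * \<bar>\<tau> - t\<bar>)) \<longlongrightarrow> 0) (at t within {0..T})"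
      by (auto intro!: tendsto_eq_intros)
    have nn: "0 \<le> nrm (sobolev \<sigma>) G" for G by (simp add: sobolev_def)
    show "\<forall>\<^sub>F \<tau> in at t within {0..T}. norm (nrm (sobolev \<sigma>) (?F \<tau> - ?F t)) \<le> K * (C * \<bar>\<tau> - t\<bar>)"
      using lip[OF t] nn by (simp add: eventually_at_filter)
  qed
  moreover have "?F t \<in> points (sobolev \<sigma>)" if "t \<in> {0..T}" for t
    using dist_of_synth_sobolev[OF ra ha] that by (simp add: curve_of_def)
  moreover have "?F t = 0" if "t \<notin> {0..T}" for t
    using that by (simp add: curve_of_def del: atLeastAtMost_iff)
  ultimately show ?thesis by (simp add: C_space_def)
qed

text \<open>The quadratic remainder divided by \<open>\<tau> - t\<close> is still of first order, in
  a decay weight strong enough for the norm of order \<open>\<sigma>\<close>.\<close>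

lemma has_td_curve_derivative:
  assumes a: "tame T a" and b: "tame T b" and ab: "has_td T a b"
  shows "has_curve_derivative T (sobolev \<sigma>) (curve_of T (\<lambda>t. synth (a t))) (curve_of T (\<lambda>t. synth (b t)))"
  unfolding has_curve_derivative_def
proof
  fix t assume t: "t \<in> {0..T}"
  obtain N K where K: "K \<ge> 0" "\<forall>F g C. has_fourier F g \<longrightarrow> (\<forall>\<xi>. (1 + norm \<xi>) ^ N * cmod (g \<xi>) \<le> C) \<longrightarrow> nrm (sobolev \<sigma>) F \<le> K * C"
    using sobolev_decay_bound[of \<sigma>] by (elim exE conjE)
  obtain C where C: "\<forall>t\<in>{0..T}. \<forall>\<tau>\<in>{0..T}. decays N (\<lambda>\<xi>. a \<tau> \<xi> - a t \<xi> - of_real (\<tau> - t) * b t \<xi>) (C * (\<tau> - t)\<^sup>2)"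
    using td_remainder[OF ab b] by metis
  let ?F = "curve_of T (\<lambda>t. synth (a t))" and ?G = "curve_of T (\<lambda>t. synth (b t))"
  have F: "has_fourier (?F t) (a t)" if "t \<in> {0..T}" for t
    using dist_of_synth(1)[OF tame_rapid[OF a] tame_hermitian[OF a]] that by (simp add: curve_of_def)
  have G: "has_fourier (?G t) (b t)"
    using dist_of_synth(1)[OF tame_rapid[OF b t] tame_hermitian[OF b t]] t by (simp add: curve_of_def)
  have lip: "nrm (sobolev \<sigma>) ((1 / (\<tau> - t)) *\<^sub>R (?F \<tau> - ?F t) - ?G t) \<le> K * (C * \<bar>\<tau> - t\<bar>)"
    if \<tau>: "\<tau> \<in> {0..T}" "\<tau> \<noteq> t" for \<tau>
  proof (rule K(2)[rule_format, OF has_fourier_diff[OF has_fourier_scale[OF has_fourier_diff[OF F[OF \<tau>(1)] F[OF t]]] G]])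
    fix \<xi>
    have "(1 / (\<tau> - t)) *\<^sub>R (a \<tau> \<xi> - a t \<xi>) - b t \<xi> = (1 / (\<tau> - t)) *\<^sub>R (a \<tau> \<xi> - a t \<xi> - of_real (\<tau> - t) * b t \<xi>)"
      using \<tau>(2) by (simp add: scaleR_diff_right scaleR_conv_of_real[of _ "_ * _"] del: of_real_diff)
    then have "(1 + norm \<xi>) ^ N * cmod ((1 / (\<tau> - t)) *\<^sub>R (a \<tau> \<xi> - a t \<xi>) - b t \<xi>)
      = (1 / \<bar>\<tau> - t\<bar>) * ((1 + norm \<xi>) ^ N * cmod (a \<tau> \<xi> - a t \<xi> - of_real (\<tau> - t) * b t \<xi>))"
      by simp
    also have "\<dots> \<le> (1 / \<bar>\<tau> - t\<bar>) * (C * (\<tau> - t)\<^sup>2)"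
      using C t \<tau> by (intro mult_left_mono decaysD) auto
    also have "\<dots> = (1 / \<bar>\<tau> - t\<bar>) * (C * (\<bar>\<tau> - t\<bar> * \<bar>\<tau> - t\<bar>))" by (simp only: power2_eq_square abs_mult_self_eq)
    also have "\<dots> = C * \<bar>\<tau> - t\<bar>"
    proof -
      have *: "(1 / x) * (C * (x * x)) = C * x" if "x \<noteq> 0" for x :: real using that by simp
      show ?thesis by (rule *) (use \<tau>(2) in simp)
    qed
    finally show "(1 + norm \<xi>) ^ N * cmod ((1 / (\<tau> - t)) *\<^sub>R (a \<tau> \<xi> - a t \<xi>) - b t \<xi>) \<le> C * \<bar>\<tau> - t\<bar>" .
  qed
  show "((\<lambda>\<tau>. nrm (sobolev \<sigma>) ((1 / (\<tau> - t)) *\<^sub>R (?F \<tau> - ?F t) - ?G t)) \<longlongrightarrow> 0) (at t within {0..T})"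
  proof (rule Lim_null_comparison)
    show "((\<lambda>\<tau>. K * (C * \<bar>\<tau> - t\<bar>)) \<longlongrightarrow> 0) (at t within {0..T})"
      by (auto intro!: tendsto_eq_intros)
    have nn: "0 \<le> nrm (sobolev \<sigma>) G" for G by (simp add: sobolev_def)
    show "\<forall>\<^sub>F \<tau> in at t within {0..T}. norm (nrm (sobolev \<sigma>) ((1 / (\<tau> - t)) *\<^sub>R (?F \<tau> - ?F t) - ?G t)) \<le> K * (C * \<bar>\<tau> - t\<bar>)"
      using lip nn by (simp add: eventually_at_filter)
  qed
qed

lemma ctame_curve:
  assumes "ctame k T a"
  shows "curve_of T (\<lambda>t. synth (a t)) \<in> points (Ck_space k T (sobolev \<sigma>))"
  using assms
proof (induction k arbitrary: a)
  case (Suc k)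
  then obtain b where b: "tame T a" "ctame k T b" "has_td T a b" by auto
  from has_td_curve_derivative[OF b(1) ctame_tame[OF b(2)] b(3)] Suc.IH[OF b(2)] tame_curve[OF b(1)]
  show ?case by auto
qed (simp add: tame_curve)

lemma has_td_synth_derivative:
  assumes a: "tame T a" and b: "tame T b" and ab: "has_td T a b" and t: "t \<in> {0..T}"
  shows "((\<lambda>\<tau>. synth (a \<tau>) x) has_real_derivative synth (b t) x) (at t within {0..T})"
proof -
  obtain C where C: "\<forall>t\<in>{0..T}. \<forall>\<tau>\<in>{0..T}. decays 4 (\<lambda>\<xi>. a \<tau> \<xi> - a t \<xi> - of_real (\<tau> - t) * b t \<xi>) (C * (\<tau> - t)\<^sup>2)"
    using td_remainder[OF ab b] by metis
  note ra = tame_rapid[OF a] and rb = tame_rapid[OF b]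
  have "((\<lambda>\<tau>. synth (a \<tau>) x) has_vector_derivative synth (b t) x) (at t within {0..T})"
  proof (rule has_derivative_within_quadratic_remainder)
    fix \<tau> assume \<tau>: "\<tau> \<in> {0..T}"
    let ?r = "\<lambda>\<xi>. a \<tau> \<xi> - a t \<xi> - of_real (\<tau> - t) * b t \<xi>"
    have r: "rapid ?r" using t \<tau> by (intro rapid_diff rapid_cmult ra rb)
    have "inv_fourier ?r x = inv_fourier (a \<tau>) x - inv_fourier (a t) x - of_real (\<tau> - t) * inv_fourier (b t) x"
      using t \<tau> by (simp add: inv_fourier_diff inv_fourier_cmult rapid_integrable rapid_diff rapid_cmult ra rb del: of_real_diff)
    then have "synth (a \<tau>) x - synth (a t) x - (\<tau> - t) *\<^sub>R synth (b t) x = Re (inv_fourier ?r x)"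
      by (simp add: synth_def del: of_real_diff)
    also have "\<bar>\<dots>\<bar> \<le> cmod (inv_fourier ?r x)" by (rule abs_Re_le_cmod)
    also have "\<dots> \<le> C * (\<tau> - t)\<^sup>2 * decay_mass"
      using C t \<tau> by (intro inv_fourier_decay_le rapid_measurable r decaysD) auto
    finally show "norm (synth (a \<tau>) x - synth (a t) x - (\<tau> - t) *\<^sub>R synth (b t) x) \<le> (C * decay_mass) * (\<tau> - t)\<^sup>2"
      by (simp add: mult_ac)
  qed
  then show ?thesis by (simp add: has_real_derivative_iff_has_vector_derivative)
qed


section \<open>Oscillating Duhamel integrals\<close>

text \<open>For \<open>k = sin\<close> and \<open>\<omega> \<noteq> 0\<close>, dividing by
  \<open>\<omega>\<close> gives the solution of the oscillator of frequency \<open>\<omega>\<close>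
  with forcing \<open>h\<close> and zero initial values. The case \<open>k = cos\<close> supplies
  its time derivative.\<close>

definition osc :: "(real \<Rightarrow> real) \<Rightarrow> real \<Rightarrow> (real \<Rightarrow> complex) \<Rightarrow> real \<Rightarrow> complex" where
  "osc k \<omega> h t = integral {0..t} (\<lambda>\<tau>. of_real (k (\<omega> * (t - \<tau>))) * h \<tau>)"

lemma osc_0: "osc k \<omega> h 0 = 0"
  by (simp add: osc_def)

lemma osc_bound:
  assumes "continuous_on UNIV k" "\<And>x. \<bar>k x\<bar> \<le> 1" "continuous_on {0..T} h" "\<And>\<tau>. \<tau> \<in> {0..T} \<Longrightarrow> cmod (h \<tau>) \<le> B"
    and t: "t \<in> {0..T}"
  shows "cmod (osc k \<omega> h t) \<le> B * T"
proof -
  have "0 \<le> B" using order_trans[OF norm_ge_zero assms(4)[OF t]] .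
  have "cmod (osc k \<omega> h t) \<le> B * (t - 0)"
    unfolding osc_def
  proof (rule integral_bound)
    show "continuous_on {0..t} (\<lambda>\<tau>. of_real (k (\<omega> * (t - \<tau>))) * h \<tau>)"
      using t by (intro continuous_intros continuous_on_compose2[OF assms(1)] continuous_on_subset[OF assms(3)]) auto
    fix \<tau> assume "\<tau> \<in> {0..t}"
    then have "cmod (h \<tau>) \<le> B" using t assms(4) by simp
    then have "\<bar>k (\<omega> * (t - \<tau>))\<bar> * cmod (h \<tau>) \<le> 1 * B" using assms(2) by (intro mult_mono) auto
    then show "cmod (of_real (k (\<omega> * (t - \<tau>))) * h \<tau>) \<le> B" by (simp add: norm_mult)
  qed (use t in simp)
  also have "\<dots> \<le> B * T" using t \<open>0 \<le> B\<close> by (intro mult_left_mono) auto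
  finally show ?thesis .
qed

lemma osc_integrable:
  fixes k :: "real \<Rightarrow> real"
  assumes "continuous_on UNIV k" "continuous_on {0..T} h" "t \<in> {0..T}"
  shows "(\<lambda>\<tau>. of_real (k (\<omega> * (t - \<tau>))) * h \<tau> :: complex) integrable_on {0..t}"
proof (rule integrable_continuous_real)
  show "continuous_on {0..t} (\<lambda>\<tau>. complex_of_real (k (\<omega> * (t - \<tau>))) * h \<tau>)"
    using assms(3) by (intro continuous_intros continuous_on_compose2[OF assms(1)] continuous_on_subset[OF assms(2)]) auto
qed

lemma osc_diff:
  assumes "continuous_on UNIV k" "continuous_on {0..T} h" "continuous_on {0..T} h'" "t \<in> {0..T}"
  shows "osc k \<omega> (\<lambda>\<tau>. h \<tau> - h' \<tau>) t = osc k \<omega> h t - osc k \<omega> h' t"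
  unfolding osc_def right_diff_distrib[of "complex_of_real _"]
  by (rule Henstock_Kurzweil_Integration.integral_diff) (rule osc_integrable[OF assms(1,2,4)] osc_integrable[OF assms(1,3,4)])+

lemma osc_cmult: "osc k \<omega> (\<lambda>\<tau>. c * h \<tau>) t = c * osc k \<omega> h t"
  unfolding osc_def by (simp add: mult.left_commute[of _ c])

lemma osc_cnj: "cnj (osc k \<omega> h t) = osc k \<omega> (\<lambda>\<tau>. cnj (h \<tau>)) t"
  unfolding osc_def by (simp add: Henstock_Kurzweil_Integration.integral_cnj)

lemma osc_cong: "(\<And>\<tau>. \<tau> \<in> {0..t} \<Longrightarrow> h \<tau> = h' \<tau>) \<Longrightarrow> osc k \<omega> h t = osc k \<omega> h' t"
  unfolding osc_def by (intro Henstock_Kurzweil_Integration.integral_cong) auto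

text \<open>The variable \<open>t\<close> occurs both as limit and inside the integrand. The
  addition formulas pull it out of the integrand, after which the fundamental theorem and the
  product rule apply.\<close>

lemma osc_derivative:
  assumes h: "continuous_on {0..T} h" and t: "t \<in> {0..T}"
  shows "(osc sin \<omega> h has_vector_derivative of_real \<omega> * osc cos \<omega> h t) (at t within {0..T})"
    and "(osc cos \<omega> h has_vector_derivative h t - of_real \<omega> * osc sin \<omega> h t) (at t within {0..T})"
proof -
  \<comment> \<open>\<open>S\<close> and \<open>C\<close> are named after the outer factor that
    accompanies them in the expansion of \<open>osc sin\<close>, hence the opposite function under
    the integral.\<close>
  define S where "S t = integral {0..t} (\<lambda>\<tau>. of_real (cos (\<omega> * \<tau>)) * h \<tau>)" for t
  define C where "C t = integral {0..t} (\<lambda>\<tau>. of_real (sin (\<omega> * \<tau>)) * h \<tau>)" for t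
  have cS: "continuous_on {0..T} (\<lambda>\<tau>. of_real (cos (\<omega> * \<tau>)) * h \<tau>)"
    and cC: "continuous_on {0..T} (\<lambda>\<tau>. of_real (sin (\<omega> * \<tau>)) * h \<tau>)"
    by (intro continuous_intros h)+
  have dS: "(S has_vector_derivative of_real (cos (\<omega> * t)) * h t) (at t within {0..T})"
    unfolding S_def[abs_def] by (rule integral_has_vector_derivative[OF cS t])
  have dC: "(C has_vector_derivative of_real (sin (\<omega> * t)) * h t) (at t within {0..T})"
    unfolding C_def[abs_def] by (rule integral_has_vector_derivative[OF cC t])
  have int: "(\<lambda>\<tau>. of_real (cos (\<omega> * \<tau>)) * h \<tau>) integrable_on {0..s}" "(\<lambda>\<tau>. of_real (sin (\<omega> * \<tau>)) * h \<tau>) integrable_on {0..s}"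
    if "s \<in> {0..T}" for s
    using that by (intro integrable_continuous_real continuous_on_subset[OF cS] continuous_on_subset[OF cC]; auto)+
  have eqs: "osc sin \<omega> h s = of_real (sin (\<omega> * s)) * S s - of_real (cos (\<omega> * s)) * C s" if s: "s \<in> {0..T}" for s
  proof -
    have "osc sin \<omega> h s = integral {0..s} (\<lambda>\<tau>. of_real (sin (\<omega> * s)) * (of_real (cos (\<omega> * \<tau>)) * h \<tau>)
      - of_real (cos (\<omega> * s)) * (of_real (sin (\<omega> * \<tau>)) * h \<tau>))"
      unfolding osc_def by (intro Henstock_Kurzweil_Integration.integral_cong) (simp add: right_diff_distrib sin_diff algebra_simps)
    also have "\<dots> = of_real (sin (\<omega> * s)) * S s - of_real (cos (\<omega> * s)) * C s"
      unfolding S_def C_def using int[OF s]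
      by (subst Henstock_Kurzweil_Integration.integral_diff) (simp_all add: integrable_on_mult_right)
    finally show ?thesis .
  qed
  have eqc: "osc cos \<omega> h s = of_real (cos (\<omega> * s)) * S s + of_real (sin (\<omega> * s)) * C s" if s: "s \<in> {0..T}" for s
  proof -
    have "osc cos \<omega> h s = integral {0..s} (\<lambda>\<tau>. of_real (cos (\<omega> * s)) * (of_real (cos (\<omega> * \<tau>)) * h \<tau>)
      + of_real (sin (\<omega> * s)) * (of_real (sin (\<omega> * \<tau>)) * h \<tau>))"
      unfolding osc_def by (intro Henstock_Kurzweil_Integration.integral_cong) (simp add: right_diff_distrib cos_diff algebra_simps)
    also have "\<dots> = of_real (cos (\<omega> * s)) * S s + of_real (sin (\<omega> * s)) * C s"
      unfolding S_def C_def using int[OF s]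
      by (subst Henstock_Kurzweil_Integration.integral_add) (simp_all add: integrable_on_mult_right)
    finally show ?thesis .
  qed
  have ds: "((\<lambda>s. of_real (sin (\<omega> * s)) :: complex) has_vector_derivative of_real (\<omega> * cos (\<omega> * t))) (at t within {0..T})"
    by (rule has_vector_derivative_of_real) (auto intro!: derivative_eq_intros)
  have dc: "((\<lambda>s. of_real (cos (\<omega> * s)) :: complex) has_vector_derivative of_real (- (\<omega> * sin (\<omega> * t)))) (at t within {0..T})"
    by (rule has_vector_derivative_of_real) (auto intro!: derivative_eq_intros)
  have sc: "complex_of_real (sin (\<omega> * t)) * of_real (sin (\<omega> * t)) + of_real (cos (\<omega> * t)) * of_real (cos (\<omega> * t)) = 1"
    unfolding of_real_mult[symmetric] of_real_add[symmetric] using sin_cos_squared_add[of "\<omega> * t"] by (simp add: power2_eq_square del: of_real_mult of_real_add)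
  have "((\<lambda>s. of_real (sin (\<omega> * s)) * S s - of_real (cos (\<omega> * s)) * C s) has_vector_derivative of_real \<omega> * osc cos \<omega> h t) (at t within {0..T})"
    by (rule has_vector_derivative_eq_rhs[OF has_vector_derivative_diff[OF has_vector_derivative_mult[OF ds dS] has_vector_derivative_mult[OF dc dC]]])
      (simp add: eqc[OF t] algebra_simps)
  then show "(osc sin \<omega> h has_vector_derivative of_real \<omega> * osc cos \<omega> h t) (at t within {0..T})"
    by (rule has_vector_derivative_transform[OF t, rotated]) (simp add: eqs)
  have "((\<lambda>s. of_real (cos (\<omega> * s)) * S s + of_real (sin (\<omega> * s)) * C s) has_vector_derivative h t - of_real \<omega> * osc sin \<omega> h t) (at t within {0..T})"
  proof (rule has_vector_derivative_eq_rhs[OF has_vector_derivative_add[OF has_vector_derivative_mult[OF dc dS] has_vector_derivative_mult[OF ds dC]]])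
    have "h t = (of_real (sin (\<omega> * t)) * of_real (sin (\<omega> * t)) + of_real (cos (\<omega> * t)) * of_real (cos (\<omega> * t))) * h t"
      by (simp only: sc mult_1)
    then show "of_real (cos (\<omega> * t)) * (of_real (cos (\<omega> * t)) * h t) + of_real (- (\<omega> * sin (\<omega> * t))) * S t +
      (of_real (sin (\<omega> * t)) * (of_real (sin (\<omega> * t)) * h t) + of_real (\<omega> * cos (\<omega> * t)) * C t) = h t - of_real \<omega> * osc sin \<omega> h t"
      by (simp add: eqs[OF t] algebra_simps)
  qed
  then show "(osc cos \<omega> h has_vector_derivative h t - of_real \<omega> * osc sin \<omega> h t) (at t within {0..T})"
    by (rule has_vector_derivative_transform[OF t, rotated]) (simp add: eqc)
qed

definition jcont :: "real \<Rightarrow> (real \<Rightarrow> real^2 \<Rightarrow> complex) \<Rightarrow> bool" where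
  "jcont T h \<longleftrightarrow> continuous_on ({0..T} \<times> UNIV) (\<lambda>p. h (fst p) (snd p))"

lemma jcont_compose:
  assumes "jcont T h" "continuous_on S f" "continuous_on S g" "\<And>x. x \<in> S \<Longrightarrow> f x \<in> {0..T}"
  shows "continuous_on S (\<lambda>x. h (f x) (g x))"
  using continuous_on_compose2[OF assms(1)[unfolded jcont_def] continuous_on_Pair[OF assms(2,3)]] assms(4) by (simp add: image_subset_iff)

lemma jcont_time: "jcont T h \<Longrightarrow> continuous_on {0..T} (\<lambda>t. h t \<xi>)"
  by (erule jcont_compose) (auto intro!: continuous_intros)

lemma jcont_space: "jcont T h \<Longrightarrow> t \<in> {0..T} \<Longrightarrow> continuous_on UNIV (h t)"
  by (erule jcont_compose) (auto intro!: continuous_intros)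

lemma jcont_add: "jcont T a \<Longrightarrow> jcont T b \<Longrightarrow> jcont T (\<lambda>t \<xi>. a t \<xi> + b t \<xi>)"
  and jcont_diff: "jcont T a \<Longrightarrow> jcont T b \<Longrightarrow> jcont T (\<lambda>t \<xi>. a t \<xi> - b t \<xi>)"
  unfolding jcont_def by (intro continuous_intros; assumption)+

lemma jcont_mult: "continuous_on UNIV p \<Longrightarrow> jcont T a \<Longrightarrow> jcont T (\<lambda>t \<xi>. p \<xi> * a t \<xi>)"
  unfolding jcont_def by (intro continuous_on_mult continuous_on_compose2[OF _ continuous_on_snd]) (auto intro: continuous_intros)

text \<open>The substitution of \<open>t * \<sigma>\<close> for \<open>\<tau>\<close> moves the
  integral to the fixed interval from \<open>0\<close> to \<open>1\<close>, where continuity of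
  parametric integrals gives joint continuity, including at \<open>t = 0\<close>.\<close>

lemma osc_jcont:
  assumes k: "continuous_on UNIV k" and \<omega>: "continuous_on UNIV \<omega>" and h: "jcont T h" and T: "T \<ge> 0"
  shows "jcont T (\<lambda>t \<xi>. osc k (\<omega> \<xi>) (\<lambda>\<tau>. h \<tau> \<xi>) t)"
proof -
  define F where "F p \<sigma> = of_real (fst p) * (of_real (k (\<omega> (snd p) * (fst p - fst p * \<sigma>))) * h (fst p * \<sigma>) (snd p))"
    for p :: "real \<times> (real^2)" and \<sigma>
  have "osc k (\<omega> \<xi>) (\<lambda>\<tau>. h \<tau> \<xi>) t = integral (cbox 0 1) (F (t, \<xi>))" if t: "t \<in> {0..T}" for t \<xi>
  proof (cases "t = 0")
    case True
    then show ?thesis by (simp add: F_def[abs_def] osc_0)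
  next
    case False
    then have t0: "t > 0" using t by simp
    have "(\<lambda>x. x / t) ` {0..t} = {0..1}" using t0 by (simp add: image_divide_atLeastAtMost)
    then have "integral {0..1} (\<lambda>\<sigma>. of_real (k (\<omega> \<xi> * (t - t * \<sigma>))) * h (t * \<sigma>) \<xi>) = (1 / t) *\<^sub>R osc k (\<omega> \<xi>) (\<lambda>\<tau>. h \<tau> \<xi>) t"
      using integral_stretch_real[of t 0 t "\<lambda>\<tau>. of_real (k (\<omega> \<xi> * (t - \<tau>))) * h \<tau> \<xi>"] t0 by (simp add: osc_def)
    then show ?thesis using t0 by (simp add: F_def[abs_def] scaleR_conv_of_real)
  qed
  then have eq: "osc k (\<omega> (snd p)) (\<lambda>\<tau>. h \<tau> (snd p)) (fst p) = integral (cbox 0 1) (F p)" if "p \<in> {0..T} \<times> UNIV" for p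
    using that by (cases p) auto
  have "continuous_on (({0..T} \<times> UNIV) \<times> cbox 0 1) (\<lambda>(p, \<sigma>). F p \<sigma>)"
  proof -
    have le: "0 \<le> t * \<sigma> \<and> t * \<sigma> \<le> T" if "0 \<le> t" "t \<le> T" "0 \<le> \<sigma>" "\<sigma> \<le> 1" for t \<sigma> :: real
      using that mult_mono[of t T \<sigma> 1] by simp
    show ?thesis
      unfolding F_def split_beta
      by (intro continuous_intros continuous_on_compose2[OF k] continuous_on_compose2[OF \<omega>] jcont_compose[OF h])
        (auto simp: le)
  qed
  then have "continuous_on ({0..T} \<times> UNIV) (\<lambda>p. integral (cbox 0 1) (F p))"
    by (rule integral_continuous_on_param)
  then show ?thesis unfolding jcont_def by (rule continuous_on_eq) (simp only: eq)
qed


section \<open>An exponentially weighted algebra\<close>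

text \<open>The exponential supplies decay of every order; the fourth power supplies integrability,
  so that functions bounded against the weight form a convolution algebra.\<close>

definition wt :: "real^2 \<Rightarrow> real" where
  "wt \<xi> = exp (norm \<xi>) * (1 + norm \<xi>) ^ 4"

lemma wt_pos: "0 < wt \<xi>"
  unfolding wt_def by (intro mult_pos_pos zero_less_power add_pos_nonneg) auto

lemma wt_ge: "(1 + norm \<xi>) ^ 4 \<le> wt \<xi>"
  using mult_right_mono[of 1 "exp (norm \<xi>)" "(1 + norm \<xi>) ^ 4"] by (simp add: wt_def)

lemma wt_continuous: "continuous_on UNIV wt"
  unfolding wt_def[abs_def] by (intro continuous_intros)

lemma wt_minus [simp]: "wt (- \<xi>) = wt \<xi>"
  by (simp add: wt_def)

text \<open>The exponentials obey the triangle inequality. For the powers,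
  \<open>1 + norm \<xi>\<close> is at most twice the larger of the two factors, which gives
  \<open>2 ^ 4 = 16\<close> and leaves an integrable inverse power of one of them.\<close>

lemma wt_submult: "wt \<xi> / (wt (\<xi> - \<eta>) * wt \<eta>) \<le> 16 * (1 / (1 + norm (\<xi> - \<eta>)) ^ 4 + 1 / (1 + norm \<eta>) ^ 4)"
proof -
  define a b where "a = 1 + norm (\<xi> - \<eta>)" and "b = 1 + norm \<eta>"
  have ab: "a > 0" "b > 0" unfolding a_def b_def by (simp_all add: add_pos_nonneg)
  have tri: "norm \<xi> \<le> norm (\<xi> - \<eta>) + norm \<eta>" using norm_triangle_sub[of \<xi> \<eta>] by simp
  have "(1 + norm \<xi>) ^ 4 \<le> (2 * max a b) ^ 4"
  proof (rule power_mono)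
    have "1 + norm \<xi> \<le> a + b" using tri by (simp add: a_def b_def)
    also have "\<dots> \<le> 2 * max a b" by simp
    finally show "1 + norm \<xi> \<le> 2 * max a b" .
  qed simp
  also have "\<dots> = 16 * (max a b) ^ 4" by (simp add: power_mult_distrib)
  also have "\<dots> \<le> 16 * (a ^ 4 + b ^ 4)" using ab by (simp add: max_def)
  finally have "wt \<xi> \<le> exp (norm (\<xi> - \<eta>) + norm \<eta>) * (16 * (a ^ 4 + b ^ 4))"
    unfolding wt_def using tri by (intro mult_mono) auto
  also have "\<dots> = 16 * (1 / a ^ 4 + 1 / b ^ 4) * (wt (\<xi> - \<eta>) * wt \<eta>)"
    using ab unfolding wt_def a_def[symmetric] b_def[symmetric] by (simp add: exp_add field_simps)
  finally show ?thesis
    unfolding a_def[symmetric] b_def[symmetric] using wt_pos by (subst pos_divide_le_eq) auto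
qed

text \<open>\<open>q\<close> holds a frequency factor to be distributed over the two arguments:
  \<open>norm \<xi>\<close> for the wave kernel, \<open>1\<close> for the Klein-Gordon kernel. The
  number \<open>32\<close> is the \<open>16\<close> of \<open>wt_submult\<close> for each of its two
  summands.\<close>

lemma conv_weighted_bound:
  assumes [measurable]: "f \<in> borel_measurable borel" "g \<in> borel_measurable borel"
    and "q \<ge> 0" "M \<ge> 0" and bound: "\<And>\<eta>. q * (cmod (f (\<xi> - \<eta>)) * cmod (g \<eta>)) \<le> M / (wt (\<xi> - \<eta>) * wt \<eta>)"
  shows "wt \<xi> * (q * cmod (conv f g \<xi>)) \<le> M * (32 * decay_mass)"
proof -
  let ?d = "\<lambda>x::real^2. 1 / (1 + norm x) ^ 4"
  have d: "integrable lborel ?d" by (rule integrable_decay)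
  have dm: "?d \<in> borel_measurable borel" by measurable
  have sh: "integrable lborel (\<lambda>\<eta>. ?d (\<xi> - \<eta>))" "(\<integral>\<eta>. ?d (\<xi> - \<eta>) \<partial>lborel) = decay_mass"
    using integral_lborel_reflect[OF dm, of \<xi>] d by (simp_all add: decay_mass_def)
  have pt: "norm (of_real (wt \<xi> * q) * (f (\<xi> - \<eta>) * g \<eta>)) \<le> (16 * M) * (?d (\<xi> - \<eta>) + ?d \<eta>)" for \<eta>
  proof -
    have "norm (of_real (wt \<xi> * q) * (f (\<xi> - \<eta>) * g \<eta>)) = wt \<xi> * (q * (cmod (f (\<xi> - \<eta>)) * cmod (g \<eta>)))"
      using wt_pos[of \<xi>] assms(3) by (simp add: norm_mult abs_mult)
    also have "\<dots> \<le> wt \<xi> * (M / (wt (\<xi> - \<eta>) * wt \<eta>))"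
      using bound wt_pos[of \<xi>] by (intro mult_left_mono) auto
    also have "\<dots> = M * (wt \<xi> / (wt (\<xi> - \<eta>) * wt \<eta>))" by simp
    also have "\<dots> \<le> M * (16 * (?d (\<xi> - \<eta>) + ?d \<eta>))"
      using wt_submult assms(4) by (intro mult_left_mono)
    finally show ?thesis by (simp only: mult_ac)
  qed
  have R: "integrable lborel (\<lambda>\<eta>. (16 * M) * (?d (\<xi> - \<eta>) + ?d \<eta>))"
    by (intro integrable_mult_right Bochner_Integration.integrable_add sh d)
  have "wt \<xi> * (q * cmod (conv f g \<xi>)) = cmod (\<integral>\<eta>. of_real (wt \<xi> * q) * (f (\<xi> - \<eta>) * g \<eta>) \<partial>lborel)"
    unfolding conv_def integral_mult_right_zero using wt_pos[of \<xi>] assms(3) by (simp add: norm_mult abs_mult)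
  also have "\<dots> \<le> (\<integral>\<eta>. norm (of_real (wt \<xi> * q) * (f (\<xi> - \<eta>) * g \<eta>)) \<partial>lborel)"
    by (rule integral_norm_bound)
  also have "\<dots> \<le> (\<integral>\<eta>. (16 * M) * (?d (\<xi> - \<eta>) + ?d \<eta>) \<partial>lborel)"
    by (rule integral_mono_AE'[OF R]) (use pt assms(4) in \<open>auto intro!: mult_nonneg_nonneg add_nonneg_nonneg\<close>)
  also have "\<dots> = M * (32 * decay_mass)"
    using sh d by (simp add: decay_mass_def)
  finally show ?thesis .
qed

text \<open>\<open>m = 1\<close> is used for the Klein--Gordon and \<open>m = 0\<close> for the wave component.\<close>

definition fam :: "nat \<Rightarrow> real \<Rightarrow> (real \<Rightarrow> real^2 \<Rightarrow> complex) \<Rightarrow> real \<Rightarrow> bool" where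
  "fam m T a A \<longleftrightarrow> jcont T a \<and> (\<forall>t\<in>{0..T}. \<forall>\<xi>. (1 + norm \<xi>) ^ m * wt \<xi> * cmod (a t \<xi>) \<le> A)"

lemma famD: "fam m T a A \<Longrightarrow> t \<in> {0..T} \<Longrightarrow> (1 + norm \<xi>) ^ m * wt \<xi> * cmod (a t \<xi>) \<le> A"
  and fam_jcont: "fam m T a A \<Longrightarrow> jcont T a"
  by (simp_all add: fam_def)

lemma fam_1_0: "fam 1 T a A \<Longrightarrow> fam 0 T a A"
  unfolding fam_def
proof (elim conjE, intro conjI ballI allI, assumption)
  fix t \<xi> assume "\<forall>t\<in>{0..T}. \<forall>\<xi>. (1 + norm \<xi>) ^ 1 * wt \<xi> * cmod (a t \<xi>) \<le> A" "t \<in> {0..T}"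
  then have "(1 + norm \<xi>) * (wt \<xi> * cmod (a t \<xi>)) \<le> A" by (simp add: mult.assoc)
  moreover have "1 * (wt \<xi> * cmod (a t \<xi>)) \<le> (1 + norm \<xi>) * (wt \<xi> * cmod (a t \<xi>))"
    using wt_pos[of \<xi>] by (intro mult_right_mono) auto
  ultimately show "(1 + norm \<xi>) ^ 0 * wt \<xi> * cmod (a t \<xi>) \<le> A" by simp
qed

lemma fam_nonneg:
  assumes "fam m T a A" "T \<ge> 0"
  shows "0 \<le> A"
proof -
  have "0 \<le> (1 + norm (0::real^2)) ^ m * wt 0 * cmod (a 0 0)" using wt_pos[of 0] by simp
  also have "\<dots> \<le> A" using assms by (intro famD) auto
  finally show ?thesis .
qed

text \<open>A single exponential bound yields decay of all orders, at the cost of a factorial in the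
  constant.\<close>

lemma fam_decays:
  assumes "fam m T a A" "t \<in> {0..T}"
  shows "decays k (a t) (fact k * exp 1 * A)"
  unfolding decays_def
proof
  fix \<xi>
  have "exp (norm \<xi>) \<le> (1 + norm \<xi>) ^ m * wt \<xi>"
  proof -
    have "1 \<le> (1 + norm \<xi>) ^ (m + 4)" by (rule one_le_power) simp
    then have "exp (norm \<xi>) * 1 \<le> exp (norm \<xi>) * (1 + norm \<xi>) ^ (m + 4)" by (intro mult_left_mono) auto
    then show ?thesis by (simp add: wt_def power_add)
  qed
  then have "exp (norm \<xi>) * cmod (a t \<xi>) \<le> (1 + norm \<xi>) ^ m * wt \<xi> * cmod (a t \<xi>)" by (intro mult_right_mono) auto
  also have "\<dots> \<le> A" by (rule famD[OF assms])
  finally have e: "exp (norm \<xi>) * cmod (a t \<xi>) \<le> A" .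
  have "(1 + norm \<xi>) ^ k * cmod (a t \<xi>) \<le> (fact k * exp (1 + norm \<xi>)) * cmod (a t \<xi>)"
    using exp_ge_power[of "1 + norm \<xi>" k] by (intro mult_right_mono) auto
  also have "\<dots> = fact k * exp 1 * (exp (norm \<xi>) * cmod (a t \<xi>))" by (simp add: exp_add)
  also have "\<dots> \<le> fact k * exp 1 * A" using e by (intro mult_left_mono) auto
  finally show "(1 + norm \<xi>) ^ k * cmod (a t \<xi>) \<le> fact k * exp 1 * A" .
qed

lemma fam_rapid: "fam m T a A \<Longrightarrow> t \<in> {0..T} \<Longrightarrow> rapid (a t)"
  unfolding rapid_decays using jcont_space[OF fam_jcont] fam_decays by blast

lemma fam_add:
  assumes "fam m T a A" "fam m T b B"
  shows "fam m T (\<lambda>t \<xi>. a t \<xi> + b t \<xi>) (A + B)"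
  unfolding fam_def
proof (intro conjI ballI allI)
  show "jcont T (\<lambda>t \<xi>. a t \<xi> + b t \<xi>)" using assms by (intro jcont_add fam_jcont)
  fix t \<xi> assume t: "t \<in> {0..T}"
  have "(1 + norm \<xi>) ^ m * wt \<xi> * cmod (a t \<xi> + b t \<xi>) \<le> (1 + norm \<xi>) ^ m * wt \<xi> * (cmod (a t \<xi>) + cmod (b t \<xi>))"
    using wt_pos[of \<xi>] by (intro mult_left_mono norm_triangle_ineq) auto
  then show "(1 + norm \<xi>) ^ m * wt \<xi> * cmod (a t \<xi> + b t \<xi>) \<le> A + B"
    using famD[OF assms(1) t, of \<xi>] famD[OF assms(2) t, of \<xi>] by (simp add: distrib_left)
qed

lemma fam_cong:
  assumes "fam m T a A" "\<And>t \<xi>. t \<in> {0..T} \<Longrightarrow> a t \<xi> = b t \<xi>"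
  shows "fam m T b A"
proof -
  have "jcont T b"
    using assms(1) unfolding fam_def jcont_def by (elim conjE) (erule continuous_on_eq, use assms(2) in auto)
  then show ?thesis using assms unfolding fam_def by simp
qed

lemma conv_jcont:
  assumes a: "fam 0 T a A" and b: "fam 0 T b B" and T: "T \<ge> 0"
  shows "jcont T (\<lambda>t. conv (a t) (b t))"
  unfolding jcont_def conv_def
proof (rule continuous_on_lebesgue_integral[where w = "\<lambda>\<eta>. (A * B) * (1 / (1 + norm \<eta>) ^ 4)"])
  note AB = fam_nonneg[OF a T] fam_nonneg[OF b T]
  fix \<eta> :: "real^2"
  show "continuous_on ({0..T} \<times> UNIV) (\<lambda>p. a (fst p) (snd p - \<eta>) * b (fst p) \<eta>)"
    by (intro continuous_on_mult jcont_compose[OF fam_jcont[OF a]] jcont_compose[OF fam_jcont[OF b]] continuous_intros) auto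
  fix p :: "real \<times> (real^2)" assume p: "p \<in> {0..T} \<times> UNIV"
  then have t: "fst p \<in> {0..T}" by auto
  have [measurable]: "a (fst p) \<in> borel_measurable borel" "b (fst p) \<in> borel_measurable borel"
    using fam_rapid[OF a t] fam_rapid[OF b t] by (auto intro: rapid_measurable)
  show "(\<lambda>\<eta>. a (fst p) (snd p - \<eta>) * b (fst p) \<eta>) \<in> borel_measurable lborel" by measurable
  have d: "(1 + norm \<zeta>) ^ 4 * cmod (f \<zeta>) \<le> F" if "(1 + norm \<zeta>) ^ 0 * wt \<zeta> * cmod (f \<zeta>) \<le> F" for f :: "real^2 \<Rightarrow> complex" and \<zeta> F
    using order_trans[OF mult_right_mono[OF wt_ge[of \<zeta>], of "cmod (f \<zeta>)"]] that by simp
  have "cmod (a (fst p) (snd p - \<eta>)) \<le> A"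
  proof -
    have "1 * cmod (a (fst p) (snd p - \<eta>)) \<le> (1 + norm (snd p - \<eta>)) ^ 4 * cmod (a (fst p) (snd p - \<eta>))"
      by (intro mult_right_mono one_le_power) auto
    also have "\<dots> \<le> A" by (rule d[of _ "a (fst p)" A, OF famD[OF a t]])
    finally show ?thesis by simp
  qed
  moreover have "cmod (b (fst p) \<eta>) \<le> B * (1 / (1 + norm \<eta>) ^ 4)"
    using d[of \<eta> "b (fst p)" B, OF famD[OF b t]] by (simp add: field_simps add_nonneg_eq_0_iff)
  ultimately have "cmod (a (fst p) (snd p - \<eta>)) * cmod (b (fst p) \<eta>) \<le> A * (B * (1 / (1 + norm \<eta>) ^ 4))"
    using AB by (intro mult_mono) auto
  then show "norm (a (fst p) (snd p - \<eta>) * b (fst p) \<eta>) \<le> (A * B) * (1 / (1 + norm \<eta>) ^ 4)"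
    by (simp add: norm_mult)
qed (intro integrable_mult_right integrable_decay)


section \<open>The Duhamel iteration\<close>

definition japanese :: "real^2 \<Rightarrow> real" where
  "japanese \<xi> = sqrt (1 + (norm \<xi>)\<^sup>2)"

lemma japanese_pos: "0 < japanese \<xi>"
  unfolding japanese_def by (intro real_sqrt_gt_zero add_pos_nonneg) auto

lemma japanese_square: "(japanese \<xi>)\<^sup>2 = 1 + (norm \<xi>)\<^sup>2"
  unfolding japanese_def by simp

lemma japanese_continuous: "continuous_on UNIV japanese"
  unfolding japanese_def[abs_def] by (intro continuous_intros)

lemma japanese_minus [simp]: "japanese (- \<xi>) = japanese \<xi>"
  by (simp add: japanese_def)

lemma japanese_le: "japanese \<xi> \<le> 1 + norm \<xi>"
  unfolding japanese_def by (rule real_le_lsqrt) (simp_all add: power2_sum)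

lemma le_japanese: "1 + norm \<xi> \<le> 2 * japanese \<xi>"
proof -
  have "1 \<le> japanese \<xi>" "norm \<xi> \<le> japanese \<xi>"
    unfolding japanese_def by (simp_all add: real_le_rsqrt)
  then show ?thesis by simp
qed

locale kgz =
  fixes c T :: real
  assumes c: "c > 0" and T: "T > 0"
begin

lemma T0: "0 \<le> T" using T by simp

text \<open>The forcing on the Fourier side is \<open>- (norm \<xi>)\<^sup>2 / (2 * pi)\<close>
  times the convolution, and the wave kernel divides by \<open>c * norm \<xi>\<close>. One power of
  \<open>norm \<xi>\<close> remains in the numerator, so there is no singularity at the
  origin.\<close>

definition wave_op :: "(real \<Rightarrow> real^2 \<Rightarrow> complex) \<Rightarrow> (real \<Rightarrow> real^2 \<Rightarrow> complex) \<Rightarrow> real \<Rightarrow> real^2 \<Rightarrow> complex" where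
  "wave_op a b t \<xi> = - of_real (norm \<xi> / (2 * pi * c)) * osc sin (c * norm \<xi>) (\<lambda>\<tau>. conv (a \<tau>) (b \<tau>) \<xi>) t"

definition kg_op :: "(real \<Rightarrow> real^2 \<Rightarrow> complex) \<Rightarrow> (real \<Rightarrow> real^2 \<Rightarrow> complex) \<Rightarrow> real \<Rightarrow> real^2 \<Rightarrow> complex" where
  "kg_op n a t \<xi> = - of_real (1 / (2 * pi * japanese \<xi>)) * osc sin (japanese \<xi>) (\<lambda>\<tau>. conv (n \<tau>) (a \<tau>) \<xi>) t"

definition wave_const :: real where "wave_const = 64 * decay_mass * T / c"
definition kg_const :: real where "kg_const = 32 * decay_mass * T"

lemma consts_nonneg: "0 \<le> wave_const" "0 \<le> kg_const"
  using c T decay_mass_nonneg by (simp_all add: wave_const_def kg_const_def)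

lemma conv_time_continuous:
  assumes "fam 0 T a A" "fam 0 T b B"
  shows "continuous_on {0..T} (\<lambda>\<tau>. conv (a \<tau>) (b \<tau>) \<xi>)"
  by (rule jcont_time[OF conv_jcont[OF assms T0]])

lemma osc_weighted_bound:
  assumes h: "continuous_on {0..T} h" and "q \<ge> 0" "\<And>\<tau>. \<tau> \<in> {0..T} \<Longrightarrow> q * cmod (h \<tau>) \<le> M" and t: "t \<in> {0..T}"
  shows "q * cmod (osc sin \<omega> h t) \<le> M * T"
proof -
  have "q * cmod (osc sin \<omega> h t) = cmod (osc sin \<omega> (\<lambda>\<tau>. of_real q * h \<tau>) t)"
    unfolding osc_cmult using assms(2) by (simp add: norm_mult)
  also have "\<dots> \<le> M * T"
  proof (rule osc_bound[OF continuous_on_sin[OF continuous_on_id] abs_sin_le_one _ _ t])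
    show "continuous_on {0..T} (\<lambda>\<tau>. of_real q * h \<tau>)" by (intro continuous_intros h)
  qed (use assms in \<open>simp add: norm_mult\<close>)
  finally show ?thesis .
qed

text \<open>The remaining factor \<open>norm \<xi>\<close> is at most \<open>x + y\<close>, and each
  of the two inputs of class \<open>fam 1\<close> carries a spare power, \<open>x\<close> or
  \<open>y\<close>, to cancel it. This is why the output is of class \<open>fam 0\<close>
  only.\<close>

lemma wave_op_fam:
  assumes a: "fam 1 T a A" and b: "fam 1 T b B"
  shows "fam 0 T (wave_op a b) (wave_const * A * B)"
  unfolding fam_def
proof (intro conjI ballI allI)
  note a0 = fam_1_0[OF a] and b0 = fam_1_0[OF b]
  note AB = fam_nonneg[OF a T0] fam_nonneg[OF b T0]
  show "jcont T (wave_op a b)"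
    unfolding wave_op_def[abs_def]
    by (intro jcont_mult osc_jcont conv_jcont[OF a0 b0] T0 continuous_intros) (use c in auto)
  fix t \<xi> assume t: "t \<in> {0..T}"
  have key: "wt \<xi> * (norm \<xi> * cmod (conv (a \<tau>) (b \<tau>) \<xi>)) \<le> (2 * A * B) * (32 * decay_mass)" if \<tau>: "\<tau> \<in> {0..T}" for \<tau>
  proof (rule conv_weighted_bound)
    show "a \<tau> \<in> borel_measurable borel" "b \<tau> \<in> borel_measurable borel"
      using fam_rapid[OF a \<tau>] fam_rapid[OF b \<tau>] by (auto intro: rapid_measurable)
    fix \<eta>
    define x y where "x = 1 + norm (\<xi> - \<eta>)" and "y = 1 + norm \<eta>"
    have xy: "x \<ge> 1" "y \<ge> 1" by (simp_all add: x_def y_def)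
    then have p: "0 < x * wt (\<xi> - \<eta>)" "0 < y * wt \<eta>" by (auto intro!: mult_pos_pos wt_pos)
    have "cmod (a \<tau> (\<xi> - \<eta>)) \<le> A / (x * wt (\<xi> - \<eta>))"
      unfolding pos_le_divide_eq[OF p(1)] using famD[OF a \<tau>, of "\<xi> - \<eta>"] by (simp add: x_def mult_ac)
    moreover have "cmod (b \<tau> \<eta>) \<le> B / (y * wt \<eta>)"
      unfolding pos_le_divide_eq[OF p(2)] using famD[OF b \<tau>, of \<eta>] by (simp add: y_def mult_ac)
    ultimately have ab: "cmod (a \<tau> (\<xi> - \<eta>)) * cmod (b \<tau> \<eta>) \<le> A / (x * wt (\<xi> - \<eta>)) * (B / (y * wt \<eta>))"
      using AB less_imp_le[OF p(1)] by (intro mult_mono) auto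
    have "norm \<xi> \<le> x + y" using norm_triangle_sub[of \<xi> \<eta>] by (simp add: x_def y_def)
    from mult_mono[OF this ab] have "norm \<xi> * (cmod (a \<tau> (\<xi> - \<eta>)) * cmod (b \<tau> \<eta>)) \<le> (x + y) * (A / (x * wt (\<xi> - \<eta>)) * (B / (y * wt \<eta>)))"
      using xy by simp
    also have "\<dots> = (1 / x + 1 / y) * (A * B / (wt (\<xi> - \<eta>) * wt \<eta>))"
      using xy wt_pos[of "\<xi> - \<eta>"] wt_pos[of \<eta>] by (simp add: field_simps)
    also have "\<dots> \<le> 2 * (A * B / (wt (\<xi> - \<eta>) * wt \<eta>))"
    proof (intro mult_right_mono)
      have "1 / x \<le> 1" "1 / y \<le> 1" using xy by simp_all
      then show "1 / x + 1 / y \<le> 2" by linarith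
    qed (use AB wt_pos[of "\<xi> - \<eta>"] wt_pos[of \<eta>] in auto)
    finally show "norm \<xi> * (cmod (a \<tau> (\<xi> - \<eta>)) * cmod (b \<tau> \<eta>)) \<le> (2 * A * B) / (wt (\<xi> - \<eta>) * wt \<eta>)" by simp
  qed (use AB in auto)
  have bd: "(wt \<xi> * norm \<xi>) * cmod (osc sin (c * norm \<xi>) (\<lambda>\<tau>. conv (a \<tau>) (b \<tau>) \<xi>) t) \<le> (2 * A * B) * (32 * decay_mass) * T"
    by (rule osc_weighted_bound[OF conv_time_continuous[OF a0 b0] _ _ t]) (use key wt_pos[of \<xi>] in \<open>simp_all add: mult.assoc\<close>)
  have "1 / (2 * pi * c) \<le> 1 / c" using c pi_gt3 by (intro divide_left_mono) auto
  from mult_mono[OF this bd] have "(1 / (2 * pi * c)) * ((wt \<xi> * norm \<xi>) * cmod (osc sin (c * norm \<xi>) (\<lambda>\<tau>. conv (a \<tau>) (b \<tau>) \<xi>) t))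
    \<le> (1 / c) * ((2 * A * B) * (32 * decay_mass) * T)"
    using c wt_pos[of \<xi>] by simp
  then show "(1 + norm \<xi>) ^ 0 * wt \<xi> * cmod (wave_op a b t \<xi>) \<le> wave_const * A * B"
    using c by (simp add: wave_op_def wave_const_def norm_mult norm_divide mult_ac)
qed

text \<open>Division by \<open>japanese \<xi>\<close> gains the power that separates
  \<open>fam 0\<close> from \<open>fam 1\<close>, so the composition with \<open>wave_op\<close>
  returns to the space it started from.\<close>

lemma kg_op_fam:
  assumes n: "fam 0 T n A" and b: "fam 1 T b B"
  shows "fam 1 T (kg_op n b) (kg_const * A * B)"
  unfolding fam_def
proof (intro conjI ballI allI)
  note b0 = fam_1_0[OF b]
  note AB = fam_nonneg[OF n T0] fam_nonneg[OF b T0]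
  have "continuous_on UNIV (\<lambda>\<xi>. - complex_of_real (1 / (2 * pi * japanese \<xi>)))"
    by (intro continuous_intros japanese_continuous) (use japanese_pos in \<open>simp add: less_imp_neq[symmetric]\<close>)
  then show "jcont T (kg_op n b)"
    unfolding kg_op_def[abs_def]
    by (intro jcont_mult osc_jcont conv_jcont[OF n b0] T0 japanese_continuous continuous_on_sin continuous_on_id)
  fix t \<xi> assume t: "t \<in> {0..T}"
  have key: "wt \<xi> * (1 * cmod (conv (n \<tau>) (b \<tau>) \<xi>)) \<le> (A * B) * (32 * decay_mass)" if \<tau>: "\<tau> \<in> {0..T}" for \<tau>
  proof (rule conv_weighted_bound)
    show "n \<tau> \<in> borel_measurable borel" "b \<tau> \<in> borel_measurable borel"
      using fam_rapid[OF n \<tau>] fam_rapid[OF b \<tau>] by (auto intro: rapid_measurable)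
    fix \<eta>
    have "cmod (n \<tau> (\<xi> - \<eta>)) \<le> A / wt (\<xi> - \<eta>)"
      using famD[OF n \<tau>, of "\<xi> - \<eta>"] wt_pos[of "\<xi> - \<eta>"] by (simp add: pos_le_divide_eq mult_ac)
    moreover have "cmod (b \<tau> \<eta>) \<le> B / wt \<eta>"
      using famD[OF b0 \<tau>, of \<eta>] wt_pos[of \<eta>] by (simp add: pos_le_divide_eq mult_ac)
    ultimately have "cmod (n \<tau> (\<xi> - \<eta>)) * cmod (b \<tau> \<eta>) \<le> A / wt (\<xi> - \<eta>) * (B / wt \<eta>)"
      using AB by (intro mult_mono) (auto intro!: divide_nonneg_nonneg less_imp_le[OF wt_pos])
    then show "1 * (cmod (n \<tau> (\<xi> - \<eta>)) * cmod (b \<tau> \<eta>)) \<le> (A * B) / (wt (\<xi> - \<eta>) * wt \<eta>)" by simp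
  qed (use AB in auto)
  have bd: "wt \<xi> * cmod (osc sin (japanese \<xi>) (\<lambda>\<tau>. conv (n \<tau>) (b \<tau>) \<xi>) t) \<le> (A * B) * (32 * decay_mass) * T"
    by (rule osc_weighted_bound[OF conv_time_continuous[OF n b0] _ _ t]) (use key wt_pos[of \<xi>] in simp_all)
  have le1: "(1 + norm \<xi>) / (2 * pi * japanese \<xi>) \<le> 1"
  proof -
    have "2 * japanese \<xi> \<le> 2 * pi * japanese \<xi>" using japanese_pos[of \<xi>] pi_gt3 by simp
    then have "1 + norm \<xi> \<le> 2 * pi * japanese \<xi>" using le_japanese[of \<xi>] by linarith
    then show ?thesis using japanese_pos[of \<xi>] by simp
  qed
  from mult_mono[OF le1 bd] have "((1 + norm \<xi>) / (2 * pi * japanese \<xi>)) * (wt \<xi> * cmod (osc sin (japanese \<xi>) (\<lambda>\<tau>. conv (n \<tau>) (b \<tau>) \<xi>) t))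
    \<le> 1 * ((A * B) * (32 * decay_mass) * T)"
    using wt_pos[of \<xi>] by simp
  then show "(1 + norm \<xi>) ^ 1 * wt \<xi> * cmod (kg_op n b t \<xi>) \<le> kg_const * A * B"
    using japanese_pos[of \<xi>] by (simp add: kg_op_def kg_const_def norm_mult norm_divide mult_ac)
qed

lemma wave_op_diff_left:
  assumes "fam 1 T a A" "fam 1 T a' A'" "fam 1 T b B" "t \<in> {0..T}"
  shows "wave_op (\<lambda>t \<xi>. a t \<xi> - a' t \<xi>) b t \<xi> = wave_op a b t \<xi> - wave_op a' b t \<xi>"
proof -
  have "osc sin (c * norm \<xi>) (\<lambda>\<tau>. conv (\<lambda>\<xi>. a \<tau> \<xi> - a' \<tau> \<xi>) (b \<tau>) \<xi>) t
    = osc sin (c * norm \<xi>) (\<lambda>\<tau>. conv (a \<tau>) (b \<tau>) \<xi> - conv (a' \<tau>) (b \<tau>) \<xi>) t"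
    by (rule osc_cong, rule conv_diff_left) (use assms in \<open>auto intro: fam_rapid\<close>)
  also have "\<dots> = osc sin (c * norm \<xi>) (\<lambda>\<tau>. conv (a \<tau>) (b \<tau>) \<xi>) t - osc sin (c * norm \<xi>) (\<lambda>\<tau>. conv (a' \<tau>) (b \<tau>) \<xi>) t"
    by (rule osc_diff[OF continuous_on_sin[OF continuous_on_id] conv_time_continuous[OF fam_1_0[OF assms(1)] fam_1_0[OF assms(3)]] conv_time_continuous[OF fam_1_0[OF assms(2)] fam_1_0[OF assms(3)]] assms(4)])
  finally show ?thesis unfolding wave_op_def by (simp only: right_diff_distrib)
qed

lemma wave_op_diff_right:
  assumes "fam 1 T a A" "fam 1 T b B" "fam 1 T b' B'" "t \<in> {0..T}"
  shows "wave_op a (\<lambda>t \<xi>. b t \<xi> - b' t \<xi>) t \<xi> = wave_op a b t \<xi> - wave_op a b' t \<xi>"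
proof -
  have "osc sin (c * norm \<xi>) (\<lambda>\<tau>. conv (a \<tau>) (\<lambda>\<xi>. b \<tau> \<xi> - b' \<tau> \<xi>) \<xi>) t
    = osc sin (c * norm \<xi>) (\<lambda>\<tau>. conv (a \<tau>) (b \<tau>) \<xi> - conv (a \<tau>) (b' \<tau>) \<xi>) t"
    by (rule osc_cong, rule conv_diff_right) (use assms in \<open>auto intro: fam_rapid\<close>)
  also have "\<dots> = osc sin (c * norm \<xi>) (\<lambda>\<tau>. conv (a \<tau>) (b \<tau>) \<xi>) t - osc sin (c * norm \<xi>) (\<lambda>\<tau>. conv (a \<tau>) (b' \<tau>) \<xi>) t"
    by (rule osc_diff[OF continuous_on_sin[OF continuous_on_id] conv_time_continuous[OF fam_1_0[OF assms(1)] fam_1_0[OF assms(2)]] conv_time_continuous[OF fam_1_0[OF assms(1)] fam_1_0[OF assms(3)]] assms(4)])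
  finally show ?thesis unfolding wave_op_def by (simp only: right_diff_distrib)
qed

lemma kg_op_diff_left:
  assumes "fam 0 T a A" "fam 0 T a' A'" "fam 1 T b B" "t \<in> {0..T}"
  shows "kg_op (\<lambda>t \<xi>. a t \<xi> - a' t \<xi>) b t \<xi> = kg_op a b t \<xi> - kg_op a' b t \<xi>"
proof -
  have "osc sin (japanese \<xi>) (\<lambda>\<tau>. conv (\<lambda>\<xi>. a \<tau> \<xi> - a' \<tau> \<xi>) (b \<tau>) \<xi>) t
    = osc sin (japanese \<xi>) (\<lambda>\<tau>. conv (a \<tau>) (b \<tau>) \<xi> - conv (a' \<tau>) (b \<tau>) \<xi>) t"
    by (rule osc_cong, rule conv_diff_left) (use assms in \<open>auto intro: fam_rapid\<close>)
  also have "\<dots> = osc sin (japanese \<xi>) (\<lambda>\<tau>. conv (a \<tau>) (b \<tau>) \<xi>) t - osc sin (japanese \<xi>) (\<lambda>\<tau>. conv (a' \<tau>) (b \<tau>) \<xi>) t"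
    by (rule osc_diff[OF continuous_on_sin[OF continuous_on_id] conv_time_continuous[OF assms(1) fam_1_0[OF assms(3)]] conv_time_continuous[OF assms(2) fam_1_0[OF assms(3)]] assms(4)])
  finally show ?thesis unfolding kg_op_def by (simp only: right_diff_distrib)
qed

lemma kg_op_diff_right:
  assumes "fam 0 T a A" "fam 1 T b B" "fam 1 T b' B'" "t \<in> {0..T}"
  shows "kg_op a (\<lambda>t \<xi>. b t \<xi> - b' t \<xi>) t \<xi> = kg_op a b t \<xi> - kg_op a b' t \<xi>"
proof -
  have "osc sin (japanese \<xi>) (\<lambda>\<tau>. conv (a \<tau>) (\<lambda>\<xi>. b \<tau> \<xi> - b' \<tau> \<xi>) \<xi>) t
    = osc sin (japanese \<xi>) (\<lambda>\<tau>. conv (a \<tau>) (b \<tau>) \<xi> - conv (a \<tau>) (b' \<tau>) \<xi>) t"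
    by (rule osc_cong, rule conv_diff_right) (use assms in \<open>auto intro: fam_rapid\<close>)
  also have "\<dots> = osc sin (japanese \<xi>) (\<lambda>\<tau>. conv (a \<tau>) (b \<tau>) \<xi>) t - osc sin (japanese \<xi>) (\<lambda>\<tau>. conv (a \<tau>) (b' \<tau>) \<xi>) t"
    by (rule osc_diff[OF continuous_on_sin[OF continuous_on_id] conv_time_continuous[OF assms(1) fam_1_0[OF assms(2)]] conv_time_continuous[OF assms(1) fam_1_0[OF assms(3)]] assms(4)])
  finally show ?thesis unfolding kg_op_def by (simp only: right_diff_distrib)
qed

text \<open>Bilinearity in the form \<open>a a - b b = (a - b) a + b (a - b)\<close>.\<close>

lemma wave_op_square_diff:
  assumes a: "fam 1 T a A" and b: "fam 1 T b B" and d: "fam 1 T (\<lambda>t \<xi>. a t \<xi> - b t \<xi>) D"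
  shows "fam 0 T (\<lambda>t \<xi>. wave_op a a t \<xi> - wave_op b b t \<xi>) (wave_const * D * A + wave_const * B * D)"
proof (rule fam_cong[OF fam_add[OF wave_op_fam[OF d a] wave_op_fam[OF b d]]])
  fix t \<xi> assume t: "t \<in> {0..T}"
  show "wave_op (\<lambda>t \<xi>. a t \<xi> - b t \<xi>) a t \<xi> + wave_op b (\<lambda>t \<xi>. a t \<xi> - b t \<xi>) t \<xi> = wave_op a a t \<xi> - wave_op b b t \<xi>"
    by (simp add: wave_op_diff_left[OF a b a t] wave_op_diff_right[OF b a b t])
qed

text \<open>With zero data the wave component equals \<open>wave_op u u\<close>. Inserting it into
  the Klein-Gordon integral leaves a closed equation for \<open>u\<close>.\<close>

definition cubic :: "(real \<Rightarrow> real^2 \<Rightarrow> complex) \<Rightarrow> real \<Rightarrow> real^2 \<Rightarrow> complex" where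
  "cubic a = kg_op (wave_op a a) a"

definition cubic_const :: real where "cubic_const = kg_const * wave_const"

lemma cubic_const_nonneg: "0 \<le> cubic_const"
  using consts_nonneg by (simp add: cubic_const_def)

lemma cubic_fam:
  assumes "fam 1 T a A"
  shows "fam 1 T (cubic a) (cubic_const * A ^ 3)"
  using kg_op_fam[OF wave_op_fam[OF assms assms] assms]
  by (simp add: cubic_def cubic_const_def power3_eq_cube mult_ac)

text \<open>The factor \<open>3\<close> counts the three slots in which \<open>a\<close> can be
  exchanged for \<open>b\<close>: two inside the wave component, one outside.\<close>

lemma cubic_diff:
  assumes a: "fam 1 T a R" and b: "fam 1 T b R" and d: "fam 1 T (\<lambda>t \<xi>. a t \<xi> - b t \<xi>) D"
  shows "fam 1 T (\<lambda>t \<xi>. cubic a t \<xi> - cubic b t \<xi>) (3 * cubic_const * R\<^sup>2 * D)"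
proof -
  note na = wave_op_fam[OF a a] and nb = wave_op_fam[OF b b] and nd = wave_op_square_diff[OF a b d]
  have "fam 1 T (\<lambda>t \<xi>. cubic a t \<xi> - cubic b t \<xi>)
    (kg_const * (wave_const * D * R + wave_const * R * D) * R + kg_const * (wave_const * R * R) * D)"
  proof (rule fam_cong[OF fam_add[OF kg_op_fam[OF nd a] kg_op_fam[OF nb d]]])
    fix t \<xi> assume t: "t \<in> {0..T}"
    show "kg_op (\<lambda>t \<xi>. wave_op a a t \<xi> - wave_op b b t \<xi>) a t \<xi> + kg_op (wave_op b b) (\<lambda>t \<xi>. a t \<xi> - b t \<xi>) t \<xi>
      = cubic a t \<xi> - cubic b t \<xi>"
      by (simp add: cubic_def kg_op_diff_left[OF na nb a t] kg_op_diff_right[OF nb a b t])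
  qed
  moreover have "kg_const * (wave_const * D * R + wave_const * R * D) * R + kg_const * (wave_const * R * R) * D
    = 3 * cubic_const * R\<^sup>2 * D"
    by (simp add: cubic_const_def power2_eq_square algebra_simps)
  ultimately show ?thesis by (simp only:)
qed

lemma wave_op_hermitian:
  assumes "fam 1 T a A" "\<And>t. t \<in> {0..T} \<Longrightarrow> hermitian (a t)" "t \<in> {0..T}"
  shows "hermitian (wave_op a a t)"
  unfolding hermitian_def
proof
  fix \<xi>
  have "hermitian (conv (a \<tau>) (a \<tau>))" if "\<tau> \<in> {0..t}" for \<tau>
    using that assms by (intro hermitian_conv fam_rapid[OF assms(1)] assms(2)) auto
  then have "osc sin (c * norm \<xi>) (\<lambda>\<tau>. conv (a \<tau>) (a \<tau>) (- \<xi>)) t = osc sin (c * norm \<xi>) (\<lambda>\<tau>. cnj (conv (a \<tau>) (a \<tau>) \<xi>)) t"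
    by (intro osc_cong) (simp add: hermitian_def)
  then show "wave_op a a t (- \<xi>) = cnj (wave_op a a t \<xi>)" by (simp add: wave_op_def osc_cnj)
qed

lemma kg_op_hermitian:
  assumes "fam 0 T n A" "fam 1 T a B" "\<And>t. t \<in> {0..T} \<Longrightarrow> hermitian (n t)" "\<And>t. t \<in> {0..T} \<Longrightarrow> hermitian (a t)" "t \<in> {0..T}"
  shows "hermitian (kg_op n a t)"
  unfolding hermitian_def
proof
  fix \<xi>
  have "hermitian (conv (n \<tau>) (a \<tau>))" if "\<tau> \<in> {0..t}" for \<tau>
    using that assms by (intro hermitian_conv fam_rapid[OF assms(1)] fam_rapid[OF assms(2)] assms(3,4)) auto
  then have "osc sin (japanese \<xi>) (\<lambda>\<tau>. conv (n \<tau>) (a \<tau>) (- \<xi>)) t = osc sin (japanese \<xi>) (\<lambda>\<tau>. cnj (conv (n \<tau>) (a \<tau>) \<xi>)) t"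
    by (intro osc_cong) (simp add: hermitian_def)
  then show "kg_op n a t (- \<xi>) = cnj (kg_op n a t \<xi>)" by (simp add: kg_op_def osc_cnj)
qed

section \<open>The contraction argument for the closed equation\<close>

definition lin :: "(real^2 \<Rightarrow> complex) \<Rightarrow> real \<Rightarrow> real^2 \<Rightarrow> complex" where
  "lin g t \<xi> = of_real (cos (t * japanese \<xi>)) * g \<xi>"

lemma lin_fam:
  assumes "continuous_on UNIV g" "\<And>\<xi>. (1 + norm \<xi>) * wt \<xi> * cmod (g \<xi>) \<le> A"
  shows "fam 1 T (lin g) A"
  unfolding fam_def
proof (intro conjI ballI allI)
  show "jcont T (lin g)"
    unfolding jcont_def lin_def
    by (intro continuous_intros continuous_on_compose2[OF japanese_continuous] continuous_on_compose2[OF assms(1)]) auto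
  fix t \<xi>
  have "cmod (lin g t \<xi>) \<le> 1 * cmod (g \<xi>)"
    unfolding lin_def norm_mult norm_of_real by (intro mult_right_mono abs_cos_le_one) auto
  then have "(1 + norm \<xi>) * wt \<xi> * cmod (lin g t \<xi>) \<le> (1 + norm \<xi>) * wt \<xi> * cmod (g \<xi>)"
    using wt_pos[of \<xi>] by (intro mult_left_mono) auto
  then show "(1 + norm \<xi>) ^ 1 * wt \<xi> * cmod (lin g t \<xi>) \<le> A" using assms(2)[of \<xi>] by simp
qed

text \<open>Bounded continuous functions are a complete space at hand; division by the weight makes
  their supremum norm the bound of class \<open>fam 1\<close>.\<close>

definition unscaled :: "(real \<times> (real^2)) \<Rightarrow>\<^sub>C complex \<Rightarrow> real \<Rightarrow> real^2 \<Rightarrow> complex" where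
  "unscaled v t \<xi> = apply_bcontfun v (t, \<xi>) / of_real ((1 + norm \<xi>) * wt \<xi>)"

text \<open>Time is clamped to \<open>{0..T}\<close>, so that a family known only on the interval
  gives a function on the whole space with the same bound.\<close>

definition rescaled :: "(real \<Rightarrow> real^2 \<Rightarrow> complex) \<Rightarrow> real \<times> (real^2) \<Rightarrow> complex" where
  "rescaled a p = of_real ((1 + norm (snd p)) * wt (snd p)) * a (max 0 (min T (fst p))) (snd p)"

lemma scale_pos: "0 < (1 + norm \<xi>) * wt \<xi>" for \<xi> :: "real^2"
  using wt_pos[of \<xi>] by (intro mult_pos_pos add_pos_nonneg) auto

lemma scale_neq_0: "complex_of_real ((1 + norm \<xi>) * wt \<xi>) \<noteq> 0" for \<xi> :: "real^2"
  unfolding of_real_eq_0_iff using scale_pos[of \<xi>] by linarith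

lemma unscaled_fam: "fam 1 T (unscaled v) (norm v)"
  unfolding fam_def
proof (intro conjI ballI allI)
  show "jcont T (unscaled v)"
    unfolding jcont_def unscaled_def
    by (intro continuous_intros continuous_on_compose2[OF wt_continuous] continuous_on_compose2[OF continuous_on_apply_bcontfun[of UNIV v]] ballI scale_neq_0)
      auto
  fix t and \<xi> :: "real^2"
  show "(1 + norm \<xi>) ^ 1 * wt \<xi> * cmod (unscaled v t \<xi>) \<le> norm v"
    unfolding unscaled_def norm_divide norm_of_real
    using scale_pos[of \<xi>] norm_bounded[of v "(t, \<xi>)"] by simp
qed

lemma rescaled_bcontfun:
  assumes "fam 1 T a A"
  shows "rescaled a \<in> bcontfun" "norm (rescaled a p) \<le> A"
proof -
  have b: "norm (rescaled a p) \<le> A" for p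
    using famD[OF assms, of "max 0 (min T (fst p))" "snd p"] scale_pos[of "snd p"] T0
    unfolding rescaled_def norm_mult norm_of_real by simp
  have "continuous_on UNIV (rescaled a)"
    unfolding rescaled_def[abs_def]
    by (intro continuous_intros continuous_on_compose2[OF wt_continuous] jcont_compose[OF fam_jcont[OF assms]]) (use T0 in auto)
  then show "rescaled a \<in> bcontfun" using b by (rule bcontfun_normI)
  show "norm (rescaled a p) \<le> A" by (rule b)
qed

text \<open>Banach's fixed point theorem on the ball of radius \<open>2 * r\<close>; the smallness
  condition is precisely the Lipschitz constant of \<open>cubic_diff\<close> at that radius being at
  most \<open>1 / 2\<close>.\<close>

lemma small_solution:
  assumes g: "continuous_on UNIV g" "hermitian g" "\<And>\<xi>. (1 + norm \<xi>) * wt \<xi> * cmod (g \<xi>) \<le> r"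
    and small: "3 * cubic_const * (2 * r)\<^sup>2 \<le> 1 / 2"
  obtains u where "fam 1 T u (2 * r)" "\<And>t. t \<in> {0..T} \<Longrightarrow> hermitian (u t)"
    "\<And>t \<xi>. t \<in> {0..T} \<Longrightarrow> u t \<xi> = lin g t \<xi> + cubic u t \<xi>"
proof -
  have r: "0 \<le> r" using order_trans[OF _ g(3)[of 0]] wt_pos[of 0] by simp
  define R where "R = 2 * r"
  define F where "F v = Bcontfun (rescaled (\<lambda>t \<xi>. lin g t \<xi> + cubic (unscaled v) t \<xi>))" for v
  \<comment> \<open>The symmetry is built into the domain of the contraction: it is a closed
    condition respected by the map, so the fixed point is the symbol of a real function.\<close>
  define H where "H = {v :: (real \<times> (real^2)) \<Rightarrow>\<^sub>C complex. \<forall>t \<xi>. apply_bcontfun v (t, - \<xi>) = cnj (apply_bcontfun v (t, \<xi>))}"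
  define S where "S = cball 0 R \<inter> H"
  have Ffam: "fam 1 T (\<lambda>t \<xi>. lin g t \<xi> + cubic (unscaled v) t \<xi>) (r + cubic_const * (norm v) ^ 3)" for v
    by (intro fam_add lin_fam g cubic_fam unscaled_fam)
  have Fapp: "apply_bcontfun (F v) = rescaled (\<lambda>t \<xi>. lin g t \<xi> + cubic (unscaled v) t \<xi>)" for v
    unfolding F_def by (rule Bcontfun_inverse[OF rescaled_bcontfun(1)[OF Ffam]])
  have herm: "hermitian (unscaled v t)" if "v \<in> H" for v t
    using that by (simp add: H_def hermitian_def unscaled_def)
  have FS: "F v \<in> S" if v: "v \<in> S" for v
  proof -
    have nv: "norm v \<le> R" "v \<in> H" using v by (auto simp: S_def)
    have "norm (F v) \<le> r + cubic_const * (norm v) ^ 3"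
      by (rule norm_bound) (unfold Fapp, rule rescaled_bcontfun(2)[OF Ffam])
    also have "\<dots> \<le> r + cubic_const * R ^ 3"
      using nv cubic_const_nonneg by (intro add_left_mono mult_left_mono power_mono) auto
    \<comment> \<open>The contraction constant is reused: the cubic term is at most
      \<open>R / 6\<close>, and \<open>r + R / 6\<close> stays below
      \<open>R = 2 * r\<close>.\<close>
    also have "cubic_const * R ^ 3 = (3 * cubic_const * R\<^sup>2) * R / 3" by (simp add: power2_eq_square power3_eq_cube)
    also have "\<dots> \<le> (1 / 2) * R / 3"
      using small r unfolding R_def by (intro divide_right_mono mult_right_mono) auto
    also have "r + (1 / 2) * R / 3 \<le> R" using r by (simp add: R_def)
    finally have "F v \<in> cball 0 R" by simp
    moreover have "F v \<in> H"
      unfolding H_def mem_Collect_eq Fapp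
    proof (intro allI)
      fix t \<xi>
      let ?s = "max 0 (min T t)"
      have s: "?s \<in> {0..T}" using T0 by auto
      have "hermitian (cubic (unscaled v) ?s)"
        unfolding cubic_def
        by (intro kg_op_hermitian[OF wave_op_fam[OF unscaled_fam unscaled_fam] unscaled_fam _ _ s] wave_op_hermitian[OF unscaled_fam] herm nv)
      moreover have "lin g ?s (- \<xi>) = cnj (lin g ?s \<xi>)" using g(2) by (simp add: lin_def hermitian_def)
      ultimately show "rescaled (\<lambda>t \<xi>. lin g t \<xi> + cubic (unscaled v) t \<xi>) (t, - \<xi>) = cnj (rescaled (\<lambda>t \<xi>. lin g t \<xi> + cubic (unscaled v) t \<xi>) (t, \<xi>))"
        by (simp add: rescaled_def hermitian_def)
    qed
    ultimately show ?thesis by (simp add: S_def)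
  qed
  have lip: "dist (F v) (F w) \<le> 1 / 2 * dist v w" if vw: "v \<in> S" "w \<in> S" for v w
  proof (rule dist_bound)
    fix p :: "real \<times> (real^2)"
    let ?s = "max 0 (min T (fst p))"
    have s: "?s \<in> {0..T}" using T0 by auto
    have fR: "fam 1 T (unscaled v) R" if "norm v \<le> R" for v
      using unscaled_fam[of v] that unfolding fam_def by (meson order_trans)
    have "unscaled (v - w) = (\<lambda>t \<xi>. unscaled v t \<xi> - unscaled w t \<xi>)"
      by (intro ext) (simp add: unscaled_def diff_divide_distrib minus_bcontfun.rep_eq)
    then have d: "fam 1 T (\<lambda>t \<xi>. unscaled v t \<xi> - unscaled w t \<xi>) (dist v w)"
      using unscaled_fam[of "v - w"] by (simp add: dist_norm)
    have v: "norm v \<le> R" and w: "norm w \<le> R" using vw by (auto simp: S_def)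
    note cd = famD[OF cubic_diff[OF fR[OF v] fR[OF w] d] s, of "snd p"]
    have "dist (apply_bcontfun (F v) p) (apply_bcontfun (F w) p)
      = (1 + norm (snd p)) ^ 1 * wt (snd p) * cmod (cubic (unscaled v) ?s (snd p) - cubic (unscaled w) ?s (snd p))"
    proof -
      have "rescaled (\<lambda>t \<xi>. lin g t \<xi> + cubic (unscaled v) t \<xi>) p - rescaled (\<lambda>t \<xi>. lin g t \<xi> + cubic (unscaled w) t \<xi>) p
        = of_real ((1 + norm (snd p)) * wt (snd p)) * (cubic (unscaled v) ?s (snd p) - cubic (unscaled w) ?s (snd p))"
        by (simp add: rescaled_def algebra_simps)
      then show ?thesis
        unfolding Fapp dist_norm using scale_pos[of "snd p"] by (simp only: norm_mult norm_of_real power_one_right abs_of_pos)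
    qed
    also have "\<dots> \<le> (3 * cubic_const * R\<^sup>2) * dist v w" using cd by (simp only: mult.assoc)
    also have "\<dots> \<le> 1 / 2 * dist v w" using small unfolding R_def by (intro mult_right_mono) auto
    finally show "dist (apply_bcontfun (F v) p) (apply_bcontfun (F w) p) \<le> 1 / 2 * dist v w" .
  qed
  have ev: "continuous_on UNIV (\<lambda>v :: (real \<times> (real^2)) \<Rightarrow>\<^sub>C complex. apply_bcontfun v p)" for p
    unfolding continuous_on_iff using dist_bounded le_less_trans by blast
  have "closed H"
    unfolding H_def by (intro closed_Collect_all closed_Collect_eq continuous_on_cnj ev)
  then have cS: "closed S" unfolding S_def by (intro closed_Int closed_cball)
  have "0 \<in> S" using r by (simp add: S_def H_def R_def)
  then have "\<exists>!v\<in>S. F v = v"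
    using FS lip by (intro Banach_fix[where c = "1 / 2"] complete_eq_closed[THEN iffD2, OF cS]) auto
  then obtain v where v: "v \<in> S" "F v = v" by blast
  show thesis
  proof (rule that[of "unscaled v"])
    have "norm v \<le> 2 * r" using v by (simp add: S_def R_def)
    then show "fam 1 T (unscaled v) (2 * r)" using unscaled_fam[of v] unfolding fam_def by (meson order_trans)
    show "hermitian (unscaled v t)" for t using herm v by (simp add: S_def)
    fix t \<xi> assume t: "t \<in> {0..T}"
    have "unscaled v t \<xi> = rescaled (\<lambda>t \<xi>. lin g t \<xi> + cubic (unscaled v) t \<xi>) (t, \<xi>) / of_real ((1 + norm \<xi>) * wt \<xi>)"
      using v(2) Fapp[of v] unfolding unscaled_def by simp
    also have "\<dots> = lin g t \<xi> + cubic (unscaled v) t \<xi>"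
    proof -
      have "max 0 (min T t) = t" using t by simp
      then show ?thesis
        by (simp only: rescaled_def fst_conv snd_conv nonzero_mult_div_cancel_left[OF scale_neq_0])
    qed
    finally show "unscaled v t \<xi> = lin g t \<xi> + cubic (unscaled v) t \<xi>" .
  qed
qed

end


section \<open>Regularity of the solution\<close>

text \<open>The part of \<open>tame\<close> without Lipschitz bounds. The latter are recovered in
  \<open>tame_of_derivative\<close> from a time derivative that is itself
  \<open>udec\<close>.\<close>

definition udec :: "real \<Rightarrow> (real \<Rightarrow> real^2 \<Rightarrow> complex) \<Rightarrow> bool" where
  "udec T a \<longleftrightarrow> (\<forall>m. \<exists>C. \<forall>t\<in>{0..T}. decays m (a t) C)"

lemma udec_fam: "fam m T a A \<Longrightarrow> udec T a"
  unfolding udec_def using fam_decays by blast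

lemma udec_add:
  assumes "udec T a" "udec T b"
  shows "udec T (\<lambda>t \<xi>. a t \<xi> + b t \<xi>)"
  unfolding udec_def
proof
  fix m
  obtain A where "\<forall>t\<in>{0..T}. decays m (a t) A" using assms(1) unfolding udec_def by metis
  moreover obtain B where "\<forall>t\<in>{0..T}. decays m (b t) B" using assms(2) unfolding udec_def by metis
  ultimately show "\<exists>C. \<forall>t\<in>{0..T}. decays m (\<lambda>\<xi>. a t \<xi> + b t \<xi>) C"
    by (intro exI[of _ "A + B"] ballI decays_add) auto
qed

lemma udec_mult:
  assumes "\<And>t \<xi>. t \<in> {0..T} \<Longrightarrow> cmod (p t \<xi>) \<le> K * (1 + norm \<xi>) ^ k" "udec T a"
  shows "udec T (\<lambda>t \<xi>. p t \<xi> * a t \<xi>)"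
  unfolding udec_def
proof
  fix m
  obtain C where "\<forall>t\<in>{0..T}. decays (k + m) (a t) C" using assms(2) unfolding udec_def by metis
  then show "\<exists>C. \<forall>t\<in>{0..T}. decays m (\<lambda>\<xi>. p t \<xi> * a t \<xi>) C"
    using assms(1) by (intro exI[of _ "K * C"] ballI decays_mult) auto
qed

lemma udec_conv:
  assumes a: "fam k T a A" and b: "fam l T b B"
  shows "udec T (\<lambda>t. conv (a t) (b t))"
  unfolding udec_def
  using decays_conv[OF rapid_measurable[OF fam_rapid[OF a]] fam_decays[OF a] rapid_measurable[OF fam_rapid[OF b]] fam_decays[OF b]]
  by blast

lemma udec_osc:
  assumes k: "continuous_on UNIV k" "\<And>x. \<bar>k x\<bar> \<le> 1" and h: "\<And>\<xi>. continuous_on {0..T} (\<lambda>\<tau>. h \<tau> \<xi>)" "udec T h"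
  shows "udec T (\<lambda>t \<xi>. osc k (\<omega> \<xi>) (\<lambda>\<tau>. h \<tau> \<xi>) t)"
  unfolding udec_def
proof
  fix m
  obtain C where C: "\<forall>t\<in>{0..T}. decays m (h t) C" using h(2) unfolding udec_def by metis
  have "decays m (\<lambda>\<xi>. osc k (\<omega> \<xi>) (\<lambda>\<tau>. h \<tau> \<xi>) t) (C * T)" if t: "t \<in> {0..T}" for t
    unfolding decays_def
  proof
    fix \<xi> :: "real^2"
    define q where "q = (1 + norm \<xi>) ^ m"
    have q: "0 \<le> q" by (simp add: q_def)
    have "q * cmod (osc k (\<omega> \<xi>) (\<lambda>\<tau>. h \<tau> \<xi>) t) = cmod (osc k (\<omega> \<xi>) (\<lambda>\<tau>. of_real q * h \<tau> \<xi>) t)"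
      unfolding osc_cmult using q by (simp add: norm_mult)
    also have "\<dots> \<le> C * T"
    proof (rule osc_bound[OF k _ _ t])
      show "continuous_on {0..T} (\<lambda>\<tau>. of_real q * h \<tau> \<xi>)" by (intro continuous_intros h)
      fix \<tau> assume "\<tau> \<in> {0..T}"
      then have "q * cmod (h \<tau> \<xi>) \<le> C" unfolding q_def using C by (intro decaysD) auto
      then show "cmod (of_real q * h \<tau> \<xi>) \<le> C" using q by (simp add: norm_mult)
    qed
    finally show "(1 + norm \<xi>) ^ m * cmod (osc k (\<omega> \<xi>) (\<lambda>\<tau>. h \<tau> \<xi>) t) \<le> C * T" by (simp add: q_def)
  qed
  then show "\<exists>C. \<forall>t\<in>{0..T}. decays m (\<lambda>\<xi>. osc k (\<omega> \<xi>) (\<lambda>\<tau>. h \<tau> \<xi>) t) C" by blast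
qed

text \<open>The mean value inequality at each frequency, with the decay weight kept in the
  derivative bound.\<close>

lemma tame_of_derivative:
  assumes "\<And>t. t \<in> {0..T} \<Longrightarrow> continuous_on UNIV (a t)" "\<And>t. t \<in> {0..T} \<Longrightarrow> hermitian (a t)"
    and "udec T a" "has_td T a b" "udec T b"
  shows "tame T a"
  unfolding tame_def
proof (intro conjI ballI allI)
  fix m
  obtain A where A: "\<forall>t\<in>{0..T}. decays m (a t) A" using assms(3) unfolding udec_def by metis
  obtain B where B: "\<forall>t\<in>{0..T}. decays m (b t) B" using assms(5) unfolding udec_def by metis
  have "decays m (\<lambda>\<xi>. a \<tau> \<xi> - a t \<xi>) (max A B * \<bar>\<tau> - t\<bar>)" if t: "t \<in> {0..T}" "\<tau> \<in> {0..T}" for t \<tau>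
    unfolding decays_def
  proof
    fix \<xi> :: "real^2"
    define q where "q = (1 + norm \<xi>) ^ m"
    have q: "0 < q" unfolding q_def by (intro zero_less_power add_pos_nonneg) auto
    have "norm (a \<tau> \<xi> - a t \<xi>) \<le> (B / q) * norm (\<tau> - t)"
    proof (rule differentiable_bound[of "{0..T}" "\<lambda>t. a t \<xi>" "\<lambda>\<sigma> h. h *\<^sub>R b \<sigma> \<xi>"])
      fix \<sigma> assume \<sigma>: "\<sigma> \<in> {0..T}"
      then show "((\<lambda>t. a t \<xi>) has_derivative (\<lambda>h. h *\<^sub>R b \<sigma> \<xi>)) (at \<sigma> within {0..T})"
        using assms(4) unfolding has_td_def has_vector_derivative_def by blast
      have "q * cmod (b \<sigma> \<xi>) \<le> B" unfolding q_def using B \<sigma> by (intro decaysD) auto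
      then have *: "cmod (b \<sigma> \<xi>) \<le> B / q" using q by (simp add: pos_le_divide_eq mult.commute)
      show "onorm (\<lambda>h. h *\<^sub>R b \<sigma> \<xi>) \<le> B / q"
      proof (rule onorm_le)
        fix h :: real
        show "norm (h *\<^sub>R b \<sigma> \<xi>) \<le> B / q * norm h"
          unfolding norm_scaleR using mult_left_mono[OF *, of "\<bar>h\<bar>"] by (simp only: mult.commute real_norm_def abs_ge_zero)
      qed
    qed (use t in auto)
    then have "q * norm (a \<tau> \<xi> - a t \<xi>) \<le> B * \<bar>\<tau> - t\<bar>" using q by (simp add: field_simps)
    also have "\<dots> \<le> max A B * \<bar>\<tau> - t\<bar>" by (intro mult_right_mono) auto
    finally show "(1 + norm \<xi>) ^ m * cmod (a \<tau> \<xi> - a t \<xi>) \<le> max A B * \<bar>\<tau> - t\<bar>" by (simp add: q_def)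
  qed
  moreover have "decays m (a t) (max A B)" if "t \<in> {0..T}" for t
    by (rule decays_mono[OF A[rule_format, OF that] max.cobounded1])
  ultimately show "\<exists>C. (\<forall>t\<in>{0..T}. decays m (a t) C) \<and>
    (\<forall>t\<in>{0..T}. \<forall>\<tau>\<in>{0..T}. decays m (\<lambda>\<xi>. a \<tau> \<xi> - a t \<xi>) (C * \<bar>\<tau> - t\<bar>))" by blast
qed (use assms in auto)

lemma multiplier_real: "continuous_on UNIV f \<Longrightarrow> (\<And>\<xi>. f (- \<xi>) = f \<xi>) \<Longrightarrow> (\<And>\<xi>. \<bar>f \<xi>\<bar> \<le> K * (1 + norm \<xi>) ^ k) \<Longrightarrow>
    multiplier (\<lambda>\<xi>. of_real (f \<xi>))"
  unfolding multiplier_def hermitian_def by (intro conjI allI exI) (auto intro: continuous_on_of_real)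

lemma multiplier_const: "multiplier (\<lambda>\<xi>. of_real r)"
  by (rule multiplier_real[where K = "\<bar>r\<bar>" and k = 0]) auto

lemma multiplier_norm_square: "multiplier (\<lambda>\<xi>. of_real (r * (norm \<xi>)\<^sup>2))"
proof (rule multiplier_real[where K = "\<bar>r\<bar>" and k = 2])
  fix \<xi> :: "real^2"
  have "(norm \<xi>)\<^sup>2 \<le> (1 + norm \<xi>)\<^sup>2" by (intro power_mono) auto
  then show "\<bar>r * (norm \<xi>)\<^sup>2\<bar> \<le> \<bar>r\<bar> * (1 + norm \<xi>)\<^sup>2" by (simp add: abs_mult mult_left_mono)
qed (auto intro!: continuous_intros)

context kgz
begin

text \<open>
  The four coefficient functions \<open>u\<close>, \<open>\<partial>\<^sub>t u\<close>, \<open>n\<close>, \<open>\<partial>\<^sub>t n\<close> of a solution of the Duhamel equation form a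
  first order system in time with polynomial multipliers and convolutions, so differentiability in time
  bootstraps.
\<close>

lemma duhamel_system:
  assumes g: "continuous_on UNIV g" "hermitian g" "\<And>\<xi>. (1 + norm \<xi>) * wt \<xi> * cmod (g \<xi>) \<le> A"
    and u: "fam 1 T u B" and hu: "\<And>t. t \<in> {0..T} \<Longrightarrow> hermitian (u t)"
    and eq: "\<And>t \<xi>. t \<in> {0..T} \<Longrightarrow> u t \<xi> = lin g t \<xi> + cubic u t \<xi>"
  defines "n \<equiv> wave_op u u"
  obtains ut nt where
    "tame T u" "tame T ut" "tame T n" "tame T nt"
    "has_td T u ut" "has_td T n nt"
    "has_td T ut (\<lambda>t \<xi>. of_real (- 1) * u t \<xi> + (of_real (- 1 * (norm \<xi>)\<^sup>2) * u t \<xi> + of_real (- (1 / (2 * pi))) * conv (n t) (u t) \<xi>))"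
    "has_td T nt (\<lambda>t \<xi>. of_real (- c\<^sup>2 * (norm \<xi>)\<^sup>2) * n t \<xi> + of_real (- (1 / (2 * pi)) * (norm \<xi>)\<^sup>2) * conv (u t) (u t) \<xi>)"
    "u 0 = g" "ut 0 = (\<lambda>\<xi>. 0)" "n 0 = (\<lambda>\<xi>. 0)" "nt 0 = (\<lambda>\<xi>. 0)"
proof -
  have u0: "fam 0 T u B" by (rule fam_1_0[OF u])
  have n: "fam 0 T n (wave_const * B * B)" unfolding n_def by (rule wave_op_fam[OF u u])
  have hn: "hermitian (n t)" if "t \<in> {0..T}" for t unfolding n_def by (rule wave_op_hermitian[OF u hu that])
  have z: "0 \<in> {0..T}" using T0 by simp
  define h where "h t = conv (n t) (u t)" for t
  define k where "k t = conv (u t) (u t)" for t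
  have jh: "jcont T h" and jk: "jcont T k"
    unfolding h_def[abs_def] k_def[abs_def] by (rule conv_jcont[OF n u0 T0], rule conv_jcont[OF u0 u0 T0])
  have dh: "udec T h" and dk: "udec T k"
    unfolding h_def[abs_def] k_def[abs_def] by (rule udec_conv[OF n u0], rule udec_conv[OF u0 u0])
  have hh: "hermitian (h t)" and hk: "hermitian (k t)" if t: "t \<in> {0..T}" for t
    unfolding h_def k_def
    by (rule hermitian_conv[OF fam_rapid[OF n t] fam_rapid[OF u t] hn[OF t] hu[OF t]],
        rule hermitian_conv[OF fam_rapid[OF u t] fam_rapid[OF u t] hu[OF t] hu[OF t]])
  have ch: "continuous_on {0..T} (\<lambda>\<tau>. h \<tau> \<xi>)" and ck: "continuous_on {0..T} (\<lambda>\<tau>. k \<tau> \<xi>)" for \<xi>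
    by (rule jcont_time[OF jh], rule jcont_time[OF jk])
  have cc: "continuous_on UNIV (cos :: real \<Rightarrow> real)" "continuous_on UNIV (sin :: real \<Rightarrow> real)" by (intro continuous_intros)+
  define ut where "ut t \<xi> = of_real (- japanese \<xi> * sin (t * japanese \<xi>)) * g \<xi>
    + of_real (- (1 / (2 * pi))) * osc cos (japanese \<xi>) (\<lambda>\<tau>. h \<tau> \<xi>) t" for t \<xi>
  define nt where "nt t \<xi> = of_real (- (1 / (2 * pi)) * (norm \<xi>)\<^sup>2) * osc cos (c * norm \<xi>) (\<lambda>\<tau>. k \<tau> \<xi>) t" for t \<xi>
  \<comment> \<open>The factor \<open>1 + (norm \<xi>)\<^sup>2\<close> is split and the constants
    are written as \<open>of_real\<close> terms, so that every summand matches
    \<open>multiplier_const\<close> or \<open>multiplier_norm_square\<close> in the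
    bootstrap.\<close>
  define utt where "utt t \<xi> = of_real (- 1) * u t \<xi> + (of_real (- 1 * (norm \<xi>)\<^sup>2) * u t \<xi> + of_real (- (1 / (2 * pi))) * h t \<xi>)" for t \<xi>
  define ntt where "ntt t \<xi> = of_real (- c\<^sup>2 * (norm \<xi>)\<^sup>2) * n t \<xi> + of_real (- (1 / (2 * pi)) * (norm \<xi>)\<^sup>2) * k t \<xi>" for t \<xi>
  have ueq: "u t \<xi> = of_real (cos (t * japanese \<xi>)) * g \<xi> + - of_real (1 / (2 * pi * japanese \<xi>)) * osc sin (japanese \<xi>) (\<lambda>\<tau>. h \<tau> \<xi>) t"
    if "t \<in> {0..T}" for t \<xi>
    using eq[OF that, of \<xi>] by (simp add: lin_def cubic_def kg_op_def h_def n_def)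
  have neq: "n t \<xi> = - of_real (norm \<xi> / (2 * pi * c)) * osc sin (c * norm \<xi>) (\<lambda>\<tau>. k \<tau> \<xi>) t" for t \<xi>
    by (simp add: n_def wave_op_def k_def)
  have td_u: "has_td T u ut"
    unfolding has_td_def
  proof (intro ballI allI)
    fix t and \<xi> :: "real^2" assume t: "t \<in> {0..T}"
    have "((\<lambda>t. of_real (cos (t * japanese \<xi>)) :: complex) has_vector_derivative of_real (- japanese \<xi> * sin (t * japanese \<xi>))) (at t within {0..T})"
      by (rule has_vector_derivative_of_real) (auto intro!: derivative_eq_intros)
    from has_vector_derivative_add[OF has_vector_derivative_mult_left[OF this, of "g \<xi>"]
        has_vector_derivative_mult_right[OF osc_derivative(1)[OF ch[of \<xi>] t, of "japanese \<xi>"], of "- of_real (1 / (2 * pi * japanese \<xi>))"]]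
    have d: "((\<lambda>t. of_real (cos (t * japanese \<xi>)) * g \<xi> + - of_real (1 / (2 * pi * japanese \<xi>)) * osc sin (japanese \<xi>) (\<lambda>\<tau>. h \<tau> \<xi>) t)
      has_vector_derivative of_real (- japanese \<xi> * sin (t * japanese \<xi>)) * g \<xi> +
        - of_real (1 / (2 * pi * japanese \<xi>)) * (of_real (japanese \<xi>) * osc cos (japanese \<xi>) (\<lambda>\<tau>. h \<tau> \<xi>) t)) (at t within {0..T})" .
    have "- of_real (1 / (2 * pi * japanese \<xi>)) * (of_real (japanese \<xi>) * z) = of_real (- (1 / (2 * pi))) * z" for z :: complex
      using japanese_pos[of \<xi>] by simp
    then have e: "of_real (- japanese \<xi> * sin (t * japanese \<xi>)) * g \<xi> +
        - of_real (1 / (2 * pi * japanese \<xi>)) * (of_real (japanese \<xi>) * osc cos (japanese \<xi>) (\<lambda>\<tau>. h \<tau> \<xi>) t) = ut t \<xi>"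
      by (simp only: ut_def)
    show "((\<lambda>\<tau>. u \<tau> \<xi>) has_vector_derivative ut t \<xi>) (at t within {0..T})"
      by (rule has_vector_derivative_transform[OF t _ d[unfolded e]]) (rule ueq)
  qed
  have td_ut: "has_td T ut utt"
    unfolding has_td_def
  proof (intro ballI allI)
    fix t and \<xi> :: "real^2" assume t: "t \<in> {0..T}"
    have d1: "((\<lambda>t. of_real (- japanese \<xi> * sin (t * japanese \<xi>)) :: complex) has_vector_derivative of_real (- (1 + (norm \<xi>)\<^sup>2) * cos (t * japanese \<xi>))) (at t within {0..T})"
      unfolding japanese_square[symmetric]
      by (rule has_vector_derivative_of_real) (auto intro!: derivative_eq_intros simp: power2_eq_square)
    from has_vector_derivative_add[OF has_vector_derivative_mult_left[OF this, of "g \<xi>"]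
        has_vector_derivative_mult_right[OF osc_derivative(2)[OF ch[of \<xi>] t, of "japanese \<xi>"], of "of_real (- (1 / (2 * pi)))"]]
    have d: "((\<lambda>t. ut t \<xi>) has_vector_derivative of_real (- (1 + (norm \<xi>)\<^sup>2) * cos (t * japanese \<xi>)) * g \<xi> +
        of_real (- (1 / (2 * pi))) * (h t \<xi> - of_real (japanese \<xi>) * osc sin (japanese \<xi>) (\<lambda>\<tau>. h \<tau> \<xi>) t)) (at t within {0..T})"
      by (simp only: ut_def)
    have e: "of_real (- (1 + (norm \<xi>)\<^sup>2) * cos (t * japanese \<xi>)) * g \<xi> +
        of_real (- (1 / (2 * pi))) * (h t \<xi> - of_real (japanese \<xi>) * osc sin (japanese \<xi>) (\<lambda>\<tau>. h \<tau> \<xi>) t) = utt t \<xi>"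
    proof -
      have "of_real (1 / (2 * pi)) * of_real (japanese \<xi>) * z = - (of_real (- (1 + (norm \<xi>)\<^sup>2)) * of_real (1 / (2 * pi * japanese \<xi>)) * z)" for z :: complex
        unfolding japanese_square[symmetric] using japanese_pos[of \<xi>] by (simp add: power2_eq_square)
      note this[of "osc sin (japanese \<xi>) (\<lambda>\<tau>. h \<tau> \<xi>) t"]
      then show ?thesis unfolding utt_def ueq[OF t] by (simp add: algebra_simps del: of_real_divide)
    qed
    show "((\<lambda>\<tau>. ut \<tau> \<xi>) has_vector_derivative utt t \<xi>) (at t within {0..T})" using d unfolding e .
  qed
  have td_n: "has_td T n nt"
    unfolding has_td_def
  proof (intro ballI allI)
    fix t and \<xi> :: "real^2" assume t: "t \<in> {0..T}"
    have "- of_real (norm \<xi> / (2 * pi * c)) * (of_real (c * norm \<xi>) * z) = of_real (- (1 / (2 * pi)) * (norm \<xi>)\<^sup>2) * z" for z :: complex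
      using c by (simp add: power2_eq_square)
    with has_vector_derivative_mult_right[OF osc_derivative(1)[OF ck[of \<xi>] t, of "c * norm \<xi>"], of "- of_real (norm \<xi> / (2 * pi * c))"]
    show "((\<lambda>\<tau>. n \<tau> \<xi>) has_vector_derivative nt t \<xi>) (at t within {0..T})" by (simp only: neq nt_def)
  qed
  have td_nt: "has_td T nt ntt"
    unfolding has_td_def
  proof (intro ballI allI)
    fix t and \<xi> :: "real^2" assume t: "t \<in> {0..T}"
    have "of_real (- (1 / (2 * pi)) * (norm \<xi>)\<^sup>2) * (w - of_real (c * norm \<xi>) * z)
      = of_real (- c\<^sup>2 * (norm \<xi>)\<^sup>2) * (- of_real (norm \<xi> / (2 * pi * c)) * z) + of_real (- (1 / (2 * pi)) * (norm \<xi>)\<^sup>2) * w" for w z :: complex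
      using c by (simp add: power2_eq_square field_simps)
    with has_vector_derivative_mult_right[OF osc_derivative(2)[OF ck[of \<xi>] t, of "c * norm \<xi>"], of "of_real (- (1 / (2 * pi)) * (norm \<xi>)\<^sup>2)"]
    show "((\<lambda>\<tau>. nt \<tau> \<xi>) has_vector_derivative ntt t \<xi>) (at t within {0..T})" by (simp only: nt_def ntt_def neq)
  qed
  have one: "\<bar>cos x\<bar> \<le> 1" "\<bar>sin x\<bar> \<le> 1" for x :: real by simp_all
  have gr: "rapid g" using fam_rapid[OF lin_fam[OF g(1,3)] z] by (simp add: lin_def[abs_def])
  then have dg: "udec T (\<lambda>t. g)" unfolding udec_def rapid_decays by blast
  have d_ut: "udec T ut"
    unfolding ut_def[abs_def]
  proof (intro udec_add)
    show "udec T (\<lambda>t \<xi>. of_real (- japanese \<xi> * sin (t * japanese \<xi>)) * g \<xi>)"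
    proof (rule udec_mult[where K = 1 and k = 1, OF _ dg])
      fix t \<xi>
      have "japanese \<xi> * \<bar>sin (t * japanese \<xi>)\<bar> \<le> (1 + norm \<xi>) * 1"
        using japanese_pos[of \<xi>] japanese_le[of \<xi>] by (intro mult_mono) auto
      then show "cmod (of_real (- japanese \<xi> * sin (t * japanese \<xi>))) \<le> 1 * (1 + norm \<xi>) ^ 1"
        unfolding norm_of_real using japanese_pos[of \<xi>] by (simp add: abs_mult)
    qed
    show "udec T (\<lambda>t \<xi>. of_real (- (1 / (2 * pi))) * osc cos (japanese \<xi>) (\<lambda>\<tau>. h \<tau> \<xi>) t)"
      by (rule udec_mult[where K = "1 / (2 * pi)" and k = 0]) (auto intro!: udec_osc cc one ch dh simp: norm_divide norm_mult)
  qed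
  have nsq: "cmod (of_real (r * (norm \<xi>)\<^sup>2)) \<le> \<bar>r\<bar> * (1 + norm \<xi>) ^ 2" for r and \<xi> :: "real^2"
  proof -
    have "(norm \<xi>)\<^sup>2 \<le> (1 + norm \<xi>)\<^sup>2" by (intro power_mono) auto
    then show ?thesis unfolding norm_of_real abs_mult by (intro mult_mono) auto
  qed
  have d_nt: "udec T nt"
    unfolding nt_def[abs_def] by (rule udec_mult[OF nsq]) (intro udec_osc cc one ck dk)
  have d_utt: "udec T utt"
    unfolding utt_def[abs_def]
    by (intro udec_add udec_mult[where K = 1 and k = 0 and a = u] udec_mult[OF nsq] udec_mult[where K = "1 / (2 * pi)" and k = 0 and a = h] udec_fam[OF u] dh)
      (auto simp: norm_divide norm_mult)
  have d_ntt: "udec T ntt"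
    unfolding ntt_def[abs_def] by (intro udec_add udec_mult[OF nsq] udec_fam[OF n] dk)
  have j_ut: "jcont T ut"
    unfolding ut_def[abs_def]
  proof (intro jcont_add jcont_mult osc_jcont cc japanese_continuous jh T0 continuous_on_const)
    show "jcont T (\<lambda>t \<xi>. of_real (- japanese \<xi> * sin (t * japanese \<xi>)) * g \<xi>)"
      unfolding jcont_def
      by (intro continuous_intros continuous_on_compose2[OF japanese_continuous] continuous_on_compose2[OF g(1)]) auto
  qed
  have j_nt: "jcont T nt"
    unfolding nt_def[abs_def] by (intro jcont_mult osc_jcont cc jk T0 continuous_intros)
  have osc_herm: "osc cos w (\<lambda>\<tau>. f \<tau> (- \<xi>)) t = cnj (osc cos w (\<lambda>\<tau>. f \<tau> \<xi>) t)"
    if "\<And>t. t \<in> {0..T} \<Longrightarrow> hermitian (f t)" "t \<in> {0..T}" for w and f :: "real \<Rightarrow> real^2 \<Rightarrow> complex" and t \<xi>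
    unfolding osc_cnj using that by (intro osc_cong) (auto simp: hermitian_def)
  have h_ut: "hermitian (ut t)" if t: "t \<in> {0..T}" for t
    using osc_herm[OF hh t] g(2) by (simp add: hermitian_def ut_def)
  have h_nt: "hermitian (nt t)" if t: "t \<in> {0..T}" for t
    using osc_herm[OF hk t] by (simp add: hermitian_def nt_def)
  show thesis
  proof (rule that[of ut nt])
    show "tame T u" by (rule tame_of_derivative[OF jcont_space[OF fam_jcont[OF u]] hu udec_fam[OF u] td_u d_ut])
    show "tame T ut" by (rule tame_of_derivative[OF jcont_space[OF j_ut] h_ut d_ut td_ut d_utt])
    show "tame T n" by (rule tame_of_derivative[OF jcont_space[OF fam_jcont[OF n]] hn udec_fam[OF n] td_n d_nt])
    show "tame T nt" by (rule tame_of_derivative[OF jcont_space[OF j_nt] h_nt d_nt td_nt d_ntt])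
    show "has_td T ut (\<lambda>t \<xi>. of_real (- 1) * u t \<xi> + (of_real (- 1 * (norm \<xi>)\<^sup>2) * u t \<xi> + of_real (- (1 / (2 * pi))) * conv (n t) (u t) \<xi>))"
      using td_ut unfolding utt_def[abs_def] h_def .
    show "has_td T nt (\<lambda>t \<xi>. of_real (- c\<^sup>2 * (norm \<xi>)\<^sup>2) * n t \<xi> + of_real (- (1 / (2 * pi)) * (norm \<xi>)\<^sup>2) * conv (u t) (u t) \<xi>)"
      using td_nt unfolding ntt_def[abs_def] k_def .
    show "u 0 = g" by (rule ext) (simp add: ueq[OF z] osc_0)
    show "ut 0 = (\<lambda>\<xi>. 0)" "n 0 = (\<lambda>\<xi>. 0)" "nt 0 = (\<lambda>\<xi>. 0)"
      by (rule ext, simp add: ut_def nt_def neq osc_0)+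
  qed (fact td_u td_n)+
qed

lemma duhamel_smooth_solution:
  assumes g: "continuous_on UNIV g" "hermitian g" "\<And>\<xi>. (1 + norm \<xi>) * wt \<xi> * cmod (g \<xi>) \<le> A"
    and u: "fam 1 T u B" and hu: "\<And>t. t \<in> {0..T} \<Longrightarrow> hermitian (u t)"
    and eq: "\<And>t \<xi>. t \<in> {0..T} \<Longrightarrow> u t \<xi> = lin g t \<xi> + cubic u t \<xi>"
  shows "smooth_solution c T (dist_of (synth g), 0, 0, 0) (\<lambda>t. synth (u t)) (\<lambda>t. synth (wave_op u u t))"
proof -
  let ?n = "wave_op u u"
  obtain ut nt where tame: "tame T u" "tame T ut" "tame T ?n" "tame T nt"
    and td: "has_td T u ut" "has_td T ?n nt"
      "has_td T ut (\<lambda>t \<xi>. of_real (- 1) * u t \<xi> + (of_real (- 1 * (norm \<xi>)\<^sup>2) * u t \<xi> + of_real (- (1 / (2 * pi))) * conv (?n t) (u t) \<xi>))"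
      "has_td T nt (\<lambda>t \<xi>. of_real (- c\<^sup>2 * (norm \<xi>)\<^sup>2) * ?n t \<xi> + of_real (- (1 / (2 * pi)) * (norm \<xi>)\<^sup>2) * conv (u t) (u t) \<xi>)"
    and init: "u 0 = g" "ut 0 = (\<lambda>\<xi>. 0)" "?n 0 = (\<lambda>\<xi>. 0)" "nt 0 = (\<lambda>\<xi>. 0)"
    by (rule duhamel_system[OF g u hu eq])
  let ?utt = "\<lambda>t \<xi>. of_real (- 1) * u t \<xi> + (of_real (- 1 * (norm \<xi>)\<^sup>2) * u t \<xi> + of_real (- (1 / (2 * pi))) * conv (?n t) (u t) \<xi>)"
  let ?ntt = "\<lambda>t \<xi>. of_real (- c\<^sup>2 * (norm \<xi>)\<^sup>2) * ?n t \<xi> + of_real (- (1 / (2 * pi)) * (norm \<xi>)\<^sup>2) * conv (u t) (u t) \<xi>"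
  have rhs: "ctame k T ?utt \<and> ctame k T ?ntt" if "ctame k T u" "ctame k T ?n" for k
    using that by (intro conjI ctame_add ctame_mult multiplier_const multiplier_norm_square ctame_conv)
  \<comment> \<open>The time derivative of each of the four families is another of them or one of
    \<open>?utt\<close> and \<open>?ntt\<close>, which are polynomial expressions in the families.
    One order of regularity is gained per round.\<close>
  have all: "ctame k T u \<and> ctame k T ut \<and> ctame k T ?n \<and> ctame k T nt" for k
  proof (induction k)
    case (Suc k)
    then show ?case using rhs[of k] tame td by auto
  qed (simp add: tame)
  have tame2: "tame T ?utt" "tame T ?ntt"
    using rhs[of 0] tame by simp_all
  note ru = tame_rapid[OF tame(1)] and rn = tame_rapid[OF tame(3)]
    and hu = tame_hermitian[OF tame(1)] and hn = tame_hermitian[OF tame(3)]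
  have cu: "smooth_curve T (\<lambda>t. synth (u t))" and cn: "smooth_curve T (\<lambda>t. synth (?n t))"
    unfolding smooth_curve_def using all ctame_curve smooth_synth[OF ru] smooth_synth[OF rn] by blast+
  have d0: "dist_of (\<lambda>x. 0) = 0" by (simp add: dist_of_def fun_eq_iff)
  have s0: "synth (\<lambda>\<xi>. 0) = (\<lambda>x. 0)" by (simp add: synth_def[abs_def] inv_fourier_def)
  have nsq: "rapid (\<lambda>\<xi>. of_real (r * (norm \<xi>)\<^sup>2) * f \<xi>)" if "rapid f" for r f
    using multiplier_norm_square[of r] that unfolding multiplier_def by (auto intro: rapid_mult)
  have pde1: "synth (?utt t) x - laplace (synth (u t)) x + synth (u t) x = - (synth (?n t) x * synth (u t) x)" if t: "t \<in> {0..T}" for t x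
  proof -
    have "inv_fourier (?utt t) x = of_real (- 1) * inv_fourier (u t) x + (inv_fourier (\<lambda>\<xi>. of_real (- 1 * (norm \<xi>)\<^sup>2) * u t \<xi>) x
      + of_real (- (1 / (2 * pi))) * inv_fourier (conv (?n t) (u t)) x)"
      using ru[OF t] rn[OF t]
      by (simp only: inv_fourier_add rapid_integrable rapid_add rapid_cmult nsq rapid_conv inv_fourier_cmult)
    also have "of_real (- (1 / (2 * pi))) * inv_fourier (conv (?n t) (u t)) x = - of_real (synth (?n t) x * synth (u t) x)"
      unfolding inv_fourier_conv[OF rn[OF t] ru[OF t]] inv_fourier_hermitian[OF rn[OF t] hn[OF t]] inv_fourier_hermitian[OF ru[OF t] hu[OF t]]
      by simp
    finally have "synth (?utt t) x = - synth (u t) x + (synth (\<lambda>\<xi>. of_real (- 1 * (norm \<xi>)\<^sup>2) * u t \<xi>) x - synth (?n t) x * synth (u t) x)"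
      by (simp add: synth_def)
    moreover have "laplace (synth (u t)) x = synth (\<lambda>\<xi>. of_real (- 1 * (norm \<xi>)\<^sup>2) * u t \<xi>) x"
      using laplace_synth[OF ru[OF t], of x] by simp
    ultimately show ?thesis by simp
  qed
  have pde2: "synth (?ntt t) x - c\<^sup>2 * laplace (synth (?n t)) x = laplace (\<lambda>y. \<bar>synth (u t) y\<bar>\<^sup>2) x" if t: "t \<in> {0..T}" for t x
  proof -
    \<comment> \<open>The symbol of the square of \<open>synth (u t)\<close>, so that its Laplacian
      can be read off by \<open>laplace_synth\<close>.\<close>
    let ?q = "\<lambda>\<xi>. of_real (1 / (2 * pi)) * conv (u t) (u t) \<xi>"
    have q: "rapid ?q" by (intro rapid_cmult rapid_conv ru t)
    have "(\<lambda>y. \<bar>synth (u t) y\<bar>\<^sup>2) = synth ?q"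
    proof
      fix y
      have "inv_fourier ?q y = of_real (synth (u t) y * synth (u t) y)"
        unfolding inv_fourier_cmult inv_fourier_conv[OF ru[OF t] ru[OF t]] inv_fourier_hermitian[OF ru[OF t] hu[OF t]] by simp
      then show "\<bar>synth (u t) y\<bar>\<^sup>2 = synth ?q y" unfolding synth_def[of ?q] by (simp add: power2_eq_square)
    qed
    then have r: "laplace (\<lambda>y. \<bar>synth (u t) y\<bar>\<^sup>2) x = synth (\<lambda>\<xi>. - of_real ((norm \<xi>)\<^sup>2) * ?q \<xi>) x"
      using laplace_synth[OF q, of x] by simp
    have "?ntt t = (\<lambda>\<xi>. of_real (c\<^sup>2) * (- of_real ((norm \<xi>)\<^sup>2) * ?n t \<xi>) + - of_real ((norm \<xi>)\<^sup>2) * ?q \<xi>)"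
      by (simp add: fun_eq_iff algebra_simps)
    moreover have "rapid (\<lambda>\<xi>. - of_real ((norm \<xi>)\<^sup>2) * f \<xi>)" if "rapid f" for f
      using nsq[OF that, of "-1"] by simp
    ultimately have "inv_fourier (?ntt t) x = of_real (c\<^sup>2) * inv_fourier (\<lambda>\<xi>. - of_real ((norm \<xi>)\<^sup>2) * ?n t \<xi>) x + inv_fourier (\<lambda>\<xi>. - of_real ((norm \<xi>)\<^sup>2) * ?q \<xi>) x"
      using rn[OF t] q by (simp only: inv_fourier_add rapid_integrable rapid_cmult inv_fourier_cmult)
    then have "synth (?ntt t) x = c\<^sup>2 * synth (\<lambda>\<xi>. - of_real ((norm \<xi>)\<^sup>2) * ?n t \<xi>) x + synth (\<lambda>\<xi>. - of_real ((norm \<xi>)\<^sup>2) * ?q \<xi>) x"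
    proof -
      have R: "Re (of_real r * z) = r * Re z" for r z by simp
      show ?thesis unfolding synth_def using \<open>inv_fourier _ x = _\<close> by (simp only: plus_complex.sel R)
    qed
    then show ?thesis unfolding r laplace_synth[OF rn[OF t]] by simp
  qed
  show ?thesis
    unfolding smooth_solution_def
  proof (rule conjI[OF cu conjI[OF cn]], rule exI[of _ "\<lambda>t. synth (ut t)"], rule exI[of _ "\<lambda>t. synth (?utt t)"],
      rule exI[of _ "\<lambda>t. synth (nt t)"], rule exI[of _ "\<lambda>t. synth (?ntt t)"], intro conjI ballI allI)
    fix t x assume t: "t \<in> {0..T}"
    show "((\<lambda>\<tau>. synth (u \<tau>) x) has_real_derivative synth (ut t) x) (at t within {0..T})"
      by (rule has_td_synth_derivative[OF tame(1,2) td(1) t])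
    show "((\<lambda>\<tau>. synth (ut \<tau>) x) has_real_derivative synth (?utt t) x) (at t within {0..T})"
      by (rule has_td_synth_derivative[OF tame(2) tame2(1) td(3) t])
    show "((\<lambda>\<tau>. synth (?n \<tau>) x) has_real_derivative synth (nt t) x) (at t within {0..T})"
      by (rule has_td_synth_derivative[OF tame(3,4) td(2) t])
    show "((\<lambda>\<tau>. synth (nt \<tau>) x) has_real_derivative synth (?ntt t) x) (at t within {0..T})"
      by (rule has_td_synth_derivative[OF tame(4) tame2(2) td(4) t])
    show "synth (?utt t) x - laplace (synth (u t)) x + synth (u t) x = - (synth (?n t) x * synth (u t) x)"
      by (rule pde1[OF t])
    show "synth (?ntt t) x - c\<^sup>2 * laplace (synth (?n t)) x = laplace (\<lambda>y. \<bar>synth (u t) y\<bar>\<^sup>2) x"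
      by (rule pde2[OF t])
  qed (simp add: init s0 d0)
qed

end


section \<open>The quadratic response of the wave component\<close>

lemma normed_points_data: "normed_points (data_space s)"
  unfolding data_space_def by (intro normed_points_prod normed_points_sobolev)

lemma normed_points_solution: "T > 0 \<Longrightarrow> normed_points (solution_space s T)"
  unfolding solution_space_def
  by (intro normed_points_prod normed_points_inter normed_points_Ck_space normed_points_sobolev)

text \<open>Evaluation of the wave component at the final time is bounded on the target space. Only
  its continuity with values of order \<open>s\<close> is tested.\<close>

lemma solution_space_wave_component:
  assumes T: "T > 0" and y: "y \<in> points (solution_space s T)"
  shows "snd y T \<in> points (sobolev s)"
    and "nrm (sobolev s) (snd y T) \<le> nrm (solution_space s T) y"
proof -
  let ?A = "inter_space (Ck_space 0 T (sobolev (s + 1))) (Ck_space 1 T (sobolev s))"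
  let ?B = "inter_space (Ck_space 0 T (sobolev s)) (Ck_space 1 T (sobolev (s - 1)))"
  have yB: "snd y \<in> points ?B" using y by (auto simp: solution_space_def prod_space_def)
  then have yC: "snd y \<in> points (C_space T (sobolev s))" and yC1: "snd y \<in> points (Ck_space 1 T (sobolev (s - 1)))"
    by (simp_all add: inter_space_def)
  interpret C1: normed_points "Ck_space 1 T (sobolev (s - 1))"
    by (rule normed_points_Ck_space[OF normed_points_sobolev T])
  have TT: "T \<in> {0..T}" using T by simp
  show "snd y T \<in> points (sobolev s)" using yC TT by (simp add: C_space_def)
  have "nrm (sobolev s) (snd y T) \<le> nrm (C_space T (sobolev s)) (snd y)"
    by (rule C_space_nrm_ge[OF normed_points_sobolev yC TT])
  also have "\<dots> \<le> nrm ?B (snd y)" using C1.nrm_nonneg[OF yC1] by (simp add: inter_space_def)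
  also have "\<dots> \<le> \<bar>nrm ?B (snd y)\<bar>" by simp
  also have "\<dots> \<le> nrm (solution_space s T) y"
    unfolding solution_space_def prod_space_def nspace.simps split_beta by (rule real_sqrt_ge_abs2)
  finally show "nrm (sobolev s) (snd y T) \<le> nrm (solution_space s T) y" .
qed

text \<open>The test functional: the mass of the transform over a frequency window. The real part
  makes it real-valued, as the comparison of quadratic coefficients requires.\<close>

definition loc :: "(real^2) set \<Rightarrow> dist \<Rightarrow> real" where
  "loc E F = Re (\<integral>\<xi>. indicat_real E \<xi> *\<^sub>R fourier_of F \<xi> \<partial>lborel)"

lemma loc_eq:
  assumes F: "has_fourier F g" and [measurable]: "E \<in> sets borel"
  shows "loc E F = Re (\<integral>\<xi>. indicat_real E \<xi> *\<^sub>R g \<xi> \<partial>lborel)"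
proof -
  have [measurable]: "g \<in> borel_measurable borel" "fourier_of F \<in> borel_measurable borel"
    using F fourier_of_AE(1)[OF F] by (auto intro: has_fourier_measurable)
  have "(\<integral>\<xi>. indicat_real E \<xi> *\<^sub>R fourier_of F \<xi> \<partial>lborel) = (\<integral>\<xi>. indicat_real E \<xi> *\<^sub>R g \<xi> \<partial>lborel)"
  proof (rule integral_cong_AE)
    show "AE \<xi> in lborel. indicat_real E \<xi> *\<^sub>R fourier_of F \<xi> = indicat_real E \<xi> *\<^sub>R g \<xi>"
      using fourier_of_AE(2)[OF F] by eventually_elim simp
  qed measurable
  then show ?thesis by (simp add: loc_def)
qed

lemma loc_linear:
  assumes E: "E \<in> sets borel" "integrable lborel (\<lambda>\<xi>. indicat_real E \<xi> * sobolev_weight (- \<sigma>) \<xi>)"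
    and F: "F \<in> points (sobolev \<sigma>)" and G: "G \<in> points (sobolev \<sigma>)"
  shows "loc E (F + G) = loc E F + loc E G" and "loc E (r *\<^sub>R F) = r * loc E F"
    and "\<bar>loc E F\<bar> \<le> sqrt (\<integral>\<xi>. indicat_real E \<xi> * sobolev_weight (- \<sigma>) \<xi> \<partial>lborel) * nrm (sobolev \<sigma>) F"
proof -
  obtain f where f: "has_fourier F f" "integrable lborel (\<lambda>\<xi>. sobolev_weight \<sigma> \<xi> * (cmod (f \<xi>))\<^sup>2)"
    by (rule sobolev_points_fourier[OF F])
  obtain g where g: "has_fourier G g" "integrable lborel (\<lambda>\<xi>. sobolev_weight \<sigma> \<xi> * (cmod (g \<xi>))\<^sup>2)"
    by (rule sobolev_points_fourier[OF G])
  note If = sobolev_localized_functional[OF E F f(1)] and Ig = sobolev_localized_functional[OF E G g(1)]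
  show "loc E (F + G) = loc E F + loc E G"
    unfolding loc_eq[OF f(1) E(1)] loc_eq[OF g(1) E(1)] loc_eq[OF has_fourier_add[OF f(1) g(1)] E(1)]
    using If(1) Ig(1) by (simp add: scaleR_add_right)
  have "(\<integral>\<xi>. indicat_real E \<xi> *\<^sub>R (r *\<^sub>R f \<xi>) \<partial>lborel) = r *\<^sub>R (\<integral>\<xi>. indicat_real E \<xi> *\<^sub>R f \<xi> \<partial>lborel)"
    by (simp only: scaleR_left_commute integral_scaleR_right)
  then show "loc E (r *\<^sub>R F) = r * loc E F"
    unfolding loc_eq[OF f(1) E(1)] loc_eq[OF has_fourier_scale[OF f(1)] E(1)] by simp
  show "\<bar>loc E F\<bar> \<le> sqrt (\<integral>\<xi>. indicat_real E \<xi> * sobolev_weight (- \<sigma>) \<xi> \<partial>lborel) * nrm (sobolev \<sigma>) F"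
    unfolding loc_eq[OF f(1) E(1)] by (rule order_trans[OF abs_Re_le_cmod If(2)])
qed

lemma dist_of_synth_scale: "dist_of (synth (\<lambda>\<xi>. of_real r * g \<xi>)) = r *\<^sub>R dist_of (synth g)"
proof -
  have "synth (\<lambda>\<xi>. of_real r * g \<xi>) = (\<lambda>x. r * synth g x)"
    by (simp add: synth_def inv_fourier_cmult fun_eq_iff)
  then show ?thesis
    by (simp add: dist_of_def fun_eq_iff scaleR_fun_def scaleR_conv_of_real mult.assoc)
qed

context kgz
begin

text \<open>The quadratic coefficient of the wave component at time \<open>T\<close>: the Duhamel
  integral of the free wave with itself.\<close>

definition response :: "(real^2 \<Rightarrow> complex) \<Rightarrow> real^2 \<Rightarrow> complex" where
  "response g = wave_op (lin g) (lin g) T"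

lemma lin_scale: "lin (\<lambda>\<xi>. of_real r * g \<xi>) = (\<lambda>t \<xi>. of_real r * lin g t \<xi>)"
  by (simp add: lin_def fun_eq_iff)

lemma response_scale: "response (\<lambda>\<xi>. of_real r * g \<xi>) \<xi> = of_real (r\<^sup>2) * response g \<xi>"
  unfolding response_def wave_op_def lin_scale conv_cmult_left conv_cmult_right osc_cmult
  by (simp add: power2_eq_square)

lemma fam_response:
  assumes "continuous_on UNIV g" "\<And>\<xi>. (1 + norm \<xi>) * wt \<xi> * cmod (g \<xi>) \<le> A"
  shows "rapid (response g)"
  unfolding response_def using T0 by (intro fam_rapid[OF wave_op_fam[OF lin_fam[OF assms] lin_fam[OF assms]]]) simp

text \<open>The solution differs from the free wave by a term of order \<open>r ^ 3\<close>, so the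
  wave component differs from its quadratic part by order \<open>r ^ 4\<close>. For
  \<open>r \<le> 1\<close> this is weakened to the cubic remainder that
  \<open>C2_quadratic_coefficient_bound\<close> accepts.\<close>

lemma solution_expansion:
  assumes g: "continuous_on UNIV g" "hermitian g" "\<And>\<xi>. (1 + norm \<xi>) * wt \<xi> * cmod (g \<xi>) \<le> A"
    and r: "0 \<le> r" "r \<le> 1" "3 * cubic_const * (2 * (r * A))\<^sup>2 \<le> 1 / 2" and E: "E \<in> sets borel"
  shows "\<exists>u n. smooth_solution c T (r *\<^sub>R (dist_of (synth g), 0, 0, 0)) u n \<and>
    \<bar>loc E (curve_of T n T) - r\<^sup>2 * Re (\<integral>\<xi>. indicat_real E \<xi> *\<^sub>R response g \<xi> \<partial>lborel)\<bar>
      \<le> 24 * wave_const * cubic_const * A ^ 4 * decay_mass * r ^ 3"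
proof -
  let ?g = "\<lambda>\<xi>. of_real r * g \<xi>"
  have A: "0 \<le> A" using order_trans[OF _ g(3)[of 0]] wt_pos[of 0] by simp
  have g': "continuous_on UNIV ?g" "hermitian ?g" using g by (auto intro!: continuous_intros simp: hermitian_def)
  have gA: "(1 + norm \<xi>) * wt \<xi> * cmod (?g \<xi>) \<le> r * A" for \<xi>
    using mult_left_mono[OF g(3)[of \<xi>] r(1)] r(1) by (simp add: norm_mult mult_ac)
  obtain u where u: "fam 1 T u (2 * (r * A))" "\<And>t. t \<in> {0..T} \<Longrightarrow> hermitian (u t)"
    "\<And>t \<xi>. t \<in> {0..T} \<Longrightarrow> u t \<xi> = lin ?g t \<xi> + cubic u t \<xi>"
    using small_solution[OF g' gA r(3)] by metis
  define n where "n = wave_op u u"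
  have sol: "smooth_solution c T (r *\<^sub>R (dist_of (synth g), 0, 0, 0)) (\<lambda>t. synth (u t)) (\<lambda>t. synth (n t))"
    using duhamel_smooth_solution[OF g' gA u] by (simp add: dist_of_synth_scale n_def)
  have z: "T \<in> {0..T}" using T0 by simp
  have fn: "fam 0 T n (wave_const * (2 * (r * A)) * (2 * (r * A)))" unfolding n_def by (rule wave_op_fam[OF u(1) u(1)])
  have hn: "hermitian (n T)" unfolding n_def by (rule wave_op_hermitian[OF u(1,2) z])
  have "has_fourier (curve_of T (\<lambda>t. synth (n t)) T) (n T)"
    using dist_of_synth(1)[OF fam_rapid[OF fn z] hn] z by (simp add: curve_of_def)
  from loc_eq[OF this E] have locn: "loc E (curve_of T (\<lambda>t. synth (n t)) T) = Re (\<integral>\<xi>. indicat_real E \<xi> *\<^sub>R n T \<xi> \<partial>lborel)" .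
  note fl = lin_fam[OF g'(1) gA]
  have "fam 1 T (\<lambda>t \<xi>. u t \<xi> - lin ?g t \<xi>) (cubic_const * (2 * (r * A)) ^ 3)"
    by (rule fam_cong[OF cubic_fam[OF u(1)]]) (simp add: u(3))
  from wave_op_square_diff[OF u(1) fl this]
  have fd: "fam 0 T (\<lambda>t \<xi>. n t \<xi> - wave_op (lin ?g) (lin ?g) t \<xi>)
    (wave_const * (cubic_const * (2 * (r * A)) ^ 3) * (2 * (r * A)) + wave_const * (r * A) * (cubic_const * (2 * (r * A)) ^ 3))"
    unfolding n_def .
  define D where "D = 24 * wave_const * cubic_const * A ^ 4"
  have D: "0 \<le> D" using consts_nonneg cubic_const_nonneg A by (simp add: D_def)
  \<comment> \<open>The \<open>24\<close> is \<open>16 + 8\<close>: a cubic difference of size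
    \<open>8\<close> times \<open>cubic_const * (r * A) ^ 3\<close> meets the solution of size
    \<open>2 * (r * A)\<close> in one term and the free wave of size \<open>r * A\<close> in the
    other.\<close>
  have Deq: "wave_const * (cubic_const * (2 * (r * A)) ^ 3) * (2 * (r * A)) + wave_const * (r * A) * (cubic_const * (2 * (r * A)) ^ 3)
    = D * r ^ 4"
    by (simp add: D_def power3_eq_cube power4_eq_xxxx)
  define d where "d \<xi> = n T \<xi> - of_real (r\<^sup>2) * response g \<xi>" for \<xi>
  have rn: "rapid (n T)" by (rule fam_rapid[OF fn z])
  have rr: "rapid (\<lambda>\<xi>. of_real (r\<^sup>2) * response g \<xi>)" by (intro rapid_cmult fam_response[OF g(1,3)])
  have rd: "rapid d" unfolding d_def[abs_def] by (rule rapid_diff[OF rn rr])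
  have ind: "integrable lborel (\<lambda>\<xi>. indicat_real E \<xi> *\<^sub>R f \<xi>)" if "rapid f" for f :: "real^2 \<Rightarrow> complex"
    using integrable_mult_indicator[OF _ rapid_integrable[OF that]] E by simp
  have "Re (\<integral>\<xi>. indicat_real E \<xi> *\<^sub>R d \<xi> \<partial>lborel)
    = loc E (curve_of T (\<lambda>t. synth (n t)) T) - r\<^sup>2 * Re (\<integral>\<xi>. indicat_real E \<xi> *\<^sub>R response g \<xi> \<partial>lborel)"
  proof -
    have "(\<integral>\<xi>. indicat_real E \<xi> *\<^sub>R d \<xi> \<partial>lborel) = (\<integral>\<xi>. indicat_real E \<xi> *\<^sub>R n T \<xi> - of_real (r\<^sup>2) * (indicat_real E \<xi> *\<^sub>R response g \<xi>) \<partial>lborel)"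
      by (rule Bochner_Integration.integral_cong) (simp_all add: d_def scaleR_diff_right)
    also have "\<dots> = (\<integral>\<xi>. indicat_real E \<xi> *\<^sub>R n T \<xi> \<partial>lborel) - of_real (r\<^sup>2) * (\<integral>\<xi>. indicat_real E \<xi> *\<^sub>R response g \<xi> \<partial>lborel)"
      by (simp only: Bochner_Integration.integral_diff[OF ind[OF rn] integrable_mult_right[OF ind[OF fam_response[OF g(1,3)]]]]
          integral_mult_right_zero)
    finally show ?thesis unfolding locn by (simp only: minus_complex.sel Re_complex_of_real Im_complex_of_real times_complex.sel mult_zero_left diff_zero)
  qed
  moreover have "cmod (\<integral>\<xi>. indicat_real E \<xi> *\<^sub>R d \<xi> \<partial>lborel) \<le> (D * r ^ 4) * decay_mass"
  proof -
    have [measurable]: "d \<in> borel_measurable borel" "E \<in> sets borel" using rapid_measurable[OF rd] E by auto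
    have "(1 + norm \<xi>) ^ 4 * norm (indicat_real E \<xi> *\<^sub>R d \<xi>) \<le> D * r ^ 4" for \<xi>
    proof -
      have "wave_op (lin ?g) (lin ?g) T \<xi> = of_real (r\<^sup>2) * response g \<xi>"
        using response_scale[of r g \<xi>] by (simp add: response_def)
      then have "wt \<xi> * cmod (d \<xi>) \<le> D * r ^ 4"
        using famD[OF fd z, of \<xi>] unfolding Deq d_def by simp
      moreover have "(1 + norm \<xi>) ^ 4 * norm (indicat_real E \<xi> *\<^sub>R d \<xi>) \<le> wt \<xi> * cmod (d \<xi>)"
        using wt_ge[of \<xi>] wt_pos[of \<xi>] by (intro mult_mono) (auto simp: indicator_def)
      ultimately show ?thesis by linarith
    qed
    then show ?thesis by (intro order_trans[OF integral_norm_bound integral_le_decay_mass]) auto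
  qed
  moreover have "(D * r ^ 4) * decay_mass \<le> D * decay_mass * r ^ 3"
  proof -
    have "r ^ 4 \<le> r ^ 3" using r by (intro power_decreasing) auto
    then have "D * decay_mass * r ^ 4 \<le> D * decay_mass * r ^ 3" using D decay_mass_nonneg by (intro mult_left_mono) auto
    then show ?thesis by (simp add: mult_ac)
  qed
  ultimately have "\<bar>loc E (curve_of T (\<lambda>t. synth (n t)) T) - r\<^sup>2 * Re (\<integral>\<xi>. indicat_real E \<xi> *\<^sub>R response g \<xi> \<partial>lborel)\<bar>
      \<le> D * decay_mass * r ^ 3"
    using abs_Re_le_cmod[of "\<integral>\<xi>. indicat_real E \<xi> *\<^sub>R d \<xi> \<partial>lborel"] by linarith
  then show ?thesis using sol unfolding D_def by blast
qed

text \<open>The essential point is that \<open>K\<close> does not depend on \<open>A\<close>. The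
  weight bound \<open>A\<close> of concentrated data grows exponentially with the frequency, but it
  only restricts the \<open>r\<close> for which a solution is constructed.\<close>

definition response_bounded :: "real \<Rightarrow> real \<Rightarrow> bool" where
  "response_bounded s K \<longleftrightarrow> (\<forall>g A E. continuous_on UNIV g \<longrightarrow> hermitian g \<longrightarrow> (\<forall>\<xi>. (1 + norm \<xi>) * wt \<xi> * cmod (g \<xi>) \<le> A) \<longrightarrow>
    nrm (sobolev (s + 1)) (dist_of (synth g)) \<le> 1 \<longrightarrow> E \<in> sets borel \<longrightarrow>
    integrable lborel (\<lambda>\<xi>. indicat_real E \<xi> * sobolev_weight (- s) \<xi>) \<longrightarrow>
    \<bar>Re (\<integral>\<xi>. indicat_real E \<xi> *\<^sub>R response g \<xi> \<partial>lborel)\<bar>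
      \<le> K * sqrt (\<integral>\<xi>. indicat_real E \<xi> * sobolev_weight (- s) \<xi> \<partial>lborel))"

lemma response_bound:
  assumes C2: "C2_on (data_space s) (solution_space s T) (unit_ball (data_space s)) \<Phi>"
    and map: "data_to_solution_map c s T \<Phi>"
  shows "\<exists>K. response_bounded s K"
proof (rule C2_quadratic_coefficient_bound[OF normed_points_data normed_points_solution[OF T] C2])
  let ?X = "data_space s" and ?Y = "solution_space s T"
  fix K assume "K \<ge> 0" and K: "\<And>d \<phi> L q M e. d \<in> points ?X \<Longrightarrow> nrm ?X d \<le> 1 \<Longrightarrow>
      (\<And>x y. x \<in> points ?Y \<Longrightarrow> y \<in> points ?Y \<Longrightarrow> \<phi> (x + y) = \<phi> x + \<phi> y) \<Longrightarrow>
      (\<And>r x. x \<in> points ?Y \<Longrightarrow> \<phi> (r *\<^sub>R x) = r * \<phi> x) \<Longrightarrow>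
      (\<And>x. x \<in> points ?Y \<Longrightarrow> \<bar>\<phi> x\<bar> \<le> L * nrm ?Y x) \<Longrightarrow> L \<ge> 0 \<Longrightarrow> 0 < e \<Longrightarrow>
      (\<And>r. 0 \<le> r \<Longrightarrow> r < e \<Longrightarrow> \<bar>\<phi> (\<Phi> (r *\<^sub>R d)) - r\<^sup>2 * q\<bar> \<le> M * r ^ 3) \<Longrightarrow> \<bar>q\<bar> \<le> K * L"
  show ?thesis
    unfolding response_bounded_def
  proof (intro exI[of _ K] allI impI)
    fix g A E
    assume g: "continuous_on UNIV g" "hermitian g" "\<forall>\<xi>. (1 + norm \<xi>) * wt \<xi> * cmod (g \<xi>) \<le> A"
      and n1: "nrm (sobolev (s + 1)) (dist_of (synth g)) \<le> 1"
      and E: "E \<in> sets borel" "integrable lborel (\<lambda>\<xi>. indicat_real E \<xi> * sobolev_weight (- s) \<xi>)"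
    have gA: "\<And>\<xi>. (1 + norm \<xi>) * wt \<xi> * cmod (g \<xi>) \<le> A" using g(3) by simp
    have z: "0 \<in> {0..T}" using T0 by simp
    have rg: "rapid g" using fam_rapid[OF lin_fam[OF g(1) gA] z] by (simp add: lin_def[abs_def])
    define d :: "dist \<times> dist \<times> dist \<times> dist" where "d = (dist_of (synth g), 0, 0, 0)"
    have sm: "r *\<^sub>R d \<in> smooth_data" for r
      using dist_of_synth_sobolev[OF rg g(2)] normed_points.scale_in[OF normed_points_sobolev] normed_points.zero_in[OF normed_points_sobolev]
      by (simp add: smooth_data_def d_def Let_def)
    have dX: "d \<in> points ?X"
      using dist_of_synth_sobolev[OF rg g(2)] normed_points.zero_in[OF normed_points_sobolev]
      by (simp add: data_space_def prod_space_def d_def)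
    have dn: "nrm ?X d \<le> 1"
      using n1 normed_points.nrm_0[OF normed_points_sobolev] normed_points.nrm_nonneg[OF normed_points_sobolev dist_of_synth_sobolev[OF rg g(2)]]
      by (simp add: data_space_def prod_space_def d_def)
    define \<phi> where "\<phi> y = loc E (snd y T)" for y :: "(real \<Rightarrow> dist) \<times> (real \<Rightarrow> dist)"
    define L where "L = sqrt (\<integral>\<xi>. indicat_real E \<xi> * sobolev_weight (- s) \<xi> \<partial>lborel)"
    have L: "L \<ge> 0" unfolding L_def by (intro real_sqrt_ge_zero integral_nonneg_AE) auto
    note comp = solution_space_wave_component[OF T]
    \<comment> \<open>Since \<open>r\<^sup>2 \<le> r < e\<close>, the product
      \<open>24 * cubic_const * A\<^sup>2 * r\<^sup>2\<close> is at most \<open>1\<close>, which is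
      twice the smallness condition of the fixed point argument.\<close>
    define e where "e = 1 / (1 + 24 * cubic_const * A\<^sup>2)"
    have cA: "0 \<le> cubic_const * A\<^sup>2" using cubic_const_nonneg by simp
    have e: "0 < e" "e \<le> 1" using cA by (simp_all add: e_def)
    have "\<bar>Re (\<integral>\<xi>. indicat_real E \<xi> *\<^sub>R response g \<xi> \<partial>lborel)\<bar> \<le> K * L"
    proof (rule K[of d \<phi> L e _ "24 * wave_const * cubic_const * A ^ 4 * decay_mass", OF dX dn])
      show "\<phi> (x + y) = \<phi> x + \<phi> y" if "x \<in> points ?Y" "y \<in> points ?Y" for x y
        unfolding \<phi>_def using loc_linear(1)[OF E comp(1)[OF that(1)] comp(1)[OF that(2)]] by simp
      show "\<phi> (r *\<^sub>R x) = r * \<phi> x" if "x \<in> points ?Y" for r x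
        unfolding \<phi>_def using loc_linear(2)[OF E comp(1)[OF that] comp(1)[OF that], of r] by (simp add: scaleR_fun_def)
      show "\<bar>\<phi> x\<bar> \<le> L * nrm ?Y x" if "x \<in> points ?Y" for x
        unfolding \<phi>_def L_def
        by (rule order_trans[OF loc_linear(3)[OF E comp(1)[OF that] comp(1)[OF that]] mult_left_mono[OF comp(2)[OF that]]])
          (use L in \<open>simp add: L_def\<close>)
      fix r assume r: "0 \<le> r" "r < e"
      have r1: "r < 1" using r e by simp
      have sml: "3 * cubic_const * (2 * (r * A))\<^sup>2 \<le> 1 / 2"
      proof -
        have "r\<^sup>2 \<le> r" using r r1 by (simp add: power2_eq_square mult_left_le)
        then have "(24 * cubic_const * A\<^sup>2) * r\<^sup>2 \<le> (24 * cubic_const * A\<^sup>2) * e"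
          using r cA by (intro mult_left_mono) auto
        also have "\<dots> \<le> 1" using cA by (simp add: e_def field_simps)
        finally show ?thesis by (simp add: power_mult_distrib mult_ac)
      qed
      obtain u n where un: "smooth_solution c T (r *\<^sub>R (dist_of (synth g), 0, 0, 0)) u n"
        "\<bar>loc E (curve_of T n T) - r\<^sup>2 * Re (\<integral>\<xi>. indicat_real E \<xi> *\<^sub>R response g \<xi> \<partial>lborel)\<bar>
          \<le> 24 * wave_const * cubic_const * A ^ 4 * decay_mass * r ^ 3"
        using solution_expansion[OF g(1,2) gA r(1) less_imp_le[OF r1] sml E(1)] by (elim exE conjE)
      have "r *\<^sub>R d \<in> unit_ball ?X"
      proof -
        have "r * nrm ?X d \<le> r" using r dn normed_points.nrm_nonneg[OF normed_points_data dX] by (simp add: mult_left_le)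
        then show ?thesis
          using r r1 normed_points.nrm_scale[OF normed_points_data dX, of r] normed_points.scale_in[OF normed_points_data dX, of r]
          by (simp add: unit_ball_def)
      qed
      then have "\<Phi> (r *\<^sub>R d) = (curve_of T u, curve_of T n)"
        using map[unfolded data_to_solution_map_def, rule_format, OF IntI[OF _ sm]] un(1) by (simp add: d_def)
      then show "\<bar>\<phi> (\<Phi> (r *\<^sub>R d)) - r\<^sup>2 * Re (\<integral>\<xi>. indicat_real E \<xi> *\<^sub>R response g \<xi> \<partial>lborel)\<bar>
        \<le> 24 * wave_const * cubic_const * A ^ 4 * decay_mass * r ^ 3"
        using un(2) by (simp add: \<phi>_def)
    qed (use L e in auto)
    then show "\<bar>Re (\<integral>\<xi>. indicat_real E \<xi> *\<^sub>R response g \<xi> \<partial>lborel)\<bar>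
      \<le> K * sqrt (\<integral>\<xi>. indicat_real E \<xi> * sobolev_weight (- s) \<xi> \<partial>lborel)" by (simp add: L_def)
  qed
qed

end


section \<open>Resonant lower bound\<close>

text \<open>The bound does not involve \<open>T\<close>: a phase whose frequency stays away from
  zero contributes only its boundary terms.\<close>

lemma integral_sin_linear_le:
  fixes \<phi> \<nu> T :: real
  assumes "T \<ge> 0" "0 < m" "m \<le> \<bar>\<nu>\<bar>"
  shows "\<bar>integral {0..T} (\<lambda>\<tau>. sin (\<phi> - \<nu> * \<tau>))\<bar> \<le> 2 / m"
proof -
  have \<nu>: "\<nu> \<noteq> 0" using assms by auto
  have "((\<lambda>\<tau>. sin (\<phi> - \<nu> * \<tau>)) has_integral (cos (\<phi> - \<nu> * T) / \<nu> - cos (\<phi> - \<nu> * 0) / \<nu>)) {0..T}"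
    using \<nu> by (intro fundamental_theorem_of_calculus assms(1))
      (auto intro!: derivative_eq_intros simp: has_real_derivative_iff_has_vector_derivative[symmetric])
  then have "integral {0..T} (\<lambda>\<tau>. sin (\<phi> - \<nu> * \<tau>)) = (cos (\<phi> - \<nu> * T) - cos \<phi>) / \<nu>"
    by (simp add: integral_unique diff_divide_distrib)
  moreover have "\<bar>(cos (\<phi> - \<nu> * T) - cos \<phi>) / \<nu>\<bar> \<le> 2 / m"
    unfolding abs_divide
  proof (rule frac_le)
    show "\<bar>cos (\<phi> - \<nu> * T) - cos \<phi>\<bar> \<le> 2"
      using abs_cos_le_one[of "\<phi> - \<nu> * T"] abs_cos_le_one[of \<phi>] by linarith
  qed (use assms in auto)
  ultimately show ?thesis by simp
qed

text \<open>Around a maximum the sine is the cosine of the displacement, and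
  \<open>1 < pi / 3\<close>.\<close>

lemma half_le_sin_near_peak:
  fixes y :: real
  assumes "\<bar>y - (pi / 2 + 2 * real j * pi)\<bar> \<le> 1"
  shows "1 / 2 \<le> sin y"
proof -
  define e where "e = y - (pi / 2 + 2 * real j * pi)"
  have "sin y = sin ((pi / 2 + e) + 2 * real j * pi)" by (simp add: e_def)
  also have "\<dots> = cos e" unfolding sin_add sin_2npi cos_2npi by simp
  finally have "sin y = cos \<bar>e\<bar>" by simp
  moreover have "cos (pi / 3) \<le> cos \<bar>e\<bar>"
    using assms pi_gt3 by (intro cos_monotone_0_pi_le) (auto simp: e_def)
  ultimately show ?thesis by (simp add: cos_60)
qed

text \<open>Product-to-sum formulas give four sines with frequencies \<open>k - (a - b)\<close>,
  \<open>k + (a - b)\<close>, \<open>k - (a + b)\<close> and \<open>k + (a + b)\<close>. The first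
  is nearly stationary and stays near its peak throughout, giving at least \<open>T / 2\<close>; the
  other three oscillate and cost at most \<open>2 / m\<close> each.\<close>

lemma resonant_time_integral:
  fixes a b k T :: real
  assumes T: "T > 0" and m: "m > 0" "m \<le> k + (a - b)" "m \<le> a + b - k" "m \<le> a + b + k"
    and res: "\<bar>k * T - (pi / 2 + 2 * real j * pi)\<bar> + \<bar>k - (a - b)\<bar> * T \<le> 1"
  shows "(T / 2 - 6 / m) / 4 \<le> integral {0..T} (\<lambda>\<tau>. sin (k * (T - \<tau>)) * (cos (\<tau> * a) * cos (\<tau> * b)))"
proof -
  define S where "S \<nu> \<tau> = sin (k * T - \<nu> * \<tau>)" for \<nu> \<tau>
  have I: "S \<nu> integrable_on {0..T}" for \<nu>
    unfolding S_def[abs_def] by (intro integrable_continuous_interval continuous_intros)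
  have eq: "sin (k * (T - \<tau>)) * (cos (\<tau> * a) * cos (\<tau> * b))
      = (S (k - (a - b)) \<tau> + (S (k + (a - b)) \<tau> + (S (k - (a + b)) \<tau> + S (k + (a + b)) \<tau>))) / 4" for \<tau>
  proof -
    have "S (k - (a - b)) \<tau> = sin (k * (T - \<tau>) + (a - b) * \<tau>)" "S (k + (a - b)) \<tau> = sin (k * (T - \<tau>) - (a - b) * \<tau>)"
      "S (k - (a + b)) \<tau> = sin (k * (T - \<tau>) + (a + b) * \<tau>)" "S (k + (a + b)) \<tau> = sin (k * (T - \<tau>) - (a + b) * \<tau>)"
      unfolding S_def by (simp_all add: algebra_simps)
    moreover have "cos (\<tau> * a) * cos (\<tau> * b) = (cos ((a - b) * \<tau>) + cos ((a + b) * \<tau>)) / 2"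
      by (simp add: cos_times_cos algebra_simps)
    moreover have "sin x * ((cos p + cos q) / 2) = (sin (x + p) + (sin (x - p) + (sin (x + q) + sin (x - q)))) / 4" for x p q :: real
      by (simp add: sin_add sin_diff field_simps)
    ultimately show ?thesis by (simp only:)
  qed
  have "integral {0..T} (\<lambda>\<tau>. sin (k * (T - \<tau>)) * (cos (\<tau> * a) * cos (\<tau> * b)))
      = (integral {0..T} (S (k - (a - b))) + (integral {0..T} (S (k + (a - b)))
        + (integral {0..T} (S (k - (a + b))) + integral {0..T} (S (k + (a + b)))))) / 4"
    unfolding eq by (simp add: I integrable_add integral_add)
  moreover have "\<bar>integral {0..T} (S (k + (a - b)))\<bar> \<le> 2 / m"
    unfolding S_def[abs_def] using m T by (intro integral_sin_linear_le) auto
  moreover have "\<bar>integral {0..T} (S (k - (a + b)))\<bar> \<le> 2 / m"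
    unfolding S_def[abs_def] using m T by (intro integral_sin_linear_le) auto
  moreover have "\<bar>integral {0..T} (S (k + (a + b)))\<bar> \<le> 2 / m"
    unfolding S_def[abs_def] using m T by (intro integral_sin_linear_le) auto
  moreover have "T / 2 \<le> integral {0..T} (S (k - (a - b)))"
  proof -
    have "integral {0..T} (\<lambda>\<tau>. 1 / 2) \<le> integral {0..T} (S (k - (a - b)))"
    proof (rule integral_le[OF _ I])
      fix \<tau> assume \<tau>: "\<tau> \<in> {0..T}"
      have "\<bar>(k - (a - b)) * \<tau>\<bar> \<le> \<bar>k - (a - b)\<bar> * T"
        using \<tau> by (simp add: abs_mult mult_left_mono)
      then show "1 / 2 \<le> S (k - (a - b)) \<tau>" unfolding S_def
        using res by (intro half_le_sin_near_peak[of _ j]) linarith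
    qed (rule integrable_const_ivl)
    then show ?thesis using T by simp
  qed
  ultimately show ?thesis by (simp only: abs_le_iff) (simp add: field_simps)
qed

text \<open>A transversal square \<open>z\<close> enters the root only as
  \<open>z / (2 * \<bar>x\<bar>)\<close>. The condition \<open>d \<le> X / 2\<close> keeps
  \<open>\<bar>x\<bar>\<close> above \<open>X / 2\<close>, so this is at most
  \<open>q / X\<close>.\<close>

lemma abs_sqrt_sum_squares_le:
  fixes x z X d q :: real
  assumes "\<bar>\<bar>x\<bar> - X\<bar> \<le> d" "d \<le> X / 2" "0 < X" "0 \<le> z" "z \<le> q"
  shows "\<bar>sqrt (x\<^sup>2 + z) - X\<bar> \<le> d + q / X"
proof -
  have x: "X / 2 \<le> \<bar>x\<bar>" "0 < \<bar>x\<bar>" using assms by linarith+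
  have "sqrt (x\<^sup>2 + z) \<le> \<bar>x\<bar> + z / (2 * \<bar>x\<bar>)"
  proof (rule real_le_lsqrt)
    have "x\<^sup>2 + z \<le> x\<^sup>2 + z + (z / (2 * \<bar>x\<bar>))\<^sup>2" by simp
    also have "\<dots> = (\<bar>x\<bar> + z / (2 * \<bar>x\<bar>))\<^sup>2" using x by (simp add: power2_sum)
    finally show "x\<^sup>2 + z \<le> (\<bar>x\<bar> + z / (2 * \<bar>x\<bar>))\<^sup>2" .
  qed (use assms in simp)
  moreover have "z / (2 * \<bar>x\<bar>) \<le> q / X"
    using assms x by (intro frac_le) auto
  moreover have "\<bar>x\<bar> \<le> sqrt (x\<^sup>2 + z)" using assms by (intro real_le_rsqrt) simp
  ultimately show ?thesis using assms(1) by linarith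
qed

section \<open>Rectangles, bumps and weights on frequency annuli\<close>

lemma norm_square_plane: "(norm (\<xi> :: real^2))\<^sup>2 = (\<xi> $ 1)\<^sup>2 + (\<xi> $ 2)\<^sup>2"
  by (simp add: norm_vec_def L2_set_def sum_2)

definition rectangle :: "real \<Rightarrow> real \<Rightarrow> real \<Rightarrow> (real^2) set" where
  "rectangle a l w = {\<xi>. \<bar>\<xi> $ 1 - a\<bar> \<le> l \<and> \<bar>\<xi> $ 2\<bar> \<le> w}"

lemma rectangle_eq_cbox: "rectangle a l w = cbox (vector [a - l, - w]) (vector [a + l, w])"
  by (auto simp: rectangle_def mem_box_cart forall_2 abs_le_iff)

lemma rectangle_sets [measurable]: "rectangle a l w \<in> sets borel"
  by (simp add: rectangle_eq_cbox)

lemma rectangle_measure: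
  assumes "0 \<le> l" "0 \<le> w"
  shows "integrable lborel (\<lambda>\<xi>. indicat_real (rectangle a l w) \<xi>)"
    and "(\<integral>\<xi>. indicat_real (rectangle a l w) \<xi> \<partial>lborel) = (2 * l) * (2 * w)"
proof -
  have ne: "rectangle a l w \<noteq> {}" using assms by (auto simp: rectangle_def intro!: exI[of _ "vector [a, 0]"])
  show "integrable lborel (\<lambda>\<xi>. indicat_real (rectangle a l w) \<xi>)"
    unfolding rectangle_eq_cbox by (intro integrable_real_indicator) (simp_all add: emeasure_lborel_cbox_finite[unfolded infinity_ennreal_def])
  have "(\<integral>\<xi>. indicat_real (rectangle a l w) \<xi> \<partial>lborel) = measure lborel (cbox (vector [a - l, - w]) (vector [a + l, w] :: real^2))"
    by (simp add: rectangle_eq_cbox)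
  also have "\<dots> = (2 * l) * (2 * w)"
    using content_cbox_cart[of "vector [a - l, - w] :: real^2" "vector [a + l, w]"] ne
    by (simp add: rectangle_eq_cbox UNIV_2)
  finally show "(\<integral>\<xi>. indicat_real (rectangle a l w) \<xi> \<partial>lborel) = (2 * l) * (2 * w)" .
qed

text \<open>Symbols have to be continuous to be \<open>rapid\<close>, so indicators of intervals are
  replaced by piecewise linear functions, which stay above \<open>1 / 2\<close> on the half
  interval.\<close>

definition tent :: "real \<Rightarrow> real" where
  "tent x = max 0 (1 - \<bar>x\<bar>)"

definition bump :: "real \<Rightarrow> real \<Rightarrow> real \<Rightarrow> real^2 \<Rightarrow> real" where
  "bump l w a \<xi> = tent ((\<xi> $ 1 - a) / l) * tent (\<xi> $ 2 / w)"

lemma bump_basic: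
  shows "0 \<le> bump l w a \<xi>" and "bump l w a \<xi> \<le> 1" and "bump l w a (- \<xi>) = bump l w (- a) \<xi>"
    and "continuous_on UNIV (bump l w a)"
proof -
  show "0 \<le> bump l w a \<xi>" "bump l w a \<xi> \<le> 1" by (simp_all add: bump_def tent_def mult_le_one)
  have e: "\<bar>- \<xi> $ 1 - a\<bar> = \<bar>\<xi> $ 1 + a\<bar>" by linarith
  show "bump l w a (- \<xi>) = bump l w (- a) \<xi>" using e by (simp add: bump_def tent_def abs_divide)
  show "continuous_on UNIV (bump l w a)" unfolding bump_def[abs_def] tent_def divide_inverse
    by (intro continuous_intros)
qed

lemma bump_support:
  assumes "0 < l" "0 < w" "bump l w a \<xi> \<noteq> 0"
  shows "\<xi> \<in> rectangle a l w"
  using assms by (auto simp: bump_def tent_def rectangle_def max_def field_simps split: if_splits)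

lemma bump_ge:
  assumes "0 < l" "0 < w" "\<xi> \<in> rectangle a (l / 2) (w / 2)"
  shows "1 / 4 \<le> bump l w a \<xi>"
proof -
  have "\<bar>(\<xi> $ 1 - a) / l\<bar> \<le> 1 / 2" "\<bar>\<xi> $ 2 / w\<bar> \<le> 1 / 2"
    using assms by (simp_all add: rectangle_def field_simps)
  then have "1 / 2 \<le> tent ((\<xi> $ 1 - a) / l)" "1 / 2 \<le> tent (\<xi> $ 2 / w)" unfolding tent_def by linarith+
  from mult_mono[OF this] show ?thesis unfolding bump_def by (simp add: tent_def del: abs_divide)
qed

text \<open>The weight is increasing or decreasing in the frequency according to the sign of
  \<open>\<sigma>\<close>. Adding the two extreme values in the constant treats both signs at
  once.\<close>

lemma powr_weight_le:
  assumes a: "0 < a" and b: "0 < b"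
  shows "\<exists>C>0. \<forall>N\<ge>1. \<forall>\<xi> :: real^2. a * N \<le> norm \<xi> \<longrightarrow> norm \<xi> \<le> b * N \<longrightarrow> sobolev_weight \<sigma> \<xi> \<le> C * N powr (2 * \<sigma>)"
proof (intro exI conjI allI impI)
  let ?C = "(a\<^sup>2) powr \<sigma> + (1 + b\<^sup>2) powr \<sigma>"
  show "0 < ?C" using a by (intro add_pos_nonneg) auto
  fix N :: real and \<xi> :: "real^2" assume N: "1 \<le> N" and \<xi>: "a * N \<le> norm \<xi>" "norm \<xi> \<le> b * N"
  have e: "(N\<^sup>2) powr \<sigma> = N powr (2 * \<sigma>)" using N by (simp add: powr_powr flip: powr_numeral)
  have "(a * N)\<^sup>2 \<le> (norm \<xi>)\<^sup>2" "(norm \<xi>)\<^sup>2 \<le> (b * N)\<^sup>2" using \<xi> a N by (auto intro: power_mono)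
  then have lo: "a\<^sup>2 * N\<^sup>2 \<le> 1 + (norm \<xi>)\<^sup>2" and "1 + (norm \<xi>)\<^sup>2 \<le> 1 + b\<^sup>2 * N\<^sup>2"
    by (simp_all add: power_mult_distrib)
  moreover have "1 + b\<^sup>2 * N\<^sup>2 \<le> (1 + b\<^sup>2) * N\<^sup>2" using N by (simp add: distrib_right)
  ultimately have hi: "1 + (norm \<xi>)\<^sup>2 \<le> (1 + b\<^sup>2) * N\<^sup>2" by linarith
  have "sobolev_weight \<sigma> \<xi> \<le> (a\<^sup>2 * N\<^sup>2) powr \<sigma> + ((1 + b\<^sup>2) * N\<^sup>2) powr \<sigma>"
  proof (cases "0 \<le> \<sigma>")
    case True
    have "sobolev_weight \<sigma> \<xi> \<le> ((1 + b\<^sup>2) * N\<^sup>2) powr \<sigma>" using hi True by (intro powr_mono2) auto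
    then show ?thesis by (simp add: add_increasing)
  next
    case False
    have "sobolev_weight \<sigma> \<xi> \<le> (a\<^sup>2 * N\<^sup>2) powr \<sigma>" using lo False a N by (intro powr_mono2') auto
    then show ?thesis by (simp add: add_increasing2)
  qed
  also have "\<dots> = ?C * N powr (2 * \<sigma>)" using a N by (simp only: powr_mult e distrib_right[of _ _ "N powr _"])
  finally show "sobolev_weight \<sigma> \<xi> \<le> ?C * N powr (2 * \<sigma>)" .
qed

context kgz
begin

text \<open>Exchanging the time and frequency integrals exhibits the response as an average over
  interacting pairs of the time integral \<open>J\<close>, whose sign the resonance
  controls.\<close>

lemma response_real:
  fixes G :: "real^2 \<Rightarrow> real" and \<xi> :: "real^2"
  assumes G: "rapid (\<lambda>\<xi>. of_real (G \<xi>))"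
  defines "J \<equiv> \<lambda>\<eta>. integral {0..T} (\<lambda>\<tau>. sin (c * norm \<xi> * (T - \<tau>)) * (cos (\<tau> * japanese (\<xi> - \<eta>)) * cos (\<tau> * japanese \<eta>)))"
  shows "integrable lborel (\<lambda>\<eta>. G (\<xi> - \<eta>) * G \<eta> * J \<eta>)"
    and "Re (response (\<lambda>\<xi>. of_real (G \<xi>)) \<xi>) = - (norm \<xi> / (2 * pi * c)) * (\<integral>\<eta>. G (\<xi> - \<eta>) * G \<eta> * J \<eta> \<partial>lborel)"
proof -
  let ?j = "\<lambda>\<eta> \<tau>. sin (c * norm \<xi> * (T - \<tau>)) * (cos (\<tau> * japanese (\<xi> - \<eta>)) * cos (\<tau> * japanese \<eta>))"
  let ?H = "\<lambda>\<eta>. G (\<xi> - \<eta>) * G \<eta>"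
  let ?F = "\<lambda>\<eta> \<tau>. indicat_real {0..T} \<tau> * (?H \<eta> * ?j \<eta> \<tau>)"
  have "(\<lambda>\<xi>. Re (of_real (G \<xi>))) \<in> borel_measurable borel"
    using rapid_measurable[OF G] by (intro measurable_compose[OF _ borel_measurable_Re])
  then have Gm [measurable]: "G \<in> borel_measurable borel" by simp
  have [measurable]: "japanese \<in> borel_measurable borel"
    by (intro borel_measurable_continuous_onI japanese_continuous)
  have Hi: "integrable lborel ?H"
    using integrable_Re[OF conv_integrable[OF G G, of \<xi>]] by simp
  have I: "integrable (lborel \<Otimes>\<^sub>M lborel) (case_prod ?F)"
  proof (rule Bochner_Integration.integrable_bound)
    show "integrable (lborel \<Otimes>\<^sub>M lborel) (case_prod (\<lambda>\<eta> \<tau>. indicat_real {0..T} \<tau> * ?H \<eta>))"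
    proof (rule lborel_pair.Fubini_integrable)
      have "(\<integral>\<tau>. norm (indicat_real {0..T} \<tau> * ?H \<eta>) \<partial>lborel) = T * norm (?H \<eta>)" for \<eta>
        using T by (simp add: abs_mult)
      then show "integrable lborel (\<lambda>\<eta>. \<integral>\<tau>. norm (case (\<eta>, \<tau>) of (\<eta>, \<tau>) \<Rightarrow> indicat_real {0..T} \<tau> * ?H \<eta>) \<partial>lborel)"
        using Hi by (simp only: prod.case) (intro integrable_mult_right integrable_norm)
      have "integrable lborel (indicat_real {0..T})"
        by (intro integrable_real_indicator) (simp_all add: emeasure_lborel_Icc_eq)
      then have "integrable lborel (\<lambda>\<tau>. indicat_real {0..T} \<tau> * ?H \<eta>)" for \<eta> by simp
      then show "AE \<eta> in lborel. integrable lborel (\<lambda>\<tau>. case (\<eta>, \<tau>) of (\<eta>, \<tau>) \<Rightarrow> indicat_real {0..T} \<tau> * ?H \<eta>)"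
        by (simp only: prod.case) simp
    qed measurable
    have "norm (?F \<eta> \<tau>) \<le> norm (indicat_real {0..T} \<tau> * ?H \<eta>)" for \<eta> \<tau>
    proof -
      have "\<bar>?j \<eta> \<tau>\<bar> \<le> 1 * (1 * 1)" unfolding abs_mult by (intro mult_mono) auto
      then have "\<bar>?H \<eta>\<bar> * \<bar>?j \<eta> \<tau>\<bar> \<le> \<bar>?H \<eta>\<bar> * 1" by (intro mult_left_mono) auto
      then show ?thesis unfolding real_norm_def abs_mult[of "indicat_real _ _"] abs_mult[of "?H _"]
        by (intro mult_left_mono) auto
    qed
    then show "AE p in lborel \<Otimes>\<^sub>M lborel. norm (case_prod ?F p) \<le> norm (case_prod (\<lambda>\<eta> \<tau>. indicat_real {0..T} \<tau> * ?H \<eta>) p)"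
      by (intro AE_I2) (simp only: split_beta)
  qed measurable
  have inner: "(\<integral>\<tau>. ?F \<eta> \<tau> \<partial>lborel) = ?H \<eta> * J \<eta>" for \<eta>
  proof -
    have "set_integrable lborel {0..T} (?j \<eta>)" by (intro borel_integrable_atLeastAtMost' continuous_intros)
    from set_borel_integral_eq_integral(2)[OF this] show ?thesis
      by (simp only: J_def set_lebesgue_integral_def real_scaleR_def mult.left_commute[of "indicator _ _"] integral_mult_right_zero)
  qed
  show "integrable lborel (\<lambda>\<eta>. ?H \<eta> * J \<eta>)"
    using lborel_pair.integrable_fst[OF I] by (simp only: inner)
  define f where "f \<tau> = (\<integral>\<eta>. ?H \<eta> * ?j \<eta> \<tau> \<partial>lborel)" for \<tau>
  have outer: "(\<integral>\<eta>. ?F \<eta> \<tau> \<partial>lborel) = indicat_real {0..T} \<tau> *\<^sub>R f \<tau>" for \<tau>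
    by (simp only: f_def integral_mult_right_zero real_scaleR_def)
  have fi: "set_integrable lborel {0..T} f"
    using lborel_pair.integrable_snd[OF I] unfolding set_integrable_def by (simp only: outer)
  have "set_integrable lborel {0..T} (\<lambda>\<tau>. complex_of_real (f \<tau>))"
    using integrable_of_real[OF fi[unfolded set_integrable_def]]
    unfolding set_integrable_def by (simp add: scaleR_conv_of_real)
  from set_borel_integral_eq_integral(2)[OF this]
  have cf: "integral {0..T} (\<lambda>\<tau>. complex_of_real (f \<tau>)) = of_real (LINT \<tau>:{0..T}|lborel. f \<tau>)"
    by (simp add: set_integral_complex_of_real)
  have "osc sin (c * norm \<xi>) (\<lambda>\<tau>. conv (lin (\<lambda>\<xi>. of_real (G \<xi>)) \<tau>) (lin (\<lambda>\<xi>. of_real (G \<xi>)) \<tau>) \<xi>) T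
      = integral {0..T} (\<lambda>\<tau>. complex_of_real (f \<tau>))"
    unfolding osc_def
  proof (rule integral_cong)
    fix \<tau>
    have "conv (lin (\<lambda>\<xi>. of_real (G \<xi>)) \<tau>) (lin (\<lambda>\<xi>. of_real (G \<xi>)) \<tau>) \<xi>
      = (\<integral>\<eta>. complex_of_real (?H \<eta> * (cos (\<tau> * japanese (\<xi> - \<eta>)) * cos (\<tau> * japanese \<eta>))) \<partial>lborel)"
      unfolding conv_def lin_def by (simp add: mult_ac)
    also have "\<dots> = of_real (\<integral>\<eta>. ?H \<eta> * (cos (\<tau> * japanese (\<xi> - \<eta>)) * cos (\<tau> * japanese \<eta>)) \<partial>lborel)"
      by (rule integral_complex_of_real)
    finally show "of_real (sin (c * norm \<xi> * (T - \<tau>))) * conv (lin (\<lambda>\<xi>. of_real (G \<xi>)) \<tau>) (lin (\<lambda>\<xi>. of_real (G \<xi>)) \<tau>) \<xi>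
      = complex_of_real (f \<tau>)"
      by (simp only: f_def of_real_mult[symmetric] integral_mult_right_zero[symmetric] mult.left_commute[of "sin _"])
  qed
  also have "\<dots> = of_real (\<integral>\<tau>. (\<integral>\<eta>. ?F \<eta> \<tau> \<partial>lborel) \<partial>lborel)"
    unfolding cf set_lebesgue_integral_def outer ..
  also have "(\<integral>\<tau>. (\<integral>\<eta>. ?F \<eta> \<tau> \<partial>lborel) \<partial>lborel) = (\<integral>\<eta>. ?H \<eta> * J \<eta> \<partial>lborel)"
    unfolding inner[symmetric] by (rule lborel_pair.Fubini_integral[OF I])
  finally have o: "osc sin (c * norm \<xi>) (\<lambda>\<tau>. conv (lin (\<lambda>\<xi>. of_real (G \<xi>)) \<tau>) (lin (\<lambda>\<xi>. of_real (G \<xi>)) \<tau>) \<xi>) T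
    = of_real (\<integral>\<eta>. ?H \<eta> * J \<eta> \<partial>lborel)" .
  show "Re (response (\<lambda>\<xi>. of_real (G \<xi>)) \<xi>) = - (norm \<xi> / (2 * pi * c)) * (\<integral>\<eta>. ?H \<eta> * J \<eta> \<partial>lborel)"
    unfolding response_def wave_op_def o of_real_minus[symmetric] of_real_mult[symmetric] Re_complex_of_real ..
qed

end

text \<open>
  The resonance condition \<open>|x| - |y| = c |x + y|\<close> holds for \<open>x = (N, 0)\<close>, \<open>y = (M, 0)\<close> when
  \<open>M = \<kappa> N\<close> with \<open>\<kappa> = (1 - c) / (1 + c)\<close>, and then persists up to \<open>O(\<delta>)\<close> on rectangles of height
  \<open>\<delta> \<surd>N\<close>, since transversal displacements change the norm only to second order. The condition
  \<open>phase\<close> places the time \<open>T\<close> at a maximum of the resonant oscillation.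
\<close>

locale resonant_packet = kgz +
  fixes \<delta> \<kappa> N M :: real and j :: nat
  assumes c1: "c < 1" and \<kappa>: "0 < \<kappa>" "\<kappa> < 1" "M = \<kappa> * N" "N - M = c * (N + M)"
    and phase: "c * (N + M) * T = pi / 2 + 2 * real j * pi"
    and \<delta>: "0 < \<delta>" "\<delta> \<le> 1" "T * (\<delta> * (9 + 1 / \<kappa>)) \<le> 1"
    and large: "1 / \<delta> \<le> M" "3 \<le> M" "3 \<le> N - M" "25 / T \<le> 2 * M" "25 / T \<le> 2 * (N - M)"
begin

lemma MN: "0 < M" "M < N" "0 < N"
  using large(2,3) by linarith+

lemma width: "0 < \<delta> * sqrt N"
  using \<delta>(1) MN by simp

lemma resonant_kernel:
  assumes x: "x \<in> rectangle N \<delta> (\<delta> * sqrt N)" and y: "y \<in> rectangle M \<delta> (\<delta> * sqrt N)"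
    and xy: "x + y \<in> rectangle (N + M) (\<delta> / 4) (\<delta> * sqrt N / 4)"
  shows "T / 16 \<le> integral {0..T} (\<lambda>\<tau>. sin (c * norm (x + y) * (T - \<tau>)) * (cos (\<tau> * japanese x) * cos (\<tau> * japanese y)))"
proof -
  have dd: "\<delta>\<^sup>2 \<le> \<delta>" using \<delta> by (simp add: power2_eq_square mult_left_le)
  have M1: "1 / M \<le> \<delta>" using large(1) \<delta>(1) MN by (simp add: field_simps)
  have N1: "1 / N \<le> \<delta>" using M1 frac_le[of 1 1 M N] MN by simp
  have sq: "z\<^sup>2 \<le> \<delta>\<^sup>2 * N" if "\<bar>z\<bar> \<le> \<delta> * sqrt N" for z
  proof -
    have "\<bar>z\<bar>\<^sup>2 \<le> (\<delta> * sqrt N)\<^sup>2" using that by (intro power_mono) auto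
    then show ?thesis using MN by (simp add: power_mult_distrib)
  qed
  \<comment> \<open>The mass term \<open>1\<close> is counted with the transversal part, so one
    estimate serves the Klein-Gordon and the wave dispersion.\<close>
  have jap: "japanese z = sqrt ((z $ 1)\<^sup>2 + (1 + (z $ 2)\<^sup>2))" for z
    by (simp add: japanese_def norm_square_plane algebra_simps)
  have "\<bar>japanese x - N\<bar> \<le> \<delta> + (1 + \<delta>\<^sup>2 * N) / N" unfolding jap
    using x sq[of "x $ 2"] MN large(2) \<delta> by (intro abs_sqrt_sum_squares_le) (auto simp: rectangle_def)
  also have "\<dots> = \<delta> + 1 / N + \<delta>\<^sup>2" using MN by (simp add: field_simps)
  finally have ex: "\<bar>japanese x - N\<bar> \<le> 3 * \<delta>" using N1 dd by linarith
  have "\<bar>japanese y - M\<bar> \<le> \<delta> + (1 + \<delta>\<^sup>2 * N) / M" unfolding jap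
    using y sq[of "y $ 2"] MN large(2) \<delta> by (intro abs_sqrt_sum_squares_le) (auto simp: rectangle_def)
  also have "\<dots> = \<delta> + 1 / M + \<delta>\<^sup>2 * (1 / \<kappa>)" using MN \<kappa> by (simp add: field_simps)
  also have "\<dots> \<le> \<delta> + \<delta> + \<delta> * (1 / \<kappa>)"
    using M1 dd \<kappa> by (intro add_mono mult_right_mono) auto
  finally have ey: "\<bar>japanese y - M\<bar> \<le> \<delta> * (2 + 1 / \<kappa>)" by (simp add: distrib_left)
  have "norm (x + y) = sqrt (((x + y) $ 1)\<^sup>2 + ((x + y) $ 2)\<^sup>2)"
    by (simp add: norm_square_plane[symmetric] del: vector_add_component)
  moreover have "\<bar>sqrt (((x + y) $ 1)\<^sup>2 + ((x + y) $ 2)\<^sup>2) - (N + M)\<bar> \<le> \<delta> / 4 + (\<delta>\<^sup>2 * N) / (N + M)"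
  proof (rule abs_sqrt_sum_squares_le)
    have r: "\<bar>(x + y) $ 1 - (N + M)\<bar> \<le> \<delta> / 4" "\<bar>(x + y) $ 2\<bar> \<le> \<delta> * sqrt N / 4"
      using xy unfolding rectangle_def by auto
    show "\<bar>\<bar>(x + y) $ 1\<bar> - (N + M)\<bar> \<le> \<delta> / 4" using r MN large(2) \<delta> by linarith
    have "\<bar>(x + y) $ 2\<bar> \<le> \<delta> * sqrt N" using r(2) width by linarith
    then show "((x + y) $ 2)\<^sup>2 \<le> \<delta>\<^sup>2 * N" by (rule sq)
  qed (use MN large(2) \<delta> in auto)
  moreover have "(\<delta>\<^sup>2 * N) / (N + M) \<le> \<delta>"
    using MN \<delta> dd by (simp add: divide_le_eq mult_mono)
  ultimately have en: "\<bar>norm (x + y) - (N + M)\<bar> \<le> 2 * \<delta>" using \<delta>(1) by linarith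
  define k where "k = c * norm (x + y)"
  have ek: "\<bar>k - (N - M)\<bar> \<le> 2 * \<delta>"
  proof -
    have "\<bar>k - (N - M)\<bar> = c * \<bar>norm (x + y) - (N + M)\<bar>"
      using c by (simp add: k_def \<kappa>(4) abs_mult flip: right_diff_distrib)
    also have "\<dots> \<le> 1 * (2 * \<delta>)" using en c c1 by (intro mult_mono) auto
    finally show ?thesis by simp
  qed
  define a where "a = japanese x"
  define b where "b = japanese y"
  \<comment> \<open>The sum of the three errors: \<open>2\<close> for \<open>k\<close>,
    \<open>3\<close> for \<open>a\<close> and \<open>2 + 1 / \<kappa>\<close> for \<open>b\<close>,
    in units of \<open>\<delta>\<close>. The phase condition counts the error of \<open>k\<close>
    once more, which explains \<open>9 + 1 / \<kappa>\<close> in the assumption on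
    \<open>\<delta>\<close>.\<close>
  define B where "B = \<delta> * (7 + 1 / \<kappa>)"
  have B: "B + 2 * \<delta> = \<delta> * (9 + 1 / \<kappa>)" by (simp add: B_def algebra_simps)
  have err: "\<bar>k - (N - M)\<bar> + \<bar>a - N\<bar> + \<bar>b - M\<bar> \<le> B"
    using ek ex ey by (simp add: a_def b_def B_def algebra_simps)
  have BT: "B \<le> 1 / T"
  proof -
    have "T * B \<le> T * (B + 2 * \<delta>)" using T \<delta> by (intro mult_left_mono) auto
    then have "T * B \<le> 1" using \<delta>(3) unfolding B by linarith
    then show ?thesis using T by (simp add: field_simps)
  qed
  \<comment> \<open>The nonresonant frequencies are close to \<open>2 * (N - M)\<close>,
    \<open>2 * M\<close> and \<open>2 * N\<close>; of the assumed \<open>25 / T\<close> the error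
    \<open>B\<close> takes at most \<open>1 / T\<close>. With \<open>m = 24 / T\<close> the
    oscillating terms cost \<open>6 / m = T / 4\<close>, half of the resonant gain.\<close>
  have m: "24 / T + 1 / T = 25 / T" by (simp add: add_divide_distrib[symmetric])
  have "(T / 2 - 6 / (24 / T)) / 4 \<le> integral {0..T} (\<lambda>\<tau>. sin (k * (T - \<tau>)) * (cos (\<tau> * a) * cos (\<tau> * b)))"
  proof (rule resonant_time_integral[OF T])
    have "(N - M - k) + (N - a) + (b - M) \<le> B" "(k - (N - M)) + (N - a) + (M - b) \<le> B"
      "(N - M - k) + (N - a) + (M - b) \<le> B"
      using err abs_ge_self[of "k - (N - M)"] abs_ge_minus_self[of "k - (N - M)"] abs_ge_minus_self[of "a - N"]
        abs_ge_self[of "b - M"] abs_ge_minus_self[of "b - M"] by argo+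
    then show "24 / T \<le> k + (a - b)" "24 / T \<le> a + b - k" "24 / T \<le> a + b + k"
      using BT m large(4,5) MN by argo+
    show "\<bar>k * T - (pi / 2 + 2 * real j * pi)\<bar> + \<bar>k - (a - b)\<bar> * T \<le> 1"
    proof -
      have "k * T - (pi / 2 + 2 * real j * pi) = (k - (N - M)) * T"
        unfolding phase[symmetric] \<kappa>(4)[symmetric] by (simp add: left_diff_distrib)
      then have "\<bar>k * T - (pi / 2 + 2 * real j * pi)\<bar> + \<bar>k - (a - b)\<bar> * T
        = T * (\<bar>k - (N - M)\<bar> + \<bar>k - (a - b)\<bar>)"
        using T by (simp add: abs_mult distrib_left mult.commute)
      also have "\<dots> \<le> T * (\<delta> * (9 + 1 / \<kappa>))"
        using T ek err unfolding B[symmetric] by (intro mult_left_mono) linarith+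
      also have "\<dots> \<le> 1" by (rule \<delta>(3))
      finally show ?thesis .
    qed
  qed (use T in simp)
  moreover have "(T / 2 - 6 / (24 / T)) / 4 = T / 16" by simp
  ultimately show ?thesis by (simp only: k_def a_def b_def)
qed

section \<open>The packet, its response and its norms\<close>

definition packet :: "real^2 \<Rightarrow> real" where
  "packet \<xi> = bump \<delta> (\<delta> * sqrt N) N \<xi> + bump \<delta> (\<delta> * sqrt N) (- N) \<xi>
    + (bump \<delta> (\<delta> * sqrt N) M \<xi> + bump \<delta> (\<delta> * sqrt N) (- M) \<xi>)"

lemma packet_bounds: "0 \<le> packet \<xi>" "packet \<xi> \<le> 4" "packet (- \<xi>) = packet \<xi>"
proof -
  let ?b = "\<lambda>a. bump \<delta> (\<delta> * sqrt N) a \<xi>"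
  have "?b N \<le> 1" "?b (- N) \<le> 1" "?b M \<le> 1" "?b (- M) \<le> 1" by (rule bump_basic(2))+
  then show "packet \<xi> \<le> 4" unfolding packet_def by linarith
qed (simp_all add: packet_def bump_basic(1,3))

lemma packet_continuous: "continuous_on UNIV packet"
  unfolding packet_def[abs_def] by (intro continuous_intros bump_basic(4))

lemma packet_support:
  assumes "packet \<xi> \<noteq> 0"
  shows "\<exists>a\<in>{N, - N, M, - M}. \<xi> \<in> rectangle a \<delta> (\<delta> * sqrt N)"
proof -
  have "\<exists>a\<in>{N, - N, M, - M}. bump \<delta> (\<delta> * sqrt N) a \<xi> \<noteq> 0"
    using assms by (force simp: packet_def)
  then show ?thesis using bump_support[OF \<delta>(1) width] by metis
qed

lemma packet_norm:
  assumes "packet \<xi> \<noteq> 0"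
  shows "\<kappa> / 2 * N \<le> norm \<xi>" "norm \<xi> \<le> 4 * N"
proof -
  obtain a where a0: "a \<in> {N, - N, M, - M}" "\<xi> \<in> rectangle a \<delta> (\<delta> * sqrt N)"
    using packet_support[OF assms] by (elim bexE)
  then have a: "a \<in> {N, - N, M, - M}" "\<bar>\<xi> $ 1 - a\<bar> \<le> \<delta>" "\<bar>\<xi> $ 2\<bar> \<le> \<delta> * sqrt N"
    by (simp_all add: rectangle_def)
  have "M \<le> \<bar>a\<bar>" "\<bar>a\<bar> \<le> N" using a(1) MN by auto
  then have x1: "M / 2 \<le> \<bar>\<xi> $ 1\<bar>" "\<bar>\<xi> $ 1\<bar> \<le> N + 1" using a(2) \<delta>(2) large(2) by linarith+
  show "\<kappa> / 2 * N \<le> norm \<xi>" using x1(1) component_le_norm_cart[of \<xi> 1] \<kappa>(3) by simp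
  have "1 \<le> N" using MN large(2) by linarith
  then have "\<delta> * sqrt N \<le> 1 * N" using \<delta> by (intro mult_mono real_le_lsqrt) (auto simp: power2_eq_square)
  then show "norm \<xi> \<le> 4 * N" using norm_le_l1_cart[of \<xi>] x1(2) a(3) \<open>1 \<le> N\<close> by (simp add: sum_2)
qed

text \<open>The support is compact, so even the exponential weight is bounded on it. The bound is
  enormous in \<open>N\<close> but does not enter the final inequality.\<close>

lemma packet_weight: "\<exists>A. \<forall>\<xi>. (1 + norm \<xi>) * wt \<xi> * cmod (of_real (packet \<xi>)) \<le> A"
proof (intro exI allI)
  fix \<xi>
  show "(1 + norm \<xi>) * wt \<xi> * cmod (of_real (packet \<xi>)) \<le> (1 + 4 * N) * (exp (4 * N) * (1 + 4 * N) ^ 4) * 4"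
  proof (cases "packet \<xi> = 0")
    case True
    then show ?thesis using MN by simp
  next
    case False
    from packet_norm(2)[OF this] show ?thesis unfolding wt_def
      using packet_bounds[of \<xi>] MN by (intro mult_mono power_mono) auto
  qed
qed

text \<open>Of all sums of two centres only \<open>N + M\<close> lies within \<open>9 / 4\<close> of
  \<open>N + M\<close>; any other sum misses it by at least \<open>3\<close>. No other pair reaches
  the window, so nothing can cancel the resonant contribution.\<close>

lemma packet_sum:
  assumes \<xi>: "\<xi> \<in> rectangle (N + M) (\<delta> / 4) (\<delta> * sqrt N / 4)" and "packet (\<xi> - \<eta>) \<noteq> 0" "packet \<eta> \<noteq> 0"
  shows "\<xi> - \<eta> \<in> rectangle N \<delta> (\<delta> * sqrt N) \<and> \<eta> \<in> rectangle M \<delta> (\<delta> * sqrt N)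
    \<or> \<xi> - \<eta> \<in> rectangle M \<delta> (\<delta> * sqrt N) \<and> \<eta> \<in> rectangle N \<delta> (\<delta> * sqrt N)"
proof -
  obtain a where a: "a \<in> {N, - N, M, - M}" "\<xi> - \<eta> \<in> rectangle a \<delta> (\<delta> * sqrt N)"
    using packet_support[OF assms(2)] by (elim bexE)
  obtain b where b: "b \<in> {N, - N, M, - M}" "\<eta> \<in> rectangle b \<delta> (\<delta> * sqrt N)"
    using packet_support[OF assms(3)] by (elim bexE)
  have "\<bar>\<xi> $ 1 - \<eta> $ 1 - a\<bar> \<le> \<delta>" "\<bar>\<eta> $ 1 - b\<bar> \<le> \<delta>" "\<bar>\<xi> $ 1 - (N + M)\<bar> \<le> \<delta> / 4"
    using a(2) b(2) \<xi> by (auto simp: rectangle_def)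
  then have "\<bar>a + b - (N + M)\<bar> \<le> 9 / 4" using \<delta>(2) by linarith
  moreover have "a = N \<or> a = - N \<or> a = M \<or> a = - M" "b = N \<or> b = - N \<or> b = M \<or> b = - M"
    using a(1) b(1) by auto
  ultimately have "a = N \<and> b = M \<or> a = M \<and> b = N"
    using large(2,3) MN by (elim disjE) linarith+
  then show ?thesis using a(2) b(2) by auto
qed

lemma packet_rapid: "rapid (\<lambda>\<xi>. of_real (packet \<xi>))"
proof -
  obtain A where A: "\<forall>\<xi>. (1 + norm \<xi>) * wt \<xi> * cmod (of_real (packet \<xi>)) \<le> A" using packet_weight by (elim exE)
  have "continuous_on UNIV (\<lambda>\<xi>. complex_of_real (packet \<xi>))" by (intro continuous_intros packet_continuous)
  from fam_rapid[OF lin_fam[OF this A[rule_format]], of 0] show ?thesis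
    using T by (simp add: lin_def[abs_def])
qed

text \<open>Wherever the product of packets is nonzero the kernel is at least \<open>T / 16\<close>,
  so discarding all but a small rectangle only lowers the integral. The product is at least
  \<open>1 / 16\<close> there and the area is \<open>\<delta> * (\<delta> * sqrt N) / 4\<close>,
  which together give \<open>1024\<close>. The sign comes from the minus in
  \<open>wave_op\<close>.\<close>

lemma packet_response:
  assumes \<xi>: "\<xi> \<in> rectangle (N + M) (\<delta> / 4) (\<delta> * sqrt N / 4)"
  shows "Re (response (\<lambda>\<xi>. of_real (packet \<xi>)) \<xi>) \<le> - (N / (2 * pi * c) * (T * \<delta> * (\<delta> * sqrt N) / 1024))"
proof -
  define J where "J \<eta> = integral {0..T} (\<lambda>\<tau>. sin (c * norm \<xi> * (T - \<tau>)) * (cos (\<tau> * japanese (\<xi> - \<eta>)) * cos (\<tau> * japanese \<eta>)))" for \<eta>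
  note R = response_real[OF packet_rapid, of \<xi>, folded J_def]
  let ?E = "rectangle M (\<delta> / 4) (\<delta> * sqrt N / 4)"
  have J: "T / 16 \<le> J \<eta>" if nz: "packet (\<xi> - \<eta>) \<noteq> 0" "packet \<eta> \<noteq> 0" for \<eta>
    using packet_sum[OF \<xi> nz]
  proof (elim disjE conjE)
    assume "\<xi> - \<eta> \<in> rectangle N \<delta> (\<delta> * sqrt N)" "\<eta> \<in> rectangle M \<delta> (\<delta> * sqrt N)"
    from resonant_kernel[OF this] \<xi> show ?thesis by (simp add: J_def)
  next
    assume "\<xi> - \<eta> \<in> rectangle M \<delta> (\<delta> * sqrt N)" "\<eta> \<in> rectangle N \<delta> (\<delta> * sqrt N)"
    from resonant_kernel[OF this(2,1)] \<xi> show ?thesis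
      by (simp add: J_def mult.commute[of "cos (_ * japanese \<eta>)"])
  qed
  \<comment> \<open>Quarter-size rectangles for \<open>\<xi>\<close> and \<open>\<eta>\<close> keep
    the difference in the half-size rectangle around \<open>N\<close>, where the bump is at least
    \<open>1 / 4\<close>.\<close>
  have big: "1 / 16 \<le> packet (\<xi> - \<eta>) * packet \<eta>" if \<eta>: "\<eta> \<in> ?E" for \<eta>
  proof -
    have "\<eta> \<in> rectangle M (\<delta> / 2) (\<delta> * sqrt N / 2)" using \<eta> \<delta>(1) width by (simp add: rectangle_def)
    then have 1: "1 / 4 \<le> bump \<delta> (\<delta> * sqrt N) M \<eta>" by (rule bump_ge[OF \<delta>(1) width])
    have "\<bar>\<eta> $ 1 - M\<bar> \<le> \<delta> / 4" "\<bar>\<eta> $ 2\<bar> \<le> \<delta> * sqrt N / 4" "\<bar>\<xi> $ 1 - (N + M)\<bar> \<le> \<delta> / 4" "\<bar>\<xi> $ 2\<bar> \<le> \<delta> * sqrt N / 4"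
      using \<eta> \<xi> by (simp_all add: rectangle_def)
    then have "\<bar>\<xi> $ 1 - \<eta> $ 1 - N\<bar> \<le> \<delta> / 2" "\<bar>\<xi> $ 2 - \<eta> $ 2\<bar> \<le> \<delta> * sqrt N / 2" by linarith+
    then have "\<xi> - \<eta> \<in> rectangle N (\<delta> / 2) (\<delta> * sqrt N / 2)" by (simp add: rectangle_def)
    then have 2: "1 / 4 \<le> bump \<delta> (\<delta> * sqrt N) N (\<xi> - \<eta>)" by (rule bump_ge[OF \<delta>(1) width])
    have "1 / 4 \<le> packet (\<xi> - \<eta>)" "1 / 4 \<le> packet \<eta>"
      unfolding packet_def using 1 2 bump_basic(1)[of \<delta> "\<delta> * sqrt N"] by (simp_all add: add_increasing add_increasing2)
    from mult_mono[OF this] packet_bounds(1) show ?thesis by simp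
  qed
  have pt: "indicat_real ?E \<eta> * (T / 256) \<le> packet (\<xi> - \<eta>) * packet \<eta> * J \<eta>" for \<eta>
  proof (cases "packet (\<xi> - \<eta>) * packet \<eta> = 0")
    case True
    then have "\<eta> \<notin> ?E" using big[of \<eta>] by auto
    then show ?thesis by (simp only: True) simp
  next
    case False
    have "indicat_real ?E \<eta> * (1 / 16) \<le> packet (\<xi> - \<eta>) * packet \<eta>"
      using big[of \<eta>] packet_bounds(1) by (cases "\<eta> \<in> ?E") auto
    from mult_mono[OF this J[of \<eta>]] False packet_bounds(1) T show ?thesis by simp
  qed
  note w = width \<delta>(1)
  have Ri: "integrable lborel (indicat_real ?E)" "(\<integral>\<eta>. indicat_real ?E \<eta> \<partial>lborel) = (2 * (\<delta> / 4)) * (2 * (\<delta> * sqrt N / 4))"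
    using w by (intro rectangle_measure; simp)+
  have "(\<integral>\<eta>. indicat_real ?E \<eta> * (T / 256) \<partial>lborel) \<le> (\<integral>\<eta>. packet (\<xi> - \<eta>) * packet \<eta> * J \<eta> \<partial>lborel)"
    using Ri(1) R(1) pt by (intro integral_mono) auto
  then have lower: "T * \<delta> * (\<delta> * sqrt N) / 1024 \<le> (\<integral>\<eta>. packet (\<xi> - \<eta>) * packet \<eta> * J \<eta> \<partial>lborel)"
    unfolding integral_mult_left_zero Ri(2) by (simp add: mult_ac)
  have "\<bar>\<xi> $ 1 - (N + M)\<bar> \<le> \<delta> / 4" using \<xi> by (simp add: rectangle_def)
  then have "N \<le> norm \<xi>" using component_le_norm_cart[of \<xi> 1] \<delta>(2) large(2) by linarith
  then have "N / (2 * pi * c) \<le> norm \<xi> / (2 * pi * c)" using c by (intro divide_right_mono) auto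
  from mult_mono[OF this lower] have "N / (2 * pi * c) * (T * \<delta> * (\<delta> * sqrt N) / 1024)
      \<le> norm \<xi> / (2 * pi * c) * (\<integral>\<eta>. packet (\<xi> - \<eta>) * packet \<eta> * J \<eta> \<partial>lborel)"
    using c T \<delta> MN by auto
  then show ?thesis unfolding R(2) by simp
qed

text \<open>\<open>256\<close> is \<open>16\<close> for the square of the bound \<open>4\<close> on
  the packet, times four rectangles, times \<open>4\<close> from the full side lengths.\<close>

lemma packet_sobolev:
  assumes W: "\<And>\<xi>. \<kappa> / 2 * N \<le> norm \<xi> \<Longrightarrow> norm \<xi> \<le> 4 * N \<Longrightarrow> sobolev_weight \<sigma> \<xi> \<le> W" and W0: "0 \<le> W"
  shows "(nrm (sobolev \<sigma>) (dist_of (synth (\<lambda>\<xi>. of_real (packet \<xi>)))))\<^sup>2 \<le> 256 * W * \<delta> * (\<delta> * sqrt N)"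
proof -
  let ?I = "\<lambda>a. indicat_real (rectangle a \<delta> (\<delta> * sqrt N))"
  have h: "hermitian (\<lambda>\<xi>. of_real (packet \<xi>))" by (simp add: hermitian_def packet_bounds(3))
  have Ri: "integrable lborel (?I a)" "(\<integral>\<xi>. ?I a \<xi> \<partial>lborel) = (2 * \<delta>) * (2 * (\<delta> * sqrt N))" for a
    using width \<delta>(1) by (intro rectangle_measure; simp)+
  have "(\<integral>\<xi>. sobolev_weight \<sigma> \<xi> * (packet \<xi>)\<^sup>2 \<partial>lborel) \<le> (\<integral>\<xi>. 16 * W * (?I N \<xi> + ?I (- N) \<xi> + (?I M \<xi> + ?I (- M) \<xi>)) \<partial>lborel)"
  proof (rule integral_mono')
    show "integrable lborel (\<lambda>\<xi>. 16 * W * (?I N \<xi> + ?I (- N) \<xi> + (?I M \<xi> + ?I (- M) \<xi>)))"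
      using Ri(1) by (intro integrable_mult_right Bochner_Integration.integrable_add)
    show pos: "0 \<le> 16 * W * (?I N \<xi> + ?I (- N) \<xi> + (?I M \<xi> + ?I (- M) \<xi>))" for \<xi>
      using W0 by (intro mult_nonneg_nonneg add_nonneg_nonneg) auto
    show "sobolev_weight \<sigma> \<xi> * (packet \<xi>)\<^sup>2 \<le> 16 * W * (?I N \<xi> + ?I (- N) \<xi> + (?I M \<xi> + ?I (- M) \<xi>))" for \<xi>
    proof (cases "packet \<xi> = 0")
      case True
      then show ?thesis using pos[of \<xi>] by simp
    next
      case False
      have "(packet \<xi>)\<^sup>2 \<le> 4\<^sup>2" using packet_bounds by (intro power_mono) auto
      then have "sobolev_weight \<sigma> \<xi> * (packet \<xi>)\<^sup>2 \<le> W * 16"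
        using W[OF packet_norm[OF False]] W0 by (intro mult_mono) auto
      moreover have "1 \<le> ?I N \<xi> + ?I (- N) \<xi> + (?I M \<xi> + ?I (- M) \<xi>)"
        using packet_support[OF False] by (auto simp: indicator_def)
      then have "16 * W * 1 \<le> 16 * W * (?I N \<xi> + ?I (- N) \<xi> + (?I M \<xi> + ?I (- M) \<xi>))"
        using W0 by (intro mult_left_mono) auto
      ultimately show ?thesis by linarith
    qed
  qed
  also have "\<dots> = 256 * W * \<delta> * (\<delta> * sqrt N)"
    by (simp only: integral_mult_right_zero Bochner_Integration.integral_add Bochner_Integration.integrable_add Ri) simp
  finally have "(\<integral>\<xi>. sobolev_weight \<sigma> \<xi> * (packet \<xi>)\<^sup>2 \<partial>lborel) \<le> 256 * W * \<delta> * (\<delta> * sqrt N)" .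
  then show ?thesis unfolding nrm_sobolev_eq[OF dist_of_synth(1)[OF packet_rapid h]]
    by (simp add: integral_nonneg_AE)
qed

text \<open>The output window lies in the same annulus as the packet, so one pair of frequency
  bounds controls both the data norm and the norm of the functional.\<close>

lemma window_weight:
  assumes W: "\<And>\<xi>. \<kappa> / 2 * N \<le> norm \<xi> \<Longrightarrow> norm \<xi> \<le> 4 * N \<Longrightarrow> sobolev_weight \<sigma> \<xi> \<le> W"
  defines "E \<equiv> rectangle (N + M) (\<delta> / 4) (\<delta> * sqrt N / 4)"
  shows "integrable lborel (\<lambda>\<xi>. indicat_real E \<xi> * sobolev_weight \<sigma> \<xi>)"
    and "(\<integral>\<xi>. indicat_real E \<xi> * sobolev_weight \<sigma> \<xi> \<partial>lborel) \<le> W * (\<delta> * (\<delta> * sqrt N) / 4)"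
    and "integrable lborel (indicat_real E)"
    and "(\<integral>\<xi>. indicat_real E \<xi> \<partial>lborel) = \<delta> * (\<delta> * sqrt N) / 4"
proof -
  show Ei: "integrable lborel (indicat_real E)" "(\<integral>\<xi>. indicat_real E \<xi> \<partial>lborel) = \<delta> * (\<delta> * sqrt N) / 4"
    using rectangle_measure[of "\<delta> / 4" "\<delta> * sqrt N / 4" "N + M"] width \<delta>(1) by (simp_all add: E_def)
  have [measurable]: "E \<in> sets borel" by (simp add: E_def)
  have le: "indicat_real E \<xi> * sobolev_weight \<sigma> \<xi> \<le> W * indicat_real E \<xi>" for \<xi>
  proof (cases "\<xi> \<in> E")
    case True
    then have x: "\<bar>\<xi> $ 1 - (N + M)\<bar> \<le> \<delta> / 4" "\<bar>\<xi> $ 2\<bar> \<le> \<delta> * sqrt N / 4" by (simp_all add: E_def rectangle_def)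
    have lo: "\<kappa> / 2 * N \<le> norm \<xi>" using x(1) component_le_norm_cart[of \<xi> 1] \<kappa>(3) MN \<delta>(2) large(2) by linarith
    have "1 \<le> N" using MN large(2) by linarith
    then have "\<delta> * sqrt N \<le> 1 * N" using \<delta> by (intro mult_mono real_le_lsqrt) (auto simp: power2_eq_square)
    then have "norm \<xi> \<le> 4 * N" using norm_le_l1_cart[of \<xi>] x \<open>1 \<le> N\<close> MN \<delta>(2) unfolding sum_2 by linarith
    from W[OF lo this] True show ?thesis by simp
  qed simp
  show I: "integrable lborel (\<lambda>\<xi>. indicat_real E \<xi> * sobolev_weight \<sigma> \<xi>)"
  proof (rule Bochner_Integration.integrable_bound)
    show "integrable lborel (\<lambda>\<xi>. W * indicat_real E \<xi>)" using Ei(1) by (rule integrable_mult_right)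
    show "AE \<xi> in lborel. norm (indicat_real E \<xi> * sobolev_weight \<sigma> \<xi>) \<le> norm (W * indicat_real E \<xi>)"
    proof (intro AE_I2)
      fix \<xi> :: "real^2"
      have "0 \<le> indicat_real E \<xi> * sobolev_weight \<sigma> \<xi>" by simp
      then show "norm (indicat_real E \<xi> * sobolev_weight \<sigma> \<xi>) \<le> norm (W * indicat_real E \<xi>)"
        using le[of \<xi>] unfolding real_norm_def by linarith
    qed
  qed measurable
  have "(\<integral>\<xi>. indicat_real E \<xi> * sobolev_weight \<sigma> \<xi> \<partial>lborel) \<le> (\<integral>\<xi>. W * indicat_real E \<xi> \<partial>lborel)"
    using I Ei(1) le by (intro integral_mono integrable_mult_right) auto
  then show "(\<integral>\<xi>. indicat_real E \<xi> * sobolev_weight \<sigma> \<xi> \<partial>lborel) \<le> W * (\<delta> * (\<delta> * sqrt N) / 4)"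
    unfolding integral_mult_right_zero Ei(2) .
qed

text \<open>The packet is divided by the bound \<open>sqrt P\<close> on its norm to enter the unit
  ball. The response is quadratic, so the lower bound is divided by \<open>P\<close> itself.\<close>

lemma packet_inequality:
  assumes K: "response_bounded s K"
    and W: "\<And>\<xi>. \<kappa> / 2 * N \<le> norm \<xi> \<Longrightarrow> norm \<xi> \<le> 4 * N \<Longrightarrow> sobolev_weight (s + 1) \<xi> \<le> W" "0 < W"
    and V: "\<And>\<xi>. \<kappa> / 2 * N \<le> norm \<xi> \<Longrightarrow> norm \<xi> \<le> 4 * N \<Longrightarrow> sobolev_weight (- s) \<xi> \<le> V"
  shows "N / (2 * pi * c) * (T * \<delta> * (\<delta> * sqrt N) / 1024) * (\<delta> * (\<delta> * sqrt N) / 4) / (256 * W * \<delta> * (\<delta> * sqrt N))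
    \<le> \<bar>K\<bar> * sqrt (V * (\<delta> * (\<delta> * sqrt N) / 4))"
proof -
  define E where "E = rectangle (N + M) (\<delta> / 4) (\<delta> * sqrt N / 4)"
  define q where "q = N / (2 * pi * c) * (T * \<delta> * (\<delta> * sqrt N) / 1024)"
  define P where "P = 256 * W * \<delta> * (\<delta> * sqrt N)"
  define r where "r = 1 / sqrt P"
  have P: "0 < P" unfolding P_def using W(2) \<delta>(1) width by simp
  then have r: "0 < r" "r\<^sup>2 = 1 / P" by (simp_all add: r_def power_divide)
  let ?p = "\<lambda>\<xi>. complex_of_real (packet \<xi>)" and ?g = "\<lambda>\<xi>. of_real r * complex_of_real (packet \<xi>)"
  note Ew = window_weight[OF V, folded E_def]
  have E: "E \<in> sets borel" by (simp add: E_def)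
  have h: "hermitian ?p" by (simp add: hermitian_def packet_bounds(3))
  obtain A where A: "\<forall>\<xi>. (1 + norm \<xi>) * wt \<xi> * cmod (?p \<xi>) \<le> A" using packet_weight by (elim exE)
  have pc: "continuous_on UNIV ?p" by (intro continuous_intros packet_continuous)
  have "(nrm (sobolev (s + 1)) (dist_of (synth ?p)))\<^sup>2 \<le> P"
    unfolding P_def using W by (intro packet_sobolev) auto
  then have "nrm (sobolev (s + 1)) (dist_of (synth ?p)) \<le> sqrt P" by (rule real_le_rsqrt)
  then have "r * nrm (sobolev (s + 1)) (dist_of (synth ?p)) \<le> r * sqrt P" using r(1) by (intro mult_left_mono) auto
  also have "r * sqrt P = 1" using P by (simp add: r_def)
  finally have "nrm (sobolev (s + 1)) (dist_of (synth ?g)) \<le> 1"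
    using r(1) normed_points.nrm_scale[OF normed_points_sobolev dist_of_synth_sobolev[OF packet_rapid h], of "s + 1" r]
    by (simp add: dist_of_synth_scale)
  moreover have "\<forall>\<xi>. (1 + norm \<xi>) * wt \<xi> * cmod (?g \<xi>) \<le> r * A"
  proof
    fix \<xi>
    have "r * ((1 + norm \<xi>) * wt \<xi> * cmod (?p \<xi>)) \<le> r * A" using A r(1) by (intro mult_left_mono) auto
    then show "(1 + norm \<xi>) * wt \<xi> * cmod (?g \<xi>) \<le> r * A" using r(1) by (simp add: norm_mult mult_ac)
  qed
  moreover have "continuous_on UNIV ?g" "hermitian ?g" using h pc by (auto intro!: continuous_intros simp: hermitian_def)
  ultimately have up: "\<bar>Re (\<integral>\<xi>. indicat_real E \<xi> *\<^sub>R response ?g \<xi> \<partial>lborel)\<bar>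
      \<le> K * sqrt (\<integral>\<xi>. indicat_real E \<xi> * sobolev_weight (- s) \<xi> \<partial>lborel)"
    using E Ew(1) K unfolding response_bounded_def by blast
  have Ir: "integrable lborel (\<lambda>\<xi>. indicat_real E \<xi> *\<^sub>R response ?p \<xi>)"
    using integrable_mult_indicator[OF _ rapid_integrable[OF fam_response[OF pc A[rule_format]]]] E by simp
  have "(\<integral>\<xi>. indicat_real E \<xi> *\<^sub>R response ?g \<xi> \<partial>lborel) = of_real (r\<^sup>2) * (\<integral>\<xi>. indicat_real E \<xi> *\<^sub>R response ?p \<xi> \<partial>lborel)"
    unfolding response_scale mult_scaleR_right[symmetric] integral_mult_right_zero ..
  then have e1: "Re (\<integral>\<xi>. indicat_real E \<xi> *\<^sub>R response ?g \<xi> \<partial>lborel) = r\<^sup>2 * Re (\<integral>\<xi>. indicat_real E \<xi> *\<^sub>R response ?p \<xi> \<partial>lborel)"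
    by (simp only: Re_complex_of_real Im_complex_of_real times_complex.sel mult_zero_left diff_zero)
  have "Re (\<integral>\<xi>. indicat_real E \<xi> *\<^sub>R response ?p \<xi> \<partial>lborel) = (\<integral>\<xi>. Re (indicat_real E \<xi> *\<^sub>R response ?p \<xi>) \<partial>lborel)"
    by (rule integral_Re[OF Ir, symmetric])
  also have "\<dots> \<le> (\<integral>\<xi>. - q * indicat_real E \<xi> \<partial>lborel)"
  proof (rule integral_mono)
    show "Re (indicat_real E \<xi> *\<^sub>R response ?p \<xi>) \<le> - q * indicat_real E \<xi>" for \<xi>
      using packet_response[of \<xi>] by (cases "\<xi> \<in> E") (simp_all add: E_def q_def)
    show "integrable lborel (\<lambda>\<xi>. Re (indicat_real E \<xi> *\<^sub>R response ?p \<xi>))" by (rule integrable_Re[OF Ir])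
    show "integrable lborel (\<lambda>\<xi>. - q * indicat_real E \<xi>)" by (rule integrable_mult_right[OF Ew(3)])
  qed
  also have "\<dots> = - (q * (\<delta> * (\<delta> * sqrt N) / 4))" using Ew(4) by (simp add: field_simps)
  finally have "q * (\<delta> * (\<delta> * sqrt N) / 4) \<le> \<bar>Re (\<integral>\<xi>. indicat_real E \<xi> *\<^sub>R response ?p \<xi> \<partial>lborel)\<bar>" by linarith
  then have "r\<^sup>2 * (q * (\<delta> * (\<delta> * sqrt N) / 4)) \<le> r\<^sup>2 * \<bar>Re (\<integral>\<xi>. indicat_real E \<xi> *\<^sub>R response ?p \<xi> \<partial>lborel)\<bar>"
    by (intro mult_left_mono) auto
  also have "\<dots> = \<bar>Re (\<integral>\<xi>. indicat_real E \<xi> *\<^sub>R response ?g \<xi> \<partial>lborel)\<bar>"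
    unfolding e1 abs_mult by simp
  also note up
  also have "K * sqrt (\<integral>\<xi>. indicat_real E \<xi> * sobolev_weight (- s) \<xi> \<partial>lborel) \<le> \<bar>K\<bar> * sqrt (V * (\<delta> * (\<delta> * sqrt N) / 4))"
    using Ew(2) by (intro mult_mono) (auto intro!: integral_nonneg_AE)
  finally show ?thesis unfolding r(2) q_def[symmetric] P_def[symmetric] by simp
qed

text \<open>Collecting powers after squaring gives
  \<open>5 / 2 - 4 * (s + 1) + 2 * s = - 2 * s - 3 / 2\<close>, which is positive exactly for
  \<open>s < - 3 / 4\<close>, while the right-hand side is free of \<open>N\<close>.\<close>

lemma packet_growth:
  assumes K: "response_bounded s K"
    and C: "0 < C" "\<And>\<xi>. \<kappa> / 2 * N \<le> norm \<xi> \<Longrightarrow> norm \<xi> \<le> 4 * N \<Longrightarrow> sobolev_weight (s + 1) \<xi> \<le> C * N powr (2 * (s + 1))"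
    and D: "0 < D" "\<And>\<xi>. \<kappa> / 2 * N \<le> norm \<xi> \<Longrightarrow> norm \<xi> \<le> 4 * N \<Longrightarrow> sobolev_weight (- s) \<xi> \<le> D * N powr (2 * (- s))"
  shows "N powr (- 2 * s - 3 / 2) \<le> (\<bar>K\<bar> * (2 ^ 21 * pi * c * C) / (T * \<delta>))\<^sup>2 * D / 4"
proof -
  \<comment> \<open>The numerical factors \<open>2\<close>, \<open>1024\<close>, \<open>4\<close>
    and \<open>256\<close> of the preceding inequality multiply to \<open>2 ^ 21\<close>.\<close>
  define R where "R = 2 ^ 21 * pi * c * C"
  define P where "P = N powr (2 * (s + 1))"
  define Q where "Q = N powr (2 * (- s))"
  define w where "w = \<delta> * sqrt N"
  have pos: "0 < R" "0 < P" "0 < Q" "0 < w" "0 < N" "0 < \<delta>" "0 < T"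
    using c C(1) MN width \<delta>(1) T by (simp_all add: R_def P_def Q_def w_def)
  have "N / (2 * pi * c) * (T * \<delta> * w / 1024) * (\<delta> * w / 4) / (256 * (C * P) * \<delta> * w)
    \<le> \<bar>K\<bar> * sqrt (D * Q * (\<delta> * w / 4))"
    unfolding P_def Q_def w_def using C D(2) MN by (intro packet_inequality[OF K]) auto
  moreover have "N / (2 * pi * c) * (T * \<delta> * w / 1024) * (\<delta> * w / 4) / (256 * (C * P) * \<delta> * w) = N * T * (\<delta> * w) / (R * P)"
    unfolding R_def using pos c C(1) by (simp add: field_simps)
  ultimately have "N * T * (\<delta> * w) / (R * P) \<le> \<bar>K\<bar> * sqrt (D * Q * (\<delta> * w / 4))" by simp
  then have "(N * T * (\<delta> * w) / (R * P))\<^sup>2 \<le> (\<bar>K\<bar> * sqrt (D * Q * (\<delta> * w / 4)))\<^sup>2"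
    using pos by (intro power_mono) auto
  also have "\<dots> = K\<^sup>2 * (D * Q * (\<delta> * w / 4))" using pos D(1) by (simp add: power_mult_distrib)
  finally have "(N * T * (\<delta> * w) / (R * P))\<^sup>2 \<le> K\<^sup>2 * (D * Q * (\<delta> * w / 4))" .
  \<comment> \<open>This factor moves every power of \<open>N\<close>, including the one hidden in
    \<open>w\<close>, to the left and everything else to the right.\<close>
  then have "(N * T * (\<delta> * w) / (R * P))\<^sup>2 * (R\<^sup>2 / (T\<^sup>2 * Q * \<delta> * w * \<delta>\<^sup>2))
      \<le> K\<^sup>2 * (D * Q * (\<delta> * w / 4)) * (R\<^sup>2 / (T\<^sup>2 * Q * \<delta> * w * \<delta>\<^sup>2))"
    using pos by (intro mult_right_mono) auto
  moreover have "K\<^sup>2 * (D * Q * (\<delta> * w / 4)) * (R\<^sup>2 / (T\<^sup>2 * Q * \<delta> * w * \<delta>\<^sup>2)) = (\<bar>K\<bar> * R / (T * \<delta>))\<^sup>2 * D / 4"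
    using pos by (simp add: field_simps power2_eq_square)
  moreover have "(N * T * (\<delta> * w) / (R * P))\<^sup>2 * (R\<^sup>2 / (T\<^sup>2 * Q * \<delta> * w * \<delta>\<^sup>2)) = N\<^sup>2 * sqrt N / (P\<^sup>2 * Q)"
    using pos by (simp add: field_simps power2_eq_square w_def)
  moreover have "N\<^sup>2 * sqrt N / (P\<^sup>2 * Q) = N powr (- 2 * s - 3 / 2)"
  proof -
    have "N\<^sup>2 = N powr 2" "sqrt N = N powr (1 / 2)" "P\<^sup>2 = N powr (4 * (s + 1))"
      using pos(5) by (simp_all add: powr_half_sqrt P_def powr_power)
    then show ?thesis unfolding Q_def
      by (simp add: powr_add[symmetric] powr_diff[symmetric] del: powr_numeral) (rule arg_cong[where f = "(powr) N"], simp add: algebra_simps)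
  qed
  ultimately show ?thesis unfolding R_def by simp
qed

end

text \<open>The order of choices matters: \<open>\<delta>\<close> depends only on \<open>T\<close>
  and \<open>\<kappa>\<close>, the constants \<open>C\<close> and \<open>D\<close> only on
  \<open>\<kappa>\<close> and \<open>s\<close>, and all are fixed before the frequency grows along a
  sequence dictated by the phase condition.\<close>

lemma (in kgz) no_uniform_response_bound:
  assumes c1: "c < 1" and s: "s < - 3 / 4"
    and K: "response_bounded s K"
  shows False
proof -
  define \<kappa> where "\<kappa> = (1 - c) / (1 + c)"
  define \<delta> where "\<delta> = min 1 (1 / (T * (9 + 1 / \<kappa>)))"
  have \<kappa>: "0 < \<kappa>" "\<kappa> < 1" "1 - \<kappa> = c * (1 + \<kappa>)"
    using c c1 by (simp_all add: \<kappa>_def field_simps)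
  have cancel: "x / y * y = x" if "0 < y" for x y :: real using that by simp
  have p: "0 < T * (9 + 1 / \<kappa>)" using T \<kappa> by (intro mult_pos_pos add_pos_pos) auto
  have \<delta>: "0 < \<delta>" "\<delta> \<le> 1" "T * (\<delta> * (9 + 1 / \<kappa>)) \<le> 1"
  proof -
    show "0 < \<delta>" "\<delta> \<le> 1" using p by (simp_all add: \<delta>_def)
    have "\<delta> * (T * (9 + 1 / \<kappa>)) \<le> 1 / (T * (9 + 1 / \<kappa>)) * (T * (9 + 1 / \<kappa>))"
      using p by (intro mult_right_mono) (auto simp: \<delta>_def)
    also have "\<dots> = 1" by (rule cancel[OF p])
    finally show "T * (\<delta> * (9 + 1 / \<kappa>)) \<le> 1" by (simp add: mult_ac)
  qed
  have half: "0 < \<kappa> / 2" and four: "(0::real) < 4" using \<kappa>(1) by simp_all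
  obtain C where C: "C > 0" "\<forall>N\<ge>1. \<forall>\<xi> :: real^2. \<kappa> / 2 * N \<le> norm \<xi> \<longrightarrow> norm \<xi> \<le> 4 * N \<longrightarrow>
      sobolev_weight (s + 1) \<xi> \<le> C * N powr (2 * (s + 1))"
    using powr_weight_le[OF half four, where \<sigma> = "s + 1"] by (elim exE conjE)
  obtain D where D: "D > 0" "\<forall>N\<ge>1. \<forall>\<xi> :: real^2. \<kappa> / 2 * N \<le> norm \<xi> \<longrightarrow> norm \<xi> \<le> 4 * N \<longrightarrow>
      sobolev_weight (- s) \<xi> \<le> D * N powr (2 * (- s))"
    using powr_weight_le[OF half four, where \<sigma> = "- s"] by (elim exE conjE)
  define B where "B = (\<bar>K\<bar> * (2 ^ 21 * pi * c * C) / (T * \<delta>))\<^sup>2 * D / 4"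
  define e where "e = - 2 * s - 3 / 2"
  have e: "0 < e" using s by (simp add: e_def)
  have B: "0 \<le> B" using D(1) by (simp add: B_def)
  define S where "S = 1 / \<delta> + 3 + 25 / T"
  have S: "0 < S" using \<delta>(1) T by (simp add: S_def add_pos_pos)
  \<comment> \<open>The first two summands make both \<open>M\<close> and \<open>N - M\<close> at
    least \<open>S\<close>, which covers all largeness conditions; the third makes
    \<open>N powr e\<close> exceed \<open>B\<close>.\<close>
  define n0 where "n0 = S / \<kappa> + S / (1 - \<kappa>) + (B + 1) powr (1 / e)"
  \<comment> \<open>The phase condition solved for the frequency, with \<open>M\<close> replaced by
    \<open>\<kappa>\<close> times it; these values are unbounded in \<open>j\<close>.\<close>
  define N where "N j = (pi / 2 + 2 * real j * pi) / (c * (1 + \<kappa>) * T)" for j :: nat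
  have q: "0 < c * (1 + \<kappa>) * T" using c \<kappa>(1) T by simp
  obtain j :: nat where "n0 * (c * (1 + \<kappa>) * T) < real j * (2 * pi)"
    using reals_Archimedean3[of "2 * pi"] pi_gt_zero by auto
  then have "n0 * (c * (1 + \<kappa>) * T) \<le> pi / 2 + 2 * real j * pi"
    unfolding mult.commute[of "real j" "2 * pi"] mult.commute[of 2 pi] mult.commute[of "2 * real j" pi] mult.assoc
    using pi_gt_zero by linarith
  then have n0: "n0 \<le> N j" unfolding N_def using q by (simp add: pos_le_divide_eq)
  have f: "0 < S / \<kappa>" "0 < S / (1 - \<kappa>)" "0 < (B + 1) powr (1 / e)" using S \<kappa> B by simp_all
  have "S / \<kappa> \<le> N j" "S / (1 - \<kappa>) \<le> N j" and Bn: "(B + 1) powr (1 / e) \<le> N j"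
    using n0 f unfolding n0_def by linarith+
  then have SN: "S \<le> \<kappa> * N j" "S \<le> N j - \<kappa> * N j" using \<kappa>(1,2) by (simp_all add: field_simps)
  have pt: "0 < 1 / \<delta>" "0 < 25 / T" using \<delta>(1) T by simp_all
  have le: "1 / \<delta> \<le> S" "3 \<le> S" "25 / T \<le> S" using pt unfolding S_def by linarith+
  interpret resonant_packet c T \<delta> \<kappa> "N j" "\<kappa> * N j" j
  proof
    have "N j - \<kappa> * N j = (1 - \<kappa>) * N j" by (simp add: left_diff_distrib)
    then show "N j - \<kappa> * N j = c * (N j + \<kappa> * N j)" unfolding \<kappa>(3) by (simp add: algebra_simps)
    have "c * (N j + \<kappa> * N j) * T = N j * (c * (1 + \<kappa>) * T)" by (simp add: algebra_simps)
    also have "\<dots> = pi / 2 + 2 * real j * pi" unfolding N_def by (rule cancel[OF q])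
    finally show "c * (N j + \<kappa> * N j) * T = pi / 2 + 2 * real j * pi" .
    show "1 / \<delta> \<le> \<kappa> * N j" "3 \<le> \<kappa> * N j" "3 \<le> N j - \<kappa> * N j"
      using SN le(1,2) by linarith+
    have dbl: "25 / T \<le> 2 * x" if "S \<le> x" for x using that le(3) S by linarith
    show "25 / T \<le> 2 * (\<kappa> * N j)" "25 / T \<le> 2 * (N j - \<kappa> * N j)"
      using SN by (simp_all only: dbl)
  qed (use c1 \<kappa> \<delta> in simp_all)
  have N1: "1 \<le> N j" using MN large(2) by linarith
  have "N j powr e \<le> B"
    unfolding e_def B_def
    by (rule packet_growth[OF K C(1) _ D(1)]) (use C(2)[rule_format, OF N1] D(2)[rule_format, OF N1] in auto)
  moreover have "((B + 1) powr (1 / e)) powr e \<le> N j powr e"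
    using Bn e by (intro powr_mono2) auto
  moreover have "((B + 1) powr (1 / e)) powr e = B + 1" using e B by (simp add: powr_powr)
  ultimately show False by linarith
qed

theorem theorem1p3:
  fixes c s T :: real
  assumes "0 < c" and "c < 1" and "s < - 3 / 4" and "T > 0"
  shows "\<not> (\<exists>\<Phi>. C2_on (data_space s) (solution_space s T) (unit_ball (data_space s)) \<Phi> \<and>
                  data_to_solution_map c s T \<Phi>)"
proof
  interpret kgz c T using assms by unfold_locales
  assume "\<exists>\<Phi>. C2_on (data_space s) (solution_space s T) (unit_ball (data_space s)) \<Phi> \<and> data_to_solution_map c s T \<Phi>"
  then obtain \<Phi> where \<Phi>: "C2_on (data_space s) (solution_space s T) (unit_ball (data_space s)) \<Phi>" "data_to_solution_map c s T \<Phi>"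
    by (elim exE conjE)
  from response_bound[OF \<Phi>] show False
    by (elim exE) (rule no_uniform_response_bound[OF assms(2,3)])
qed

end
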